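(* Let $\Phi$ be an indecomposable root system of rank $>1$ and $p$ a prime. (i) Let $G_\pi(\Phi,\mathbb Q_p)$ be the corresponding Chevalley group over $\mathbb Q_p$. If an element $g\in E_\pi(\Phi,\mathbb Q_p)$ is not computable, then the Diophantine problem for equations with coefficients in $\{x_\alpha(1)\mid\alpha\in\Phi\}\cup\{g\}$ is undecidable in any large subgroup of $G_\pi(\Phi,\mathbb Q_p)$. (ii) Let $p\neq 2$ and let $G_\pi(\Phi,\mathbb Z_p)$ be the corresponding Chevalley group over $\mathbb Z_p$. If an element $g\in E_\pi(\Phi,\mathbb Z_p)$ is not computable, then the Diophantine problem for equations with coefficients in $\{x_\alpha(1)\mid\alpha\in\Phi\}\cup\{g\}$ is undecidable in any large subgroup of $G_\pi(\Phi,\mathbb Z_p)$.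
   Context: Every nonzero $p$-adic number $a\in\mathbb Q_p$ has a unique presentation $a=p^m\xi$ with $m\in\mathbb Z$ and $\xi$ a unit of $\mathbb Z_p$; $\xi$ is uniquely determined by a sequence of natural numbers $\{\xi(i)\}_{i\in\mathbb N}$ with $0\leqslant\xi(i)<p^{i+1}$ and $\xi(i+1)\equiv\xi(i)\pmod{p^{i+1}}$ (where $\xi\equiv\xi(i)\pmod{p^{i+1}}$). The number $a$ is computable if $i\mapsto\xi(i)$ is a computable function; $0$ is computable. Elements of $G_\pi(\Phi,\mathbb Q_p)$ (resp. $G_\pi(\Phi,\mathbb Z_p)$) are represented by matrices in $\mathrm{SL}_n(\mathbb Q_p)$ (resp. $\mathrm{SL}_n(\mathbb Z_p)$); an element is computable if all entries of its matrix are computable $p$-adic numbers. Root systems are reduced. Let $\mathcal L$ be the complex semisimple Lie algebra with root system $\Phi$, with Chevalley basis $\{h_i;x_\alpha\}$, and let $\pi$ be a faithful finite-dimensional representation of $\mathcal L$ with weight lattice $\Lambda_\pi$. $G_\pi(\Phi,R)$ denotes the Chevalley group of type $(\Phi,\Lambda_\pi)$ over a commutative ring $R$ with $1$, i.e. the group of $R$-points of the Chevalley--Demazure group scheme, realized as the subgroup of $\mathrm{SL}_n(R)$, $n=\dim\pi$, given by polynomial equations with integer coefficients in the matrix entries. $x_\alpha(t)=\exp(t\pi(x_\alpha))$ ($\alpha\in\Phi$, $t\in R$) are the elementary root unipotents, $E_\pi(\Phi,R)$ is the subgroup generated by all of them, and a subgroup of $G_\pi(\Phi,R)$ is large if it contains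 $E_\pi(\Phi,R)$. The Diophantine problem in a group $G$ for equations with coefficients in a finite set $C\subseteq G$ is decidable if there is an algorithm which, given a finite system of group equations with coefficients in $C$, decides whether the system has a solution in $G$; otherwise it is undecidable. *)

theory Defs
  imports
    "HOL-Analysis.Euclidean_Space"
    "HOL-Algebra.Generated_Groups"
    "HOL-Library.Poly_Mapping"
    "HOL-Library.Nat_Bijection"
    "HOL-Computational_Algebra.Polynomial_Factorial"
    "Jordan_Normal_Form.Determinant"
    "Berlekamp_Zassenhaus.Finite_Field"
begin

section \<open>Computable functions\<close>

text \<open>Codes of mu-recursive functions.  \<open>Mu f\<close> searches for the least zero of \<open>f\<close> in its
  first argument; the evaluation relation is undefined where the computation diverges.\<close>

datatype recf = Zero | Succ | Proj nat | Comp recf "recf list" | PrimRec recf recf | Mu recf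

inductive computes :: "recf \<Rightarrow> nat list \<Rightarrow> nat \<Rightarrow> bool" where
  zero: "computes Zero xs 0"
| succ: "computes Succ [x] (Suc x)"
| proj: "i < length xs \<Longrightarrow> computes (Proj i) xs (xs ! i)"
| comp: "list_all2 (\<lambda>g y. computes g xs y) gs ys \<Longrightarrow> computes f ys z \<Longrightarrow> computes (Comp f gs) xs z"
| rec_0: "computes f xs z \<Longrightarrow> computes (PrimRec f g) (0 # xs) z"
| rec_Suc: "computes (PrimRec f g) (k # xs) y \<Longrightarrow> computes g (k # y # xs) z \<Longrightarrow>
    computes (PrimRec f g) (Suc k # xs) z"
| mu: "computes f (k # xs) 0 \<Longrightarrow> (\<forall>j<k. \<exists>y>0. computes f (j # xs) y) \<Longrightarrow> computes (Mu f) xs k"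

definition computable :: "(nat \<Rightarrow> nat) \<Rightarrow> bool" where
  "computable f \<longleftrightarrow> (\<exists>r. \<forall>x. computes r [x] (f x))"

section \<open>The Diophantine problem in a group\<close>

text \<open>A letter is a variable or a coefficient symbol, together with a flag marking its inverse.
  A word \<open>w\<close> stands for the equation \<open>w = 1\<close>.  Coefficient symbols are indices into a list
  enumerating the coefficient set.\<close>

datatype gsym = Var nat | Coeff nat

type_synonym gword = "(gsym \<times> bool) list"

context
  fixes G :: "('a, 'b) monoid_scheme" and cs :: "'a list" and \<sigma> :: "nat \<Rightarrow> 'a"
begin

fun sym_value :: "gsym \<Rightarrow> 'a" where
  "sym_value (Var i) = \<sigma> i"
| "sym_value (Coeff j) = cs ! j"

fun letter_value :: "gsym \<times> bool \<Rightarrow> 'a" where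
  "letter_value (s, inverted) = (if inverted then inv\<^bsub>G\<^esub> (sym_value s) else sym_value s)"

definition word_value :: "gword \<Rightarrow> 'a" where
  "word_value w = foldr (\<lambda>l a. letter_value l \<otimes>\<^bsub>G\<^esub> a) w \<one>\<^bsub>G\<^esub>"

end

definition system_over :: "'a list \<Rightarrow> gword list \<Rightarrow> bool" where
  "system_over cs S \<longleftrightarrow> (\<forall>w\<in>set S. \<forall>j inverted. (Coeff j, inverted) \<in> set w \<longrightarrow> j < length cs)"

definition solvable_in :: "('a, 'b) monoid_scheme \<Rightarrow> 'a list \<Rightarrow> gword list \<Rightarrow> bool" where
  "solvable_in G cs S \<longleftrightarrow>
    (\<exists>\<sigma>. (\<forall>i. \<sigma> i \<in> carrier G) \<and> (\<forall>w\<in>set S. word_value G cs \<sigma> w = \<one>\<^bsub>G\<^esub>))"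

fun sym_code :: "gsym \<Rightarrow> nat" where
  "sym_code (Var i) = sum_encode (Inl i)"
| "sym_code (Coeff j) = sum_encode (Inr j)"

definition word_code :: "gword \<Rightarrow> nat" where
  "word_code w = list_encode (map (\<lambda>(s, inverted). prod_encode (sym_code s, of_bool inverted)) w)"

definition system_code :: "gword list \<Rightarrow> nat" where
  "system_code S = list_encode (map word_code S)"

text \<open>The coefficient set \<open>C\<close> is meant to be finite.  Decidability does not depend on the
  enumeration \<open>cs\<close>, since any two enumerations differ by a finite renaming of symbols.\<close>

definition diophantine_decidable :: "('a, 'b) monoid_scheme \<Rightarrow> 'a set \<Rightarrow> bool" where
  "diophantine_decidable G C \<longleftrightarrow>
    (\<exists>cs f. set cs = C \<and> computable f \<and>
      (\<forall>S. system_over cs S \<longrightarrow> (f (system_code S) = 1 \<longleftrightarrow> solvable_in G cs S)))"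

section \<open>The $p$-adic integers and numbers\<close>

text \<open>The prime \<open>p\<close> is the cardinality of the type \<open>'p\<close>.  A $p$-adic integer is the sequence
  of its least nonnegative residues modulo \<open>p ^ (i + 1)\<close>.\<close>

typedef (overloaded) ('p::prime_card) padic_int =
  "{\<xi> :: nat \<Rightarrow> int. \<forall>i. 0 \<le> \<xi> i \<and> \<xi> i < int CARD('p) ^ (i + 1) \<and>
      [\<xi> (i + 1) = \<xi> i] (mod int CARD('p) ^ (i + 1))}"
  morphisms residue Abs_padic_int
  by (rule exI[of _ "\<lambda>_. 0"]) (auto simp: prime_gt_0_nat[OF prime_card])

setup_lifting type_definition_padic_int

lemma card_pos: "0 < int CARD('p::prime_card)"
  using prime_gt_0_int[OF prime_card_int] .

lemma card_gt_1: "1 < int CARD('p::prime_card)"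
  using prime_gt_1_int[OF prime_card_int] .

lemma cong_mod_Suc_power:
  assumes "[a = b] (mod (p::int) ^ (i + 1))"
  shows "[a mod p ^ (i + 2) = b mod p ^ (i + 1)] (mod p ^ (i + 1))"
proof -
  have "p ^ (i + 1) dvd p ^ (i + 2)" by (simp add: le_imp_power_dvd)
  hence "a mod p ^ (i + 2) mod p ^ (i + 1) = a mod p ^ (i + 1)" by (simp add: mod_mod_cancel)
  thus ?thesis using assms by (simp add: cong_def)
qed

instantiation padic_int :: (prime_card) comm_ring_1
begin

lift_definition zero_padic_int :: "'a padic_int" is "\<lambda>_. 0"
  by (auto simp: prime_gt_0_nat[OF prime_card])

lift_definition one_padic_int :: "'a padic_int" is "\<lambda>_. 1"
  using card_gt_1[where 'p = 'a] by (auto simp: one_less_power simp del: power_Suc)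

lift_definition plus_padic_int :: "'a padic_int \<Rightarrow> 'a padic_int \<Rightarrow> 'a padic_int"
  is "\<lambda>\<xi> \<eta> i. (\<xi> i + \<eta> i) mod int CARD('a) ^ (i + 1)"
  using card_pos[where 'p = 'a] cong_mod_Suc_power[where p = "int CARD('a)"] cong_add
  by (simp del: power_Suc) blast

lift_definition minus_padic_int :: "'a padic_int \<Rightarrow> 'a padic_int \<Rightarrow> 'a padic_int"
  is "\<lambda>\<xi> \<eta> i. (\<xi> i - \<eta> i) mod int CARD('a) ^ (i + 1)"
  using card_pos[where 'p = 'a] cong_mod_Suc_power[where p = "int CARD('a)"] cong_diff
  by (simp del: power_Suc) blast

lift_definition uminus_padic_int :: "'a padic_int \<Rightarrow> 'a padic_int"
  is "\<lambda>\<xi> i. (- \<xi> i) mod int CARD('a) ^ (i + 1)"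
  using card_pos[where 'p = 'a] cong_mod_Suc_power[where p = "int CARD('a)"] cong_minus_minus_iff
  by (simp del: power_Suc) blast

lift_definition times_padic_int :: "'a padic_int \<Rightarrow> 'a padic_int \<Rightarrow> 'a padic_int"
  is "\<lambda>\<xi> \<eta> i. (\<xi> i * \<eta> i) mod int CARD('a) ^ (i + 1)"
  using card_pos[where 'p = 'a] cong_mod_Suc_power[where p = "int CARD('a)"] cong_mult
  by (simp del: power_Suc) blast

instance
proof
  fix a b c :: "'a padic_int"
  show "a * b * c = a * (b * c)" by transfer (auto simp: mod_simps algebra_simps)
  show "a * b = b * a" by transfer (simp add: mult.commute)
  show "1 * a = a" by transfer (auto simp: fun_eq_iff)
  show "a + b + c = a + (b + c)" by transfer (auto simp: mod_simps algebra_simps)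
  show "a + b = b + a" by transfer (simp add: add.commute)
  show "0 + a = a" by transfer (auto simp: fun_eq_iff)
  show "- a + a = 0" by transfer (auto simp: mod_simps)
  show "a - b = a + - b" by transfer (auto simp: mod_simps)
  show "(a + b) * c = a * c + b * c" by transfer (auto simp: mod_simps algebra_simps)
  show "(0 :: 'a padic_int) \<noteq> 1" by transfer (auto simp: fun_eq_iff)
qed

end

lemma residue_bounds:
  "0 \<le> residue (\<xi> :: 'p::prime_card padic_int) i" "residue \<xi> i < int CARD('p) ^ (i + 1)"
  using residue[of \<xi>] by auto

lemma residue_cong:
  assumes "i \<le> k"
  shows "[residue (\<xi> :: 'p::prime_card padic_int) k = residue \<xi> i] (mod int CARD('p) ^ (i + 1))"
  using assms
proof (induction k rule: dec_induct)
  case (step k)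
  have "[residue \<xi> (k + 1) = residue \<xi> k] (mod int CARD('p) ^ (k + 1))"
    using residue[of \<xi>] by blast
  hence "[residue \<xi> (k + 1) = residue \<xi> k] (mod int CARD('p) ^ (i + 1))"
    by (rule cong_dvd_modulus) (use step in \<open>simp add: le_imp_power_dvd del: power_Suc\<close>)
  thus ?case using step.IH by (simp add: cong_def)
qed (rule cong_refl)

lemma nonzero_residue:
  assumes "(\<xi> :: 'p::prime_card padic_int) \<noteq> 0"
  obtains i where "\<And>k. k \<ge> i \<Longrightarrow> \<not> int CARD('p) ^ (i + 1) dvd residue \<xi> k"
proof -
  obtain i where i: "residue \<xi> i \<noteq> 0"
    using assms by (metis residue_inject zero_padic_int.rep_eq ext)
  have "\<not> int CARD('p) ^ (i + 1) dvd residue \<xi> i"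
    using i residue_bounds[of \<xi> i] zdvd_imp_le[of "int CARD('p) ^ (i + 1)" "residue \<xi> i"]
    by linarith
  thus ?thesis using that cong_dvd_iff[OF residue_cong] by blast
qed

instance padic_int :: (prime_card) idom
proof
  fix a b :: "'a padic_int"
  let ?p = "int CARD('a)"
  assume "a \<noteq> 0" "b \<noteq> 0"
  then obtain i j where i: "\<And>k. k \<ge> i \<Longrightarrow> \<not> ?p ^ (i + 1) dvd residue a k"
    and j: "\<And>k. k \<ge> j \<Longrightarrow> \<not> ?p ^ (j + 1) dvd residue b k"
    by (metis nonzero_residue)
  define k where "k = i + j + 1"
  have pp: "prime ?p" by (rule prime_card_int)
  show "a * b \<noteq> 0"
  proof
    assume "a * b = 0"
    hence "residue (a * b) k = 0" by (simp add: zero_padic_int.rep_eq)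
    hence dvd: "?p ^ (k + 1) dvd residue a k * residue b k"
      by (simp add: times_padic_int.rep_eq mod_eq_0_iff_dvd del: power_Suc)
    have na: "\<not> ?p ^ (i + 1) dvd residue a k" and nb: "\<not> ?p ^ (j + 1) dvd residue b k"
      using i j by (simp_all add: k_def del: power_Suc)
    have nz: "residue a k \<noteq> 0" "residue b k \<noteq> 0" using na nb by auto
    have "multiplicity ?p (residue a k) < i + 1" "multiplicity ?p (residue b k) < j + 1"
      using na nb multiplicity_dvd' not_less by blast+
    moreover have "multiplicity ?p (residue a k * residue b k)
        = multiplicity ?p (residue a k) + multiplicity ?p (residue b k)"
      by (rule prime_elem_multiplicity_mult_distrib) (use pp nz in auto)
    moreover have "k + 1 \<le> multiplicity ?p (residue a k * residue b k)"
      by (rule multiplicity_geI) (use dvd pp nz in \<open>auto simp del: power_Suc\<close>)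
    ultimately show False by (simp add: k_def)
  qed
qed

type_synonym 'p padic = "'p padic_int fract"

definition computable_padic :: "'p::prime_card padic \<Rightarrow> bool" where
  "computable_padic a \<longleftrightarrow> a = 0 \<or>
    (\<exists>(m :: int) \<xi>. \<xi> dvd 1 \<and> a = of_nat CARD('p) powi m * to_fract \<xi> \<and>
      computable (\<lambda>i. nat (residue \<xi> i)))"

definition computable_mat :: "'p::prime_card padic mat \<Rightarrow> bool" where
  "computable_mat A \<longleftrightarrow> (\<forall>i<dim_row A. \<forall>j<dim_col A. computable_padic (A $$ (i, j)))"

section \<open>Root systems\<close>

definition cartan_int :: "'v::euclidean_space \<Rightarrow> 'v \<Rightarrow> real" where
  "cartan_int \<beta> \<alpha> = 2 * inner \<beta> \<alpha> / inner \<alpha> \<alpha>"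

definition root_system :: "'v::euclidean_space set \<Rightarrow> bool" where
  "root_system \<Phi> \<longleftrightarrow> finite \<Phi> \<and> 0 \<notin> \<Phi> \<and> span \<Phi> = UNIV \<and>
    (\<forall>\<alpha>\<in>\<Phi>. \<forall>\<beta>\<in>\<Phi>. \<beta> - cartan_int \<beta> \<alpha> *\<^sub>R \<alpha> \<in> \<Phi> \<and> cartan_int \<beta> \<alpha> \<in> \<int>) \<and>
    (\<forall>\<alpha>\<in>\<Phi>. \<forall>c. c *\<^sub>R \<alpha> \<in> \<Phi> \<longrightarrow> c = 1 \<or> c = -1)"

definition indecomposable :: "'v::euclidean_space set \<Rightarrow> bool" where
  "indecomposable \<Phi> \<longleftrightarrow> \<Phi> \<noteq> {} \<and>
    \<not> (\<exists>A B. A \<noteq> {} \<and> B \<noteq> {} \<and> A \<inter> B = {} \<and> \<Phi> = A \<union> B \<and> (\<forall>\<alpha>\<in>A. \<forall>\<beta>\<in>B. inner \<alpha> \<beta> = 0))"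

definition root_base :: "'v::euclidean_space set \<Rightarrow> 'v set \<Rightarrow> bool" where
  "root_base \<Phi> \<Delta> \<longleftrightarrow> \<Delta> \<subseteq> \<Phi> \<and> independent \<Delta> \<and>
    (\<forall>\<beta>\<in>\<Phi>. \<exists>k :: 'v \<Rightarrow> int. \<beta> = (\<Sum>a\<in>\<Delta>. of_int (k a) *\<^sub>R a) \<and>
      ((\<forall>a\<in>\<Delta>. 0 \<le> k a) \<or> (\<forall>a\<in>\<Delta>. k a \<le> 0)))"

definition coroot :: "'v::euclidean_space \<Rightarrow> 'v" where
  "coroot \<alpha> = (2 / inner \<alpha> \<alpha>) *\<^sub>R \<alpha>"

section \<open>Complex semisimple Lie algebras and Chevalley bases\<close>

locale complex_lie_algebra = vector_space scale
  for scale :: "complex \<Rightarrow> 'l::ab_group_add \<Rightarrow> 'l" +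
  fixes br :: "'l \<Rightarrow> 'l \<Rightarrow> 'l"
  assumes br_add_left: "br (x + y) z = br x z + br y z"
    and br_add_right: "br x (y + z) = br x y + br x z"
    and br_scale_left: "br (scale c x) y = scale c (br x y)"
    and br_scale_right: "br x (scale c y) = scale c (br x y)"
    and br_self: "br x x = 0"
    and jacobi: "br x (br y z) + br y (br z x) + br z (br x y) = 0"
begin

definition commutator_space :: "'l set \<Rightarrow> 'l set \<Rightarrow> 'l set" where
  "commutator_space A B = span {br a b | a b. a \<in> A \<and> b \<in> B}"

definition lie_subalgebra :: "'l set \<Rightarrow> bool" where
  "lie_subalgebra H \<longleftrightarrow> subspace H \<and> (\<forall>x\<in>H. \<forall>y\<in>H. br x y \<in> H)"

definition lie_ideal :: "'l set \<Rightarrow> bool" where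
  "lie_ideal I \<longleftrightarrow> subspace I \<and> (\<forall>x. \<forall>y\<in>I. br x y \<in> I)"

primrec derived_series :: "'l set \<Rightarrow> nat \<Rightarrow> 'l set" where
  "derived_series A 0 = A"
| "derived_series A (Suc k) = commutator_space (derived_series A k) (derived_series A k)"

primrec lower_central_series :: "'l set \<Rightarrow> nat \<Rightarrow> 'l set" where
  "lower_central_series A 0 = A"
| "lower_central_series A (Suc k) = commutator_space A (lower_central_series A k)"

definition lie_solvable :: "'l set \<Rightarrow> bool" where
  "lie_solvable A \<longleftrightarrow> (\<exists>k. derived_series A k = {0})"

definition lie_nilpotent :: "'l set \<Rightarrow> bool" where
  "lie_nilpotent A \<longleftrightarrow> (\<exists>k. lower_central_series A k = {0})"

definition finite_dim_semisimple :: bool where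
  "finite_dim_semisimple \<longleftrightarrow> (\<exists>B. finite B \<and> span B = UNIV) \<and>
    (\<forall>I. lie_ideal I \<and> lie_solvable I \<longrightarrow> I = {0})"

definition cartan_subalgebra :: "'l set \<Rightarrow> bool" where
  "cartan_subalgebra H \<longleftrightarrow> lie_subalgebra H \<and> lie_nilpotent H \<and>
    (\<forall>x. (\<forall>y\<in>H. br x y \<in> H) \<longrightarrow> x \<in> H)"

definition root_space :: "'l set \<Rightarrow> ('l \<Rightarrow> complex) \<Rightarrow> 'l set" where
  "root_space H \<mu> = {x. \<forall>h\<in>H. br h x = scale (\<mu> h) x}"

text \<open>Functionals on a subspace \<open>H\<close> are given by functionals on the whole space, which are
  only ever compared on \<open>H\<close>.\<close>

abbreviation functional :: "('l \<Rightarrow> complex) \<Rightarrow> bool" where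
  "functional \<equiv> Vector_Spaces.linear scale (*)"

definition is_root :: "'l set \<Rightarrow> ('l \<Rightarrow> complex) \<Rightarrow> bool" where
  "is_root H \<mu> \<longleftrightarrow> functional \<mu> \<and> (\<exists>h\<in>H. \<mu> h \<noteq> 0) \<and> root_space H \<mu> \<noteq> {0}"

text \<open>\<open>rt\<close> identifies \<open>\<Phi>\<close> with the set of roots of the Lie algebra relative to \<open>H\<close>: it is an
  injective real-linear map into the dual of \<open>H\<close> under which \<open>\<Phi>\<close> corresponds to the roots.
  A linear isomorphism between root systems preserves Cartan integers, because the reflection
  in a root is determined by the linear structure.\<close>

definition has_root_system :: "'l set \<Rightarrow> 'v::euclidean_space set \<Rightarrow> ('v \<Rightarrow> 'l \<Rightarrow> complex) \<Rightarrow> bool" where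
  "has_root_system H \<Phi> rt \<longleftrightarrow>
    (\<forall>v. functional (rt v)) \<and>
    (\<forall>h\<in>H. linear (\<lambda>v. rt v h)) \<and>
    (\<forall>v. (\<forall>h\<in>H. rt v h = 0) \<longrightarrow> v = 0) \<and>
    (\<forall>\<mu>. functional \<mu> \<longrightarrow> (is_root H \<mu> \<longleftrightarrow> (\<exists>\<alpha>\<in>\<Phi>. \<forall>h\<in>H. \<mu> h = rt \<alpha> h)))"

text \<open>\<open>h\<close> is indexed by the simple roots.  In the bracket of \<open>x \<alpha>\<close> and \<open>x \<beta>\<close>, the number
  \<open>r\<close> is the largest one with \<open>\<beta> - r \<alpha>\<close> a root.\<close>

definition chevalley_basis ::
  "'l set \<Rightarrow> 'v::euclidean_space set \<Rightarrow> ('v \<Rightarrow> 'l \<Rightarrow> complex) \<Rightarrow> 'v set \<Rightarrow> ('v \<Rightarrow> 'l) \<Rightarrow> ('v \<Rightarrow> 'l) \<Rightarrow> bool"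
where
  "chevalley_basis H \<Phi> rt \<Delta> h x \<longleftrightarrow>
    inj_on h \<Delta> \<and> inj_on x \<Phi> \<and> h ` \<Delta> \<inter> x ` \<Phi> = {} \<and>
    independent (h ` \<Delta> \<union> x ` \<Phi>) \<and> span (h ` \<Delta> \<union> x ` \<Phi>) = UNIV \<and>
    (\<forall>a\<in>\<Delta>. h a \<in> H \<and> (\<forall>\<beta>\<in>\<Phi>. rt \<beta> (h a) = of_real (cartan_int \<beta> a))) \<and>
    (\<forall>\<alpha>\<in>\<Phi>. x \<alpha> \<in> root_space H (rt \<alpha>)) \<and>
    (\<forall>\<alpha>\<in>\<Phi>. \<exists>k :: 'v \<Rightarrow> int. coroot \<alpha> = (\<Sum>a\<in>\<Delta>. of_int (k a) *\<^sub>R coroot a) \<and>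
      br (x \<alpha>) (x (- \<alpha>)) = (\<Sum>a\<in>\<Delta>. scale (of_int (k a)) (h a))) \<and>
    (\<forall>\<alpha>\<in>\<Phi>. \<forall>\<beta>\<in>\<Phi>. \<alpha> + \<beta> \<in> \<Phi> \<longrightarrow>
      (let r = Max {r :: nat. \<beta> - of_nat r *\<^sub>R \<alpha> \<in> \<Phi>} in
        br (x \<alpha>) (x \<beta>) = scale (of_nat (r + 1)) (x (\<alpha> + \<beta>)) \<or>
        br (x \<alpha>) (x \<beta>) = scale (- of_nat (r + 1)) (x (\<alpha> + \<beta>)))) \<and>
    (\<forall>\<alpha>\<in>\<Phi>. \<forall>\<beta>\<in>\<Phi>. \<alpha> + \<beta> \<notin> \<Phi> \<and> \<alpha> + \<beta> \<noteq> 0 \<longrightarrow> br (x \<alpha>) (x \<beta>) = 0)"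

definition faithful_representation :: "nat \<Rightarrow> ('l \<Rightarrow> complex mat) \<Rightarrow> bool" where
  "faithful_representation n \<pi> \<longleftrightarrow>
    (\<forall>u. \<pi> u \<in> carrier_mat n n) \<and>
    (\<forall>u v. \<pi> (u + v) = \<pi> u + \<pi> v) \<and>
    (\<forall>c u. \<pi> (scale c u) = c \<cdot>\<^sub>m \<pi> u) \<and>
    (\<forall>u v. \<pi> (br u v) = \<pi> u * \<pi> v - \<pi> v * \<pi> u) \<and>
    inj \<pi>"

end

section \<open>Chevalley groups\<close>

definition divided_power :: "complex mat \<Rightarrow> nat \<Rightarrow> complex mat" where
  "divided_power X k = (1 / fact k) \<cdot>\<^sub>m (X ^\<^sub>m k)"

text \<open>Matrices are taken with respect to a basis of an admissible lattice, that is, a lattice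
  stable under all divided powers of the root elements; this is what gives the group its
  integral structure.\<close>

locale chevalley_representation = complex_lie_algebra scale br
  for scale :: "complex \<Rightarrow> 'l::ab_group_add \<Rightarrow> 'l" and br :: "'l \<Rightarrow> 'l \<Rightarrow> 'l" +
  fixes \<Phi> :: "'v::euclidean_space set" and H :: "'l set" and rt :: "'v \<Rightarrow> 'l \<Rightarrow> complex"
    and \<Delta> :: "'v set" and h x :: "'v \<Rightarrow> 'l" and n :: nat and \<pi> :: "'l \<Rightarrow> complex mat"
  assumes root_system: "root_system \<Phi>"
    and semisimple: "finite_dim_semisimple"
    and cartan: "cartan_subalgebra H"
    and roots: "has_root_system H \<Phi> rt"
    and base: "root_base \<Phi> \<Delta>"
    and basis: "chevalley_basis H \<Phi> rt \<Delta> h x"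
    and faithful: "faithful_representation n \<pi>"
    and admissible: "\<And>\<alpha> k i j. \<alpha> \<in> \<Phi> \<Longrightarrow> i < n \<Longrightarrow> j < n \<Longrightarrow>
      divided_power (\<pi> (x \<alpha>)) k $$ (i, j) \<in> \<int>"

definition SL :: "nat \<Rightarrow> 'a::comm_ring_1 mat monoid" where
  "SL n = \<lparr>carrier = {A \<in> carrier_mat n n. det A = 1}, monoid.mult = (*), one = 1\<^sub>m n\<rparr>"

text \<open>Below, \<open>X \<alpha>\<close> is the matrix \<open>\<pi> (x \<alpha>)\<close>.  It is nilpotent of size \<open>n\<close>, so the exponential
  series stops before \<open>k = n\<close>; the entries of its divided powers are integers, here read off
  by \<open>\<lfloor>Re _\<rfloor>\<close> and mapped to the coefficient ring.\<close>

definition root_unipotent ::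
  "nat \<Rightarrow> ('v \<Rightarrow> complex mat) \<Rightarrow> 'v \<Rightarrow> 'a::comm_ring_1 \<Rightarrow> 'a mat" where
  "root_unipotent n X \<alpha> t =
    mat n n (\<lambda>ij. \<Sum>k<n. t ^ k * of_int \<lfloor>Re (divided_power (X \<alpha>) k $$ ij)\<rfloor>)"

definition elementary_group ::
  "nat \<Rightarrow> ('v \<Rightarrow> complex mat) \<Rightarrow> 'v set \<Rightarrow> 'a::comm_ring_1 mat set" where
  "elementary_group n X \<Phi> = generate (SL n) {root_unipotent n X \<alpha> t | \<alpha> t. \<alpha> \<in> \<Phi>}"

text \<open>Integral polynomials in the matrix entries: exponents of the variables \<open>(i, j)\<close> mapped to
  coefficients.  Variables outside the \<open>n\<close> by \<open>n\<close> range have to be excluded, because \<open>$$\<close> is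
  unspecified there.\<close>

type_synonym entry_poly = "((nat \<times> nat) \<Rightarrow>\<^sub>0 nat) \<Rightarrow>\<^sub>0 int"

definition entry_polys :: "nat \<Rightarrow> entry_poly set" where
  "entry_polys n = {f. \<forall>m\<in>Poly_Mapping.keys f. Poly_Mapping.keys m \<subseteq> {..<n} \<times> {..<n}}"

definition eval_entry_poly :: "entry_poly \<Rightarrow> 'a::comm_ring_1 mat \<Rightarrow> 'a" where
  "eval_entry_poly f A = (\<Sum>m\<in>Poly_Mapping.keys f. of_int (Poly_Mapping.lookup f m) *
    (\<Prod>ij\<in>Poly_Mapping.keys m. (A $$ ij) ^ Poly_Mapping.lookup m ij))"

text \<open>Chevalley's construction of the group scheme: over the complex numbers the group is
  generated by the root unipotents, its integral coordinate ring is the quotient of the ring of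
  integral polynomials in the matrix entries by those vanishing on the complex group, and the
  points over a ring are the matrices satisfying the same equations.\<close>

definition chevalley_group ::
  "nat \<Rightarrow> ('v \<Rightarrow> complex mat) \<Rightarrow> 'v set \<Rightarrow> 'a::comm_ring_1 mat monoid" where
  "chevalley_group n X \<Phi> = (SL n)\<lparr>carrier := {A \<in> carrier (SL n).
    \<forall>f\<in>entry_polys n.
      (\<forall>B\<in>elementary_group n X \<Phi>. eval_entry_poly f (B :: complex mat) = 0) \<longrightarrow>
      eval_entry_poly f A = 0}\<rparr>"

definition large_subgroup ::
  "nat \<Rightarrow> ('v \<Rightarrow> complex mat) \<Rightarrow> 'v set \<Rightarrow> 'a::comm_ring_1 mat set \<Rightarrow> bool" where
  "large_subgroup n X \<Phi> K \<longleftrightarrow>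
    subgroup K (chevalley_group n X \<Phi>) \<and> elementary_group n X \<Phi> \<subseteq> K"

end

theory Submission
  imports Defs "HOL-Analysis.Linear_Algebra" "Jordan_Normal_Form.Schur_Decomposition"
begin

text \<open>
  Write \<open>g\<close> as a word in root elements.  A decision procedure makes it possible to search, for every
  \<open>k\<close>, for natural numbers \<open>m\<^sub>j\<close> approximating the parameters of this word up to \<open>p ^ k\<close>, provided that
  this approximation is expressed by equations with coefficients \<open>x\<^sub>\<alpha>(1)\<close> and \<open>g\<close>.  Then the entries of
  \<open>g\<close> are approximated by computable integers, so their digits are computable.

  Over the field, only long roots \<open>\<gamma>\<close> are used as parameters; commutators with \<open>x\<^sub>\<alpha>(1)\<close> yield the other
  root elements and make central factors disappear.  Up to central factors, the elements \<open>x\<^sub>\<gamma>(t)\<close> are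
  exactly those commuting with all \<open>x\<^sub>\<sigma>(1)\<close> such that the Cartan number of \<open>\<sigma>\<close> and \<open>\<gamma>\<close> is not negative.  An
  equation \<open>P h = h P\<close> with \<open>P = x\<^sub>-\<^sub>\<gamma>(a) x\<^sub>\<gamma>(b) x\<^sub>-\<^sub>\<gamma>(c)\<close>, where \<open>h\<close> lies in an anisotropic torus of \<open>SL\<^sub>2\<close>,
  forces \<open>u\<^sup>2 + p u v - p v\<^sup>2 = 1\<close> with \<open>b = \<plusminus> p v\<close>.  Since this norm form is anisotropic, \<open>v\<close> is integral;
  conversely, every \<open>v\<close> divisible by \<open>4\<close> occurs.  So \<open>x\<^sub>\<gamma>(m / p ^ s) x\<^sub>\<gamma>(b) ^ (p ^ k)\<close> has a parameter that is
  known up to \<open>p ^ k\<close>.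

  Over the ring no such equations are needed: there is an \<open>M\<close> with \<open>y ^ M\<close> congruent to \<open>1\<close> modulo \<open>p\<close>
  for all \<open>y\<close>, and then \<open>y ^ (M p ^ k)\<close> is congruent to \<open>1\<close> modulo \<open>p ^ k\<close>.
\<close>

subsection \<open>Computable functions\<close>

text \<open>Over the field a parameter may have any denominator, so the \<open>p ^ k\<close>-th
  power of an arbitrary root element need not be close to 1. This is the obstacle: integrality
  itself must be imposed by equations. The norm form arises from \<open>h - 1\<close>, whose
  characteristic polynomial \<open>T\<^sup>2 - p T - p\<close> is Eisenstein: a matrix commuting
  with \<open>h\<close> is \<open>u + v (h - 1)\<close>, and
  \<open>u\<^sup>2 + p u v - p v\<^sup>2\<close> is its determinant. Long roots are preferred
  because every other root has Cartan number -1, 0 or 1 with a long \<gamma>; this gives short root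
  strings, a centralizer that can be computed, and a standard two-dimensional module for the
  \<open>SL\<^sub>2\<close> of \<gamma>. Nothing is known about the remaining elements of a large
  subgroup except integral polynomial equations; from these it is derived that conjugation preserves
  the span of the root vectors and coroots, by transferring a polynomial identity from the complex
  group. The solution that the search finds need not be the intended one: the parameters may change
  with \<open>k\<close>, and only their product \<open>g\<close> stays fixed.\<close>

definition computable_fun :: "nat \<Rightarrow> (nat list \<Rightarrow> nat) \<Rightarrow> bool" where
  "computable_fun r F \<longleftrightarrow> (\<exists>c. \<forall>xs. length xs = r \<longrightarrow> computes c xs (F xs))"

lemma computable_funI:
  "(\<And>xs. length xs = r \<Longrightarrow> computes c xs (F xs)) \<Longrightarrow> computable_fun r F"
  by (auto simp: computable_fun_def)

lemma computable_fun_cong: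
  assumes "computable_fun r F" "\<And>xs. length xs = r \<Longrightarrow> F xs = G xs"
  shows "computable_fun r G"
  using assms by (auto simp: computable_fun_def)

lemma computable_fun_proj: "i < r \<Longrightarrow> computable_fun r (\<lambda>xs. xs ! i)"
  by (rule computable_funI[where c = "Proj i"]) (auto intro: computes.proj)

lemma computable_fun_comp:
  assumes F: "computable_fun s F" and len: "length Gs = s"
    and G: "\<And>G. G \<in> set Gs \<Longrightarrow> computable_fun r G"
  shows "computable_fun r (\<lambda>xs. F (map (\<lambda>G. G xs) Gs))"
proof -
  obtain c where c: "\<And>xs. length xs = s \<Longrightarrow> computes c xs (F xs)"
    using F by (auto simp: computable_fun_def)
  obtain d where d: "\<And>G xs. G \<in> set Gs \<Longrightarrow> length xs = r \<Longrightarrow> computes (d G) xs (G xs)"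
    using G unfolding computable_fun_def by metis
  show ?thesis
  proof (rule computable_funI[where c = "Comp c (map d Gs)"])
    fix xs :: "nat list" assume "length xs = r"
    thus "computes (Comp c (map d Gs)) xs (F (map (\<lambda>G. G xs) Gs))"
      using c d len by (intro computes.comp[where ys = "map (\<lambda>G. G xs) Gs"])
        (auto simp: list_all2_conv_all_nth)
  qed
qed

lemma computable_fun_comp1:
  assumes "computable_fun 1 (\<lambda>xs. f (xs ! 0))" "computable_fun r G"
  shows "computable_fun r (\<lambda>xs. f (G xs))"
  using computable_fun_comp[OF assms(1), of "[G]" r] assms(2) by simp

lemma computable_fun_comp2:
  assumes "computable_fun 2 (\<lambda>xs. f (xs ! 0) (xs ! 1))" "computable_fun r G" "computable_fun r H"
  shows "computable_fun r (\<lambda>xs. f (G xs) (H xs))"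
  using computable_fun_comp[OF assms(1), of "[G, H]" r] assms(2,3) by force

lemma computable_fun_Suc: "computable_fun r F \<Longrightarrow> computable_fun r (\<lambda>xs. Suc (F xs))"
proof (rule computable_fun_comp1[where f = Suc])
  show "computable_fun 1 (\<lambda>xs. Suc (xs ! 0))"
  proof (rule computable_funI[where c = Succ])
    fix xs :: "nat list" assume "length xs = 1"
    then obtain x where "xs = [x]" by (auto simp: length_Suc_conv)
    thus "computes Succ xs (Suc (xs ! 0))" by (auto intro: computes.succ)
  qed
qed

lemma computable_fun_const: "computable_fun r (\<lambda>xs. k)"
proof (induction k)
  case 0 show ?case by (rule computable_funI[where c = Zero]) (auto intro: computes.zero)
qed (rule computable_fun_Suc)

lemma computable_fun_primrec:
  assumes "computable_fun r F" "computable_fun (Suc (Suc r)) G"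
  shows "computable_fun (Suc r) (\<lambda>xs. rec_nat (F (tl xs)) (\<lambda>k y. G (k # y # tl xs)) (hd xs))"
proof -
  obtain c d where c: "\<And>xs. length xs = r \<Longrightarrow> computes c xs (F xs)"
    and d: "\<And>xs. length xs = Suc (Suc r) \<Longrightarrow> computes d xs (G xs)"
    using assms by (auto simp: computable_fun_def)
  have "computes (PrimRec c d) (k # ys) (rec_nat (F ys) (\<lambda>k y. G (k # y # ys)) k)"
    if "length ys = r" for k ys
    by (induction k) (use c d that in \<open>auto intro: computes.rec_0 computes.rec_Suc\<close>)
  thus ?thesis
    by (intro computable_funI[where c = "PrimRec c d"]) (auto simp: length_Suc_conv)
qed

lemma computable_fun_iterate:
  assumes "computable_fun 1 (\<lambda>xs. f (xs ! 0))" "computable_fun r N" "computable_fun r A"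
  shows "computable_fun r (\<lambda>xs. (f ^^ N xs) (A xs))"
proof (rule computable_fun_comp2[OF _ assms(2,3)])
  have "computable_fun (Suc 1) (\<lambda>xs. rec_nat ((\<lambda>xs. xs ! 0) (tl xs))
      (\<lambda>k y. (\<lambda>xs. f (xs ! 1)) (k # y # tl xs)) (hd xs))"
    by (intro computable_fun_primrec computable_fun_proj computable_fun_comp1[OF assms(1)]) auto
  moreover have "rec_nat a (\<lambda>k. f) k = (f ^^ k) a" for a k by (induction k) auto
  ultimately show "computable_fun 2 (\<lambda>xs. (f ^^ (xs ! 0)) (xs ! 1))"
    by (simp add: numeral_2_eq_2)
      (erule computable_fun_cong, auto simp: length_Suc_conv)
qed

lemma computable_fun_add:
  assumes "computable_fun r F" "computable_fun r G"
  shows "computable_fun r (\<lambda>xs. F xs + G xs)"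
proof -
  have "computable_fun r (\<lambda>xs. (Suc ^^ F xs) (G xs))"
    by (intro computable_fun_iterate assms computable_fun_Suc computable_fun_proj) simp
  moreover have "(Suc ^^ k) a = k + a" for k a by (induction k) auto
  ultimately show ?thesis by simp
qed

lemma computable_fun_mult:
  assumes "computable_fun r F" "computable_fun r G"
  shows "computable_fun r (\<lambda>xs. F xs * G xs)"
proof (rule computable_fun_comp2[OF _ assms])
  have "computable_fun (Suc 1) (\<lambda>xs. rec_nat ((\<lambda>xs. 0) (tl xs))
      (\<lambda>k y. (\<lambda>xs. xs ! 1 + xs ! 2) (k # y # tl xs)) (hd xs))"
    by (intro computable_fun_primrec computable_fun_proj computable_fun_const computable_fun_add) auto
  moreover have "rec_nat 0 (\<lambda>k y. y + a) k = k * a" for a k :: nat by (induction k) auto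
  ultimately show "computable_fun 2 (\<lambda>xs. xs ! 0 * xs ! 1)"
    by (simp add: numeral_2_eq_2)
      (erule computable_fun_cong, auto simp: length_Suc_conv)
qed

lemma computable_fun_power:
  assumes "computable_fun r F"
  shows "computable_fun r (\<lambda>xs. a ^ F xs)"
proof -
  have "computable_fun r (\<lambda>xs. ((\<lambda>x. a * x) ^^ F xs) 1)"
    by (intro computable_fun_iterate assms computable_fun_mult computable_fun_proj
        computable_fun_const) simp
  moreover have "((\<lambda>x. a * x) ^^ k) 1 = a ^ k" for k by (induction k) auto
  ultimately show ?thesis by simp
qed

lemma computable_fun_diff:
  assumes "computable_fun r F" "computable_fun r G"
  shows "computable_fun r (\<lambda>xs. F xs - G xs)"
proof -
  have pred: "computable_fun 1 (\<lambda>xs. xs ! 0 - 1)"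
  proof -
    have "computable_fun (Suc 0) (\<lambda>xs. rec_nat ((\<lambda>xs. 0) (tl xs))
        (\<lambda>k y. (\<lambda>xs. xs ! 0) (k # y # tl xs)) (hd xs))"
      by (intro computable_fun_primrec computable_fun_proj computable_fun_const) simp
    moreover have "rec_nat 0 (\<lambda>k y. k) k = k - 1" for k :: nat by (cases k) auto
    ultimately show ?thesis by simp (erule computable_fun_cong, auto simp: length_Suc_conv)
  qed
  have "computable_fun r (\<lambda>xs. ((\<lambda>x. x - 1) ^^ G xs) (F xs))"
    by (rule computable_fun_iterate[OF pred assms(2,1)])
  moreover have "((\<lambda>x. x - 1) ^^ k) a = a - k" for k a :: nat by (induction k) auto
  ultimately show ?thesis by simp
qed

lemma computable_fun_mu:
  assumes F: "computable_fun (Suc r) F" and ex: "\<And>xs. length xs = r \<Longrightarrow> \<exists>k. F (k # xs) = 0"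
  shows "computable_fun r (\<lambda>xs. LEAST k. F (k # xs) = 0)"
proof -
  obtain c where c: "\<And>xs. length xs = Suc r \<Longrightarrow> computes c xs (F xs)"
    using F by (auto simp: computable_fun_def)
  show ?thesis
  proof (rule computable_funI[where c = "Mu c"], rule computes.mu)
    fix xs :: "nat list" assume xs: "length xs = r"
    let ?k = "LEAST k. F (k # xs) = 0"
    have "F (?k # xs) = 0" using ex[OF xs] by (metis (mono_tags, lifting) LeastI)
    thus "computes c (?k # xs) 0" using c[of "?k # xs"] xs by simp
    show "\<forall>j<?k. \<exists>y>0. computes c (j # xs) y"
    proof (intro allI impI)
      fix j assume "j < ?k"
      hence "F (j # xs) \<noteq> 0" by (rule not_less_Least)
      thus "\<exists>y>0. computes c (j # xs) y" using c[of "j # xs"] xs by auto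
    qed
  qed
qed

lemma computable_fun_cong1:
  assumes "computable_fun 1 (\<lambda>xs. f (xs ! 0))" shows "computable f"
proof -
  obtain c where "\<And>xs. length xs = 1 \<Longrightarrow> computes c xs (f (xs ! 0))"
    using assms by (auto simp: computable_fun_def)
  from this[of "[_]"] show ?thesis unfolding computable_def by auto
qed

lemma computable_iff: "computable f \<longleftrightarrow> computable_fun 1 (\<lambda>xs. f (xs ! 0))"
proof
  assume "computable f"
  then obtain c where c: "\<And>x. computes c [x] (f x)" by (auto simp: computable_def)
  show "computable_fun 1 (\<lambda>xs. f (xs ! 0))"
    by (rule computable_funI[where c = c]) (auto simp: length_Suc_conv c)
qed (rule computable_fun_cong1)

text \<open>The quotient is the least \<open>k\<close> with \<open>x < d * Suc k\<close>, which
  truncated subtraction expresses as the vanishing of \<open>Suc x - d * Suc k\<close>.\<close>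

lemma computable_fun_div:
  assumes "computable_fun r F" "d > 0"
  shows "computable_fun r (\<lambda>xs. F xs div d)"
proof (rule computable_fun_comp1[OF _ assms(1)])
  have "computable_fun 1 (\<lambda>xs. LEAST k. (\<lambda>xs. Suc (xs ! 1) - d * Suc (xs ! 0)) (k # xs) = 0)"
  proof (rule computable_fun_mu)
    show "computable_fun (Suc 1) (\<lambda>xs. Suc (xs ! 1) - d * Suc (xs ! 0))"
      by (intro computable_fun_diff computable_fun_Suc computable_fun_mult computable_fun_proj
          computable_fun_const) auto
    fix xs :: "nat list"
    have "Suc (xs ! 0) \<le> d * Suc (xs ! 0)" using assms(2) by (cases d) auto
    thus "\<exists>k. Suc ((k # xs) ! 1) - d * Suc ((k # xs) ! 0) = 0" by (intro exI[of _ "xs ! 0"]) auto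
  qed
  moreover have "(LEAST k. Suc x - d * Suc k = 0) = x div d" for x
  proof (rule Least_equality)
    have "x < d * Suc (x div d)" using assms(2) by (metis mult_Suc_right dividend_less_times_div add.commute mult.commute)
    thus "Suc x - d * Suc (x div d) = 0" by simp
    fix k assume "Suc x - d * Suc k = 0"
    hence "x < Suc k * d" by (simp add: mult.commute)
    hence "x div d < Suc k" by (rule less_mult_imp_div_less)
    thus "x div d \<le> k" by simp
  qed
  ultimately show "computable_fun 1 (\<lambda>xs. xs ! 0 div d)" by simp
qed

text \<open>The divisor now varies with the arguments, so it enters the search as \<open>Suc\<close>
  of its predecessor: the search then ends for every argument list, and \<open>pos\<close> restores
  the intended divisor.\<close>

lemma computable_fun_mod:
  assumes F: "computable_fun r F" and G: "computable_fun r G" and pos: "\<And>xs. length xs = r \<Longrightarrow> G xs > 0"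
  shows "computable_fun r (\<lambda>xs. F xs mod G xs)"
proof -
  have "computable_fun 2 (\<lambda>xs. LEAST k. (\<lambda>xs. Suc (xs ! 1) - Suc (xs ! 2) * Suc (xs ! 0)) (k # xs) = 0)"
  proof (rule computable_fun_mu)
    show "computable_fun (Suc 2) (\<lambda>xs. Suc (xs ! 1) - Suc (xs ! 2) * Suc (xs ! 0))"
      by (intro computable_fun_diff computable_fun_Suc computable_fun_mult computable_fun_proj) auto
    fix xs :: "nat list"
    show "\<exists>k. Suc ((k # xs) ! 1) - Suc ((k # xs) ! 2) * Suc ((k # xs) ! 0) = 0"
      by (intro exI[of _ "xs ! 0"]) auto
  qed
  moreover have "(LEAST k. Suc x - Suc d * Suc k = 0) = x div Suc d" for x d
  proof (rule Least_equality)
    have "x < Suc d * Suc (x div Suc d)"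
      using dividend_less_times_div[of "Suc d" x] by simp
    thus "Suc x - Suc d * Suc (x div Suc d) = 0" by simp
    fix k assume "Suc x - Suc d * Suc k = 0"
    hence "x < Suc k * Suc d" by (simp add: mult.commute)
    hence "x div Suc d < Suc k" by (rule less_mult_imp_div_less)
    thus "x div Suc d \<le> k" by simp
  qed
  ultimately have div2: "computable_fun 2 (\<lambda>xs. xs ! 0 div Suc (xs ! 1))" by simp
  have "computable_fun 2 (\<lambda>xs. xs ! 0 - Suc (xs ! 1) * (xs ! 0 div Suc (xs ! 1)))"
    by (intro computable_fun_diff computable_fun_mult computable_fun_Suc div2 computable_fun_proj) auto
  hence "computable_fun 2 (\<lambda>xs. xs ! 0 mod Suc (xs ! 1))"
    by (simp only: minus_mult_div_eq_mod)
  from computable_fun_comp2[OF this F computable_fun_diff[OF G computable_fun_const[of r 1]]]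
  show ?thesis by (rule computable_fun_cong) (use pos in force)
qed

lemma computable_fun_triangle:
  assumes "computable_fun r F" shows "computable_fun r (\<lambda>xs. triangle (F xs))"
  unfolding triangle_def
  by (intro computable_fun_div computable_fun_mult computable_fun_Suc assms) auto

lemma computable_fun_prod_encode:
  assumes "computable_fun r F" "computable_fun r G"
  shows "computable_fun r (\<lambda>xs. prod_encode (F xs, G xs))"
  unfolding prod_encode_def prod.case
  by (intro computable_fun_add computable_fun_triangle assms)

lemma triangle_mono: "a \<le> b \<Longrightarrow> triangle a \<le> triangle b"
  by (induction b rule: dec_induct) (auto simp: triangle_Suc)

text \<open>The sum of the two components is the index of the diagonal on which the code lies.\<close>

lemma Least_diagonal: "(LEAST k. Suc (prod_encode (a, b)) - triangle (Suc k) = 0) = a + b"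
proof (rule Least_equality)
  show "Suc (prod_encode (a, b)) - triangle (Suc (a + b)) = 0"
    by (simp add: prod_encode_def triangle_Suc)
  fix k assume "Suc (prod_encode (a, b)) - triangle (Suc k) = 0"
  hence "triangle (a + b) < triangle (Suc k)" by (simp add: prod_encode_def)
  hence "\<not> Suc k \<le> a + b" using triangle_mono[of "Suc k" "a + b"] by linarith
  thus "a + b \<le> k" by simp
qed

lemma computable_fun_prod_decode:
  assumes F: "computable_fun r F"
  shows "computable_fun r (\<lambda>xs. fst (prod_decode (F xs)))" "computable_fun r (\<lambda>xs. snd (prod_decode (F xs)))"
proof -
  let ?d = "\<lambda>x. LEAST k. Suc x - triangle (Suc k) = 0"
  have "computable_fun 1 (\<lambda>xs. LEAST k. (\<lambda>xs. Suc (xs ! 1) - triangle (Suc (xs ! 0))) (k # xs) = 0)"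
  proof (rule computable_fun_mu)
    show "computable_fun (Suc 1) (\<lambda>xs. Suc (xs ! 1) - triangle (Suc (xs ! 0)))"
      by (intro computable_fun_diff computable_fun_Suc computable_fun_triangle computable_fun_proj) auto
    fix xs :: "nat list"
    show "\<exists>k. Suc ((k # xs) ! 1) - triangle (Suc ((k # xs) ! 0)) = 0"
      by (intro exI[of _ "xs ! 0"]) (auto simp: triangle_Suc)
  qed
  hence d: "computable_fun 1 (\<lambda>xs. ?d (xs ! 0))" by simp
  have sum: "fst (prod_decode x) + snd (prod_decode x) = ?d x" for x
    using Least_diagonal[of "fst (prod_decode x)" "snd (prod_decode x)"] by simp
  \<comment> \<open>A code is the triangle number of its diagonal plus the first component, so
    subtraction recovers that component.\<close>
  have fst: "fst (prod_decode x) = x - triangle (?d x)" for x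
  proof -
    obtain a b where x: "x = prod_encode (a, b)" by (metis prod_decode_inverse surj_pair)
    show ?thesis unfolding sum[of x, symmetric] by (simp add: x) (simp add: prod_encode_def)
  qed
  have snd: "snd (prod_decode x) = ?d x - (x - triangle (?d x))" for x
    using sum[of x] fst[of x] by linarith
  have "computable_fun 1 (\<lambda>xs. fst (prod_decode (xs ! 0)))" "computable_fun 1 (\<lambda>xs. snd (prod_decode (xs ! 0)))"
    unfolding fst snd by (intro computable_fun_diff computable_fun_triangle d computable_fun_proj; simp)+
  from this[THEN computable_fun_comp1, OF F]
  show "computable_fun r (\<lambda>xs. fst (prod_decode (F xs)))" "computable_fun r (\<lambda>xs. snd (prod_decode (F xs)))"
    by auto
qed

text \<open>Repeated splitting into head and tail makes every number a code of an infinite sequence,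
  so an unbounded search over a single number runs through all tuples of any fixed length.\<close>

definition tuple_entry :: "nat \<Rightarrow> nat \<Rightarrow> nat" where
  "tuple_entry j c = fst (prod_decode (((\<lambda>c. snd (prod_decode c)) ^^ j) c))"

lemma computable_fun_tuple_entry:
  assumes "computable_fun r F" shows "computable_fun r (\<lambda>xs. tuple_entry j (F xs))"
  unfolding tuple_entry_def
  by (intro computable_fun_prod_decode computable_fun_iterate computable_fun_const assms computable_fun_proj) simp

lemma tuple_entry_surj: "\<exists>c. \<forall>j<r. tuple_entry j c = m j"
proof (induction r arbitrary: m)
  case (Suc r)
  obtain c where c: "\<And>j. j < r \<Longrightarrow> tuple_entry j c = m (Suc j)" using Suc.IH[of "\<lambda>j. m (Suc j)"] by blast
  have "tuple_entry j (prod_encode (m 0, c)) = m j" if "j < Suc r" for j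
    using that c by (cases j) (auto simp: tuple_entry_def funpow_Suc_right simp del: funpow.simps(2))
  thus ?case by blast
qed simp

text \<open>Signed values are carried as differences of natural numbers: sums and products of such
  differences are of the same form again, without a case distinction on signs.\<close>

definition computable_int :: "(nat \<Rightarrow> int) \<Rightarrow> bool" where
  "computable_int Q \<longleftrightarrow> (\<exists>P R. computable P \<and> computable R \<and> (\<forall>c. Q c = int (P c) - int (R c)))"

lemma computable_intI:
  "computable_fun 1 (\<lambda>xs. P (xs ! 0)) \<Longrightarrow> computable_fun 1 (\<lambda>xs. R (xs ! 0)) \<Longrightarrow>
    (\<And>c. Q c = int (P c) - int (R c)) \<Longrightarrow> computable_int Q"
  unfolding computable_int_def computable_iff by blast

lemma computable_intE:
  assumes "computable_int Q"
  obtains P R where "computable_fun 1 (\<lambda>xs. P (xs ! 0))" "computable_fun 1 (\<lambda>xs. R (xs ! 0))"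
    "\<And>c. Q c = int (P c) - int (R c)"
  using assms unfolding computable_int_def computable_iff by blast

lemma computable_int_const: "computable_int (\<lambda>c. z)"
  by (rule computable_intI[where P = "\<lambda>c. nat z" and R = "\<lambda>c. nat (- z)"])
    (auto intro: computable_fun_const)

lemma computable_int_of_nat:
  "computable_fun 1 (\<lambda>xs. P (xs ! 0)) \<Longrightarrow> computable_int (\<lambda>c. int (P c))"
  by (erule computable_intI[where R = "\<lambda>c. 0"]) (auto intro: computable_fun_const)

lemma computable_int_add:
  assumes "computable_int Q" "computable_int Q'"
  shows "computable_int (\<lambda>c. Q c + Q' c)"
proof -
  note intros = computable_fun_add
  from assms(1) obtain P R where 1: "computable_fun 1 (\<lambda>xs. P (xs ! 0))"
    "computable_fun 1 (\<lambda>xs. R (xs ! 0))" "\<And>c. Q c = int (P c) - int (R c)"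
    by (rule computable_intE) blast
  from assms(2) obtain P' R' where 2: "computable_fun 1 (\<lambda>xs. P' (xs ! 0))"
    "computable_fun 1 (\<lambda>xs. R' (xs ! 0))" "\<And>c. Q' c = int (P' c) - int (R' c)"
    by (rule computable_intE) blast
  show ?thesis
    by (rule computable_intI[where P = "\<lambda>c. P c + P' c" and R = "\<lambda>c. R c + R' c"])
      (use 1 2 in \<open>auto intro!: intros\<close>)
qed

lemma computable_int_mult:
  assumes "computable_int Q" "computable_int Q'"
  shows "computable_int (\<lambda>c. Q c * Q' c)"
proof -
  note intros = computable_fun_add computable_fun_mult
  from assms(1) obtain P R where 1: "computable_fun 1 (\<lambda>xs. P (xs ! 0))"
    "computable_fun 1 (\<lambda>xs. R (xs ! 0))" "\<And>c. Q c = int (P c) - int (R c)"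
    by (rule computable_intE) blast
  from assms(2) obtain P' R' where 2: "computable_fun 1 (\<lambda>xs. P' (xs ! 0))"
    "computable_fun 1 (\<lambda>xs. R' (xs ! 0))" "\<And>c. Q' c = int (P' c) - int (R' c)"
    by (rule computable_intE) blast
  show ?thesis
    by (rule computable_intI[where P = "\<lambda>c. P c * P' c + R c * R' c"
          and R = "\<lambda>c. P c * R' c + R c * P' c"])
      (use 1 2 in \<open>auto intro!: intros simp: ring_distribs\<close>)
qed

lemma computable_int_power: "computable_int Q \<Longrightarrow> computable_int (\<lambda>c. Q c ^ k)"
  by (induction k) (auto intro: computable_int_const computable_int_mult)

lemma computable_int_sum:
  "(\<And>i. i \<in> I \<Longrightarrow> computable_int (Q i)) \<Longrightarrow> computable_int (\<lambda>c. \<Sum>i\<in>I. Q i c)"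
  by (induction I rule: infinite_finite_induct) (auto intro: computable_int_const computable_int_add)

subsection \<open>Arithmetic of $p$-adic integers and numbers\<close>

abbreviation padic_p :: "'p::prime_card padic_int" where "padic_p \<equiv> of_nat CARD('p)"

lemma residue_add: "residue (a + b :: 'p::prime_card padic_int) i = (residue a i + residue b i) mod int CARD('p) ^ (i + 1)"
  by (simp add: plus_padic_int.rep_eq)

lemma residue_mult: "residue (a * b :: 'p::prime_card padic_int) i = (residue a i * residue b i) mod int CARD('p) ^ (i + 1)"
  by (simp add: times_padic_int.rep_eq)

lemma residue_diff: "residue (a - b :: 'p::prime_card padic_int) i = (residue a i - residue b i) mod int CARD('p) ^ (i + 1)"
  by (simp add: minus_padic_int.rep_eq)

lemma residue_0 [simp]: "residue (0 :: 'p::prime_card padic_int) i = 0"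
  by (simp add: zero_padic_int.rep_eq)

lemma residue_eqI: "(\<And>i. residue a i = residue b i) \<Longrightarrow> a = b"
  by (metis ext residue_inject)

lemma residue_of_nat: "residue (of_nat m :: 'p::prime_card padic_int) i = int m mod int CARD('p) ^ (i + 1)"
proof (induction m)
  case (Suc m)
  have "residue (of_nat (Suc m) :: 'p padic_int) i = residue (of_nat m + 1 :: 'p padic_int) i"
    by (simp add: add.commute)
  also have "\<dots> = (int m + 1) mod int CARD('p) ^ (i + 1)"
    unfolding residue_add Suc.IH by (simp add: one_padic_int.rep_eq mod_simps)
  finally show ?case by (simp add: add.commute)
qed simp

lemma residue_of_int: "residue (of_int z :: 'p::prime_card padic_int) i = z mod int CARD('p) ^ (i + 1)"
proof (cases z rule: int_cases2)
  case (nonneg m) thus ?thesis by (simp add: residue_of_nat)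
next
  case (nonpos m)
  have "residue (of_int z :: 'p padic_int) i = residue (0 - of_nat m :: 'p padic_int) i"
    by (simp add: nonpos)
  also have "\<dots> = z mod int CARD('p) ^ (i + 1)"
    unfolding residue_diff residue_of_nat by (simp add: nonpos mod_simps)
  finally show ?thesis .
qed

text \<open>For the converse, the quotient is obtained by shifting: its residue \<open>i\<close> is
  residue \<open>i + k + 1\<close> of \<open>x\<close> divided by
  \<open>p ^ (k + 1)\<close>.\<close>

lemma p_power_dvd_iff:
  "(padic_p :: 'p::prime_card padic_int) ^ Suc k dvd x \<longleftrightarrow> residue x k = 0"
proof
  assume "padic_p ^ Suc k dvd x"
  then obtain y where "x = of_nat (CARD('p) ^ Suc k) * y" by (auto simp: dvd_def)
  hence "residue x k = int (CARD('p) ^ Suc k) mod int CARD('p) ^ (k + 1) * residue y k mod int CARD('p) ^ (k + 1)"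
    by (simp only: residue_mult residue_of_nat)
  thus "residue x k = 0" by simp
next
  let ?p = "int CARD('p)"
  assume 0: "residue x k = 0"
  define f where "f i = residue x (i + k + 1) div ?p ^ (k + 1)" for i
  have "?p ^ (k + 1) dvd residue x (i + k + 1)" for i
    using residue_cong[of k "i + k + 1" x] 0 by (simp add: cong_0_iff)
  hence f: "residue x (i + k + 1) = ?p ^ (k + 1) * f i" for i by (simp add: f_def)
  have pos: "?p > 0" by (rule card_pos)
  have "0 \<le> f i" for i using residue_bounds(1)[of x "i + k + 1"] pos by (simp add: f_def pos_imp_zdiv_nonneg_iff)
  moreover have "f i < ?p ^ (i + 1)" for i
  proof -
    have "?p ^ (k + 1) * f i < ?p ^ (i + k + 1 + 1)" using residue_bounds(2)[of x "i + k + 1"] by (simp only: f)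
    also have "\<dots> = ?p ^ (k + 1) * ?p ^ (i + 1)" by (simp add: power_add)
    finally show ?thesis using pos by (simp del: power_Suc)
  qed
  moreover have "[f (i + 1) = f i] (mod ?p ^ (i + 1))" for i
  proof -
    have "[?p ^ (k + 1) * f (i + 1) = ?p ^ (k + 1) * f i] (mod ?p ^ (i + k + 1 + 1))"
      using residue_cong[of "i + k + 1" "i + 1 + k + 1" x] unfolding f by simp
    hence "?p ^ (k + 1) * ?p ^ (i + 1) dvd ?p ^ (k + 1) * (f (i + 1) - f i)"
      by (simp add: cong_iff_dvd_diff power_add algebra_simps)
    thus ?thesis using pos by (simp add: cong_iff_dvd_diff del: power_Suc)
  qed
  ultimately have "residue (Abs_padic_int f :: 'p padic_int) = f"
    by (intro Abs_padic_int_inverse) auto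
  moreover have "residue x i = (?p ^ (k + 1) * f i) mod ?p ^ (i + 1)" for i
    using residue_cong[of i "i + k + 1" x] residue_bounds[of x i] unfolding f by (simp add: cong_def)
  ultimately have "x = of_nat (CARD('p) ^ Suc k) * (Abs_padic_int f :: 'p padic_int)"
    by (intro residue_eqI) (simp only: residue_mult residue_of_nat mod_simps, simp)
  thus "padic_p ^ Suc k dvd x" by simp
qed

lemma residue_eq_iff_dvd:
  "residue (x :: 'p::prime_card padic_int) k = residue y k \<longleftrightarrow> padic_p ^ Suc k dvd x - y"
  unfolding p_power_dvd_iff residue_diff
  using residue_bounds[of x k] residue_bounds[of y k]
  by (metis Suc_eq_plus1 cancel_comm_monoid_add_class.diff_cancel cong_def cong_diff_iff_cong_0 mod_pos_pos_trivial mod_0)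

lemma p_dvd_mult:
  assumes "(padic_p :: 'p::prime_card padic_int) dvd a * b" shows "padic_p dvd a \<or> padic_p dvd b"
proof -
  have "residue (a * b) 0 = 0" using assms p_power_dvd_iff[of 0 "a * b"] by simp
  hence "int CARD('p) dvd residue a 0 * residue b 0" by (simp add: residue_mult mod_eq_0_iff_dvd)
  hence "int CARD('p) dvd residue a 0 \<or> int CARD('p) dvd residue b 0"
    using prime_dvd_mult_iff prime_card_int by blast
  hence "residue a 0 = 0 \<or> residue b 0 = 0"
    using residue_bounds[of a 0] residue_bounds[of b 0] zdvd_imp_le[of "int CARD('p)"]
    by (metis One_nat_def add.left_neutral linorder_not_less nless_le power_one_right Suc_eq_plus1)
  thus ?thesis using p_power_dvd_iff[of 0 a] p_power_dvd_iff[of 0 b] by simp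
qed

text \<open>All residues are then invertible modulo their powers of \<open>p\<close>. Inverses
  modulo a number are unique, so those for successive powers agree and form the residue sequence of
  an inverse.\<close>

lemma unit_if_residue_nonzero:
  assumes "residue (x :: 'p::prime_card padic_int) 0 \<noteq> 0" shows "x dvd 1"
proof -
  let ?p = "int CARD('p)"
  have pos: "?p > 0" by (rule card_pos)
  have "coprime (residue x i) (?p ^ (i + 1))" for i
  proof -
    have "\<not> ?p dvd residue x 0"
      using residue_bounds[of x 0] assms zdvd_imp_le[of ?p "residue x 0"] by auto
    moreover have "[residue x i = residue x 0] (mod ?p)" using residue_cong[of 0 i x] by simp
    ultimately have "\<not> ?p dvd residue x i" by (simp add: cong_dvd_iff)
    hence "coprime ?p (residue x i)" using prime_imp_coprime prime_card_int by blast
    thus ?thesis by (simp add: ac_simps del: power_Suc)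
  qed
  note cop = this
  hence "\<exists>z. 0 \<le> z \<and> z < ?p ^ (i + 1) \<and> [residue x i * z = 1] (mod ?p ^ (i + 1))" for i
  proof -
    obtain z where "[residue x i * z = 1] (mod ?p ^ (i + 1))"
      using cong_solve_coprime_int[OF cop] by blast
    hence "[residue x i * (z mod ?p ^ (i + 1)) = 1] (mod ?p ^ (i + 1))"
      by (simp add: cong_def mod_simps)
    moreover have "0 \<le> z mod ?p ^ (i + 1)" "z mod ?p ^ (i + 1) < ?p ^ (i + 1)" using pos by auto
    ultimately show ?thesis by blast
  qed
  then obtain f where f: "\<And>i. 0 \<le> f i" "\<And>i. f i < ?p ^ (i + 1)" "\<And>i. [residue x i * f i = 1] (mod ?p ^ (i + 1))"
    by metis
  have "[f (i + 1) = f i] (mod ?p ^ (i + 1))" for i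
  proof -
    have "[residue x (i + 1) * f (i + 1) = 1] (mod ?p ^ (i + 1))"
      using f(3)[of "i + 1"] by (rule cong_dvd_modulus) (simp add: le_imp_power_dvd del: power_Suc)
    moreover have "[residue x (i + 1) * f (i + 1) = residue x i * f (i + 1)] (mod ?p ^ (i + 1))"
      using residue_cong[of i "i + 1" x] by (intro cong_scalar_right) simp
    ultimately have "[residue x i * f (i + 1) = residue x i * f i] (mod ?p ^ (i + 1))"
      using f(3)[of i] by (meson cong_sym cong_trans)
    thus ?thesis using cop[of i] by (simp add: cong_mult_lcancel)
  qed
  hence "residue (Abs_padic_int f :: 'p padic_int) = f"
    using f by (intro Abs_padic_int_inverse) auto
  hence "residue (x * Abs_padic_int f) i = residue 1 i" for i
  proof -
    have "1 < ?p ^ (i + 1)" by (rule one_less_power[OF card_gt_1]) simp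
    hence "1 mod ?p ^ (i + 1) = 1" by (intro mod_pos_pos_trivial) simp
    thus ?thesis using f(3)[of i] \<open>residue (Abs_padic_int f :: 'p padic_int) = f\<close>
      unfolding one_padic_int.rep_eq cong_def residue_mult by (simp only:)
  qed
  hence "x * Abs_padic_int f = 1" by (rule residue_eqI)
  thus ?thesis by (metis dvdI)
qed

text \<open>The exponent is the index of the first nonzero residue, that is, the valuation; the
  quotient is a unit because otherwise that residue would vanish as well.\<close>

lemma padic_int_decompose:
  assumes "(x :: 'p::prime_card padic_int) \<noteq> 0"
  obtains k u where "x = padic_p ^ k * u" "u dvd 1" "residue u 0 \<noteq> 0"
proof -
  have ex: "\<exists>i. residue x i \<noteq> 0" using assms residue_eqI[of x 0] by auto
  define k where "k = (LEAST i. residue x i \<noteq> 0)"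
  have k: "residue x k \<noteq> 0" unfolding k_def using ex by (rule LeastI_ex)
  have "padic_p ^ k dvd x"
  proof (cases k)
    case (Suc j)
    hence "residue x j = 0" using not_less_Least[of j "\<lambda>i. residue x i \<noteq> 0"] k_def by simp
    thus ?thesis unfolding Suc p_power_dvd_iff .
  qed simp
  then obtain u where u: "x = padic_p ^ k * u" by (auto simp: dvd_def)
  have "residue u 0 \<noteq> 0"
  proof
    assume "residue u 0 = 0"
    hence "padic_p dvd u" using p_power_dvd_iff[of 0 u] by simp
    hence "padic_p ^ Suc k dvd x" unfolding u by (simp add: mult.commute[of padic_p])
    thus False using k by (simp only: p_power_dvd_iff)
  qed
  thus thesis using that u unit_if_residue_nonzero by blast
qed

text \<open>Characteristic zero permits division by factorials and by integer structure constants in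
  the fraction field. It holds because numbers below \<open>p ^ (i + 1)\<close> are told apart by
  residue \<open>i\<close>.\<close>

instance padic_int :: (prime_card) ring_char_0
proof
  have "m = k" if eq: "(of_nat m :: 'a padic_int) = of_nat k" for m k
  proof -
    have "\<exists>i. m + k < CARD('a) ^ (i + 1)"
      using card_gt_1[where 'p = 'a] by (intro exI[of _ "m + k"]) (use power_gt_expt[of "CARD('a)" "m + k + 1"] in simp)
    then obtain i where i: "m + k < CARD('a) ^ (i + 1)" by blast
    have "int m mod int CARD('a) ^ (i + 1) = int k mod int CARD('a) ^ (i + 1)"
      using arg_cong[OF eq, of "\<lambda>x. residue x i"] by (simp only: residue_of_nat)
    moreover have "int m < int CARD('a) ^ (i + 1)" "int k < int CARD('a) ^ (i + 1)"
      using i by (metis of_nat_less_iff of_nat_power add_lessD1 add.commute)+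
    ultimately show ?thesis by simp
  qed
  thus "inj (of_nat :: nat \<Rightarrow> 'a padic_int)" by (auto intro: injI)
qed

instance fract :: ("{idom, ring_char_0}") field_char_0
proof
  have "of_nat m = (to_fract (of_nat m) :: 'a fract)" for m by (induction m) auto
  thus "inj (of_nat :: nat \<Rightarrow> 'a fract)" by (auto intro!: injI)
qed

lemma to_fract_of_nat [simp]: "to_fract (of_nat m) = of_nat m"
  by (induction m) auto

lemma to_fract_of_int [simp]: "to_fract (of_int m) = of_int m"
  by (cases m rule: int_cases2) auto

lemma to_fract_power [simp]: "to_fract (x ^ k) = to_fract x ^ k"
  by (induction k) auto

lemma to_fract_sum: "to_fract (sum f A) = (\<Sum>i\<in>A. to_fract (f i))"
  by (induction A rule: infinite_finite_induct) auto

lemma padic_denominator: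
  obtains s x where "(t :: 'p::prime_card padic) * of_nat CARD('p) ^ s = to_fract x"
proof (cases t)
  case (Fract a b)
  then obtain k u where b: "b = padic_p ^ k * u" "u dvd 1" using padic_int_decompose by metis
  then obtain v where v: "u * v = 1" by (metis dvdE)
  hence v': "to_fract u * to_fract v = 1" by (metis to_fract_mult to_fract_1)
  have "t * of_nat CARD('p) ^ k = to_fract (a * v)"
    using Fract(2) v' unfolding Fract(1) Fract_conv_to_fract b
    by (auto simp: field_simps)
  thus thesis by (rule that)
qed

text \<open>Eisenstein's argument: the norm form \<open>u\<^sup>2 + p u v - p v\<^sup>2\<close> is anisotropic.\<close>

lemma norm_one_integral:
  assumes "(u :: 'p::prime_card padic)\<^sup>2 + of_nat CARD('p) * u * v - of_nat CARD('p) * v\<^sup>2 = 1"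
  shows "\<exists>x. v = to_fract x"
proof -
  let ?p = "padic_p :: 'p padic_int" and ?P = "of_nat CARD('p) :: 'p padic"
  have p0: "?P \<noteq> 0" by simp
  have p0': "?p \<noteq> 0" by simp
  obtain s1 a1 s2 a2 where 1: "u * ?P ^ s1 = to_fract a1" "v * ?P ^ s2 = to_fract a2"
    by (meson padic_denominator)
  have "u * ?P ^ (s1 + s2) = to_fract (a1 * ?p ^ s2)" "v * ?P ^ (s1 + s2) = to_fract (a2 * ?p ^ s1)"
    by (simp_all add: power_add flip: 1)
  then obtain s a b where ab: "u * ?P ^ s = to_fract a" "v * ?P ^ s = to_fract b" by blast
  thus ?thesis
  \<comment> \<open>Descent on the common denominator \<open>p ^ s\<close> of \<open>u\<close> and
    \<open>v\<close>: while \<open>s\<close> is positive, both numerators turn out to be divisible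
    by \<open>p\<close>.\<close>
  proof (induction s arbitrary: a b)
    case (Suc s)
    have "to_fract (a\<^sup>2 + ?p * a * b - ?p * b\<^sup>2) = to_fract (?p ^ (2 * Suc s))"
    proof -
      have "to_fract (a\<^sup>2 + ?p * a * b - ?p * b\<^sup>2) = (u\<^sup>2 + ?P * u * v - ?P * v\<^sup>2) * (?P ^ Suc s)\<^sup>2"
        by (simp add: power2_eq_square algebra_simps flip: Suc.prems del: power_Suc)
      also have "\<dots> = ?P ^ (2 * Suc s)" using assms by (simp only: mult_1 power_mult[symmetric] mult.commute)
      finally show ?thesis by simp
    qed
    hence eq: "a * a + ?p * a * b - ?p * b * b = ?p * (?p * ?p ^ (2 * s))"
      by (simp add: power2_eq_square algebra_simps del: to_fract_mult to_fract_add to_fract_diff to_fract_power)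
    have "a * a = ?p * (?p * ?p ^ (2 * s) - a * b + b * b)" using eq by (simp add: algebra_simps)
    hence "?p dvd a" using p_dvd_mult dvd_triv_left by metis
    then obtain a' where a': "a = ?p * a'" by (auto simp: dvd_def)
    have "?p * (b * b) = ?p * (?p * (a' * a' + a' * b - ?p ^ (2 * s)))"
      using eq unfolding a' by (simp add: algebra_simps)
    hence "b * b = ?p * (a' * a' + a' * b - ?p ^ (2 * s))" using p0' by (simp only: mult_cancel_left) auto
    hence "?p dvd b" using p_dvd_mult dvd_triv_left by metis
    then obtain b' where b': "b = ?p * b'" by (auto simp: dvd_def)
    have "u * ?P ^ s = to_fract a'" "v * ?P ^ s = to_fract b'"
      using Suc.prems p0 unfolding a' b' by (simp_all add: algebra_simps)
    thus ?case by (rule Suc.IH)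
  qed auto
qed

text \<open>Banach iteration from 0: step \<open>k\<close> changes the iterate by a multiple of
  \<open>p ^ k\<close> only, so residue \<open>i\<close> is final after \<open>Suc i\<close> steps.
  The limit is assembled from these final residues.\<close>

lemma padic_contraction_fixpoint:
  fixes f :: "'p::prime_card padic_int \<Rightarrow> 'p padic_int"
  assumes contr: "\<And>k a b. padic_p ^ k dvd a - b \<Longrightarrow> padic_p ^ Suc k dvd f a - f b"
  shows "\<exists>x. f x = x"
proof -
  define X where "X k = (f ^^ k) 0" for k
  have X: "padic_p ^ k dvd X (Suc k) - X k" for k
    by (induction k) (use contr in \<open>auto simp: X_def simp del: power_Suc\<close>)
  define g where "g i = residue (X (Suc i)) i" for i
  have g: "residue (X (Suc (Suc i))) i = g i" for i
    unfolding g_def residue_eq_iff_dvd by (rule X)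
  have "[g (i + 1) = g i] (mod int CARD('p) ^ (i + 1))" for i
    using residue_cong[of i "i + 1" "X (Suc (Suc i))"] g[of i] by (simp add: g_def)
  hence res: "residue (Abs_padic_int g :: 'p padic_int) = g"
    by (intro Abs_padic_int_inverse CollectI conjI allI) (simp_all only: g_def residue_bounds)
  let ?x = "Abs_padic_int g :: 'p padic_int"
  have "residue (f ?x) i = residue ?x i" for i
  proof -
    have "padic_p ^ Suc i dvd ?x - X (Suc i)"
      by (simp only: residue_eq_iff_dvd[symmetric] res) (simp add: g_def)
    hence "padic_p ^ Suc (Suc i) dvd f ?x - f (X (Suc i))" by (rule contr)
    hence "residue (f ?x) (Suc i) = residue (X (Suc (Suc i))) (Suc i)"
      by (simp only: residue_eq_iff_dvd) (simp add: X_def)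
    hence "padic_p ^ Suc i dvd f ?x - X (Suc (Suc i))"
      unfolding residue_eq_iff_dvd by (meson dvd_trans le_imp_power_dvd lessI less_imp_le)
    thus ?thesis unfolding residue_eq_iff_dvd[symmetric] res g .
  qed
  thus ?thesis by (intro exI[of _ ?x] residue_eqI)
qed

text \<open>Solves \<open>u\<^sup>2 + p u v - p v\<^sup>2 = 1\<close> with \<open>u = 1 + 2 p x\<close> and \<open>v = 4 w\<close>: division by \<open>4 p\<close>
  leaves a fixed point equation for a contraction in \<open>x\<close>.\<close>

lemma norm_one_solvable:
  fixes w :: "'p::prime_card padic_int"
  shows "\<exists>x. (1 + 2 * padic_p * x)\<^sup>2 + padic_p * (1 + 2 * padic_p * x) * (4 * w) - padic_p * (4 * w)\<^sup>2 = 1"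
proof -
  let ?p = "padic_p :: 'p padic_int"
  define f where "f x = 4 * w * w - w - ?p * (x * x + 2 * x * w)" for x
  have "\<exists>x. f x = x"
  proof (rule padic_contraction_fixpoint)
    fix k and a b :: "'p padic_int" assume "?p ^ k dvd a - b"
    hence "?p ^ Suc k dvd ?p * (a - b) * - (a + b + 2 * w)" by simp
    also have "?p * (a - b) * - (a + b + 2 * w) = f a - f b" by (simp add: f_def algebra_simps)
    finally show "?p ^ Suc k dvd f a - f b" .
  qed
  then obtain x where x: "x = 4 * w * w - w - ?p * (x * x + 2 * x * w)" unfolding f_def by metis
  have "4 * ?p * (x - (4 * w * w - w - ?p * (x * x + 2 * x * w))) = 0" using x by simp
  thus ?thesis by (intro exI[of _ x]) (simp add: power2_eq_square algebra_simps)
qed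

lemma padic_int_approx: "\<exists>m::nat. padic_p ^ k dvd (x :: 'p::prime_card padic_int) - of_nat m"
proof -
  have "residue x k = residue (of_nat (nat (residue x k)) :: 'p padic_int) k"
    using residue_bounds[of x k] by (simp add: residue_of_int del: power_Suc)
  hence "padic_p ^ Suc k dvd x - of_nat (nat (residue x k))" by (simp only: residue_eq_iff_dvd)
  thus ?thesis by (meson dvd_trans le_imp_power_dvd lessI less_imp_le)
qed

lemma p_power_dvd_of_int:
  "(padic_p :: 'p::prime_card padic_int) ^ k dvd of_int z \<Longrightarrow> int CARD('p) ^ k dvd z"
proof (cases k)
  case (Suc j)
  assume "(padic_p :: 'p padic_int) ^ k dvd of_int z"
  thus ?thesis unfolding Suc p_power_dvd_iff residue_of_int by (simp add: mod_eq_0_iff_dvd)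
qed simp

text \<open>The valuation \<open>e\<close> of the scaled number is one fixed constant, so no
  algorithm has to find it. Residue \<open>i\<close> of the unit part follows from the approximation
  at precision \<open>e + i + 1\<close> by dividing out \<open>p ^ e\<close>.\<close>

lemma computable_padic_if_approx:
  fixes a :: "'p::prime_card padic"
  assumes c: "computable_fun 1 (\<lambda>xs. c (xs ! 0))" and Q: "computable_int Q"
    and approx: "\<And>k. \<exists>y. a * of_nat CARD('p) ^ N = to_fract y \<and> padic_p ^ k dvd y - of_int (Q (c k))"
  shows "computable_padic a"
proof (cases "a = 0")
  case False
  let ?p = "padic_p :: 'p padic_int" and ?P = "of_nat CARD('p) :: 'p padic"
  obtain y where y: "a * ?P ^ N = to_fract y" using approx by blast
  hence "y \<noteq> 0" using False by auto
  then obtain e u where u: "y = ?p ^ e * u" "u dvd 1" by (rule padic_int_decompose)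
  have "a = ?P powi (int e - int N) * to_fract u"
    using y unfolding u(1) by (simp add: power_int_diff field_simps)
  moreover have "computable (\<lambda>i. nat (residue u i))"
  proof -
    let ?q = "int CARD('p)"
    have approx': "?p ^ k dvd y - of_int (Q (c k))" for k
      using approx[of k] y by (metis to_fract_eq_iff)
    have res: "residue u i = (Q (c (e + i + 1)) mod ?q ^ (e + i + 1)) div ?q ^ e" for i
    proof -
      let ?z = "Q (c (e + i + 1))"
      have dvd: "?p ^ e * ?p ^ Suc i dvd ?p ^ e * u - of_int ?z"
        using approx'[of "e + i + 1"] unfolding u(1) by (simp add: power_add mult.assoc mult.commute[of ?p])
      hence "?p ^ e dvd ?p ^ e * u - of_int ?z" by (rule dvd_mult_left)
      hence "?p ^ e dvd of_int ?z" by (metis dvd_triv_left dvd_diff_right_iff dvd_diff_left_iff)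
      hence "?q ^ e dvd ?z" by (rule p_power_dvd_of_int)
      then obtain z where z: "?z = ?q ^ e * z" by (auto simp: dvd_def)
      have "?p ^ e * ?p ^ Suc i dvd ?p ^ e * (u - of_int z)" using dvd unfolding z by (simp add: algebra_simps)
      hence "?p ^ Suc i dvd u - of_int z" by simp
      hence "residue u i = z mod ?q ^ (i + 1)" by (simp only: residue_eq_iff_dvd[symmetric] residue_of_int)
      also have "\<dots> = (?q ^ e * z mod (?q ^ e * ?q ^ (i + 1))) div ?q ^ e" by simp
      finally show ?thesis unfolding z by (simp add: power_add mult.assoc mult.commute[of ?q])
    qed
    from Q obtain P R where PR: "computable_fun 1 (\<lambda>xs. P (xs ! 0))" "computable_fun 1 (\<lambda>xs. R (xs ! 0))"
      "\<And>c. Q c = int (P c) - int (R c)" by (rule computable_intE) blast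
    have nat: "nat (residue u i) = (let k = e + i + 1; M = CARD('p) ^ k in
        ((P (c k) + (M - 1) * R (c k)) mod M) div CARD('p) ^ e)" for i
    proof -
      define k where "k = e + i + 1"
      define M where "M = CARD('p) ^ k"
      have M: "M > 0" by (simp add: M_def)
      \<comment> \<open>Adding a multiple of \<open>M\<close> keeps the residue class and makes the
        number nonnegative, so the digit becomes a computation with natural numbers.\<close>
      have "Q (c k) mod int M = (int (P (c k)) - int (R (c k)) + int M * int (R (c k))) mod int M"
        unfolding PR(3) by simp
      also have "int (P (c k)) - int (R (c k)) + int M * int (R (c k)) = int (P (c k) + (M - 1) * R (c k))"
        using M by (cases M) (simp_all add: algebra_simps)
      finally have "residue u i = int (((P (c k) + (M - 1) * R (c k)) mod M) div CARD('p) ^ e)"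
        unfolding res[of i] k_def[symmetric] M_def
        by (simp only: of_nat_power zmod_int zdiv_int)
      thus ?thesis unfolding k_def[symmetric] Let_def M_def[symmetric] by simp
    qed
    show ?thesis unfolding nat Let_def computable_iff
      by (intro computable_fun_div computable_fun_mod computable_fun_add computable_fun_mult
          computable_fun_diff computable_fun_power computable_fun_const computable_fun_comp1[OF c]
          computable_fun_comp1[OF PR(1)] computable_fun_comp1[OF PR(2)] computable_fun_proj) auto
  qed
  ultimately show ?thesis unfolding computable_padic_def using u(2) by blast
qed (simp add: computable_padic_def)

subsection \<open>Nilpotent exponentials in an algebra\<close>

definition commutator :: "'e::ring_1 \<Rightarrow> 'e \<Rightarrow> 'e" where
  "commutator x y = x * y - y * x"

lemma commutator_simps:
  "commutator (x + y) z = commutator x z + commutator y z"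
  "commutator z (x + y) = commutator z x + commutator z y"
  "commutator (x - y) z = commutator x z - commutator y z"
  "commutator z (x - y) = commutator z x - commutator z y"
  "commutator x x = 0" "commutator 0 x = 0" "commutator x 0 = 0"
  by (simp_all add: commutator_def algebra_simps)

lemma commutator_swap: "commutator y x = - commutator x y"
  by (simp add: commutator_def)

lemma commutator_jacobi:
  "commutator x (commutator y z) = commutator (commutator x y) z + commutator y (commutator x z)"
  by (simp add: commutator_def algebra_simps)

lemma commutator_sum_left: "commutator (sum f A) z = (\<Sum>i\<in>A. commutator (f i) z)"
  by (induction A rule: infinite_finite_induct) (auto simp: commutator_simps)

lemma commutator_sum_right: "commutator z (sum f A) = (\<Sum>i\<in>A. commutator z (f i))"
  by (induction A rule: infinite_finite_induct) (auto simp: commutator_simps)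

lemma commutator_eq_0_iff: "commutator x y = 0 \<longleftrightarrow> x * y = y * x"
  by (simp add: commutator_def)

lemma commutator_conj:
  assumes "A' * A = 1"
  shows "commutator (A * x * A') (A * y * A') = A * commutator x y * A'"
proof -
  have "A' * (A * z) = z" for z using assms by (simp add: mult.assoc[symmetric])
  thus ?thesis by (simp add: commutator_def algebra_simps)
qed

lemma power_commute_mult: "a * x = x * a \<Longrightarrow> a * x ^ k = x ^ k * (a :: 'e::monoid_mult)"
proof (induction k)
  case (Suc k)
  have "a * x ^ Suc k = (a * x) * x ^ k" by (simp add: mult.assoc)
  also have "\<dots> = x * (a * x ^ k)" by (simp add: Suc.prems mult.assoc)
  finally show ?case by (simp add: Suc mult.assoc)
qed simp

text \<open>Scalars are central ring elements and not a separate multiplication, so that group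
  elements, root vectors and scalars all live in one ring and its identities apply to each of
  them.\<close>

locale scalar_algebra =
  fixes sc :: "'f::field_char_0 \<Rightarrow> 'e::ring_1"
  assumes sc_add: "sc (a + b) = sc a + sc b" and sc_mult: "sc (a * b) = sc a * sc b"
    and sc_1: "sc 1 = 1" and sc_comm: "sc a * x = x * sc a"
begin

lemma sc_0: "sc 0 = 0" using sc_add[of 0 0] by simp

lemma sc_minus: "sc (- a) = - sc a"
  using sc_add[of a "- a"] by (simp add: sc_0 eq_neg_iff_add_eq_0 add.commute)

lemma sc_diff: "sc (a - b) = sc a - sc b"
  using sc_add[of a "- b"] by (simp add: sc_minus)

lemma sc_left_comm: "x * (sc a * y) = sc a * (x * y)"
  by (metis mult.assoc sc_comm)

lemma sc_sc: "sc a * (sc b * x) = sc (a * b) * x"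
  by (simp add: sc_mult mult.assoc)

lemma sc_sum: "sc (sum f A) = (\<Sum>i\<in>A. sc (f i))"
  by (induction A rule: infinite_finite_induct) (auto simp: sc_0 sc_add)

lemma sc_of_nat: "sc (of_nat k) = of_nat k"
  by (induction k) (auto simp: sc_0 sc_add sc_1)

lemma sc_cancel: "a \<noteq> 0 \<Longrightarrow> sc a * x = sc a * y \<longleftrightarrow> x = y"
proof
  assume "a \<noteq> 0" "sc a * x = sc a * y"
  hence "sc (inverse a) * (sc a * x) = sc (inverse a) * (sc a * y)" by simp
  thus "x = y" using \<open>a \<noteq> 0\<close> by (simp add: sc_sc sc_1)
qed simp

lemma sc_eq_0_iff: "sc a * x = 0 \<longleftrightarrow> a = 0 \<or> x = 0"
  using sc_cancel[of a x 0] by (auto simp: sc_0)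

lemma commutator_sc: "commutator (sc a * x) y = sc a * commutator x y"
  "commutator x (sc a * y) = sc a * commutator x y"
  by (simp_all add: commutator_def right_diff_distrib mult.assoc sc_left_comm[of x] sc_left_comm[of y])

definition nexp :: "nat \<Rightarrow> 'e \<Rightarrow> 'f \<Rightarrow> 'e" where
  "nexp n X t = (\<Sum>k<n. sc (t ^ k / fact k) * X ^ k)"

lemma pow_ge_0: "X ^ n = 0 \<Longrightarrow> n \<le> k \<Longrightarrow> (X :: 'e) ^ k = 0"
  by (metis le_add_diff_inverse mult_zero_left power_add)

text \<open>A Vandermonde argument without determinants: evaluating at \<open>2 m\<close> and
  subtracting \<open>2 ^ N\<close> times the value at \<open>m\<close> removes the top coefficient
  and multiplies the others by the nonzero numbers \<open>2 ^ k - 2 ^ N\<close>.\<close>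

lemma polynomial_values_zero:
  assumes "\<And>m::nat. (\<Sum>k<N. sc (of_nat m ^ k) * v k) = 0" "k < N"
  shows "v k = 0"
  using assms
proof (induction N arbitrary: v k)
  case (Suc N)
  have "(\<Sum>k<N. sc (of_nat m ^ k) * (sc (2 ^ k - 2 ^ N) * v k)) = 0" for m
  proof -
    have "(\<Sum>k<Suc N. sc (of_nat (2 * m) ^ k) * v k) - sc (2 ^ N) * (\<Sum>k<Suc N. sc (of_nat m ^ k) * v k)
        = (\<Sum>k<Suc N. sc (of_nat m ^ k) * (sc (2 ^ k - 2 ^ N) * v k))"
      unfolding sum_distrib_left sum_subtractf[symmetric]
      by (rule sum.cong[OF refl]) (simp only: sc_sc left_diff_distrib[symmetric] sc_diff[symmetric],
          simp add: power_mult_distrib algebra_simps)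
    hence "(\<Sum>k<Suc N. sc (of_nat m ^ k) * (sc (2 ^ k - 2 ^ N) * v k)) = 0"
      by (simp only: Suc.prems(1) mult_zero_right diff_zero)
    thus ?thesis by (simp add: sc_0)
  qed
  hence "sc (2 ^ k - 2 ^ N) * v k = 0" if "k < N" for k by (rule Suc.IH[OF _ that])
  moreover have "(2 :: 'f) ^ k - 2 ^ N \<noteq> 0" if "k < N" for k
  proof -
    have "(of_nat (2 ^ k) :: 'f) \<noteq> of_nat (2 ^ N)" using that unfolding of_nat_eq_iff by simp
    thus ?thesis by simp
  qed
  ultimately have v: "v k = 0" if "k < N" for k using that by (simp add: sc_eq_0_iff)
  have "v N = 0" using Suc.prems(1)[of 1] by (simp add: v sc_1)
  thus ?case using v Suc.prems(2) by (cases "k = N") auto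
qed simp

text \<open>Rearrangement of a Cauchy product: the nonzero terms lie on diagonals below
  \<open>2 * n\<close>.\<close>

lemma square_sum_as_triangle:
  fixes g :: "nat \<Rightarrow> nat \<Rightarrow> 'e"
  assumes zero: "\<And>i j. i \<ge> n \<or> j \<ge> n \<Longrightarrow> g i j = 0" and N: "2 * n \<le> N"
  shows "(\<Sum>i<n. \<Sum>j<n. g i j) = (\<Sum>k<N. \<Sum>i\<le>k. g i (k - i))"
proof -
  have fin: "finite {(i, j). i + j < N}"
    by (rule finite_subset[of _ "{..<N} \<times> {..<N}"]) auto
  have "(\<Sum>k<N. \<Sum>i\<le>k. g i (k - i)) = (\<Sum>(i, j)\<in>{(i, j). i + j < N}. g i j)"
    by (simp add: sum.triangle_reindex)
  also have "\<dots> = (\<Sum>(i, j)\<in>{..<n} \<times> {..<n}. g i j)"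
  proof (rule sum.mono_neutral_right[OF fin])
    have "a < n \<and> b < n" if "g a b \<noteq> 0" for a b using zero[of a b] that by linarith
    thus "\<forall>i\<in>{(i, j). i + j < N} - {..<n} \<times> {..<n}. (case i of (i, j) \<Rightarrow> g i j) = 0" by auto
  qed (use N in auto)
  finally show ?thesis by (simp add: sum.cartesian_product)
qed

text \<open>\<open>commutator X\<close> is the difference of left and right multiplication by
  \<open>X\<close>. These two commute, so the binomial theorem applies to its powers.\<close>

lemma ad_power_binomial:
  "(commutator X ^^ k) M = (\<Sum>i\<le>k. of_nat (k choose i) * (X ^ i * M * (- X) ^ (k - i)))"
proof (induction k)
  case (Suc k)
  let ?T = "\<lambda>k i. X ^ i * M * (- X) ^ (k - i)"
  have "(commutator X ^^ Suc k) M
      = (\<Sum>i\<le>k. of_nat (k choose i) * (X * ?T k i - ?T k i * X))"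
  proof -
    have "X * (of_nat c * z) = of_nat c * (X * z)" for c z by (metis mult.assoc mult_of_nat_commute)
    thus ?thesis
      by (simp add: Suc.IH commutator_sum_right) (simp add: commutator_def right_diff_distrib mult.assoc)
  qed
  also have "\<dots> = (\<Sum>i\<le>k. of_nat (k choose i) * ?T (Suc k) (Suc i) + of_nat (k choose i) * ?T (Suc k) i)"
  proof (rule sum.cong[OF refl])
    fix i assume "i \<in> {..k}"
    hence i: "Suc k - i = Suc (k - i)" by auto
    have "- (?T k i * X) = ?T (Suc k) i"
      unfolding i power_Suc2 by (simp add: mult.assoc)
    thus "of_nat (k choose i) * (X * ?T k i - ?T k i * X)
        = of_nat (k choose i) * ?T (Suc k) (Suc i) + of_nat (k choose i) * ?T (Suc k) i"
      by (simp add: mult.assoc diff_conv_add_uminus distrib_left del: add_uminus_conv_diff)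
  qed
  also have "\<dots> = (\<Sum>i\<le>k. of_nat (k choose i) * ?T (Suc k) (Suc i)) + (\<Sum>i\<le>Suc k. of_nat (k choose i) * ?T (Suc k) i)"
    by (simp add: sum.distrib binomial_eq_0)
  also have "(\<Sum>i\<le>Suc k. of_nat (k choose i) * ?T (Suc k) i)
      = ?T (Suc k) 0 + (\<Sum>i\<le>k. of_nat (k choose Suc i) * ?T (Suc k) (Suc i))"
    by (subst sum.atMost_Suc_shift) simp
  also have "(\<Sum>i\<le>k. of_nat (k choose i) * ?T (Suc k) (Suc i)) + \<dots>
      = ?T (Suc k) 0 + (\<Sum>i\<le>k. of_nat (Suc k choose Suc i) * ?T (Suc k) (Suc i))"
    by (simp add: sum.distrib algebra_simps)
  also have "\<dots> = (\<Sum>i\<le>Suc k. of_nat (Suc k choose i) * ?T (Suc k) i)"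
    by (subst sum.atMost_Suc_shift) simp
  finally show ?case .
qed simp

context
  fixes n :: nat and X :: 'e
  assumes n: "n > 0" and nil: "X ^ n = 0"
begin

text \<open>Conjugation by an exponential is the exponential of the adjoint action. The sum may stop
  at \<open>2 * n\<close> because a term with \<open>i + j\<close> at least \<open>2 * n\<close>
  contains a power of \<open>X\<close> with exponent at least \<open>n\<close>.\<close>

lemma nexp_conj_sum:
  assumes "2 * n \<le> N"
  shows "nexp n X t * M * nexp n X (- t) = (\<Sum>k<N. sc (t ^ k / fact k) * (commutator X ^^ k) M)"
proof -
  define g where "g i j = sc (t ^ i / fact i) * X ^ i * M * (sc ((- t) ^ j / fact j) * X ^ j)" for i j
  have "nexp n X t * M * nexp n X (- t) = (\<Sum>i<n. \<Sum>j<n. g i j)"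
    unfolding nexp_def g_def by (simp add: sum_distrib_left sum_distrib_right) (rule sum.swap)
  also have "\<dots> = (\<Sum>k<N. \<Sum>i\<le>k. g i (k - i))"
    by (rule square_sum_as_triangle[OF _ assms]) (auto simp: g_def pow_ge_0[OF nil])
  also have "\<dots> = (\<Sum>k<N. sc (t ^ k / fact k) * (commutator X ^^ k) M)"
  proof (rule sum.cong[OF refl])
    fix k
    have "g i (k - i) = sc (t ^ k / fact k) * (of_nat (k choose i) * (X ^ i * M * (- X) ^ (k - i)))"
      if "i \<le> k" for i
    proof -
      have "(- X) ^ j = sc ((- 1) ^ j) * X ^ j" for j
        by (induction j) (auto simp: sc_1 sc_mult sc_minus sc_left_comm)
      hence "sc (t ^ k / fact k) * (of_nat (k choose i) * (X ^ i * M * (- X) ^ (k - i)))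
          = sc (t ^ k / fact k * of_nat (k choose i) * (- 1) ^ (k - i)) * (X ^ i * M * X ^ (k - i))"
        by (simp add: sc_left_comm[of M] sc_left_comm[of "X ^ _"] sc_sc mult.assoc flip: sc_of_nat)
      also have "t ^ k / fact k * of_nat (k choose i) * (- 1) ^ (k - i)
          = t ^ i / fact i * ((- t) ^ (k - i) / fact (k - i))"
      proof -
        have "t ^ k = t ^ i * t ^ (k - i)" using that by (simp flip: power_add)
        thus ?thesis using that by (simp add: binomial_fact power_minus[of t] field_simps)
      qed
      finally show ?thesis by (simp add: g_def sc_left_comm[of M] sc_left_comm[of "X ^ _"] sc_sc mult.assoc)
    qed
    thus "(\<Sum>i\<le>k. g i (k - i)) = sc (t ^ k / fact k) * (commutator X ^^ k) M"
      by (simp add: ad_power_binomial sum_distrib_left)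
  qed
  finally show ?thesis .
qed

lemma nexp_0: "nexp n X 0 = 1"
proof -
  have "nexp n X 0 = (\<Sum>k<n. if k = 0 then 1 else 0)"
    unfolding nexp_def by (rule sum.cong) (auto simp: sc_1 sc_0 power_0_left)
  thus ?thesis using n by simp
qed

lemma nexp_add: "nexp n X (s + t) = nexp n X s * nexp n X t"
proof -
  define g where "g i j = sc (s ^ i / fact i) * X ^ i * (sc (t ^ j / fact j) * X ^ j)" for i j
  have "nexp n X s * nexp n X t = (\<Sum>i<n. \<Sum>j<n. g i j)"
    unfolding nexp_def g_def by (simp add: sum_distrib_left sum_distrib_right) (rule sum.swap)
  also have "\<dots> = (\<Sum>k<2 * n. \<Sum>i\<le>k. g i (k - i))"
    by (rule square_sum_as_triangle) (auto simp: g_def pow_ge_0[OF nil])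
  also have "\<dots> = (\<Sum>k<2 * n. sc ((s + t) ^ k / fact k) * X ^ k)"
  proof (rule sum.cong[OF refl])
    fix k
    have "g i (k - i) = sc (of_nat (k choose i) * s ^ i * t ^ (k - i) / fact k) * X ^ k" if "i \<le> k" for i
    proof -
      have "g i (k - i) = sc (s ^ i / fact i * (t ^ (k - i) / fact (k - i))) * (X ^ i * X ^ (k - i))"
        by (simp add: g_def sc_left_comm[of "X ^ _"] sc_sc mult.assoc)
      also have "X ^ i * X ^ (k - i) = X ^ k" using that by (simp flip: power_add)
      also have "s ^ i / fact i * (t ^ (k - i) / fact (k - i)) = of_nat (k choose i) * s ^ i * t ^ (k - i) / fact k"
        using that by (simp add: binomial_fact field_simps)
      finally show ?thesis .
    qed
    hence "(\<Sum>i\<le>k. g i (k - i)) = sc (\<Sum>i\<le>k. of_nat (k choose i) * s ^ i * t ^ (k - i) / fact k) * X ^ k"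
      by (simp add: sc_sum sum_distrib_right)
    thus "(\<Sum>i\<le>k. g i (k - i)) = sc ((s + t) ^ k / fact k) * X ^ k"
      by (simp add: binomial_ring sum_divide_distrib)
  qed
  also have "\<dots> = nexp n X (s + t)" unfolding nexp_def
    by (rule sum.mono_neutral_right) (auto simp: pow_ge_0[OF nil])
  finally show ?thesis by simp
qed

lemma nexp_inverse: "nexp n X t * nexp n X (- t) = 1" "nexp n X (- t) * nexp n X t = 1"
  using nexp_add[of t "- t"] nexp_add[of "- t" t] by (simp_all add: nexp_0)

lemma nexp_power: "nexp n X t ^ m = nexp n X (of_nat m * t)"
  by (induction m) (auto simp: nexp_0 nexp_add[symmetric] algebra_simps)

lemma nexp_conj_string:
  assumes z: "(commutator X ^^ K) M = 0"
  shows "nexp n X t * M * nexp n X (- t) = (\<Sum>k<K. sc (t ^ k / fact k) * (commutator X ^^ k) M)"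
proof -
  have z': "(commutator X ^^ k) M = 0" if "k \<ge> K" for k
    using that by (induction k rule: dec_induct) (auto simp: z commutator_simps)
  have "nexp n X t * M * nexp n X (- t) = (\<Sum>k<2 * n + K. sc (t ^ k / fact k) * (commutator X ^^ k) M)"
    by (rule nexp_conj_sum) simp
  also have "\<dots> = (\<Sum>k<K. sc (t ^ k / fact k) * (commutator X ^^ k) M)"
    by (rule sum.mono_neutral_right) (auto simp: z')
  finally show ?thesis .
qed

lemma nexp_conj_string1:
  "commutator X M = 0 \<Longrightarrow> nexp n X t * M * nexp n X (- t) = M"
  using nexp_conj_string[of 1 M t] by (simp add: sc_1)

lemma nexp_conj_string2:
  "commutator X M = N \<Longrightarrow> commutator X N = 0 \<Longrightarrow> nexp n X t * M * nexp n X (- t) = M + sc t * N"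
  using nexp_conj_string[of 2 M t] by (simp add: sc_1 numeral_2_eq_2)

lemma nexp_conj_string3:
  "commutator X M = N \<Longrightarrow> commutator X N = Q \<Longrightarrow> commutator X Q = 0 \<Longrightarrow>
    nexp n X t * M * nexp n X (- t) = M + sc t * N + sc (t\<^sup>2 / 2) * Q"
  using nexp_conj_string[of 3 M t] by (simp add: sc_1 numeral_3_eq_3 numeral_2_eq_2)

text \<open>Commuting with the exponential implies commuting with its \<open>m\<close>-th power, the
  exponential at \<open>m t\<close>. Thus a polynomial in \<open>m\<close> with ring coefficients
  vanishes at all natural numbers, and its linear coefficient is a nonzero multiple of the
  commutator with \<open>X\<close>. This is the passage from the group to the Lie algebra.\<close>

lemma commutes_nexp_iff:
  assumes "t \<noteq> 0" shows "A * nexp n X t = nexp n X t * A \<longleftrightarrow> A * X = X * A"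
proof
  assume "A * X = X * A"
  thus "A * nexp n X t = nexp n X t * A" unfolding nexp_def
    by (simp add: sum_distrib_left sum_distrib_right sc_left_comm[of A] power_commute_mult mult.assoc)
next
  assume comm: "A * nexp n X t = nexp n X t * A"
  define v where "v k = sc (t ^ k / fact k) * commutator A (X ^ k)" for k
  have "(\<Sum>k<n. sc (of_nat m ^ k) * v k) = 0" for m :: nat
  proof -
    have "commutator A (nexp n X (of_nat m * t)) = 0"
      unfolding commutator_eq_0_iff nexp_power[symmetric] by (rule power_commute_mult[OF comm])
    thus ?thesis unfolding nexp_def commutator_sum_right v_def
      by (simp add: commutator_sc sc_sc power_mult_distrib)
  qed
  hence "v 1 = 0" if "1 < n" using polynomial_values_zero[where N = n and v = v and k = 1] that by blast
  hence "commutator A X = 0" if "1 < n" using that assms by (simp add: v_def sc_eq_0_iff)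
  moreover have "commutator A X = 0" if "\<not> 1 < n"
    using that n nil by (cases "n = 1") (auto simp: commutator_simps)
  ultimately show "A * X = X * A" by (auto simp: commutator_eq_0_iff)
qed

lemma conj_nexp:
  assumes inv: "A' * A = 1" "A * A' = 1" and X: "A * X * A' = sc c * X"
  shows "A * nexp n X t * A' = nexp n X (c * t)"
proof -
  have "A * X ^ k * A' = sc (c ^ k) * X ^ k" for k
  proof (induction k)
    case (Suc k)
    have "A * X ^ Suc k * A' = (A * X * A') * (A * X ^ k * A')"
    proof -
      have "A' * (A * z) = z" for z using inv(1) by (simp add: mult.assoc[symmetric])
      thus ?thesis by (simp add: mult.assoc)
    qed
    also have "\<dots> = sc c * X * (sc (c ^ k) * X ^ k)" by (simp only: X Suc)
    finally show ?case by (simp add: sc_left_comm[of X] sc_sc mult.assoc)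
  qed (use inv in \<open>simp add: sc_1\<close>)
  moreover have "A * (sc a * X ^ k) * A' = sc a * (A * X ^ k * A')" for a k
    by (simp add: sc_left_comm[of A] mult.assoc)
  ultimately have "A * (sc a * X ^ k) * A' = sc (a * c ^ k) * X ^ k" for a k
    by (simp add: sc_sc)
  thus ?thesis unfolding nexp_def
    by (simp add: sum_distrib_left sum_distrib_right power_mult_distrib mult.commute)
qed

end

end

subsection \<open>Integral dual functionals\<close>

text \<open>Gram-Schmidt without division: instead of being normalized, the functionals are scaled
  to a common nonzero value \<open>D\<close>. Integer coefficients matter because the same
  functionals are later applied to matrices over other rings.\<close>

lemma integer_dual:
  fixes b :: "'j \<Rightarrow> 'i \<Rightarrow> int"
  assumes "finite J" and I: "finite I"
    and "\<And>q :: 'j \<Rightarrow> int. (\<forall>i\<in>I. (\<Sum>j\<in>J. q j * b j i) = 0) \<Longrightarrow> \<forall>j\<in>J. q j = 0"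
  shows "\<exists>D l. D \<noteq> 0 \<and> (\<forall>j\<in>J. \<forall>j'\<in>J. (\<Sum>i\<in>I. l j i * b j' i) = (if j = j' then D else 0))"
  using assms(1,3)
proof (induction J rule: finite_induct)
  case empty
  thus ?case by (intro exI[of _ 1]) auto
next
  case (insert j0 J)
  have "\<forall>j\<in>J. q j = 0" if q: "\<forall>i\<in>I. (\<Sum>j\<in>J. q j * b j i) = 0" for q
  proof -
    have "(\<Sum>j\<in>insert j0 J. (q(j0 := 0)) j * b j i) = (\<Sum>j\<in>J. q j * b j i)" for i
      using insert.hyps by simp (rule sum.cong, auto)
    hence "\<forall>j\<in>insert j0 J. (q(j0 := 0)) j = 0" using q by (intro insert.prems) auto
    thus ?thesis using insert.hyps by (metis fun_upd_other insertCI)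
  qed
  then obtain D l where D: "D \<noteq> 0"
    and l: "\<And>j j'. j \<in> J \<Longrightarrow> j' \<in> J \<Longrightarrow> (\<Sum>i\<in>I. l j i * b j' i) = (if j = j' then D else 0)"
    using insert.IH by blast
  define m where "m j = (\<Sum>i\<in>I. l j i * b j0 i)" for j
  \<comment> \<open>\<open>D * b j0\<close> minus its projection to the span of the earlier vectors;
    independence makes this difference nonzero.\<close>
  define b' where "b' i = D * b j0 i - (\<Sum>j\<in>J. m j * b j i)" for i
  have "\<exists>i\<in>I. b' i \<noteq> 0"
  proof (rule ccontr)
    assume "\<not> ?thesis"
    hence 0: "b' i = 0" if "i \<in> I" for i using that by blast
    have "(\<Sum>j\<in>insert j0 J. (if j = j0 then D else - m j) * b j i) = b' i" for i
    proof -
      have "(\<Sum>j\<in>J. (if j = j0 then D else - m j) * b j i) = (\<Sum>j\<in>J. - (m j * b j i))"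
        using insert.hyps by (intro sum.cong) auto
      thus ?thesis using insert.hyps by (simp add: b'_def sum_negf)
    qed
    hence "\<forall>j\<in>insert j0 J. (if j = j0 then D else - m j) = 0" by (intro insert.prems) (auto simp: 0)
    thus False using D by auto
  qed
  then obtain i0 where i0: "i0 \<in> I" "b' i0 \<noteq> 0" by blast
  \<comment> \<open>\<open>D\<close> times the coordinate \<open>i0\<close>, corrected by the old
    functionals so as to vanish on the earlier vectors. On \<open>b j0\<close> it takes the value
    \<open>b' i0\<close>.\<close>
  define r where "r i = (if i = i0 then D else 0) - (\<Sum>j\<in>J. b j i0 * l j i)" for i
  have r: "(\<Sum>i\<in>I. r i * c i) = D * c i0 - (\<Sum>j\<in>J. b j i0 * (\<Sum>i\<in>I. l j i * c i))" for c
  proof -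
    have "(\<Sum>i\<in>I. r i * c i) = (\<Sum>i\<in>I. if i = i0 then D * c i else 0) - (\<Sum>i\<in>I. \<Sum>j\<in>J. b j i0 * (l j i * c i))"
      unfolding sum_subtractf[symmetric]
      by (rule sum.cong) (auto simp: r_def left_diff_distrib sum_distrib_right mult.assoc)
    also have "(\<Sum>i\<in>I. \<Sum>j\<in>J. b j i0 * (l j i * c i)) = (\<Sum>j\<in>J. b j i0 * (\<Sum>i\<in>I. l j i * c i))"
      by (subst sum.swap) (simp add: sum_distrib_left)
    finally show ?thesis using i0(1) I by simp
  qed
  have rJ: "(\<Sum>i\<in>I. r i * b j i) = 0" if "j \<in> J" for j
  proof -
    have "(\<Sum>j'\<in>J. b j' i0 * (\<Sum>i\<in>I. l j' i * b j i)) = (\<Sum>j'\<in>J. if j' = j then D * b j i0 else 0)"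
      using that by (intro sum.cong) (auto simp: l)
    thus ?thesis using that insert.hyps unfolding r by simp
  qed
  have r0: "(\<Sum>i\<in>I. r i * b j0 i) = b' i0"
    unfolding r b'_def m_def by (simp add: mult.commute)
  \<comment> \<open>The old functionals are scaled by \<open>b' i0\<close> and then freed of their
    value at \<open>b j0\<close>; the new common value is \<open>D * b' i0\<close>.\<close>
  define l' where "l' j i = (if j = j0 then D * r i else b' i0 * l j i - m j * r i)" for j i
  have l'0: "(\<Sum>i\<in>I. l' j0 i * c i) = D * (\<Sum>i\<in>I. r i * c i)" for c
    by (simp add: l'_def sum_distrib_left mult.assoc)
  have l'J: "(\<Sum>i\<in>I. l' j i * c i) = b' i0 * (\<Sum>i\<in>I. l j i * c i) - m j * (\<Sum>i\<in>I. r i * c i)" if "j \<in> J" for j c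
  proof -
    have "j \<noteq> j0" using that insert.hyps by auto
    thus ?thesis by (simp add: l'_def sum_distrib_left left_diff_distrib sum_subtractf mult.assoc)
  qed
  have "(\<Sum>i\<in>I. l' j i * b j' i) = (if j = j' then D * b' i0 else 0)"
    if j: "j \<in> insert j0 J" "j' \<in> insert j0 J" for j j'
  proof (cases "j = j0")
    case True
    thus ?thesis using j rJ r0 insert.hyps by (auto simp: l'0)
  next
    case False
    hence "j \<in> J" using j by simp
    thus ?thesis using j False rJ r0 insert.hyps l by (auto simp: l'J m_def[symmetric])
  qed
  thus ?case using D i0 by (intro exI[of _ "D * b' i0"] exI[of _ l']) auto
qed

subsection \<open>Long roots\<close>

definition cartan_number :: "'v::euclidean_space \<Rightarrow> 'v \<Rightarrow> int" where
  "cartan_number \<beta> \<alpha> = \<lfloor>cartan_int \<beta> \<alpha>\<rfloor>"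

locale root_sys =
  fixes \<Phi> \<Delta> :: "'v::euclidean_space set"
  assumes RS: "root_system \<Phi>" and RB: "root_base \<Phi> \<Delta>"
begin

lemma finite_roots: "finite \<Phi>" using RS by (simp add: root_system_def)
lemma root_nonzero: "\<alpha> \<in> \<Phi> \<Longrightarrow> \<alpha> \<noteq> 0" using RS by (auto simp: root_system_def)
lemma finite_base: "finite \<Delta>" and base_root: "a \<in> \<Delta> \<Longrightarrow> a \<in> \<Phi>"
  using RB finite_roots by (auto simp: root_base_def finite_subset)

lemma cartan_number: "\<alpha> \<in> \<Phi> \<Longrightarrow> \<beta> \<in> \<Phi> \<Longrightarrow> of_int (cartan_number \<beta> \<alpha>) = cartan_int \<beta> \<alpha>"
  using RS by (auto simp: root_system_def cartan_number_def elim!: Ints_cases)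

lemma reflection: "\<alpha> \<in> \<Phi> \<Longrightarrow> \<beta> \<in> \<Phi> \<Longrightarrow> \<beta> - of_int (cartan_number \<beta> \<alpha>) *\<^sub>R \<alpha> \<in> \<Phi>"
  using RS by (auto simp: cartan_number root_system_def)

lemma cartan_int_self: "\<alpha> \<in> \<Phi> \<Longrightarrow> cartan_int \<alpha> \<alpha> = 2"
  using root_nonzero by (simp add: cartan_int_def)

lemma cartan_number_self: "\<alpha> \<in> \<Phi> \<Longrightarrow> cartan_number \<alpha> \<alpha> = 2"
  by (simp add: cartan_number_def cartan_int_self)

lemma root_minus: "\<alpha> \<in> \<Phi> \<Longrightarrow> - \<alpha> \<in> \<Phi>"
  using reflection[of \<alpha> \<alpha>] by (simp add: cartan_number_self scaleR_2)

lemma cartan_number_eqI: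
  "\<alpha> \<in> \<Phi> \<Longrightarrow> \<beta> \<in> \<Phi> \<Longrightarrow> cartan_int \<beta> \<alpha> = of_int k \<Longrightarrow> cartan_number \<beta> \<alpha> = k"
  by (simp add: cartan_number_def)

lemma cartan_number_minus_left: "\<alpha> \<in> \<Phi> \<Longrightarrow> \<beta> \<in> \<Phi> \<Longrightarrow> cartan_number (- \<beta>) \<alpha> = - cartan_number \<beta> \<alpha>"
  using cartan_number[of \<alpha> \<beta>] by (intro cartan_number_eqI) (auto simp: root_minus cartan_int_def)

lemma cartan_number_minus_right: "\<alpha> \<in> \<Phi> \<Longrightarrow> \<beta> \<in> \<Phi> \<Longrightarrow> cartan_number \<beta> (- \<alpha>) = - cartan_number \<beta> \<alpha>"
  using cartan_number[of \<alpha> \<beta>] by (intro cartan_number_eqI) (auto simp: root_minus cartan_int_def)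

lemma cartan_number_add:
  "\<alpha> \<in> \<Phi> \<Longrightarrow> \<beta> \<in> \<Phi> \<Longrightarrow> \<gamma> \<in> \<Phi> \<Longrightarrow> \<beta> + \<gamma> \<in> \<Phi> \<Longrightarrow>
    cartan_number (\<beta> + \<gamma>) \<alpha> = cartan_number \<beta> \<alpha> + cartan_number \<gamma> \<alpha>"
  using cartan_number[of \<alpha> \<beta>] cartan_number[of \<alpha> \<gamma>]
  by (intro cartan_number_eqI) (auto simp: cartan_int_def inner_add_left add_divide_distrib distrib_left)

lemma cartan_number_diff:
  "\<alpha> \<in> \<Phi> \<Longrightarrow> \<beta> \<in> \<Phi> \<Longrightarrow> \<gamma> \<in> \<Phi> \<Longrightarrow> \<beta> - \<gamma> \<in> \<Phi> \<Longrightarrow>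
    cartan_number (\<beta> - \<gamma>) \<alpha> = cartan_number \<beta> \<alpha> - cartan_number \<gamma> \<alpha>"
  using cartan_number_add[of \<alpha> \<beta> "- \<gamma>"] cartan_number_minus_left[of \<alpha> \<gamma>] root_minus[of \<gamma>] by simp

lemma cartan_number_eq_0_iff: "\<alpha> \<in> \<Phi> \<Longrightarrow> \<beta> \<in> \<Phi> \<Longrightarrow> cartan_number \<beta> \<alpha> = 0 \<longleftrightarrow> inner \<beta> \<alpha> = 0"
  using cartan_number[of \<alpha> \<beta>] root_nonzero[of \<alpha>] by (auto simp: cartan_int_def)

definition long :: "'v \<Rightarrow> bool" where
  "long \<gamma> \<longleftrightarrow> \<gamma> \<in> \<Phi> \<and> (\<forall>\<beta>\<in>\<Phi>. norm \<beta> \<le> norm \<gamma>)"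

lemma long_root: "long \<gamma> \<Longrightarrow> \<gamma> \<in> \<Phi>" by (simp add: long_def)

lemma long_minus: "long \<gamma> \<Longrightarrow> long (- \<gamma>)" by (auto simp: long_def root_minus)

lemma ex_long: "\<Phi> \<noteq> {} \<Longrightarrow> \<exists>\<gamma>. long \<gamma>"
proof -
  assume "\<Phi> \<noteq> {}"
  hence "Max (norm ` \<Phi>) \<in> norm ` \<Phi>" using finite_roots by (intro Max_in) auto
  then obtain \<gamma> where "\<gamma> \<in> \<Phi>" "Max (norm ` \<Phi>) = norm \<gamma>" by auto
  moreover have "\<forall>\<beta>\<in>\<Phi>. norm \<beta> \<le> Max (norm ` \<Phi>)" using finite_roots by simp
  ultimately show ?thesis by (auto simp: long_def)
qed

text \<open>A root that is no longer than \<gamma> and differs from \<gamma> and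
  \<open>- \<gamma>\<close> satisfies the Cauchy-Schwarz bound strictly, so its Cartan number is
  below 2 in absolute value. Hence \<gamma> grades the roots by -2, -1, 0, 1, 2, and the extreme
  grades contain only \<open>- \<gamma>\<close> and \<gamma>.\<close>

lemma long_cartan:
  assumes \<gamma>: "long \<gamma>" and \<beta>: "\<beta> \<in> \<Phi>" and ne: "\<beta> \<noteq> \<gamma>" "\<beta> \<noteq> - \<gamma>"
  shows "\<bar>cartan_number \<beta> \<gamma>\<bar> \<le> 1"
proof -
  have \<gamma>\<Phi>: "\<gamma> \<in> \<Phi>" and le: "norm \<beta> \<le> norm \<gamma>" using \<gamma> \<beta> by (auto simp: long_def)
  have pos: "norm \<gamma> > 0" using root_nonzero[OF \<gamma>\<Phi>] by simp
  have cs: "\<bar>inner \<beta> \<gamma>\<bar> \<le> norm \<beta> * norm \<gamma>" by (rule Cauchy_Schwarz_ineq2)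
  also have le2: "norm \<beta> * norm \<gamma> \<le> norm \<gamma> * norm \<gamma>" using le by (simp add: mult_right_mono)
  finally have "\<bar>inner \<beta> \<gamma>\<bar> \<le> norm \<gamma> * norm \<gamma>" .
  moreover have "\<bar>inner \<beta> \<gamma>\<bar> \<noteq> norm \<gamma> * norm \<gamma>"
  proof
    assume eq: "\<bar>inner \<beta> \<gamma>\<bar> = norm \<gamma> * norm \<gamma>"
    hence "norm \<gamma> * norm \<gamma> \<le> norm \<beta> * norm \<gamma>" using cs by simp
    hence n: "norm \<beta> = norm \<gamma>" using le pos by simp
    hence "\<bar>inner \<beta> \<gamma>\<bar> = norm \<beta> * norm \<gamma>" using eq by simp
    hence "norm \<beta> *\<^sub>R \<gamma> = norm \<gamma> *\<^sub>R \<beta> \<or> norm \<beta> *\<^sub>R \<gamma> = - norm \<gamma> *\<^sub>R \<beta>"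
      using norm_cauchy_schwarz_abs_eq by blast
    hence "norm \<gamma> *\<^sub>R \<gamma> = norm \<gamma> *\<^sub>R \<beta> \<or> norm \<gamma> *\<^sub>R \<gamma> = norm \<gamma> *\<^sub>R (- \<beta>)" unfolding n by simp
    hence "\<gamma> = \<beta> \<or> \<gamma> = - \<beta>" using pos unfolding real_vector.scale_cancel_left by auto
    thus False using ne by auto
  qed
  ultimately have "\<bar>inner \<beta> \<gamma>\<bar> < inner \<gamma> \<gamma>" by (simp add: dot_square_norm power2_eq_square)
  hence "\<bar>cartan_int \<beta> \<gamma>\<bar> < 2"
    using root_nonzero[OF \<gamma>\<Phi>] by (simp add: cartan_int_def abs_mult pos_divide_less_eq)
  thus ?thesis using cartan_number[OF \<gamma>\<Phi> \<beta>] by linarith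
qed

lemma long_cartan_le: "long \<gamma> \<Longrightarrow> \<beta> \<in> \<Phi> \<Longrightarrow> cartan_number \<beta> \<gamma> \<ge> 2 \<Longrightarrow> \<beta> = \<gamma>"
  using long_cartan[of \<gamma> \<beta>] cartan_number_minus_left[of \<gamma> \<gamma>] cartan_number_self[of \<gamma>] long_root[of \<gamma>]
  by (cases "\<beta> = \<gamma>"; cases "\<beta> = - \<gamma>") auto

lemma long_add_root: "long \<gamma> \<Longrightarrow> \<beta> \<in> \<Phi> \<Longrightarrow> cartan_number \<beta> \<gamma> = - 1 \<Longrightarrow> \<beta> + \<gamma> \<in> \<Phi>"
  using reflection[of \<gamma> \<beta>] long_root[of \<gamma>] by simp

lemma long_sub_root: "long \<gamma> \<Longrightarrow> \<beta> \<in> \<Phi> \<Longrightarrow> cartan_number \<beta> \<gamma> = 1 \<Longrightarrow> \<beta> - \<gamma> \<in> \<Phi>"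
  using reflection[of \<gamma> \<beta>] long_root[of \<gamma>] by simp

text \<open>Adding \<gamma> raises the grade by 2, and \<gamma> is the only root of grade at least
  2.\<close>

lemma long_add_not_root:
  assumes "long \<gamma>" "\<beta> \<in> \<Phi>" "cartan_number \<beta> \<gamma> \<ge> 0"
  shows "\<beta> + \<gamma> \<notin> \<Phi>" "\<beta> + \<gamma> \<noteq> 0"
proof -
  have \<gamma>: "\<gamma> \<in> \<Phi>" using assms long_root by blast
  show "\<beta> + \<gamma> \<notin> \<Phi>"
  proof
    assume s: "\<beta> + \<gamma> \<in> \<Phi>"
    hence "cartan_number (\<beta> + \<gamma>) \<gamma> \<ge> 2"
      using assms \<gamma> by (simp add: cartan_number_add cartan_number_self)
    hence "\<beta> + \<gamma> = \<gamma>" using long_cartan_le[OF assms(1) s] by simp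
    thus False using root_nonzero[OF assms(2)] by simp
  qed
  show "\<beta> + \<gamma> \<noteq> 0"
  proof
    assume "\<beta> + \<gamma> = 0"
    hence "\<beta> = - \<gamma>" by (simp add: eq_neg_iff_add_eq_0)
    thus False using assms(3) \<gamma> by (simp add: cartan_number_minus_left cartan_number_self)
  qed
qed

lemma indecomposableD:
  assumes "indecomposable \<Phi>" "A \<subseteq> \<Phi>" "A \<noteq> {}" "\<And>\<alpha> \<beta>. \<alpha> \<in> A \<Longrightarrow> \<beta> \<in> \<Phi> - A \<Longrightarrow> inner \<alpha> \<beta> = 0"
  shows "A = \<Phi>"
proof (rule ccontr)
  assume "A \<noteq> \<Phi>"
  hence "\<Phi> - A \<noteq> {}" "A \<inter> (\<Phi> - A) = {}" "\<Phi> = A \<union> (\<Phi> - A)" using assms(2) by auto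
  moreover have "\<forall>\<alpha>\<in>A. \<forall>\<beta>\<in>\<Phi> - A. inner \<alpha> \<beta> = 0" using assms(4) by blast
  ultimately have "\<exists>A B. A \<noteq> {} \<and> B \<noteq> {} \<and> A \<inter> B = {} \<and> \<Phi> = A \<union> B \<and> (\<forall>\<alpha>\<in>A. \<forall>\<beta>\<in>B. inner \<alpha> \<beta> = 0)"
    by (intro exI[of _ A] exI[of _ "\<Phi> - A"] conjI assms(3))
  thus False using assms(1) unfolding indecomposable_def by (elim conjE notE)
qed

text \<open>Otherwise all roots except \<gamma> and \<open>- \<gamma>\<close> would be orthogonal to
  \<gamma>, and this pair would be a component of rank one. The root found here supplies the
  two-dimensional module on which the parameter of a root element can be read off.\<close>

lemma ex_grade_1:
  assumes ind: "indecomposable \<Phi>" and dim: "dim \<Phi> > 1" and \<gamma>: "long \<gamma>"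
  shows "\<exists>\<alpha>\<in>\<Phi>. cartan_number \<alpha> \<gamma> = 1"
proof (rule ccontr)
  assume no: "\<not> ?thesis"
  have \<gamma>\<Phi>: "\<gamma> \<in> \<Phi>" using \<gamma> by (rule long_root)
  have orth: "inner \<gamma> \<beta> = 0" if \<beta>: "\<beta> \<in> \<Phi> - {\<gamma>, - \<gamma>}" for \<beta>
  proof -
    have "\<bar>cartan_number \<beta> \<gamma>\<bar> \<le> 1" using long_cartan[OF \<gamma>] \<beta> by auto
    moreover have "cartan_number \<beta> \<gamma> \<noteq> 1" "cartan_number \<beta> \<gamma> \<noteq> - 1"
      using no \<beta> root_minus[of \<beta>] cartan_number_minus_left[OF \<gamma>\<Phi>, of \<beta>] by auto
    ultimately have "cartan_number \<beta> \<gamma> = 0" by linarith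
    thus ?thesis using \<beta> \<gamma>\<Phi> by (simp add: cartan_number_eq_0_iff inner_commute)
  qed
  have "{\<gamma>, - \<gamma>} = \<Phi>"
    by (rule indecomposableD[OF ind]) (use orth \<gamma>\<Phi> root_minus in auto)
  hence "\<Phi> \<subseteq> span {\<gamma>}" by (auto simp: span_base span_neg)
  hence "dim \<Phi> \<le> card {\<gamma>}" by (intro dim_le_card) auto
  thus False using dim by simp
qed

text \<open>Reflections preserve length. If \<alpha> is not orthogonal to the long root \<gamma>, a
  root orthogonal to both \<gamma> and its reflection in \<alpha> is orthogonal to \<alpha>. So the
  roots that are not orthogonal to every long root split off, and by indecomposability they are all
  roots.\<close>

lemma nonorthogonal_long:
  assumes ind: "indecomposable \<Phi>" and \<alpha>: "\<alpha> \<in> \<Phi>"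
  shows "\<exists>\<gamma>. long \<gamma> \<and> cartan_number \<alpha> \<gamma> > 0"
proof -
  define A where "A = {\<alpha> \<in> \<Phi>. \<exists>\<gamma>. long \<gamma> \<and> inner \<alpha> \<gamma> \<noteq> 0}"
  have "\<Phi> \<noteq> {}" using \<alpha> by auto
  then obtain \<gamma>0 where \<gamma>0: "long \<gamma>0" using ex_long by blast
  hence "\<gamma>0 \<in> A" using long_root root_nonzero by (auto simp: A_def)
  hence "A \<noteq> {}" by blast
  moreover have "inner \<alpha> \<beta> = 0" if "\<alpha> \<in> A" "\<beta> \<in> \<Phi> - A" for \<alpha> \<beta>
  proof -
    obtain \<gamma> where \<gamma>: "long \<gamma>" "inner \<alpha> \<gamma> \<noteq> 0" and \<alpha>: "\<alpha> \<in> \<Phi>" using \<open>\<alpha> \<in> A\<close> by (auto simp: A_def)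
    let ?c = "cartan_int \<gamma> \<alpha>"
    have s: "\<gamma> - ?c *\<^sub>R \<alpha> \<in> \<Phi>"
      using reflection[OF \<alpha> long_root[OF \<gamma>(1)]] cartan_number[OF \<alpha> long_root[OF \<gamma>(1)]] by simp
    have "inner (\<gamma> - ?c *\<^sub>R \<alpha>) (\<gamma> - ?c *\<^sub>R \<alpha>) = inner \<gamma> \<gamma>"
      using root_nonzero[OF \<alpha>] by (simp add: cartan_int_def inner_diff inner_commute field_simps)
    hence "norm (\<gamma> - ?c *\<^sub>R \<alpha>) = norm \<gamma>" by (simp add: norm_eq)
    hence "long (\<gamma> - ?c *\<^sub>R \<alpha>)" using \<gamma>(1) s by (simp add: long_def)
    hence "inner \<beta> (\<gamma> - ?c *\<^sub>R \<alpha>) = 0" "inner \<beta> \<gamma> = 0" using that \<gamma>(1) by (auto simp: A_def)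
    moreover have "?c \<noteq> 0" using \<gamma>(2) root_nonzero[OF \<alpha>] by (simp add: cartan_int_def inner_commute)
    ultimately show ?thesis by (simp add: inner_diff_right inner_commute)
  qed
  moreover have "A \<subseteq> \<Phi>" by (auto simp: A_def)
  ultimately have "A = \<Phi>" using indecomposableD[OF ind, of A] by blast
  then obtain \<gamma> where \<gamma>: "long \<gamma>" "inner \<alpha> \<gamma> \<noteq> 0" using \<alpha> by (auto simp: A_def)
  hence "cartan_number \<alpha> \<gamma> \<noteq> 0" using \<alpha> long_root by (simp add: cartan_number_eq_0_iff)
  moreover have "cartan_number \<alpha> (- \<gamma>) = - cartan_number \<alpha> \<gamma>"
    using \<alpha> \<gamma>(1) long_root by (simp add: cartan_number_minus_right)
  ultimately have "cartan_number \<alpha> \<gamma> > 0 \<or> cartan_number \<alpha> (- \<gamma>) > 0" by linarith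
  thus ?thesis using \<gamma>(1) long_minus[OF \<gamma>(1)] by blast
qed

text \<open>An integral relation would give a real vector orthogonal to all roots, which is zero.
  \<open>integer_dual\<close> carries this over to an arbitrary field of characteristic zero, where
  no inner product is at hand.\<close>

lemma cartan_nondegenerate:
  fixes d :: "'v \<Rightarrow> 'f::field_char_0"
  assumes d: "\<And>\<sigma>. \<sigma> \<in> \<Phi> \<Longrightarrow> (\<Sum>a\<in>\<Delta>. d a * of_int (cartan_number \<sigma> a)) = 0" and a: "a \<in> \<Delta>"
  shows "d a = 0"
proof -
  have "\<forall>a\<in>\<Delta>. q a = 0" if q: "\<forall>\<sigma>\<in>\<Phi>. (\<Sum>a\<in>\<Delta>. q a * cartan_number \<sigma> a) = 0" for q :: "'v \<Rightarrow> int"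
  proof -
    define w where "w = (\<Sum>a\<in>\<Delta>. (of_int (q a) * (2 / inner a a)) *\<^sub>R a)"
    have "inner \<sigma> w = 0" if \<sigma>: "\<sigma> \<in> \<Phi>" for \<sigma>
    proof -
      have "inner \<sigma> w = (\<Sum>a\<in>\<Delta>. of_int (q a) * cartan_int \<sigma> a)"
        by (simp add: w_def inner_sum_right cartan_int_def mult.assoc)
      also have "\<dots> = (\<Sum>a\<in>\<Delta>. of_int (q a) * of_int (cartan_number \<sigma> a))"
        using \<sigma> base_root by (intro sum.cong) (auto simp: cartan_number)
      also have "\<dots> = of_int (\<Sum>a\<in>\<Delta>. q a * cartan_number \<sigma> a)" by simp
      finally show ?thesis using q \<sigma> by simp
    qed
    moreover have "span \<Phi> = UNIV" using RS by (simp add: root_system_def)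
    ultimately have "inner w w = 0"
      using orthogonal_to_span[of w \<Phi> w] by (simp add: orthogonal_def inner_commute)
    hence w0: "w = 0" by simp
    have ind: "independent \<Delta>" using RB by (simp add: root_base_def)
    show ?thesis
    proof
      fix a assume a: "a \<in> \<Delta>"
      have "of_int (q a) * (2 / inner a a) = (0::real)"
        using independentD[OF ind finite_base subset_refl w0[unfolded w_def] a] .
      thus "q a = 0" using a base_root root_nonzero by simp
    qed
  qed
  then obtain D l where D: "D \<noteq> 0" and l: "\<And>a b. a \<in> \<Delta> \<Longrightarrow> b \<in> \<Delta> \<Longrightarrow>
      (\<Sum>\<sigma>\<in>\<Phi>. l a \<sigma> * cartan_number \<sigma> b) = (if a = b then D else 0)"
    using integer_dual[of \<Delta> \<Phi> "\<lambda>a \<sigma>. cartan_number \<sigma> a"] finite_base finite_roots by blast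
  have "0 = (\<Sum>\<sigma>\<in>\<Phi>. of_int (l a \<sigma>) * (\<Sum>b\<in>\<Delta>. d b * of_int (cartan_number \<sigma> b)))"
    by (simp add: d)
  also have "\<dots> = (\<Sum>b\<in>\<Delta>. d b * of_int (\<Sum>\<sigma>\<in>\<Phi>. l a \<sigma> * cartan_number \<sigma> b))"
    by (simp add: sum_distrib_left mult.left_commute) (rule sum.swap)
  also have "\<dots> = (\<Sum>b\<in>\<Delta>. if b = a then d b * of_int D else 0)"
    using a by (intro sum.cong) (auto simp: l)
  also have "\<dots> = d a * of_int D" using a finite_base by simp
  finally show ?thesis using D by simp
qed

end

subsection \<open>Chevalley relations in an algebra over a field\<close>

lemma commutator_minus: "commutator (- x) y = - commutator x y" "commutator x (- y) = - commutator x y"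
  by (simp_all add: commutator_def)

text \<open>The image of a Chevalley basis in an associative algebra. Structure constants are only
  asked to be nonzero integers, and coroots are commutators of opposite root vectors instead of
  separate data, so an element that fixes root vectors automatically fixes the coroots.\<close>

locale chev_alg = scalar_algebra sc + root_sys \<Phi> \<Delta>
  for sc :: "'f::field_char_0 \<Rightarrow> 'e::ring_1" and \<Phi> \<Delta> :: "'v::euclidean_space set" +
  fixes X :: "'v \<Rightarrow> 'e" and n :: nat
  assumes n_pos: "n > 0" and nilpotent: "\<alpha> \<in> \<Phi> \<Longrightarrow> X \<alpha> ^ n = 0"
    and bracket_zero: "\<alpha> \<in> \<Phi> \<Longrightarrow> \<beta> \<in> \<Phi> \<Longrightarrow> \<alpha> + \<beta> \<notin> \<Phi> \<Longrightarrow> \<alpha> + \<beta> \<noteq> 0 \<Longrightarrow> commutator (X \<alpha>) (X \<beta>) = 0"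
    and bracket_root: "\<alpha> \<in> \<Phi> \<Longrightarrow> \<beta> \<in> \<Phi> \<Longrightarrow> \<alpha> + \<beta> \<in> \<Phi> \<Longrightarrow>
      \<exists>N::int. N \<noteq> 0 \<and> commutator (X \<alpha>) (X \<beta>) = sc (of_int N) * X (\<alpha> + \<beta>)"
    and weight: "\<alpha> \<in> \<Phi> \<Longrightarrow> \<beta> \<in> \<Phi> \<Longrightarrow>
      commutator (commutator (X \<alpha>) (X (- \<alpha>))) (X \<beta>) = sc (of_int (cartan_number \<beta> \<alpha>)) * X \<beta>"
    and coroot_span: "\<alpha> \<in> \<Phi> \<Longrightarrow> \<exists>k. commutator (X \<alpha>) (X (- \<alpha>)) = (\<Sum>a\<in>\<Delta>. sc (k a) * commutator (X a) (X (- a)))"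
    and basis_independent: "(\<Sum>\<beta>\<in>\<Phi>. sc (c \<beta>) * X \<beta>) + (\<Sum>a\<in>\<Delta>. sc (d a) * commutator (X a) (X (- a))) = 0 \<Longrightarrow>
      (\<forall>\<beta>\<in>\<Phi>. c \<beta> = 0) \<and> (\<forall>a\<in>\<Delta>. d a = 0)"
begin

definition Hr :: "'v \<Rightarrow> 'e" where "Hr \<alpha> = commutator (X \<alpha>) (X (- \<alpha>))"

definition xr :: "'v \<Rightarrow> 'f \<Rightarrow> 'e" where "xr \<alpha> t = nexp n (X \<alpha>) t"

definition lin_comb :: "('v \<Rightarrow> 'f) \<Rightarrow> ('v \<Rightarrow> 'f) \<Rightarrow> 'e" where
  "lin_comb c d = (\<Sum>\<beta>\<in>\<Phi>. sc (c \<beta>) * X \<beta>) + (\<Sum>a\<in>\<Delta>. sc (d a) * Hr a)"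

definition lie_span :: "'e set" where "lie_span = range (\<lambda>(c, d). lin_comb c d)"

lemma lie_spanI: "lin_comb c d \<in> lie_span" by (auto simp: lie_span_def)
lemma lie_spanE: assumes "D \<in> lie_span" obtains c d where "D = lin_comb c d"
  using assms by (auto simp: lie_span_def)

lemma lin_comb_eq_0: "lin_comb c d = 0 \<Longrightarrow> \<beta> \<in> \<Phi> \<Longrightarrow> c \<beta> = 0"
  "lin_comb c d = 0 \<Longrightarrow> a \<in> \<Delta> \<Longrightarrow> d a = 0"
  using basis_independent unfolding lin_comb_def Hr_def by blast+

lemma lin_comb_add: "lin_comb c d + lin_comb c' d' = lin_comb (\<lambda>x. c x + c' x) (\<lambda>x. d x + d' x)"
  by (simp add: lin_comb_def sc_add distrib_right sum.distrib algebra_simps)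

lemma lin_comb_scale: "sc t * lin_comb c d = lin_comb (\<lambda>x. t * c x) (\<lambda>x. t * d x)"
  by (simp add: lin_comb_def sc_mult distrib_left sum_distrib_left mult.assoc)

lemma lie_span_add: "x \<in> lie_span \<Longrightarrow> y \<in> lie_span \<Longrightarrow> x + y \<in> lie_span"
  by (auto elim!: lie_spanE simp: lin_comb_add lie_spanI)

lemma lie_span_scale: "x \<in> lie_span \<Longrightarrow> sc t * x \<in> lie_span"
  by (auto elim!: lie_spanE simp: lin_comb_scale lie_spanI)

lemma lie_span_diff: "x \<in> lie_span \<Longrightarrow> y \<in> lie_span \<Longrightarrow> x - y \<in> lie_span"
  using lie_span_add[of x "sc (- 1) * y"] lie_span_scale[of y "- 1"] by (simp add: sc_minus sc_1)

lemma lie_span_0: "0 \<in> lie_span"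
  using lie_spanI[of "\<lambda>_. 0" "\<lambda>_. 0"] by (simp add: lin_comb_def sc_0)

lemma lie_span_sum: "(\<And>i. i \<in> A \<Longrightarrow> f i \<in> lie_span) \<Longrightarrow> sum f A \<in> lie_span"
  by (induction A rule: infinite_finite_induct) (auto intro: lie_span_add lie_span_0)

lemma X_lin_comb: "\<alpha> \<in> \<Phi> \<Longrightarrow> lin_comb (\<lambda>\<beta>. if \<beta> = \<alpha> then t else 0) (\<lambda>_. 0) = sc t * X \<alpha>"
proof -
  assume \<alpha>: "\<alpha> \<in> \<Phi>"
  have "(\<Sum>\<beta>\<in>\<Phi>. sc (if \<beta> = \<alpha> then t else 0) * X \<beta>) = (\<Sum>\<beta>\<in>\<Phi>. if \<beta> = \<alpha> then sc t * X \<beta> else 0)"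
    by (rule sum.cong) (auto simp: sc_0)
  thus ?thesis using \<alpha> finite_roots by (simp add: lin_comb_def sc_0)
qed

lemma X_nonzero: "\<alpha> \<in> \<Phi> \<Longrightarrow> X \<alpha> \<noteq> 0"
  using X_lin_comb[of \<alpha> 1] lin_comb_eq_0(1)[of "\<lambda>\<beta>. if \<beta> = \<alpha> then 1 else 0" "\<lambda>_. 0" \<alpha>]
  by (auto simp: sc_1)

lemma H_lin_comb: assumes "\<alpha> \<in> \<Phi>" obtains k where "Hr \<alpha> = lin_comb (\<lambda>_. 0) k"
  using coroot_span[OF assms] that by (auto simp: lin_comb_def sc_0 Hr_def)

lemma H_weight: "\<alpha> \<in> \<Phi> \<Longrightarrow> \<beta> \<in> \<Phi> \<Longrightarrow> commutator (Hr \<alpha>) (X \<beta>) = sc (of_int (cartan_number \<beta> \<alpha>)) * X \<beta>"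
  by (simp add: weight Hr_def)

lemma H_nonzero: "\<alpha> \<in> \<Phi> \<Longrightarrow> Hr \<alpha> \<noteq> 0"
  using H_weight[of \<alpha> \<alpha>] X_nonzero[of \<alpha>] by (auto simp: cartan_number_self commutator_simps sc_eq_0_iff)

lemma X_H: "\<alpha> \<in> \<Phi> \<Longrightarrow> \<beta> \<in> \<Phi> \<Longrightarrow> commutator (X \<beta>) (Hr \<alpha>) = sc (of_int (- cartan_number \<beta> \<alpha>)) * X \<beta>"
  using H_weight[of \<alpha> \<beta>] commutator_swap[of "X \<beta>" "Hr \<alpha>"] by (simp add: sc_minus)

lemma H_H: assumes "\<alpha> \<in> \<Phi>" "\<beta> \<in> \<Phi>" shows "commutator (Hr \<alpha>) (Hr \<beta>) = 0"
proof -
  have "commutator (Hr \<alpha>) (Hr \<beta>) = commutator (commutator (Hr \<alpha>) (X \<beta>)) (X (- \<beta>))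
      + commutator (X \<beta>) (commutator (Hr \<alpha>) (X (- \<beta>)))"
    unfolding Hr_def[of \<beta>] by (rule commutator_jacobi)
  also have "\<dots> = 0"
    using assms by (simp add: H_weight root_minus cartan_number_minus_left commutator_sc sc_minus commutator_minus)
  finally show ?thesis .
qed

text \<open>The bracket with \<open>X \<sigma>\<close> in coordinates, so that its vanishing can be
  read off coefficient by coefficient. The numbers \<open>k\<close> are the coordinates of the
  coroot of \<open>- \<sigma>\<close>, which is nonzero.\<close>

lemma bracket_coeffs:
  assumes \<sigma>: "\<sigma> \<in> \<Phi>"
  shows "\<exists>(N :: 'v \<Rightarrow> 'f) k. (\<forall>\<beta>\<in>\<Phi>. \<beta> + \<sigma> \<in> \<Phi> \<longrightarrow> N \<beta> \<noteq> 0) \<and> (\<exists>a\<in>\<Delta>. k a \<noteq> 0) \<and>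
    (\<forall>c d. commutator (lin_comb c d) (X \<sigma>) = lin_comb
      (\<lambda>\<mu>. (if \<mu> - \<sigma> \<in> \<Phi> then c (\<mu> - \<sigma>) * N (\<mu> - \<sigma>) else 0)
        + (if \<mu> = \<sigma> then \<Sum>a\<in>\<Delta>. d a * of_int (cartan_number \<sigma> a) else 0))
      (\<lambda>a. c (- \<sigma>) * k a))"
proof -
  have "\<exists>N::'f. (\<beta> + \<sigma> \<in> \<Phi> \<longrightarrow> N \<noteq> 0 \<and> commutator (X \<beta>) (X \<sigma>) = sc N * X (\<beta> + \<sigma>))" if "\<beta> \<in> \<Phi>" for \<beta>
    using bracket_root[OF that \<sigma>] by (metis of_int_eq_0_iff)
  then obtain N :: "'v \<Rightarrow> 'f" where N: "\<And>\<beta>. \<beta> \<in> \<Phi> \<Longrightarrow> \<beta> + \<sigma> \<in> \<Phi> \<Longrightarrow> N \<beta> \<noteq> 0"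
      "\<And>\<beta>. \<beta> \<in> \<Phi> \<Longrightarrow> \<beta> + \<sigma> \<in> \<Phi> \<Longrightarrow> commutator (X \<beta>) (X \<sigma>) = sc (N \<beta>) * X (\<beta> + \<sigma>)"
    by metis
  have m: "- \<sigma> \<in> \<Phi>" using \<sigma> by (rule root_minus)
  obtain k where k: "Hr (- \<sigma>) = lin_comb (\<lambda>_. 0) k" using H_lin_comb[OF m] .
  have "commutator (X (- \<sigma>)) (X \<sigma>) = Hr (- \<sigma>)" by (simp add: Hr_def)
  hence k': "commutator (X (- \<sigma>)) (X \<sigma>) = (\<Sum>a\<in>\<Delta>. sc (k a) * Hr a)" by (simp add: k lin_comb_def sc_0)
  have "\<exists>a\<in>\<Delta>. k a \<noteq> 0"
  proof (rule ccontr)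
    assume "\<not> ?thesis"
    hence "Hr (- \<sigma>) = 0" by (simp add: k lin_comb_def sc_0)
    thus False using H_nonzero[OF m] by simp
  qed
  moreover have "commutator (lin_comb c d) (X \<sigma>) = lin_comb
      (\<lambda>\<mu>. (if \<mu> - \<sigma> \<in> \<Phi> then c (\<mu> - \<sigma>) * N (\<mu> - \<sigma>) else 0)
        + (if \<mu> = \<sigma> then \<Sum>a\<in>\<Delta>. d a * of_int (cartan_number \<sigma> a) else 0))
      (\<lambda>a. c (- \<sigma>) * k a)" for c d
  proof -
    let ?s = "\<Sum>a\<in>\<Delta>. d a * of_int (cartan_number \<sigma> a)"
    have "commutator (lin_comb c d) (X \<sigma>)
        = (\<Sum>\<beta>\<in>\<Phi>. sc (c \<beta>) * commutator (X \<beta>) (X \<sigma>)) + (\<Sum>a\<in>\<Delta>. sc (d a) * (sc (of_int (cartan_number \<sigma> a)) * X \<sigma>))"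
      using base_root \<sigma>
      by (simp add: lin_comb_def commutator_simps commutator_sum_left commutator_sc H_weight)
    also have "(\<Sum>a\<in>\<Delta>. sc (d a) * (sc (of_int (cartan_number \<sigma> a)) * X \<sigma>)) = sc ?s * X \<sigma>"
      by (simp add: sc_sc sc_sum sum_distrib_right)
    also have "sc ?s * X \<sigma> = (\<Sum>\<mu>\<in>\<Phi>. sc (if \<mu> = \<sigma> then ?s else 0) * X \<mu>)"
      using X_lin_comb[OF \<sigma>, of ?s] by (simp add: lin_comb_def sc_0)
    also have "(\<Sum>\<beta>\<in>\<Phi>. sc (c \<beta>) * commutator (X \<beta>) (X \<sigma>))
        = (\<Sum>\<beta>\<in>\<Phi>. (if \<beta> + \<sigma> \<in> \<Phi> then sc (c \<beta> * N \<beta>) * X (\<beta> + \<sigma>) else 0)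
            + (if \<beta> = - \<sigma> then sc (c \<beta>) * commutator (X \<beta>) (X \<sigma>) else 0))"
    proof (rule sum.cong[OF refl])
      fix \<beta> assume \<beta>: "\<beta> \<in> \<Phi>"
      consider "\<beta> + \<sigma> \<in> \<Phi>" | "\<beta> = - \<sigma>" | "\<beta> + \<sigma> \<notin> \<Phi>" "\<beta> + \<sigma> \<noteq> 0"
        by (metis eq_neg_iff_add_eq_0)
      thus "sc (c \<beta>) * commutator (X \<beta>) (X \<sigma>) = (if \<beta> + \<sigma> \<in> \<Phi> then sc (c \<beta> * N \<beta>) * X (\<beta> + \<sigma>) else 0)
          + (if \<beta> = - \<sigma> then sc (c \<beta>) * commutator (X \<beta>) (X \<sigma>) else 0)"
      proof cases
        case 1
        hence "\<beta> \<noteq> - \<sigma>" using root_nonzero by force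
        thus ?thesis using 1 N(2)[OF \<beta> 1] by (simp add: sc_sc)
      next
        case 2
        hence "\<beta> + \<sigma> \<notin> \<Phi>" using root_nonzero by force
        thus ?thesis using 2 by simp
      next
        case 3
        thus ?thesis using bracket_zero[OF \<beta> \<sigma>] by auto
      qed
    qed
    also have "\<dots> = (\<Sum>\<beta>\<in>\<Phi>. if \<beta> + \<sigma> \<in> \<Phi> then sc (c \<beta> * N \<beta>) * X (\<beta> + \<sigma>) else 0)
        + sc (c (- \<sigma>)) * commutator (X (- \<sigma>)) (X \<sigma>)"
      using m finite_roots by (simp add: sum.distrib)
    also have "(\<Sum>\<beta>\<in>\<Phi>. if \<beta> + \<sigma> \<in> \<Phi> then sc (c \<beta> * N \<beta>) * X (\<beta> + \<sigma>) else 0)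
        = (\<Sum>\<mu>\<in>\<Phi>. sc (if \<mu> - \<sigma> \<in> \<Phi> then c (\<mu> - \<sigma>) * N (\<mu> - \<sigma>) else 0) * X \<mu>)"
    proof -
      have "(\<Sum>\<beta>\<in>\<Phi>. if \<beta> + \<sigma> \<in> \<Phi> then sc (c \<beta> * N \<beta>) * X (\<beta> + \<sigma>) else 0)
          = (\<Sum>\<beta>\<in>{\<beta>\<in>\<Phi>. \<beta> + \<sigma> \<in> \<Phi>}. sc (c \<beta> * N \<beta>) * X (\<beta> + \<sigma>))"
        using finite_roots by (simp add: sum.inter_filter)
      also have "\<dots> = (\<Sum>\<mu>\<in>{\<mu>\<in>\<Phi>. \<mu> - \<sigma> \<in> \<Phi>}. sc (c (\<mu> - \<sigma>) * N (\<mu> - \<sigma>)) * X \<mu>)"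
        by (rule sum.reindex_bij_witness[of _ "\<lambda>\<mu>. \<mu> - \<sigma>" "\<lambda>\<beta>. \<beta> + \<sigma>"]) auto
      also have "\<dots> = (\<Sum>\<mu>\<in>\<Phi>. if \<mu> - \<sigma> \<in> \<Phi> then sc (c (\<mu> - \<sigma>) * N (\<mu> - \<sigma>)) * X \<mu> else 0)"
        using finite_roots by (simp add: sum.inter_filter)
      also have "\<dots> = (\<Sum>\<mu>\<in>\<Phi>. sc (if \<mu> - \<sigma> \<in> \<Phi> then c (\<mu> - \<sigma>) * N (\<mu> - \<sigma>) else 0) * X \<mu>)"
        by (rule sum.cong) (auto simp: sc_0)
      finally show ?thesis .
    qed
    finally show ?thesis
      by (simp add: lin_comb_def k' sc_add distrib_right sum.distrib sum_distrib_left sc_sc algebra_simps)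
  qed
  ultimately show ?thesis using N(1) by (intro exI[of _ N] exI[of _ k]) simp
qed

lemma lie_span_bracket: "D \<in> lie_span \<Longrightarrow> \<sigma> \<in> \<Phi> \<Longrightarrow> commutator (X \<sigma>) D \<in> lie_span"
proof -
  assume D: "D \<in> lie_span" and \<sigma>: "\<sigma> \<in> \<Phi>"
  obtain c d where cd: "D = lin_comb c d" using D by (rule lie_spanE)
  obtain N k where Nk: "\<forall>c d. commutator (lin_comb c d) (X \<sigma>) = lin_comb
      (\<lambda>\<mu>. (if \<mu> - \<sigma> \<in> \<Phi> then c (\<mu> - \<sigma>) * N (\<mu> - \<sigma>) else 0)
        + (if \<mu> = \<sigma> then \<Sum>a\<in>\<Delta>. d a * of_int (cartan_number \<sigma> a) else 0))
      (\<lambda>a. c (- \<sigma>) * k a)" using bracket_coeffs[OF \<sigma>] by (elim exE conjE)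
  note eq = Nk[rule_format]
  have "commutator D (X \<sigma>) \<in> lie_span" unfolding cd eq by (rule lie_spanI)
  from lie_span_diff[OF lie_span_0 this] show ?thesis by (simp add: commutator_def)
qed

lemma lie_span_conj: "D \<in> lie_span \<Longrightarrow> \<sigma> \<in> \<Phi> \<Longrightarrow> xr \<sigma> t * D * xr \<sigma> (- t) \<in> lie_span"
proof -
  assume D: "D \<in> lie_span" and \<sigma>: "\<sigma> \<in> \<Phi>"
  have "(commutator (X \<sigma>) ^^ k) D \<in> lie_span" for k
    by (induction k) (auto simp: D \<sigma> lie_span_bracket)
  thus ?thesis unfolding xr_def nexp_conj_sum[OF n_pos nilpotent[OF \<sigma>] order_refl]
    by (auto intro!: lie_span_sum lie_span_scale)
qed

text \<open>A vanishing bracket with \<open>X \<sigma>\<close> kills the coefficient at each root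
  \<beta> for which \<open>\<beta> + \<sigma>\<close> is a root or zero. For every \<beta> other
  than \<gamma> there is such a \<sigma> of nonnegative grade. The toral part vanishes because one
  of \<sigma> and \<open>- \<sigma>\<close> always has nonnegative grade.\<close>

lemma long_centralizer:
  assumes \<gamma>: "long \<gamma>" and D: "D \<in> lie_span"
    and comm: "\<And>\<sigma>. \<sigma> \<in> \<Phi> \<Longrightarrow> cartan_number \<sigma> \<gamma> \<ge> 0 \<Longrightarrow> commutator D (X \<sigma>) = 0"
  shows "\<exists>t. D = sc t * X \<gamma>"
proof -
  have \<gamma>\<Phi>: "\<gamma> \<in> \<Phi>" using \<gamma> by (rule long_root)
  obtain c d where cd: "D = lin_comb c d" using D by (rule lie_spanE)
  have key: "(\<forall>\<beta>\<in>\<Phi>. \<beta> + \<sigma> \<in> \<Phi> \<longrightarrow> c \<beta> = 0) \<and> c (- \<sigma>) = 0 \<and> (\<Sum>a\<in>\<Delta>. d a * of_int (cartan_number \<sigma> a)) = 0"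
    if \<sigma>: "\<sigma> \<in> \<Phi>" "cartan_number \<sigma> \<gamma> \<ge> 0" for \<sigma>
  proof -
    obtain N k where N: "\<forall>\<beta>\<in>\<Phi>. \<beta> + \<sigma> \<in> \<Phi> \<longrightarrow> N \<beta> \<noteq> 0" and k: "\<exists>a\<in>\<Delta>. k a \<noteq> 0"
      and Nk: "\<forall>c d. commutator (lin_comb c d) (X \<sigma>) = lin_comb
      (\<lambda>\<mu>. (if \<mu> - \<sigma> \<in> \<Phi> then c (\<mu> - \<sigma>) * N (\<mu> - \<sigma>) else 0)
        + (if \<mu> = \<sigma> then \<Sum>a\<in>\<Delta>. d a * of_int (cartan_number \<sigma> a) else 0))
      (\<lambda>a. c (- \<sigma>) * k a)" using bracket_coeffs[OF \<sigma>(1)] by (elim exE conjE)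
    note eq = Nk[rule_format]
    note z = lin_comb_eq_0[OF trans[OF eq[symmetric] comm[OF \<sigma>, unfolded cd]]]
    have "c \<beta> = 0" if "\<beta> \<in> \<Phi>" "\<beta> + \<sigma> \<in> \<Phi>" for \<beta>
      using z(1)[OF that(2)] that N root_nonzero[OF that(1)] by auto
    moreover have "c (- \<sigma>) = 0" using z(2) k by auto
    moreover have "(\<Sum>a\<in>\<Delta>. d a * of_int (cartan_number \<sigma> a)) = 0"
    proof -
      have "0 \<notin> \<Phi>" using root_nonzero by blast
      thus ?thesis using z(1)[OF \<sigma>(1)] by simp
    qed
    ultimately show ?thesis by blast
  qed
  have "(\<Sum>a\<in>\<Delta>. d a * of_int (cartan_number \<sigma> a)) = 0" if \<sigma>: "\<sigma> \<in> \<Phi>" for \<sigma>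
  proof (cases "cartan_number \<sigma> \<gamma> \<ge> 0")
    case True thus ?thesis using key \<sigma> by blast
  next
    case False
    hence "(\<Sum>a\<in>\<Delta>. d a * of_int (cartan_number (- \<sigma>) a)) = 0"
      using key[of "- \<sigma>"] \<sigma> root_minus cartan_number_minus_left[OF \<gamma>\<Phi> \<sigma>] by auto
    moreover have "(\<Sum>a\<in>\<Delta>. d a * of_int (cartan_number (- \<sigma>) a)) = - (\<Sum>a\<in>\<Delta>. d a * of_int (cartan_number \<sigma> a))"
      unfolding sum_negf[symmetric] using \<sigma> base_root by (intro sum.cong) (auto simp: cartan_number_minus_left)
    ultimately show ?thesis by simp
  qed
  hence d: "d a = 0" if "a \<in> \<Delta>" for a using cartan_nondegenerate that by blast
  have c: "c \<beta> = 0" if \<beta>: "\<beta> \<in> \<Phi>" "\<beta> \<noteq> \<gamma>" for \<beta>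
  proof (cases "\<beta> = - \<gamma>")
    case True
    thus ?thesis using key[OF \<gamma>\<Phi>] by (simp add: cartan_number_self \<gamma>\<Phi>)
  next
    case False
    hence "\<bar>cartan_number \<beta> \<gamma>\<bar> \<le> 1" using long_cartan[OF \<gamma>] \<beta> by blast
    then consider "cartan_number \<beta> \<gamma> = - 1" | "cartan_number \<beta> \<gamma> = 0" | "cartan_number \<beta> \<gamma> = 1" by linarith
    thus ?thesis
    proof cases
      case 1
      thus ?thesis using key[OF \<gamma>\<Phi>] long_add_root[OF \<gamma> \<beta>(1)] \<beta>(1) by (simp add: cartan_number_self \<gamma>\<Phi>)
    next
      case 2
      thus ?thesis using key[of "- \<beta>"] \<beta>(1) root_minus cartan_number_minus_left[OF \<gamma>\<Phi> \<beta>(1)] by simp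
    next
      case 3
      \<comment> \<open>In grade 1 the partner of \<beta> is \<open>\<gamma> - \<beta>\<close>,
        which again has grade 1; the two add up to \<gamma>.\<close>
      have s: "\<beta> - \<gamma> \<in> \<Phi>" using long_sub_root[OF \<gamma> \<beta>(1) 3] .
      hence s': "\<gamma> - \<beta> \<in> \<Phi>" using root_minus[OF s] by simp
      have "cartan_number (\<gamma> - \<beta>) \<gamma> = 1"
        using cartan_number_diff[OF \<gamma>\<Phi> \<gamma>\<Phi> \<beta>(1) s'] 3 by (simp add: cartan_number_self \<gamma>\<Phi>)
      thus ?thesis using key[OF s'] \<beta>(1) \<gamma>\<Phi> by simp
    qed
  qed
  have "D = lin_comb (\<lambda>\<beta>. if \<beta> = \<gamma> then c \<gamma> else 0) (\<lambda>_. 0)"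
    unfolding cd lin_comb_def
    by (intro arg_cong2[where f = "(+)"] sum.cong) (auto simp: c d sc_0)
  thus ?thesis unfolding X_lin_comb[OF \<gamma>\<Phi>] ..
qed

lemma xr_0: "\<alpha> \<in> \<Phi> \<Longrightarrow> xr \<alpha> 0 = 1"
  and xr_add: "\<alpha> \<in> \<Phi> \<Longrightarrow> xr \<alpha> (s + t) = xr \<alpha> s * xr \<alpha> t"
  and xr_inverse: "\<alpha> \<in> \<Phi> \<Longrightarrow> xr \<alpha> t * xr \<alpha> (- t) = 1" "\<alpha> \<in> \<Phi> \<Longrightarrow> xr \<alpha> (- t) * xr \<alpha> t = 1"
  and xr_power: "\<alpha> \<in> \<Phi> \<Longrightarrow> xr \<alpha> t ^ m = xr \<alpha> (of_nat m * t)"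
  unfolding xr_def using n_pos nilpotent
  by (auto intro!: nexp_0 nexp_add nexp_inverse nexp_power)

lemma commutes_xr_iff: "\<alpha> \<in> \<Phi> \<Longrightarrow> t \<noteq> 0 \<Longrightarrow> A * xr \<alpha> t = xr \<alpha> t * A \<longleftrightarrow> A * X \<alpha> = X \<alpha> * A"
  unfolding xr_def by (rule commutes_nexp_iff[OF n_pos nilpotent])

lemma xr_conj1: "\<alpha> \<in> \<Phi> \<Longrightarrow> commutator (X \<alpha>) M = 0 \<Longrightarrow> xr \<alpha> t * M * xr \<alpha> (- t) = M"
  and xr_conj2: "\<alpha> \<in> \<Phi> \<Longrightarrow> commutator (X \<alpha>) M = N \<Longrightarrow> commutator (X \<alpha>) N = 0 \<Longrightarrow>
    xr \<alpha> t * M * xr \<alpha> (- t) = M + sc t * N"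
  and xr_conj3: "\<alpha> \<in> \<Phi> \<Longrightarrow> commutator (X \<alpha>) M = N \<Longrightarrow> commutator (X \<alpha>) N = Q \<Longrightarrow> commutator (X \<alpha>) Q = 0 \<Longrightarrow>
    xr \<alpha> t * M * xr \<alpha> (- t) = M + sc t * N + sc (t\<^sup>2 / 2) * Q"
  unfolding xr_def
  by (rule nexp_conj_string1[OF n_pos nilpotent] nexp_conj_string2[OF n_pos nilpotent]
      nexp_conj_string3[OF n_pos nilpotent]; assumption)+

text \<open>An element fixing all root vectors of nonnegative grade moves the coroot of \<open>\<gamma>\<close> by a multiple of
  \<open>X \<gamma>\<close>; correcting by \<open>xr \<gamma> t\<close>, it fixes the coroot, hence \<open>X (- \<gamma>)\<close>, hence everything.\<close>

lemma long_group_centralizer: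
  assumes \<gamma>: "long \<gamma>" and inv: "A * A' = 1" "A' * A = 1"
    and comm: "\<And>\<sigma>. \<sigma> \<in> \<Phi> \<Longrightarrow> cartan_number \<sigma> \<gamma> \<ge> 0 \<Longrightarrow> A * X \<sigma> = X \<sigma> * A"
    and span: "A * X (- \<gamma>) * A' \<in> lie_span"
  shows "\<exists>t. \<forall>\<alpha>\<in>\<Phi>. (xr \<gamma> t * A) * X \<alpha> = X \<alpha> * (xr \<gamma> t * A)"
proof -
  have \<gamma>\<Phi>: "\<gamma> \<in> \<Phi>" using \<gamma> by (rule long_root)
  have m\<gamma>: "- \<gamma> \<in> \<Phi>" using \<gamma>\<Phi> by (rule root_minus)
  have fixA: "A * X \<sigma> * A' = X \<sigma>" if "\<sigma> \<in> \<Phi>" "cartan_number \<sigma> \<gamma> \<ge> 0" for \<sigma>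
    using comm[OF that] inv by (simp add: mult.assoc)
  have fix\<gamma>: "A * X \<gamma> * A' = X \<gamma>" by (rule fixA) (simp_all add: \<gamma>\<Phi> cartan_number_self)
  define v where "v = A * X (- \<gamma>) * A'"
  have H: "A * Hr \<gamma> * A' = commutator (X \<gamma>) v"
    unfolding v_def Hr_def by (subst fix\<gamma>[symmetric], rule commutator_conj[OF inv(2), symmetric])
  have "A * Hr \<gamma> * A' - Hr \<gamma> \<in> lie_span"
  proof (rule lie_span_diff)
    show "A * Hr \<gamma> * A' \<in> lie_span" unfolding H v_def by (rule lie_span_bracket[OF span \<gamma>\<Phi>])
    obtain k where "Hr \<gamma> = lin_comb (\<lambda>_. 0) k" using H_lin_comb[OF \<gamma>\<Phi>] .
    thus "Hr \<gamma> \<in> lie_span" by (simp add: lie_spanI)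
  qed
  moreover have "commutator (A * Hr \<gamma> * A' - Hr \<gamma>) (X \<sigma>) = 0" if \<sigma>: "\<sigma> \<in> \<Phi>" "cartan_number \<sigma> \<gamma> \<ge> 0" for \<sigma>
  proof -
    have "commutator (A * Hr \<gamma> * A') (X \<sigma>) = A * commutator (Hr \<gamma>) (X \<sigma>) * A'"
      by (subst fixA[OF \<sigma>, symmetric]) (rule commutator_conj[OF inv(2)])
    also have "\<dots> = sc (of_int (cartan_number \<sigma> \<gamma>)) * (A * X \<sigma> * A')"
      using \<sigma>(1) \<gamma>\<Phi> by (simp add: H_weight sc_left_comm mult.assoc)
    finally show ?thesis using \<sigma> \<gamma>\<Phi> by (simp add: fixA commutator_simps H_weight)
  qed
  ultimately obtain \<tau> where \<tau>: "A * Hr \<gamma> * A' - Hr \<gamma> = sc \<tau> * X \<gamma>"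
    using long_centralizer[OF \<gamma>] by blast
  \<comment> \<open>Conjugation by \<open>xr \<gamma> t\<close> adds \<open>- 2 * t\<close> times
    \<open>X \<gamma>\<close> to the coroot, and this has to cancel \<tau> times
    \<open>X \<gamma>\<close>.\<close>
  define t where "t = \<tau> / 2"
  define B where "B = xr \<gamma> t * A"
  define B' where "B' = A' * xr \<gamma> (- t)"
  have invB: "B * B' = 1" "B' * B = 1"
  proof -
    have "B * B' = xr \<gamma> t * (A * A') * xr \<gamma> (- t)" "B' * B = A' * (xr \<gamma> (- t) * xr \<gamma> t) * A"
      by (simp_all add: B_def B'_def mult.assoc)
    thus "B * B' = 1" "B' * B = 1" using inv xr_inverse[OF \<gamma>\<Phi>, of t] by simp_all
  qed
  have conjB: "B * M * B' = xr \<gamma> t * (A * M * A') * xr \<gamma> (- t)" for M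
    by (simp add: B_def B'_def mult.assoc)
  have XX: "commutator (X \<gamma>) (X \<sigma>) = 0" if \<sigma>: "\<sigma> \<in> \<Phi>" "cartan_number \<sigma> \<gamma> \<ge> 0" for \<sigma>
    using long_add_not_root[OF \<gamma> \<sigma>] by (intro bracket_zero \<gamma>\<Phi> \<sigma>) (auto simp: add.commute)
  have fixB: "B * X \<sigma> * B' = X \<sigma>" if \<sigma>: "\<sigma> \<in> \<Phi>" "cartan_number \<sigma> \<gamma> \<ge> 0" for \<sigma>
    unfolding conjB fixA[OF \<sigma>] by (rule xr_conj1[OF \<gamma>\<Phi> XX[OF \<sigma>]])
  have XH: "commutator (X \<gamma>) (Hr \<gamma>) = sc (- 2) * X \<gamma>" using X_H[OF \<gamma>\<Phi> \<gamma>\<Phi>] by (simp add: cartan_number_self \<gamma>\<Phi>)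
  have fixH: "B * Hr \<gamma> * B' = Hr \<gamma>"
  proof -
    have "A * Hr \<gamma> * A' = Hr \<gamma> + sc \<tau> * X \<gamma>" using \<tau> by (simp add: algebra_simps)
    moreover have "commutator (X \<gamma>) (Hr \<gamma> + sc \<tau> * X \<gamma>) = sc (- 2) * X \<gamma>"
      by (simp add: commutator_simps XH commutator_sc)
    ultimately have "B * Hr \<gamma> * B' = Hr \<gamma> + sc \<tau> * X \<gamma> + sc t * (sc (- 2) * X \<gamma>)"
      unfolding conjB by (simp only:) (rule xr_conj2[OF \<gamma>\<Phi>], auto simp: commutator_sc commutator_simps)
    thus ?thesis by (simp add: sc_sc t_def sc_minus)
  qed
  define w where "w = B * X (- \<gamma>) * B'"
  have "w \<in> lie_span" unfolding w_def conjB by (rule lie_span_conj[OF span \<gamma>\<Phi>])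
  then obtain c d where cd: "w = lin_comb c d" by (rule lie_spanE)
  \<comment> \<open>\<open>w\<close> has weight -2 under the fixed coroot. Since \<gamma> is long,
    \<open>- \<gamma>\<close> is the only root of that weight, and the toral part has weight
    0.\<close>
  have "commutator (Hr \<gamma>) w = B * commutator (Hr \<gamma>) (X (- \<gamma>)) * B'"
    unfolding w_def by (subst fixH[symmetric]) (rule commutator_conj[OF invB(2)])
  also have "\<dots> = sc (- 2) * w"
    using \<gamma>\<Phi> m\<gamma> by (simp add: H_weight cartan_number_minus_left cartan_number_self sc_left_comm mult.assoc w_def)
  finally have "commutator (Hr \<gamma>) w + sc 2 * w = 0" by (simp add: sc_minus)
  moreover have "commutator (Hr \<gamma>) w = lin_comb (\<lambda>\<beta>. of_int (cartan_number \<beta> \<gamma>) * c \<beta>) (\<lambda>_. 0)"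
    unfolding cd lin_comb_def commutator_simps commutator_sum_right commutator_sc
    using base_root \<gamma>\<Phi> by (simp add: H_weight H_H sc_sc sc_0 mult.commute)
  ultimately have "lin_comb (\<lambda>\<beta>. of_int (cartan_number \<beta> \<gamma>) * c \<beta> + 2 * c \<beta>) (\<lambda>a. 0 + 2 * d a) = 0"
  proof -
    assume "commutator (Hr \<gamma>) w + sc 2 * w = 0"
      "commutator (Hr \<gamma>) w = lin_comb (\<lambda>\<beta>. of_int (cartan_number \<beta> \<gamma>) * c \<beta>) (\<lambda>_. 0)"
    hence "lin_comb (\<lambda>\<beta>. of_int (cartan_number \<beta> \<gamma>) * c \<beta>) (\<lambda>_. 0) + sc 2 * lin_comb c d = 0"
      by (simp only: cd)
    thus ?thesis by (simp only: lin_comb_add lin_comb_scale)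
  qed
  note z = lin_comb_eq_0[OF this]
  have d: "d a = 0" if "a \<in> \<Delta>" for a using z(2)[OF that] by simp
  have c: "c \<beta> = 0" if \<beta>: "\<beta> \<in> \<Phi>" "\<beta> \<noteq> - \<gamma>" for \<beta>
  proof -
    have "cartan_number \<beta> \<gamma> \<noteq> - 2"
      using long_cartan[OF \<gamma> \<beta>(1)] \<beta>(2) cartan_number_self[OF \<gamma>\<Phi>] by (cases "\<beta> = \<gamma>") auto
    hence "of_int (cartan_number \<beta> \<gamma> + 2) \<noteq> (0 :: 'f)" unfolding of_int_eq_0_iff by linarith
    moreover have "of_int (cartan_number \<beta> \<gamma> + 2) * c \<beta> = 0" using z(1)[OF \<beta>(1)] by (simp add: algebra_simps)
    ultimately show ?thesis by simp
  qed
  have "w = lin_comb (\<lambda>\<beta>. if \<beta> = - \<gamma> then c (- \<gamma>) else 0) (\<lambda>_. 0)"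
    unfolding cd lin_comb_def
    by (intro arg_cong2[where f = "(+)"] sum.cong) (auto simp: c d sc_0)
  hence w: "w = sc (c (- \<gamma>)) * X (- \<gamma>)" by (simp only: X_lin_comb[OF m\<gamma>])
  \<comment> \<open>The scalar is 1 because the bracket with the fixed \<open>X \<gamma>\<close>
    must return the fixed coroot.\<close>
  have "sc (c (- \<gamma>)) * Hr \<gamma> = commutator (X \<gamma>) w" by (simp add: w commutator_sc Hr_def)
  also have "\<dots> = commutator (B * X \<gamma> * B') (B * X (- \<gamma>) * B')"
    by (simp add: w_def[symmetric] fixB \<gamma>\<Phi> cartan_number_self)
  also have "\<dots> = Hr \<gamma>" by (simp only: commutator_conj[OF invB(2)] Hr_def[symmetric] fixH)
  finally have "sc (c (- \<gamma>) - 1) * Hr \<gamma> = 0" by (simp add: sc_diff sc_1 left_diff_distrib)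
  hence "c (- \<gamma>) = 1" using H_nonzero[OF \<gamma>\<Phi>] by (simp add: sc_eq_0_iff)
  hence fixm: "B * X (- \<gamma>) * B' = X (- \<gamma>)" using w by (simp add: w_def sc_1)
  have fix_all: "B * X \<alpha> * B' = X \<alpha>" if \<alpha>: "\<alpha> \<in> \<Phi>" for \<alpha>
  proof (cases "cartan_number \<alpha> \<gamma> \<ge> 0 \<or> \<alpha> = - \<gamma>")
    case True
    thus ?thesis using fixB[OF \<alpha>] fixm by blast
  next
    case False
    hence "\<alpha> \<noteq> \<gamma>" using cartan_number_self[OF \<gamma>\<Phi>] by auto
    hence g: "cartan_number \<alpha> \<gamma> = - 1" using False long_cartan[OF \<gamma> \<alpha>] by fastforce
    have s: "\<alpha> + \<gamma> \<in> \<Phi>" by (rule long_add_root[OF \<gamma> \<alpha> g])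
    \<comment> \<open>Grade -1 is reached from the fixed vectors \<open>X (- \<gamma>)\<close> and
      \<open>X (\<alpha> + \<gamma>)\<close> by a bracket with nonzero structure constant.\<close>
    obtain N :: int where N: "N \<noteq> 0" "commutator (X (- \<gamma>)) (X (\<alpha> + \<gamma>)) = sc (of_int N) * X \<alpha>"
      using bracket_root[OF m\<gamma> s] \<alpha> by auto
    have "cartan_number (\<alpha> + \<gamma>) \<gamma> \<ge> 0" using g by (simp add: cartan_number_add \<alpha> \<gamma>\<Phi> s cartan_number_self)
    hence "B * commutator (X (- \<gamma>)) (X (\<alpha> + \<gamma>)) * B' = commutator (X (- \<gamma>)) (X (\<alpha> + \<gamma>))"
      unfolding commutator_conj[OF invB(2), symmetric] by (simp only: fixm fixB[OF s])
    hence "sc (of_int N) * (B * X \<alpha> * B') = sc (of_int N) * X \<alpha>"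
      unfolding N(2) by (simp add: sc_left_comm mult.assoc)
    thus ?thesis using N(1) by (simp add: sc_cancel)
  qed
  have "B * X \<alpha> = X \<alpha> * B" if "\<alpha> \<in> \<Phi>" for \<alpha>
    using arg_cong[OF fix_all[OF that], of "\<lambda>x. x * B"] invB by (simp add: mult.assoc)
  thus ?thesis unfolding B_def by blast
qed

end

context chev_alg
begin

section \<open>Conjugation of root vectors by words in root elements\<close>

definition xword :: "('v \<times> 'f) list \<Rightarrow> 'e" where
  "xword ws = prod_list (map (\<lambda>(\<beta>, t). xr \<beta> t) ws)"

definition xword_inv :: "('v \<times> 'f) list \<Rightarrow> ('v \<times> 'f) list" where
  "xword_inv ws = rev (map (\<lambda>(\<beta>, t). (\<beta>, - t)) ws)"

definition conj_word :: "('v \<times> 'f) list \<Rightarrow> 'e \<Rightarrow> 'e" where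
  "conj_word ws M = xword ws * M * xword (xword_inv ws)"

lemma xword_append: "xword (us @ ws) = xword us * xword ws"
  by (simp add: xword_def)

lemma xword_inv_append: "xword_inv (us @ ws) = xword_inv ws @ xword_inv us"
  by (simp add: xword_inv_def)

lemma conj_word_append: "conj_word (us @ ws) M = conj_word us (conj_word ws M)"
  by (simp add: conj_word_def xword_append xword_inv_append mult.assoc)

lemma conj_word_Nil: "conj_word [] M = M"
  by (simp add: conj_word_def xword_def xword_inv_def)

lemma conj_word_Cons: "conj_word ((\<beta>, t) # ws) M = xr \<beta> t * conj_word ws M * xr \<beta> (- t)"
  by (simp add: conj_word_def xword_def xword_inv_def mult.assoc)

lemma xword_inverse:
  assumes "fst ` set ws \<subseteq> \<Phi>"
  shows "xword ws * xword (xword_inv ws) = 1" "xword (xword_inv ws) * xword ws = 1"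
proof -
  have "xword ws * xword (xword_inv ws) = 1 \<and> xword (xword_inv ws) * xword ws = 1"
    using assms
  proof (induction ws)
    case (Cons a ws)
    obtain \<beta> t where a: "a = (\<beta>, t)" by fastforce
    have \<beta>: "\<beta> \<in> \<Phi>" using Cons.prems a by auto
    have IH: "xword ws * xword (xword_inv ws) = 1" "xword (xword_inv ws) * xword ws = 1" using Cons by auto
    have "xword (a # ws) * xword (xword_inv (a # ws)) = xr \<beta> t * (xword ws * xword (xword_inv ws)) * xr \<beta> (- t)"
      "xword (xword_inv (a # ws)) * xword (a # ws) = xword (xword_inv ws) * (xr \<beta> (- t) * xr \<beta> t) * xword ws"
      by (simp_all add: a xword_def xword_inv_def mult.assoc)
    thus ?case using IH xr_inverse[OF \<beta>] by simp
  qed (simp add: xword_def xword_inv_def)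
  thus "xword ws * xword (xword_inv ws) = 1" "xword (xword_inv ws) * xword ws = 1" by auto
qed

text \<open>\<open>X \<alpha>\<close> and \<open>X (\<alpha> - \<gamma>)\<close> span the standard representation of the \<open>SL\<^sub>2\<close> belonging to \<open>\<gamma>\<close>.\<close>

lemma long_pair:
  assumes \<gamma>: "long \<gamma>" and \<alpha>: "\<alpha> \<in> \<Phi>" and g: "cartan_number \<alpha> \<gamma> = 1"
  shows "\<exists>e::int. e * e = 1 \<and>
    commutator (X (- \<gamma>)) (X \<alpha>) = sc (of_int e) * X (\<alpha> - \<gamma>) \<and> commutator (X (- \<gamma>)) (X (\<alpha> - \<gamma>)) = 0 \<and>
    commutator (X \<gamma>) (X (\<alpha> - \<gamma>)) = sc (of_int e) * X \<alpha> \<and> commutator (X \<gamma>) (X \<alpha>) = 0"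
proof -
  have \<gamma>\<Phi>: "\<gamma> \<in> \<Phi>" and m\<gamma>: "- \<gamma> \<in> \<Phi>" using \<gamma> long_root root_minus by blast+
  have s: "\<alpha> - \<gamma> \<in> \<Phi>" by (rule long_sub_root[OF \<gamma> \<alpha> g])
  have "cartan_number (\<alpha> - \<gamma>) (- \<gamma>) = 1"
    using g by (simp add: cartan_number_minus_right[OF \<gamma>\<Phi> s] cartan_number_diff[OF \<gamma>\<Phi> \<alpha> \<gamma>\<Phi> s] cartan_number_self[OF \<gamma>\<Phi>])
  hence 1: "commutator (X (- \<gamma>)) (X (\<alpha> - \<gamma>)) = 0"
    using long_add_not_root[OF long_minus[OF \<gamma>] s] by (intro bracket_zero m\<gamma> s) (auto simp: algebra_simps)
  have 2: "commutator (X \<gamma>) (X \<alpha>) = 0"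
    using long_add_not_root[OF \<gamma> \<alpha>] g by (intro bracket_zero \<gamma>\<Phi> \<alpha>) (auto simp: add.commute)
  obtain N :: int where N: "commutator (X (- \<gamma>)) (X \<alpha>) = sc (of_int N) * X (\<alpha> - \<gamma>)"
    using bracket_root[OF m\<gamma> \<alpha>] s by auto
  obtain N' :: int where N': "commutator (X \<gamma>) (X (\<alpha> - \<gamma>)) = sc (of_int N') * X \<alpha>"
    using bracket_root[OF \<gamma>\<Phi> s] \<alpha> by auto
  \<comment> \<open>The coroot acts on \<open>X \<alpha>\<close> by 1, so the two integral structure
    constants have product 1; hence they are the same sign.\<close>
  have "commutator (X \<gamma>) (commutator (X (- \<gamma>)) (X \<alpha>)) = commutator (Hr \<gamma>) (X \<alpha>)"
    unfolding commutator_jacobi[of "X \<gamma>"] 2 Hr_def by (simp add: commutator_simps)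
  also have "\<dots> = X \<alpha>" by (simp add: H_weight[OF \<gamma>\<Phi> \<alpha>] g sc_1)
  finally have "sc (of_int (N * N') - 1) * X \<alpha> = 0"
    by (simp add: N N' commutator_sc sc_sc sc_diff sc_1 left_diff_distrib)
  hence "(of_int (N * N') :: 'f) = 1" using X_nonzero[OF \<alpha>] by (simp add: sc_eq_0_iff)
  hence NN: "N * N' = 1" by (simp only: of_int_eq_1_iff)
  hence "N' = N" by (auto simp: zmult_eq_1_iff)
  thus ?thesis using 1 2 N N' NN by blast
qed

definition pair_comb :: "'v \<Rightarrow> 'v \<Rightarrow> 'f \<Rightarrow> 'f \<Rightarrow> 'e" where
  "pair_comb \<gamma> \<alpha> u v = sc u * X \<alpha> + sc v * X (\<alpha> - \<gamma>)"

lemma pair_comb_inject: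
  assumes "\<gamma> \<in> \<Phi>" "\<alpha> \<in> \<Phi>" "\<alpha> - \<gamma> \<in> \<Phi>" "pair_comb \<gamma> \<alpha> u v = pair_comb \<gamma> \<alpha> u' v'"
  shows "u = u' \<and> v = v'"
proof -
  have ne: "\<alpha> - \<gamma> \<noteq> \<alpha>" using root_nonzero[OF assms(1)] by simp
  have "lin_comb (\<lambda>\<beta>. (if \<beta> = \<alpha> then u - u' else 0) + (if \<beta> = \<alpha> - \<gamma> then v - v' else 0)) (\<lambda>_. 0 + 0)
      = sc (u - u') * X \<alpha> + sc (v - v') * X (\<alpha> - \<gamma>)"
    by (simp only: lin_comb_add[symmetric] X_lin_comb[OF assms(2)] X_lin_comb[OF assms(3)])
  also have "\<dots> = 0" using assms(4) by (simp add: pair_comb_def sc_diff algebra_simps)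
  finally show ?thesis using lin_comb_eq_0(1)[OF _ assms(2)] lin_comb_eq_0(1)[OF _ assms(3)] ne
    by fastforce
qed

context
  fixes \<gamma> \<alpha> :: 'v and e :: int
  assumes \<gamma>: "long \<gamma>" and \<alpha>: "\<alpha> \<in> \<Phi>" and g: "cartan_number \<alpha> \<gamma> = 1"
    and e: "e * e = 1"
    and c1: "commutator (X (- \<gamma>)) (X \<alpha>) = sc (of_int e) * X (\<alpha> - \<gamma>)"
    and c2: "commutator (X (- \<gamma>)) (X (\<alpha> - \<gamma>)) = 0"
    and c3: "commutator (X \<gamma>) (X (\<alpha> - \<gamma>)) = sc (of_int e) * X \<alpha>"
    and c4: "commutator (X \<gamma>) (X \<alpha>) = 0"
begin

lemma e_mult: "of_int e * of_int e = (1 :: 'f)"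
proof -
  have "(of_int e * of_int e :: 'f) = of_int (e * e)" by simp
  thus ?thesis unfolding e by simp
qed

text \<open>In the coordinates of \<open>pair_comb\<close>, \<open>xr \<gamma> (e a)\<close> acts as
  the unipotent matrix with rows \<open>(1, a)\<close> and \<open>(0, 1)\<close>, and
  \<open>xr (- \<gamma>) (e b)\<close> as the one with rows \<open>(1, 0)\<close> and
  \<open>(b, 1)\<close>. The sign \<open>e\<close> is put into the parameters to obtain exactly
  these matrices.\<close>

lemma pair_conj_plus:
  "xr \<gamma> (of_int e * a) * pair_comb \<gamma> \<alpha> u v * xr \<gamma> (- (of_int e * a)) = pair_comb \<gamma> \<alpha> (u + a * v) v"
proof -
  have "commutator (X \<gamma>) (pair_comb \<gamma> \<alpha> u v) = sc (of_int e * v) * X \<alpha>"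
    by (simp add: pair_comb_def commutator_simps commutator_sc c3 c4 sc_sc mult.commute)
  hence "xr \<gamma> (of_int e * a) * pair_comb \<gamma> \<alpha> u v * xr \<gamma> (- (of_int e * a))
      = pair_comb \<gamma> \<alpha> u v + sc (of_int e * a) * (sc (of_int e * v) * X \<alpha>)"
    by (rule xr_conj2[OF long_root[OF \<gamma>]]) (simp add: commutator_sc c4)
  also have "sc (of_int e * a) * (sc (of_int e * v) * X \<alpha>) = sc (a * v) * X \<alpha>"
    by (simp add: sc_sc ac_simps e_mult)
  finally show ?thesis by (simp add: pair_comb_def sc_add algebra_simps)
qed

lemma pair_conj_minus:
  "xr (- \<gamma>) (of_int e * b) * pair_comb \<gamma> \<alpha> u v * xr (- \<gamma>) (- (of_int e * b)) = pair_comb \<gamma> \<alpha> u (v + b * u)"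
proof -
  have "commutator (X (- \<gamma>)) (pair_comb \<gamma> \<alpha> u v) = sc (of_int e * u) * X (\<alpha> - \<gamma>)"
    by (simp add: pair_comb_def commutator_simps commutator_sc c1 c2 sc_sc mult.commute)
  hence "xr (- \<gamma>) (of_int e * b) * pair_comb \<gamma> \<alpha> u v * xr (- \<gamma>) (- (of_int e * b))
      = pair_comb \<gamma> \<alpha> u v + sc (of_int e * b) * (sc (of_int e * u) * X (\<alpha> - \<gamma>))"
    by (rule xr_conj2[OF root_minus[OF long_root[OF \<gamma>]]]) (simp add: commutator_sc c2)
  also have "sc (of_int e * b) * (sc (of_int e * u) * X (\<alpha> - \<gamma>)) = sc (b * u) * X (\<alpha> - \<gamma>)"
    by (simp add: sc_sc ac_simps e_mult)
  finally show ?thesis by (simp add: pair_comb_def sc_add algebra_simps)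
qed

lemma X_pair_comb: "X \<alpha> = pair_comb \<gamma> \<alpha> 1 0"
  by (simp add: pair_comb_def sc_0 sc_1)

text \<open>The three factors, applied from the right, move the vector \<open>(1, 0)\<close> to
  \<open>(1, 1)\<close>, then to \<open>(c, 1)\<close>, then to \<open>(c, 0)\<close>.\<close>

lemma torus_word_grade1:
  assumes "c \<noteq> 0"
  shows "conj_word [(- \<gamma>, of_int e * (- 1 / c)), (\<gamma>, of_int e * (c - 1)), (- \<gamma>, of_int e * 1)] (X \<alpha>) = sc c * X \<alpha>"
proof -
  have "conj_word [(- \<gamma>, of_int e * (- 1 / c)), (\<gamma>, of_int e * (c - 1)), (- \<gamma>, of_int e * 1)] (X \<alpha>)
      = pair_comb \<gamma> \<alpha> c 0"
    unfolding conj_word_Cons conj_word_Nil X_pair_comb pair_conj_minus pair_conj_plus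
    using assms by (simp add: field_simps)
  thus ?thesis by (simp add: pair_comb_def sc_0)
qed

text \<open>\<open>P\<close> has the rows \<open>(u, v)\<close> and \<open>(b, 1 + b * c)\<close>,
  and \<open>h\<close> has the rows \<open>(1, 1)\<close> and \<open>(p, p + 1)\<close>. For nonzero
  \<open>p\<close>, equality of the first columns of \<open>P h\<close> and \<open>h P\<close>
  already forces \<open>P = u + v (h - 1)\<close>, so testing a single vector is enough.\<close>

lemma norm_torus_eq_iff:
  fixes p a b c :: 'f
  defines "u \<equiv> 1 + a * b" and "v \<equiv> c + a + a * b * c"
  defines "P \<equiv> [(\<gamma>, of_int e * a), (- \<gamma>, of_int e * b), (\<gamma>, of_int e * c)]"
    and "h \<equiv> [(- \<gamma>, of_int e * p), (\<gamma>, of_int e * 1)]"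
  shows "conj_word (P @ h) (X \<alpha>) = conj_word (h @ P) (X \<alpha>) \<longleftrightarrow> b = p * v \<and> p * (1 + b * c) = p * u + p * b"
proof -
  have s: "\<alpha> - \<gamma> \<in> \<Phi>" by (rule long_sub_root[OF \<gamma> \<alpha> g])
  have 1: "conj_word (P @ h) (X \<alpha>) = pair_comb \<gamma> \<alpha> (u + p * v) (b + p * (1 + b * c))"
    unfolding P_def h_def conj_word_append conj_word_Cons conj_word_Nil X_pair_comb pair_conj_minus pair_conj_plus
    by (simp add: u_def v_def algebra_simps)
  have 2: "conj_word (h @ P) (X \<alpha>) = pair_comb \<gamma> \<alpha> (u + b) (p * u + (1 + p) * b)"
    unfolding P_def h_def conj_word_append conj_word_Cons conj_word_Nil X_pair_comb pair_conj_minus pair_conj_plus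
    by (simp add: u_def v_def algebra_simps)
  have inj: "pair_comb \<gamma> \<alpha> x y = pair_comb \<gamma> \<alpha> x' y' \<longleftrightarrow> x = x' \<and> y = y'" for x y x' y'
    using pair_comb_inject[OF long_root[OF \<gamma>] \<alpha> s] by blast
  show ?thesis unfolding 1 2 inj by (auto simp: algebra_simps)
qed

text \<open>As a product of unipotents \<open>P\<close> has determinant 1, and the determinant of
  \<open>u + v (h - 1)\<close> is the norm form.\<close>

lemma norm_torus_sound:
  fixes p a b c :: 'f
  assumes p: "p \<noteq> 0"
    and eq: "conj_word ([(\<gamma>, of_int e * a), (- \<gamma>, of_int e * b), (\<gamma>, of_int e * c)] @ [(- \<gamma>, of_int e * p), (\<gamma>, of_int e * 1)]) (X \<alpha>)
      = conj_word ([(- \<gamma>, of_int e * p), (\<gamma>, of_int e * 1)] @ [(\<gamma>, of_int e * a), (- \<gamma>, of_int e * b), (\<gamma>, of_int e * c)]) (X \<alpha>)"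
  shows "\<exists>u v. b = p * v \<and> u\<^sup>2 + p * u * v - p * v\<^sup>2 = 1"
proof -
  define u v where "u = 1 + a * b" and "v = c + a + a * b * c"
  have b: "b = p * v" and "p * (1 + b * c) = p * (u + b)"
    using eq unfolding norm_torus_eq_iff u_def v_def by (auto simp: distrib_left)
  hence bc: "1 + b * c = u + b" using p by simp
  have "u * (1 + b * c) - b * v = 1" by (simp add: u_def v_def algebra_simps)
  hence "u\<^sup>2 + p * u * v - p * v\<^sup>2 = 1" unfolding bc unfolding b by (simp add: power2_eq_square algebra_simps)
  thus ?thesis using b by blast
qed

lemma norm_torus_complete:
  fixes p u v :: 'f
  assumes p: "p \<noteq> 0" and u: "u \<noteq> 0" and norm: "u\<^sup>2 + p * u * v - p * v\<^sup>2 = 1"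
  shows "\<exists>a c. conj_word ([(\<gamma>, of_int e * a), (- \<gamma>, of_int e * (p * v)), (\<gamma>, of_int e * c)] @ [(- \<gamma>, of_int e * p), (\<gamma>, of_int e * 1)]) (X \<alpha>)
      = conj_word ([(- \<gamma>, of_int e * p), (\<gamma>, of_int e * 1)] @ [(\<gamma>, of_int e * a), (- \<gamma>, of_int e * (p * v)), (\<gamma>, of_int e * c)]) (X \<alpha>)"
proof (cases "v = 0")
  \<comment> \<open>With \<open>v = 0\<close> the middle factor is trivial, and
    \<open>a = c = 0\<close> makes the whole word trivial; the given \<open>u\<close> is then not an
    entry of \<open>P\<close>.\<close>
  case True
  show ?thesis by (rule exI[of _ 0], rule exI[of _ 0], subst norm_torus_eq_iff) (simp add: True)
next
  case False
  define b where "b = p * v"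
  have b: "b \<noteq> 0" using False p by (simp add: b_def)
  \<comment> \<open>\<open>a\<close> and \<open>c\<close> solve \<open>u = 1 + a * b\<close> and
    \<open>v = c * u + a\<close>, which factor the matrix with first row \<open>(u, v)\<close> into
    three unipotents; this is why \<open>b\<close> and \<open>u\<close> must be nonzero.\<close>
  define a where "a = (u - 1) / b"
  define c where "c = (v - a) / u"
  have u': "1 + a * b = u" using b by (simp add: a_def)
  have v': "c + a + a * b * c = v"
  proof -
    have "c + a + a * b * c = c * (1 + a * b) + a" by (simp add: algebra_simps)
    thus ?thesis unfolding u' using u by (simp add: c_def)
  qed
  have "u * (1 + b * c) = 1 + b * v"
    unfolding v'[symmetric] u'[symmetric] by (simp add: algebra_simps)
  also have "\<dots> = u * (u + b)" using norm by (simp add: b_def power2_eq_square algebra_simps)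
  finally have "1 + b * c = u + b" using u by simp
  thus ?thesis unfolding b_def[symmetric]
    by (intro exI[of _ a] exI[of _ c], subst norm_torus_eq_iff) (simp add: u' v' b_def[symmetric] flip: distrib_left)
qed

end

text \<open>\<open>X \<gamma>\<close>, its coroot and \<open>X (- \<gamma>)\<close> span the adjoint
  module of the \<open>SL\<^sub>2\<close> of \<gamma>. The torus element that scales by
  \<open>c\<close> on the standard module scales by the square of \<open>c\<close> here.\<close>

lemma torus_word_long:
  assumes \<gamma>: "\<gamma> \<in> \<Phi>" and c: "c \<noteq> 0"
  shows "conj_word [(- \<gamma>, - 1 / c), (\<gamma>, c - 1), (- \<gamma>, 1)] (X \<gamma>) = sc (c\<^sup>2) * X \<gamma>"
proof -
  have m\<gamma>: "- \<gamma> \<in> \<Phi>" using \<gamma> by (rule root_minus)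
  define comb where "comb r s t = sc r * X \<gamma> + sc s * Hr \<gamma> + sc t * X (- \<gamma>)" for r s t
  have XY: "commutator (X \<gamma>) (X (- \<gamma>)) = Hr \<gamma>" "commutator (X (- \<gamma>)) (X \<gamma>) = - Hr \<gamma>"
    by (simp_all add: Hr_def commutator_def)
  have XH: "commutator (X \<gamma>) (Hr \<gamma>) = sc (- 2) * X \<gamma>" "commutator (X (- \<gamma>)) (Hr \<gamma>) = sc 2 * X (- \<gamma>)"
    using X_H[OF \<gamma> \<gamma>] X_H[OF \<gamma> m\<gamma>] by (simp_all add: cartan_number_self cartan_number_minus_left \<gamma>)
  have plus: "xr \<gamma> a * comb r s t * xr \<gamma> (- a) = comb (r - 2 * a * s - a\<^sup>2 * t) (s + a * t) t" for a r s t
  proof -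
    have 1: "commutator (X \<gamma>) (comb r s t) = sc t * Hr \<gamma> + sc (- 2 * s) * X \<gamma>"
      by (simp add: comb_def commutator_simps commutator_sc XY XH sc_sc mult.commute add.commute)
    have 2: "commutator (X \<gamma>) (sc t * Hr \<gamma> + sc (- 2 * s) * X \<gamma>) = sc (- 2 * t) * X \<gamma>"
      by (simp add: commutator_simps commutator_sc XH sc_sc mult.commute)
    have 3: "commutator (X \<gamma>) (sc (- 2 * t) * X \<gamma>) = 0" by (simp add: commutator_simps commutator_sc)
    show ?thesis unfolding xr_conj3[OF \<gamma> 1 2 3]
      by (simp add: comb_def sc_add sc_diff sc_sc sc_minus distrib_left left_diff_distrib right_diff_distrib distrib_right
          ac_simps power2_eq_square)
  qed
  have minus: "xr (- \<gamma>) b * comb r s t * xr (- \<gamma>) (- b) = comb r (s - b * r) (t + 2 * b * s - b\<^sup>2 * r)" for b r s t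
  proof -
    have 1: "commutator (X (- \<gamma>)) (comb r s t) = sc (- r) * Hr \<gamma> + sc (2 * s) * X (- \<gamma>)"
      by (simp add: comb_def commutator_simps commutator_sc XY XH sc_sc sc_minus mult.commute add.commute)
    have 2: "commutator (X (- \<gamma>)) (sc (- r) * Hr \<gamma> + sc (2 * s) * X (- \<gamma>)) = sc (- 2 * r) * X (- \<gamma>)"
      by (simp add: commutator_simps commutator_sc XH sc_sc mult.commute)
    have 3: "commutator (X (- \<gamma>)) (sc (- 2 * r) * X (- \<gamma>)) = 0" by (simp add: commutator_simps commutator_sc)
    show ?thesis unfolding xr_conj3[OF m\<gamma> 1 2 3]
      by (simp add: comb_def sc_add sc_diff sc_sc sc_minus distrib_left left_diff_distrib right_diff_distrib distrib_right
          ac_simps power2_eq_square)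
  qed
  have X: "X \<gamma> = comb 1 0 0" by (simp add: comb_def sc_0 sc_1)
  have "conj_word [(- \<gamma>, - 1 / c), (\<gamma>, c - 1), (- \<gamma>, 1)] (X \<gamma>) = comb (c\<^sup>2) 0 0"
    unfolding conj_word_Cons conj_word_Nil X minus plus
    using c by (simp add: power2_eq_square field_simps)
  thus ?thesis by (simp add: comb_def sc_0)
qed

lemma conj_word_xr:
  assumes "fst ` set ws \<subseteq> \<Phi>" "\<alpha> \<in> \<Phi>" "conj_word ws (X \<alpha>) = sc c * X \<alpha>"
  shows "conj_word ws (xr \<alpha> t) = xr \<alpha> (c * t)"
  unfolding conj_word_def xr_def
  by (rule conj_nexp[OF n_pos nilpotent[OF assms(2)] xword_inverse(2,1)[OF assms(1)]])
    (use assms(3) in \<open>simp add: conj_word_def\<close>)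

text \<open>The source of general parameters: a torus element scales the constant
  \<open>xr \<alpha> 1\<close> by \<open>c\<close>, and the commutator then has parameter
  \<open>c - 1\<close>.\<close>

lemma conj_word_xr_commutator:
  assumes "fst ` set ws \<subseteq> \<Phi>" "\<alpha> \<in> \<Phi>" "conj_word ws (X \<alpha>) = sc c * X \<alpha>"
  shows "conj_word ws (xr \<alpha> 1) * xr \<alpha> (- 1) = xr \<alpha> (c - 1)"
  using conj_word_xr[OF assms, of 1] xr_add[OF assms(2), of c "- 1"] by simp

end

subsection \<open>Words in the parameters that ignore central factors\<close>

text \<open>Letters of a word describing an elementary element: \<open>Const \<alpha>\<close> stands for \<open>x\<^sub>\<alpha>(1)\<close>, and
  \<open>Param (\<gamma>, s)\<close> for an unknown replacing \<open>x\<^sub>\<gamma>(s)\<close>.\<close>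

datatype ('v, 'f) symb = Const 'v | Param "'v \<times> 'f"

type_synonym ('v, 'f) pword = "(('v, 'f) symb \<times> bool) list"

context chev_alg
begin

text \<open>An unknown and its inverse receive separate values because the ambient ring has no
  inversion.\<close>

fun symb_value :: "('v \<times> 'f \<Rightarrow> 'e) \<Rightarrow> ('v \<times> 'f \<Rightarrow> 'e) \<Rightarrow> ('v, 'f) symb \<times> bool \<Rightarrow> 'e" where
  "symb_value Y Y' (Const \<alpha>, inverted) = xr \<alpha> (if inverted then - 1 else 1)"
| "symb_value Y Y' (Param q, inverted) = (if inverted then Y' q else Y q)"

definition pword_value :: "('v \<times> 'f \<Rightarrow> 'e) \<Rightarrow> ('v \<times> 'f \<Rightarrow> 'e) \<Rightarrow> ('v, 'f) pword \<Rightarrow> 'e" where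
  "pword_value Y Y' w = prod_list (map (symb_value Y Y') w)"

definition root_value :: "('v \<times> 'f \<Rightarrow> 'f) \<Rightarrow> ('v, 'f) pword \<Rightarrow> 'e" where
  "root_value \<tau> = pword_value (\<lambda>q. xr (fst q) (\<tau> q)) (\<lambda>q. xr (fst q) (- \<tau> q))"

text \<open>Centrality is relative to the root vectors, not to the whole ring, and the inverse is
  carried along. This is all that the commutation equations can determine.\<close>

definition central_pair :: "'e \<Rightarrow> 'e \<Rightarrow> bool" where
  "central_pair z z' \<longleftrightarrow> z * z' = 1 \<and> z' * z = 1 \<and> (\<forall>\<alpha>\<in>\<Phi>. z * X \<alpha> = X \<alpha> * z)"

definition long_word :: "('v, 'f) pword \<Rightarrow> bool" where
  "long_word w \<longleftrightarrow> (\<forall>\<alpha> b. (Const \<alpha>, b) \<in> set w \<longrightarrow> \<alpha> \<in> \<Phi>) \<and> (\<forall>\<gamma> s b. (Param (\<gamma>, s), b) \<in> set w \<longrightarrow> long \<gamma>)"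

definition ignores_central :: "('v, 'f) pword \<Rightarrow> bool" where
  "ignores_central w \<longleftrightarrow> (\<forall>\<tau> z z'. (\<forall>q. central_pair (z q) (z' q)) \<longrightarrow>
    pword_value (\<lambda>q. z q * xr (fst q) (\<tau> q)) (\<lambda>q. xr (fst q) (- \<tau> q) * z' q) w = root_value \<tau> w)"

lemma pword_value_append: "pword_value Y Y' (u @ w) = pword_value Y Y' u * pword_value Y Y' w"
  by (simp add: pword_value_def)

lemma root_value_append: "root_value \<tau> (u @ w) = root_value \<tau> u * root_value \<tau> w"
  by (simp add: root_value_def pword_value_append)

lemma ignores_central_append: "ignores_central u \<Longrightarrow> ignores_central w \<Longrightarrow> ignores_central (u @ w)"
  unfolding ignores_central_def by (simp add: pword_value_append root_value_append)

lemma long_word_append: "long_word u \<Longrightarrow> long_word w \<Longrightarrow> long_word (u @ w)"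
  unfolding long_word_def by (simp, blast)

lemma central_commutes_xr:
  assumes "z * X \<alpha> = X \<alpha> * z" "\<alpha> \<in> \<Phi>" shows "z * xr \<alpha> t = xr \<alpha> t * z"
  using commutes_xr_iff[OF assms(2), of t z] assms by (cases "t = 0") (auto simp: xr_0)

lemma central_pair_swap: assumes "central_pair z z'" shows "central_pair z' z"
proof -
  have "z' * X \<alpha> = X \<alpha> * z'" if "\<alpha> \<in> \<Phi>" for \<alpha>
  proof -
    have "z' * (z * X \<alpha>) * z' = z' * (X \<alpha> * z) * z'" using assms that by (simp add: central_pair_def)
    thus ?thesis using assms by (simp add: central_pair_def mult.assoc) (simp add: mult.assoc[symmetric])
  qed
  thus ?thesis using assms by (simp add: central_pair_def)
qed

lemma central_factors:
  assumes "\<And>q. central_pair (z q) (z' q)" "fst ` set ws \<subseteq> \<Phi>"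
  shows "\<exists>Z Z'. central_pair Z Z' \<and>
    prod_list (map (\<lambda>q. z q * xr (fst q) (\<tau> q)) ws) = Z * prod_list (map (\<lambda>q. xr (fst q) (\<tau> q)) ws) \<and>
    prod_list (map (\<lambda>q. xr (fst q) (- \<tau> q) * z' q) (rev ws)) = prod_list (map (\<lambda>q. xr (fst q) (- \<tau> q)) (rev ws)) * Z'"
  using assms(2)
proof (induction ws)
  case Nil
  show ?case by (intro exI[of _ 1]) (simp add: central_pair_def)
next
  case (Cons q ws)
  let ?x = "xr (fst q) (\<tau> q)" and ?x' = "xr (fst q) (- \<tau> q)"
  obtain Z Z' where Z: "central_pair Z Z'"
    and 1: "prod_list (map (\<lambda>q. z q * xr (fst q) (\<tau> q)) ws) = Z * prod_list (map (\<lambda>q. xr (fst q) (\<tau> q)) ws)"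
    and 2: "prod_list (map (\<lambda>q. xr (fst q) (- \<tau> q) * z' q) (rev ws)) = prod_list (map (\<lambda>q. xr (fst q) (- \<tau> q)) (rev ws)) * Z'"
    using Cons by auto
  have q: "fst q \<in> \<Phi>" using Cons.prems by simp
  have zq: "central_pair (z q) (z' q)" by (rule assms(1))
  have cp: "central_pair (z q * Z) (Z' * z' q)"
  proof -
    have "z q * Z * (Z' * z' q) = z q * (Z * Z') * z' q" "Z' * z' q * (z q * Z) = Z' * (z' q * z q) * Z"
      by (simp_all add: mult.assoc)
    moreover have "z q * Z * X \<alpha> = X \<alpha> * (z q * Z)" if "\<alpha> \<in> \<Phi>" for \<alpha>
    proof -
      have "z q * Z * X \<alpha> = (z q * X \<alpha>) * Z" using Z that by (simp add: central_pair_def mult.assoc)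
      also have "z q * X \<alpha> = X \<alpha> * z q" using zq that by (simp add: central_pair_def)
      finally show ?thesis by (simp add: mult.assoc)
    qed
    ultimately show ?thesis using Z zq by (simp add: central_pair_def)
  qed
  have Zx: "Z * ?x = ?x * Z" by (rule central_commutes_xr[OF _ q]) (use Z q in \<open>simp add: central_pair_def\<close>)
  have Zx': "Z' * ?x' = ?x' * Z'"
    by (rule central_commutes_xr[OF _ q]) (use central_pair_swap[OF Z] q in \<open>simp add: central_pair_def\<close>)
  have "prod_list (map (\<lambda>q. z q * xr (fst q) (\<tau> q)) (q # ws)) = z q * (?x * Z) * prod_list (map (\<lambda>q. xr (fst q) (\<tau> q)) ws)"
    by (simp add: 1 mult.assoc)
  hence A: "prod_list (map (\<lambda>q. z q * xr (fst q) (\<tau> q)) (q # ws)) = (z q * Z) * prod_list (map (\<lambda>q. xr (fst q) (\<tau> q)) (q # ws))"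
    unfolding Zx[symmetric] by (simp add: mult.assoc)
  have "prod_list (map (\<lambda>q. xr (fst q) (- \<tau> q) * z' q) (rev (q # ws)))
      = prod_list (map (\<lambda>q. xr (fst q) (- \<tau> q)) (rev ws)) * (Z' * ?x') * z' q"
    by (simp add: 2 mult.assoc)
  hence B: "prod_list (map (\<lambda>q. xr (fst q) (- \<tau> q) * z' q) (rev (q # ws)))
      = prod_list (map (\<lambda>q. xr (fst q) (- \<tau> q)) (rev (q # ws))) * (Z' * z' q)"
    unfolding Zx' by (simp add: mult.assoc)
  show ?case using cp A B by blast
qed

definition commutator_pword :: "('v \<times> 'f) list \<Rightarrow> 'v \<Rightarrow> ('v, 'f) pword" where
  "commutator_pword ws \<alpha> = map (\<lambda>q. (Param q, False)) ws @ [(Const \<alpha>, False)]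
    @ map (\<lambda>q. (Param q, True)) (rev ws) @ [(Const \<alpha>, True)]"

lemma commutator_pword_value:
  "pword_value Y Y' (commutator_pword ws \<alpha>)
    = prod_list (map Y ws) * xr \<alpha> 1 * prod_list (map Y' (rev ws)) * xr \<alpha> (- 1)"
  by (simp add: commutator_pword_def pword_value_def comp_def mult.assoc)

text \<open>The central factors of the unknowns collect into one factor on \<open>ws\<close> and its
  inverse on the reversed word. Moved past the root elements in between, the two cancel.\<close>

lemma ignores_central_commutator:
  assumes "fst ` set ws \<subseteq> \<Phi>" "\<alpha> \<in> \<Phi>"
  shows "ignores_central (commutator_pword ws \<alpha>)"
  unfolding ignores_central_def root_value_def commutator_pword_value
proof (intro allI impI)
  fix \<tau> :: "'v \<times> 'f \<Rightarrow> 'f" and z z' :: "'v \<times> 'f \<Rightarrow> 'e" assume zz: "\<forall>q. central_pair (z q) (z' q)"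
  let ?H = "prod_list (map (\<lambda>q. xr (fst q) (\<tau> q)) ws)" and ?H' = "prod_list (map (\<lambda>q. xr (fst q) (- \<tau> q)) (rev ws))"
  obtain Z Z' where Z: "central_pair Z Z'"
    and 1: "prod_list (map (\<lambda>q. z q * xr (fst q) (\<tau> q)) ws) = Z * ?H"
    and 2: "prod_list (map (\<lambda>q. xr (fst q) (- \<tau> q) * z' q) (rev ws)) = ?H' * Z'"
    using central_factors[of z z' ws \<tau>] zz assms(1) by blast
  have Zx: "Z' * xr \<beta> t = xr \<beta> t * Z'" if "\<beta> \<in> \<Phi>" for \<beta> t
    by (rule central_commutes_xr[OF _ that]) (use central_pair_swap[OF Z] that in \<open>simp add: central_pair_def\<close>)
  have ZH: "Z' * prod_list (map (\<lambda>q. xr (fst q) (\<tau>' q)) us) = prod_list (map (\<lambda>q. xr (fst q) (\<tau>' q)) us) * Z'"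
    if "fst ` set us \<subseteq> \<Phi>" for us \<tau>'
    using that
  proof (induction us)
    case (Cons q us)
    have "Z' * prod_list (map (\<lambda>q. xr (fst q) (\<tau>' q)) (q # us))
        = (Z' * xr (fst q) (\<tau>' q)) * prod_list (map (\<lambda>q. xr (fst q) (\<tau>' q)) us)"
      by (simp add: mult.assoc)
    also have "\<dots> = xr (fst q) (\<tau>' q) * (Z' * prod_list (map (\<lambda>q. xr (fst q) (\<tau>' q)) us))"
      using Cons.prems by (simp add: Zx mult.assoc)
    finally show ?case using Cons by (simp add: mult.assoc)
  qed simp
  have HZ: "?H' * Z' = Z' * ?H'" using ZH[of "rev ws" "\<lambda>q. - \<tau> q"] assms(1) by simp
  have "Z * ?H * xr \<alpha> 1 * (Z' * ?H') = Z * (?H * (xr \<alpha> 1 * (Z' * ?H')))" by (simp add: mult.assoc)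
  also have "Z * (?H * (xr \<alpha> 1 * (Z' * ?H'))) = Z * (?H * (xr \<alpha> 1 * Z')) * ?H'" by (simp add: mult.assoc)
  also have "xr \<alpha> 1 * Z' = Z' * xr \<alpha> 1" by (rule Zx[OF assms(2), symmetric])
  also have "Z * (?H * (Z' * xr \<alpha> 1)) * ?H' = Z * (?H * Z') * xr \<alpha> 1 * ?H'" by (simp add: mult.assoc)
  also have "?H * Z' = Z' * ?H" by (rule ZH[OF assms(1), symmetric])
  also have "Z * (Z' * ?H) = ?H" using Z by (simp add: central_pair_def mult.assoc[symmetric])
  finally show "prod_list (map (\<lambda>q. z q * xr (fst q) (\<tau> q)) ws) * xr \<alpha> 1
      * prod_list (map (\<lambda>q. xr (fst q) (- \<tau> q) * z' q) (rev ws)) * xr \<alpha> (- 1) = ?H * xr \<alpha> 1 * ?H' * xr \<alpha> (- 1)"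
    unfolding 1 2 HZ by simp
qed

text \<open>With \<open>snd\<close> as assignment, each letter \<open>Param (\<gamma>, s)\<close>
  takes the parameter \<open>s\<close> recorded in it.\<close>

definition expressible :: "'e \<Rightarrow> bool" where
  "expressible a \<longleftrightarrow> (\<exists>w. long_word w \<and> ignores_central w \<and> root_value snd w = a)"

lemma expressible_mult: "expressible a \<Longrightarrow> expressible b \<Longrightarrow> expressible (a * b)"
proof -
  assume "expressible a" "expressible b"
  then obtain u w where "long_word u" "ignores_central u" "root_value snd u = a"
    "long_word w" "ignores_central w" "root_value snd w = b" unfolding expressible_def by blast
  thus ?thesis unfolding expressible_def
    by (intro exI[of _ "u @ w"]) (simp add: long_word_append ignores_central_append root_value_append)
qed

lemma expressible_1: "expressible 1"
  unfolding expressible_def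
  by (intro exI[of _ "[]"]) (simp add: long_word_def ignores_central_def root_value_def pword_value_def)

lemma expressible_unit: "\<alpha> \<in> \<Phi> \<Longrightarrow> expressible (xr \<alpha> 1)" "\<alpha> \<in> \<Phi> \<Longrightarrow> expressible (xr \<alpha> (- 1))"
  unfolding expressible_def
  by (rule exI[of _ "[(Const \<alpha>, False)]"], simp add: long_word_def ignores_central_def root_value_def pword_value_def)
    (rule exI[of _ "[(Const \<alpha>, True)]"], simp add: long_word_def ignores_central_def root_value_def pword_value_def)

lemma expressible_conj_word:
  assumes "\<gamma> \<in> \<Phi>" "long \<gamma>" "fst ` set ws \<subseteq> {\<gamma>, - \<gamma>}" "\<alpha> \<in> \<Phi>" "conj_word ws (X \<alpha>) = sc c * X \<alpha>"
  shows "expressible (xr \<alpha> (c - 1))"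
proof -
  have ws: "fst ` set ws \<subseteq> \<Phi>" using assms(1,3) root_minus by auto
  have "root_value snd (commutator_pword ws \<alpha>) = xr \<alpha> (c - 1)"
    unfolding root_value_def commutator_pword_value conj_word_xr_commutator[OF ws assms(4,5), symmetric]
    by (simp add: conj_word_def xword_def xword_inv_def rev_map comp_def case_prod_unfold)
  moreover have "long_word (commutator_pword ws \<alpha>)"
    using assms long_minus by (auto simp: long_word_def commutator_pword_def)
  ultimately show ?thesis using ignores_central_commutator[OF ws assms(4)] unfolding expressible_def by blast
qed

definition pword_inv :: "('v, 'f) pword \<Rightarrow> ('v, 'f) pword" where
  "pword_inv w = rev (map (\<lambda>(s, b). (s, \<not> b)) w)"

lemma pword_value_inv:
  assumes "long_word w" "\<And>q. fst q \<in> \<Phi> \<Longrightarrow> Y q * Y' q = 1 \<and> Y' q * Y q = 1"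
  shows "pword_value Y Y' w * pword_value Y Y' (pword_inv w) = 1 \<and>
    pword_value Y Y' (pword_inv w) * pword_value Y Y' w = 1"
  using assms(1)
proof (induction w)
  case (Cons l w)
  obtain s b where l: "l = (s, b)" by fastforce
  have "long_word w" using Cons.prems by (auto simp: long_word_def)
  note IH = Cons.IH[OF this]
  let ?l = "symb_value Y Y' (s, b)" and ?l' = "symb_value Y Y' (s, \<not> b)"
  have ll: "?l * ?l' = 1" "?l' * ?l = 1"
    using Cons.prems assms(2) long_root xr_inverse[of _ 1] unfolding l long_word_def
    by (cases s; cases b; force)+
  have "pword_value Y Y' (l # w) * pword_value Y Y' (pword_inv (l # w))
      = ?l * (pword_value Y Y' w * pword_value Y Y' (pword_inv w)) * ?l'"
    "pword_value Y Y' (pword_inv (l # w)) * pword_value Y Y' (l # w)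
      = pword_value Y Y' (pword_inv w) * (?l' * ?l) * pword_value Y Y' w"
    by (simp_all add: l pword_value_def pword_inv_def mult.assoc)
  thus ?case using IH ll by simp
qed (simp add: pword_value_def pword_inv_def)

text \<open>The inverse word evaluated with and without central factors is in both cases an inverse
  of the same element, so the two values agree by uniqueness of inverses.\<close>

lemma expressible_inverse:
  assumes "expressible a" "a * a' = 1" "a' * a = 1" shows "expressible a'"
proof -
  obtain w where w: "long_word w" "ignores_central w" "root_value snd w = a"
    using assms(1) by (auto simp: expressible_def)
  have rv: "root_value \<tau> w * root_value \<tau> (pword_inv w) = 1" "root_value \<tau> (pword_inv w) * root_value \<tau> w = 1" for \<tau>
    using pword_value_inv[OF w(1), of "\<lambda>q. xr (fst q) (\<tau> q)" "\<lambda>q. xr (fst q) (- \<tau> q)"] xr_inverse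
    unfolding root_value_def by auto
  have unique: "y = y'" if "x * y = 1" "y' * x = 1" for x y y' :: 'e
  proof -
    have "y = (y' * x) * y" using that by simp
    also have "\<dots> = y'" using that(1) by (simp only: mult.assoc mult_1_right)
    finally show ?thesis .
  qed
  have "ignores_central (pword_inv w)"
    unfolding ignores_central_def
  proof (intro allI impI)
    fix \<tau> :: "'v \<times> 'f \<Rightarrow> 'f" and z z' :: "'v \<times> 'f \<Rightarrow> 'e" assume zz: "\<forall>q. central_pair (z q) (z' q)"
    let ?Y = "\<lambda>q. z q * xr (fst q) (\<tau> q)" and ?Y' = "\<lambda>q. xr (fst q) (- \<tau> q) * z' q"
    have "?Y q * ?Y' q = 1 \<and> ?Y' q * ?Y q = 1" if q: "fst q \<in> \<Phi>" for q
    proof -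
      have "?Y q * ?Y' q = z q * (xr (fst q) (\<tau> q) * xr (fst q) (- \<tau> q)) * z' q"
        "?Y' q * ?Y q = xr (fst q) (- \<tau> q) * (z' q * z q) * xr (fst q) (\<tau> q)"
        by (simp_all add: mult.assoc)
      moreover have "central_pair (z q) (z' q)" using zz by blast
      ultimately show ?thesis using xr_inverse[OF q] by (simp add: central_pair_def)
    qed
    hence "pword_value ?Y ?Y' w * pword_value ?Y ?Y' (pword_inv w) = 1"
      using pword_value_inv[OF w(1), of ?Y ?Y'] by blast
    moreover have "pword_value ?Y ?Y' w = root_value \<tau> w"
      using w(2) zz unfolding ignores_central_def by blast
    ultimately show "pword_value ?Y ?Y' (pword_inv w) = root_value \<tau> (pword_inv w)"
      using unique[OF _ rv(2)] by simp
  qed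
  moreover have "long_word (pword_inv w)"
  proof -
    have "(s, b) \<in> set (pword_inv w) \<longleftrightarrow> (s, \<not> b) \<in> set w" for s b
      by (force simp: pword_inv_def image_iff)
    thus ?thesis using w(1) unfolding long_word_def by blast
  qed
  moreover have "root_value snd (pword_inv w) = a'"
    using unique[OF rv(1)[of snd, unfolded w(3)] assms(3)] .
  ultimately show ?thesis unfolding expressible_def by blast
qed

text \<open>A long root \<gamma> with positive Cartan number supplies the torus. If \<alpha> has
  grade 1, it scales by \<open>c\<close> and \<open>c = t + 1\<close> works. If \<alpha> is \<gamma>
  itself, it scales by squares, and \<open>t\<close> is written as a difference of the squares of
  \<open>(t + 1) / 2\<close> and \<open>(t - 1) / 2\<close>. The excluded parameters 1 and -1 are
  constants.\<close>

lemma expressible_xr: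
  assumes ind: "indecomposable \<Phi>" and \<alpha>: "\<alpha> \<in> \<Phi>"
  shows "expressible (xr \<alpha> t)"
proof -
  obtain \<gamma> where \<gamma>: "long \<gamma>" and pos: "cartan_number \<alpha> \<gamma> > 0" using nonorthogonal_long[OF ind \<alpha>] by blast
  have \<gamma>\<Phi>: "\<gamma> \<in> \<Phi>" using \<gamma> by (rule long_root)
  show ?thesis
  proof (cases "\<alpha> = \<gamma>")
    case False
    hence "\<alpha> \<noteq> - \<gamma>" using pos by (auto simp: cartan_number_minus_left \<gamma>\<Phi> cartan_number_self)
    hence g: "cartan_number \<alpha> \<gamma> = 1" using long_cartan[OF \<gamma> \<alpha> False] pos by linarith
    from long_pair[OF \<gamma> \<alpha> g] obtain e :: int where e: "e * e = 1"
      "commutator (X (- \<gamma>)) (X \<alpha>) = sc (of_int e) * X (\<alpha> - \<gamma>)" "commutator (X (- \<gamma>)) (X (\<alpha> - \<gamma>)) = 0"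
      "commutator (X \<gamma>) (X (\<alpha> - \<gamma>)) = sc (of_int e) * X \<alpha>" "commutator (X \<gamma>) (X \<alpha>) = 0" by blast
    show ?thesis
    proof (cases "t = - 1")
      case True thus ?thesis using expressible_unit[OF \<alpha>] by simp
    next
      case t: False
      hence "t + 1 \<noteq> 0" by (simp add: add_eq_0_iff2)
      from expressible_conj_word[OF \<gamma>\<Phi> \<gamma> _ \<alpha> torus_word_grade1[OF \<gamma> \<alpha> g e this]] show ?thesis by simp
    qed
  next
    case True
    have step: "expressible (xr \<gamma> (c\<^sup>2 - 1))" if "c \<noteq> 0" for c
      by (rule expressible_conj_word[OF \<gamma>\<Phi> \<gamma> _ \<gamma>\<Phi> torus_word_long[OF \<gamma>\<Phi> that]]) simp
    show ?thesis
    proof (cases "t = 1 \<or> t = - 1")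
      case True
      thus ?thesis using expressible_unit[OF \<alpha>] by auto
    next
      case t: False
      define a b where "a = (t + 1) / 2" and "b = (t - 1) / 2"
      have "a \<noteq> 0" "b \<noteq> 0" using t by (auto simp: a_def b_def add_eq_0_iff2)
      hence "expressible (xr \<gamma> (a\<^sup>2 - 1))" "expressible (xr \<gamma> (- (b\<^sup>2 - 1)))"
        using step expressible_inverse[OF step xr_inverse[OF \<gamma>\<Phi>, of "b\<^sup>2 - 1"]] by auto
      hence "expressible (xr \<gamma> ((a\<^sup>2 - 1) + - (b\<^sup>2 - 1)))"
        unfolding xr_add[OF \<gamma>\<Phi>] by (rule expressible_mult)
      moreover have "(a\<^sup>2 - 1) + - (b\<^sup>2 - 1) = t" by (simp add: a_def b_def power2_eq_square field_simps)
      ultimately show ?thesis using True by simp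
    qed
  qed
qed

end

subsection \<open>Group equations through an embedding into a ring\<close>

definition inverse_word :: "gword \<Rightarrow> gword" where
  "inverse_word w = rev (map (\<lambda>(s, b). (s, \<not> b)) w)"

definition equation :: "gword \<Rightarrow> gword \<Rightarrow> gword" where
  "equation u w = u @ inverse_word w"

definition coeffs_below :: "nat \<Rightarrow> gword \<Rightarrow> bool" where
  "coeffs_below k w \<longleftrightarrow> (\<forall>s\<in>fst ` set w. \<forall>j. s = Coeff j \<longrightarrow> j < k)"

lemma coeffs_below_append [simp]: "coeffs_below k (u @ w) \<longleftrightarrow> coeffs_below k u \<and> coeffs_below k w"
  by (auto simp: coeffs_below_def)

lemma coeffs_below_Cons [simp]: "coeffs_below k ((s, b) # w) \<longleftrightarrow> (\<forall>j. s = Coeff j \<longrightarrow> j < k) \<and> coeffs_below k w"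
  by (auto simp: coeffs_below_def)

lemma coeffs_below_Nil [simp]: "coeffs_below k []" by (simp add: coeffs_below_def)

lemma coeffs_below_inverse_word [simp]: "coeffs_below k (inverse_word w) \<longleftrightarrow> coeffs_below k w"
  by (simp add: coeffs_below_def inverse_word_def image_image case_prod_unfold)

lemma coeffs_below_equation [simp]: "coeffs_below k (equation u w) \<longleftrightarrow> coeffs_below k u \<and> coeffs_below k w"
  by (simp add: equation_def)

lemma coeffs_below_replicate [simp]: "coeffs_below k (replicate m (Var i, b))"
  by (auto simp: coeffs_below_def)

lemma coeffs_below_replicate_Coeff: "j < k \<Longrightarrow> coeffs_below k (replicate m (Coeff j, b))"
  by (auto simp: coeffs_below_def)

lemma system_over_iff: "system_over cs S \<longleftrightarrow> (\<forall>w\<in>set S. coeffs_below (length cs) w)"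
proof -
  have "coeffs_below k w \<longleftrightarrow> (\<forall>j b. (Coeff j, b) \<in> set w \<longrightarrow> j < k)" for k w
  proof
    assume c: "coeffs_below k w"
    show "\<forall>j b. (Coeff j, b) \<in> set w \<longrightarrow> j < k"
    proof (intro allI impI)
      fix j b assume "(Coeff j, b) \<in> set w"
      hence "Coeff j \<in> fst ` set w" by (metis fst_conv imageI)
      thus "j < k" using c unfolding coeffs_below_def by blast
    qed
  next
    assume c: "\<forall>j b. (Coeff j, b) \<in> set w \<longrightarrow> j < k"
    show "coeffs_below k w" unfolding coeffs_below_def
    proof (intro ballI allI impI)
      fix s j assume "s \<in> fst ` set w" "s = Coeff j"
      then obtain b where "(Coeff j, b) \<in> set w" by (metis imageE prod.collapse)
      thus "j < k" using c by blast
    qed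
  qed
  thus ?thesis unfolding system_over_def by simp
qed

text \<open>Words are evaluated in a multiplicative monoid, in the applications that of a ring of
  endomorphisms in which group elements can be multiplied with root vectors. Injectivity makes a
  group equation equivalent to the identity of the images.\<close>

locale group_embedding = group G for G (structure) +
  fixes emb :: "'a \<Rightarrow> 'e::monoid_mult" and cs :: "'a list"
  assumes emb_mult: "a \<in> carrier G \<Longrightarrow> b \<in> carrier G \<Longrightarrow> emb (a \<otimes> b) = emb a * emb b"
    and emb_one: "emb \<one> = 1"
    and emb_inj: "a \<in> carrier G \<Longrightarrow> b \<in> carrier G \<Longrightarrow> emb a = emb b \<Longrightarrow> a = b"
    and coeffs: "set cs \<subseteq> carrier G"
begin

definition emb_word :: "(nat \<Rightarrow> 'a) \<Rightarrow> gword \<Rightarrow> 'e" where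
  "emb_word \<sigma> w = prod_list (map (\<lambda>l. emb (letter_value G cs \<sigma> l)) w)"

lemma emb_word_append: "emb_word \<sigma> (u @ w) = emb_word \<sigma> u * emb_word \<sigma> w"
  by (simp add: emb_word_def)

lemma emb_word_Cons: "emb_word \<sigma> (l # w) = emb (letter_value G cs \<sigma> l) * emb_word \<sigma> w"
  by (simp add: emb_word_def)

lemma emb_word_Nil: "emb_word \<sigma> [] = 1"
  by (simp add: emb_word_def)

lemma emb_word_replicate: "emb_word \<sigma> (replicate m l) = emb (letter_value G cs \<sigma> l) ^ m"
  by (induction m) (simp_all add: emb_word_def)

context
  fixes \<sigma> :: "nat \<Rightarrow> 'a" assumes \<sigma>: "\<And>i. \<sigma> i \<in> carrier G"
begin

lemma sym_closed: "(\<And>j. s = Coeff j \<Longrightarrow> j < length cs) \<Longrightarrow> sym_value cs \<sigma> s \<in> carrier G"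
  using coeffs \<sigma> by (cases s) (auto dest: nth_mem)

lemma letter_closed: "(\<And>j. s = Coeff j \<Longrightarrow> j < length cs) \<Longrightarrow> letter_value G cs \<sigma> (s, b) \<in> carrier G"
  using sym_closed by simp

lemma word_value_closed_emb:
  "coeffs_below (length cs) w \<Longrightarrow> word_value G cs \<sigma> w \<in> carrier G \<and> emb (word_value G cs \<sigma> w) = emb_word \<sigma> w"
proof (induction w)
  case (Cons l w)
  obtain s b where l: "l = (s, b)" by fastforce
  have "letter_value G cs \<sigma> l \<in> carrier G" using Cons.prems letter_closed[of s b] unfolding l by auto
  thus ?case using Cons unfolding l
    by (simp add: word_value_def emb_word_Cons emb_mult del: letter_value.simps)
qed (simp add: word_value_def emb_word_def emb_one)

lemma emb_letter_inverse:
  assumes "\<And>j. s = Coeff j \<Longrightarrow> j < length cs"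
  shows "emb (letter_value G cs \<sigma> (s, b)) * emb (letter_value G cs \<sigma> (s, \<not> b)) = 1"
proof -
  have "sym_value cs \<sigma> s \<in> carrier G" using assms by (rule sym_closed)
  thus ?thesis by (cases b) (simp_all add: emb_one flip: emb_mult)
qed

lemma emb_inverse_word:
  "coeffs_below (length cs) w \<Longrightarrow> emb_word \<sigma> w * emb_word \<sigma> (inverse_word w) = 1 \<and>
    emb_word \<sigma> (inverse_word w) * emb_word \<sigma> w = 1"
proof (induction w)
  case (Cons l w)
  obtain s b where l: "l = (s, b)" by fastforce
  have ll: "emb (letter_value G cs \<sigma> (s, b)) * emb (letter_value G cs \<sigma> (s, \<not> b)) = 1"
    "emb (letter_value G cs \<sigma> (s, \<not> b)) * emb (letter_value G cs \<sigma> (s, b)) = 1"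
    using Cons.prems emb_letter_inverse[of s b] emb_letter_inverse[of s "\<not> b"] unfolding l by auto
  have IH: "emb_word \<sigma> w * emb_word \<sigma> (inverse_word w) = 1" "emb_word \<sigma> (inverse_word w) * emb_word \<sigma> w = 1"
    using Cons unfolding l by auto
  have inv: "emb_word \<sigma> (inverse_word (l # w)) = emb_word \<sigma> (inverse_word w) * emb (letter_value G cs \<sigma> (s, \<not> b))"
    by (simp add: l inverse_word_def emb_word_append emb_word_Cons emb_word_Nil del: letter_value.simps)
  have "emb_word \<sigma> (l # w) * emb_word \<sigma> (inverse_word (l # w)) = emb (letter_value G cs \<sigma> (s, b)) *
      (emb_word \<sigma> w * emb_word \<sigma> (inverse_word w)) * emb (letter_value G cs \<sigma> (s, \<not> b))"
    "emb_word \<sigma> (inverse_word (l # w)) * emb_word \<sigma> (l # w) = emb_word \<sigma> (inverse_word w) *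
      (emb (letter_value G cs \<sigma> (s, \<not> b)) * emb (letter_value G cs \<sigma> (s, b))) * emb_word \<sigma> w"
    unfolding inv by (simp_all add: l emb_word_Cons mult.assoc del: letter_value.simps)
  thus ?case using IH ll by simp
qed (simp add: emb_word_def inverse_word_def)

lemma word_value_eq_one_iff:
  "coeffs_below (length cs) w \<Longrightarrow> word_value G cs \<sigma> w = \<one> \<longleftrightarrow> emb_word \<sigma> w = 1"
  using word_value_closed_emb[of w] emb_inj[of "word_value G cs \<sigma> w" \<one>] by (auto simp: emb_one)

lemma equation_iff:
  assumes "coeffs_below (length cs) u" "coeffs_below (length cs) w"
  shows "word_value G cs \<sigma> (equation u w) = \<one> \<longleftrightarrow> emb_word \<sigma> u = emb_word \<sigma> w"
proof -
  have 1: "emb_word \<sigma> w * emb_word \<sigma> (inverse_word w) = 1" "emb_word \<sigma> (inverse_word w) * emb_word \<sigma> w = 1"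
    using emb_inverse_word[OF assms(2)] by auto
  have "emb_word \<sigma> u = emb_word \<sigma> w" if "emb_word \<sigma> u * emb_word \<sigma> (inverse_word w) = 1"
  proof -
    have "emb_word \<sigma> u = emb_word \<sigma> u * (emb_word \<sigma> (inverse_word w) * emb_word \<sigma> w)" using 1 by simp
    also have "\<dots> = emb_word \<sigma> w" using that by (simp add: mult.assoc[symmetric])
    finally show ?thesis .
  qed
  thus ?thesis using 1 word_value_eq_one_iff[of "equation u w"] assms
    by (auto simp: equation_def emb_word_append)
qed

end

end

subsection \<open>Searching for a solvable system\<close>

text \<open>The unknown with index \<open>prod_encode (j, 0)\<close> is a product of powers of the unknowns with indices
  \<open>prod_encode (j, 1)\<close> and \<open>prod_encode (j, 2)\<close>; only the exponents vary.\<close>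

definition power_word :: "nat \<Rightarrow> nat \<Rightarrow> nat \<Rightarrow> gword" where
  "power_word j m N = (Var (prod_encode (j, 0)), True) # replicate m (Var (prod_encode (j, 1)), False)
    @ replicate N (Var (prod_encode (j, 2)), False)"

definition power_system :: "nat \<Rightarrow> gword list \<Rightarrow> (nat \<Rightarrow> nat) \<Rightarrow> nat \<Rightarrow> gword list" where
  "power_system r S m N = map (\<lambda>j. power_word j (m j) N) [0..<r] @ S"

text \<open>Prepending one letter is a fixed computable map on codes, so a variable exponent becomes
  a number of iterations.\<close>

lemma list_encode_replicate:
  "list_encode (replicate m a @ l) = ((\<lambda>x. Suc (prod_encode (a, x))) ^^ m) (list_encode l)"
  by (induction m) auto

lemma computable_list_encode_map:
  assumes "\<And>j. j \<in> set js \<Longrightarrow> computable_fun r (\<lambda>xs. W j xs)"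
  shows "computable_fun r (\<lambda>xs. list_encode (map (\<lambda>j. W j xs) js @ l))"
  using assms
proof (induction js)
  case (Cons j js)
  have "computable_fun r (\<lambda>xs. Suc (prod_encode (W j xs, list_encode (map (\<lambda>j. W j xs) js @ l))))"
    using Cons by (intro computable_fun_Suc computable_fun_prod_encode) auto
  thus ?case by simp
qed (simp add: computable_fun_const)

lemma computable_list_encode_replicate:
  assumes "computable_fun r M" "computable_fun r (\<lambda>xs. list_encode (L xs))"
  shows "computable_fun r (\<lambda>xs. list_encode (replicate (M xs) a @ L xs))"
  unfolding list_encode_replicate
  by (intro computable_fun_iterate assms computable_fun_Suc computable_fun_prod_encode computable_fun_const
      computable_fun_proj) simp

lemma computable_power_system:
  assumes m: "\<And>j. computable_fun s (\<lambda>xs. m xs j)" and N: "computable_fun s N"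
  shows "computable_fun s (\<lambda>xs. system_code (power_system r S (m xs) (N xs)))"
proof -
  have word: "computable_fun s (\<lambda>xs. word_code (power_word j (m xs j) (N xs)))" for j
  proof -
    define a b c where "a = prod_encode (sym_code (Var (prod_encode (j, 0))), of_bool True)"
      and "b = prod_encode (sym_code (Var (prod_encode (j, 1))), of_bool False)"
      and "c = prod_encode (sym_code (Var (prod_encode (j, 2))), of_bool False)"
    have "word_code (power_word j (m xs j) (N xs))
        = Suc (prod_encode (a, list_encode (replicate (m xs j) b @ replicate (N xs) c @ [])))" for xs
      by (simp add: word_code_def power_word_def a_def b_def c_def map_replicate del: sym_code.simps)
    moreover have "computable_fun s (\<lambda>xs. Suc (prod_encode (a, list_encode (replicate (m xs j) b @ replicate (N xs) c @ []))))"
      by (intro computable_fun_Suc computable_fun_prod_encode computable_fun_const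
          computable_list_encode_replicate m N)
    ultimately show ?thesis by simp
  qed
  have "computable_fun s (\<lambda>xs. list_encode (map (\<lambda>j. word_code (power_word j (m xs j) (N xs))) [0..<r] @ map word_code S))"
    by (intro computable_list_encode_map word)
  thus ?thesis by (simp add: system_code_def power_system_def comp_def)
qed

text \<open>Solvability for every \<open>k\<close> makes the search for exponents total. The
  exponents are packed into one number by \<open>tuple_entry\<close>, and the least number accepted
  by the decision procedure is a computable function of \<open>k\<close>.\<close>

lemma computable_search:
  assumes dec: "computable f" "\<And>S. system_over cs S \<Longrightarrow> f (system_code S) = 1 \<longleftrightarrow> solvable_in G cs S"
    and over: "system_over cs S"
    and ex: "\<And>k. \<exists>m. solvable_in G cs (power_system r S m (M * p ^ k))"
  shows "\<exists>c. computable_fun 1 (\<lambda>xs. c (xs ! 0)) \<and>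
    (\<forall>k. solvable_in G cs (power_system r S (\<lambda>j. tuple_entry j (c k)) (M * p ^ k)))"
proof -
  define F where "F a k = f (system_code (power_system r S (\<lambda>j. tuple_entry j a) (M * p ^ k)))" for a k
  have over': "system_over cs (power_system r S m N)" for m N
    using over by (auto simp: system_over_iff power_system_def power_word_def)
  have F: "F a k = 1 \<longleftrightarrow> solvable_in G cs (power_system r S (\<lambda>j. tuple_entry j a) (M * p ^ k))" for a k
    unfolding F_def by (rule dec(2)[OF over'])
  have exF: "\<exists>a. F a k = 1" for k
  proof -
    obtain m where m: "solvable_in G cs (power_system r S m (M * p ^ k))" using ex by blast
    obtain a where a: "\<forall>j<r. tuple_entry j a = m j" using tuple_entry_surj by blast
    have "power_system r S (\<lambda>j. tuple_entry j a) (M * p ^ k) = power_system r S m (M * p ^ k)"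
      using a by (simp add: power_system_def)
    thus ?thesis using m F by metis
  qed
  define c where "c k = (LEAST a. F a k = 1)" for k
  have "F (c k) k = 1" for k unfolding c_def using exF by (rule LeastI_ex)
  moreover have "computable_fun 1 (\<lambda>xs. c (xs ! 0))"
  proof -
    have "computable_fun 2 (\<lambda>xs. F (xs ! 0) (xs ! 1))"
      unfolding F_def
      by (intro computable_fun_comp1[OF dec(1)[unfolded computable_iff]] computable_power_system
          computable_fun_tuple_entry computable_fun_mult computable_fun_power computable_fun_const computable_fun_proj) auto
    \<comment> \<open>With truncated subtraction this sum is zero exactly when \<open>F\<close>
      takes the value 1.\<close>
    hence "computable_fun (Suc 1) (\<lambda>xs. (F (xs ! 0) (xs ! 1) - 1) + (1 - F (xs ! 0) (xs ! 1)))"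
      by (intro computable_fun_add computable_fun_diff computable_fun_const) (simp_all add: numeral_2_eq_2)
    hence "computable_fun 1 (\<lambda>xs. LEAST a. (\<lambda>xs. (F (xs ! 0) (xs ! 1) - 1) + (1 - F (xs ! 0) (xs ! 1))) (a # xs) = 0)"
    proof (rule computable_fun_mu)
      fix xs :: "nat list"
      obtain a where "F a (xs ! 0) = 1" using exF by blast
      thus "\<exists>a. (F ((a # xs) ! 0) ((a # xs) ! 1) - 1) + (1 - F ((a # xs) ! 0) ((a # xs) ! 1)) = 0"
        by (intro exI[of _ a]) simp
    qed
    moreover have "(F a k - 1) + (1 - F a k) = 0 \<longleftrightarrow> F a k = 1" for a k by auto
    ultimately show ?thesis by (simp add: c_def)
  qed
  ultimately show ?thesis using F by blast
qed

lemma computable_int_tuple_entry: "computable_int (\<lambda>a. int (tuple_entry j a))"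
  by (intro computable_int_of_nat computable_fun_tuple_entry computable_fun_proj) simp

subsection \<open>Matrices as endomorphisms\<close>

text \<open>Linear endomorphisms of the space of all sequences form a ring with a type of its own, whereas the
  dimension of a matrix is a term.  \<open>mat_endo n\<close> extends an \<open>n\<close> by \<open>n\<close> matrix by zero, \<open>group_endo n\<close> by
  the identity.\<close>

typedef (overloaded) 'a endo =
  "{f :: (nat \<Rightarrow> 'a::comm_ring_1) \<Rightarrow> nat \<Rightarrow> 'a. (\<forall>u v. f (\<lambda>i. u i + v i) = (\<lambda>i. f u i + f v i)) \<and>
      (\<forall>c u. f (\<lambda>i. c * u i) = (\<lambda>i. c * f u i))}"
  morphisms endo_apply Abs_endo
  by (rule exI[of _ "\<lambda>u. u"]) simp

setup_lifting type_definition_endo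

instantiation endo :: (comm_ring_1) ring_1
begin

lift_definition zero_endo :: "'a endo" is "\<lambda>u i. 0" by simp
lift_definition one_endo :: "'a endo" is "\<lambda>u. u" by simp
lift_definition plus_endo :: "'a endo \<Rightarrow> 'a endo \<Rightarrow> 'a endo" is "\<lambda>f g u i. f u i + g u i"
  by (simp add: algebra_simps)
lift_definition minus_endo :: "'a endo \<Rightarrow> 'a endo \<Rightarrow> 'a endo" is "\<lambda>f g u i. f u i - g u i"
  by (simp add: algebra_simps)
lift_definition uminus_endo :: "'a endo \<Rightarrow> 'a endo" is "\<lambda>f u i. - f u i"
  by simp
lift_definition times_endo :: "'a endo \<Rightarrow> 'a endo \<Rightarrow> 'a endo" is "\<lambda>f g u. f (g u)"
  by simp

instance
proof
  fix a b c :: "'a endo"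
  show "a * b * c = a * (b * c)" by transfer simp
  show "1 * a = a" "a * 1 = a" by (transfer, simp)+
  show "a + b + c = a + (b + c)" by transfer (simp add: add.assoc)
  show "a + b = b + a" by transfer (simp add: add.commute)
  show "0 + a = a" by transfer simp
  show "- a + a = 0" by transfer simp
  show "a - b = a + - b" by transfer simp
  show "(a + b) * c = a * c + b * c" by transfer simp
  show "a * (b + c) = a * b + a * c" by transfer simp
  show "(0 :: 'a endo) \<noteq> 1" by transfer (auto simp: fun_eq_iff intro: exI[of _ "\<lambda>_. 1"])
qed

end

lift_definition scalar_endo :: "'a::comm_ring_1 \<Rightarrow> 'a endo" is "\<lambda>c u i. c * u i"
  by (auto simp: algebra_simps)

lift_definition mat_endo :: "nat \<Rightarrow> 'a::comm_ring_1 mat \<Rightarrow> 'a endo" is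
  "\<lambda>n A u i. if i < n then \<Sum>j<n. A $$ (i, j) * u j else 0"
  by (auto simp: algebra_simps sum.distrib sum_distrib_left fun_eq_iff)

definition group_endo :: "nat \<Rightarrow> 'a::comm_ring_1 mat \<Rightarrow> 'a endo" where
  "group_endo n A = mat_endo n A + (1 - mat_endo n (1\<^sub>m n))"

interpretation scalar_endo: scalar_algebra "scalar_endo :: 'f::field_char_0 \<Rightarrow> 'f endo"
proof
  fix a b :: 'f and x :: "'f endo"
  show "scalar_endo (a + b) = scalar_endo a + scalar_endo b" by transfer (auto simp: algebra_simps)
  show "scalar_endo (a * b) = scalar_endo a * scalar_endo b" by transfer (auto simp: algebra_simps)
  show "scalar_endo (1 :: 'f) = 1" by transfer simp
  show "scalar_endo a * x = x * scalar_endo a" by transfer (auto simp: fun_eq_iff)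
qed

lemma mat_mult_index:
  "A \<in> carrier_mat n n \<Longrightarrow> B \<in> carrier_mat n n \<Longrightarrow> i < n \<Longrightarrow> j < n \<Longrightarrow>
    (A * B) $$ (i, j) = (\<Sum>k<n. A $$ (i, k) * B $$ (k, j))"
  by (simp add: scalar_prod_def lessThan_atLeast0)

lemma mat_endo_mult:
  assumes "A \<in> carrier_mat n n" "B \<in> carrier_mat n n"
  shows "mat_endo n (A * B) = mat_endo n A * mat_endo n B"
  using assms
proof (transfer fixing: n)
  fix A B :: "'a mat" assume AB: "A \<in> carrier_mat n n" "B \<in> carrier_mat n n"
  have "(\<Sum>j<n. (A * B) $$ (i, j) * u j) = (\<Sum>k<n. A $$ (i, k) * (\<Sum>j<n. B $$ (k, j) * u j))" if "i < n" for i and u :: "nat \<Rightarrow> 'a"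
  proof -
    have "(\<Sum>j<n. (A * B) $$ (i, j) * u j) = (\<Sum>j<n. \<Sum>k<n. A $$ (i, k) * (B $$ (k, j) * u j))"
      using that by (intro sum.cong) (auto simp: mat_mult_index[OF AB] sum_distrib_right mult.assoc)
    also have "\<dots> = (\<Sum>k<n. \<Sum>j<n. A $$ (i, k) * (B $$ (k, j) * u j))" by (rule sum.swap)
    finally show ?thesis by (simp add: sum_distrib_left)
  qed
  thus "(\<lambda>u i. if i < n then \<Sum>j<n. (A * B) $$ (i, j) * u j else 0) =
      (\<lambda>u i. if i < n then \<Sum>j<n. A $$ (i, j) * (if j < n then \<Sum>ja<n. B $$ (j, ja) * u ja else 0) else 0)"
    by (auto simp: fun_eq_iff)
qed

lemma mat_endo_add:
  "A \<in> carrier_mat n n \<Longrightarrow> B \<in> carrier_mat n n \<Longrightarrow> mat_endo n (A + B) = mat_endo n A + mat_endo n B"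
  by transfer (auto simp: fun_eq_iff sum.distrib algebra_simps)

lemma mat_endo_diff:
  "A \<in> carrier_mat n n \<Longrightarrow> B \<in> carrier_mat n n \<Longrightarrow> mat_endo n (A - B) = mat_endo n A - mat_endo n B"
  by transfer (auto simp: fun_eq_iff sum_subtractf algebra_simps)

lemma mat_endo_smult:
  "A \<in> carrier_mat n n \<Longrightarrow> mat_endo n (c \<cdot>\<^sub>m A) = scalar_endo c * mat_endo n A"
  by transfer (auto simp: fun_eq_iff sum_distrib_left algebra_simps)

lemma mat_endo_zero: "mat_endo n (0\<^sub>m n n) = 0"
  by transfer (auto simp: fun_eq_iff)

lemma endo_apply_sum: "endo_apply (sum f A) u i = (\<Sum>a\<in>A. endo_apply (f a) u i)"
  by (induction A rule: infinite_finite_induct) (auto simp: zero_endo.rep_eq plus_endo.rep_eq)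

lemma endo_apply_scalar: "endo_apply (scalar_endo c * f) u i = c * endo_apply f u i"
  by transfer simp

definition endo_entry :: "'a::comm_ring_1 endo \<Rightarrow> nat \<times> nat \<Rightarrow> 'a" where
  "endo_entry f ij = endo_apply f (\<lambda>k. if k = snd ij then 1 else 0) (fst ij)"

lemma endo_entry_mat: "i < n \<Longrightarrow> j < n \<Longrightarrow> endo_entry (mat_endo n A) (i, j) = A $$ (i, j)"
proof -
  assume "i < n" "j < n"
  moreover have "(\<Sum>k<n. A $$ (i, k) * (if k = j then 1 else 0)) = (\<Sum>k<n. if k = j then A $$ (i, k) else 0)"
    by (rule sum.cong) auto
  ultimately show ?thesis by (simp add: endo_entry_def mat_endo.rep_eq)
qed

lemma endo_entry_sum: "endo_entry (sum f A) ij = (\<Sum>a\<in>A. endo_entry (f a) ij)"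
  by (simp add: endo_entry_def endo_apply_sum)

lemma endo_entry_add: "endo_entry (f + g) ij = endo_entry f ij + endo_entry g ij"
  by (simp add: endo_entry_def plus_endo.rep_eq)

lemma endo_entry_scalar: "endo_entry (scalar_endo c * f) ij = c * endo_entry f ij"
  by (simp add: endo_entry_def endo_apply_scalar)

lemma endo_entry_0: "endo_entry 0 ij = 0"
  by (simp add: endo_entry_def zero_endo.rep_eq)

lemma mat_endo_inject:
  "A \<in> carrier_mat n n \<Longrightarrow> B \<in> carrier_mat n n \<Longrightarrow> mat_endo n A = mat_endo n B \<Longrightarrow> A = B"
  by (intro eq_matI) (auto simp: endo_entry_mat[symmetric])

lemma mat_endo_sum_mat:
  assumes "\<And>k. k \<in> K \<Longrightarrow> M k \<in> carrier_mat n n"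
  shows "mat_endo n (mat n n (\<lambda>ij. \<Sum>k\<in>K. c k * M k $$ ij)) = (\<Sum>k\<in>K. scalar_endo (c k) * mat_endo n (M k))"
proof -
  have "endo_apply (mat_endo n (mat n n (\<lambda>ij. \<Sum>k\<in>K. c k * M k $$ ij))) u i
      = endo_apply (\<Sum>k\<in>K. scalar_endo (c k) * mat_endo n (M k)) u i" for u i
  proof (cases "i < n")
    case True
    have "(\<Sum>j<n. (\<Sum>k\<in>K. c k * M k $$ (i, j)) * u j) = (\<Sum>k\<in>K. c k * (\<Sum>j<n. M k $$ (i, j) * u j))"
      by (simp add: sum_distrib_left sum_distrib_right mult.assoc) (rule sum.swap)
    thus ?thesis using True by (simp add: endo_apply_sum endo_apply_scalar mat_endo.rep_eq)
  qed (simp add: endo_apply_sum endo_apply_scalar mat_endo.rep_eq)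
  thus ?thesis by (intro endo_apply_inject[THEN iffD1] ext)
qed

lemma group_endo_mult:
  assumes "A \<in> carrier_mat n n" "B \<in> carrier_mat n n"
  shows "group_endo n (A * B) = group_endo n A * group_endo n B"
    "group_endo n A * mat_endo n B = mat_endo n (A * B)"
    "mat_endo n B * group_endo n A = mat_endo n (B * A)"
proof -
  have I: "1\<^sub>m n \<in> carrier_mat n n" by simp
  have "mat_endo n (1\<^sub>m n) * mat_endo n B = mat_endo n B" "mat_endo n A * mat_endo n (1\<^sub>m n) = mat_endo n A"
    "mat_endo n (1\<^sub>m n) * (mat_endo n (1\<^sub>m n) :: 'a endo) = mat_endo n (1\<^sub>m n)"
    "mat_endo n B * mat_endo n (1\<^sub>m n) = mat_endo n B"
    using assms by (simp_all flip: mat_endo_mult[OF I] mat_endo_mult[OF _ I])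
  thus "group_endo n (A * B) = group_endo n A * group_endo n B"
    "group_endo n A * mat_endo n B = mat_endo n (A * B)"
    "mat_endo n B * group_endo n A = mat_endo n (B * A)"
    using assms by (simp_all add: group_endo_def mat_endo_mult algebra_simps)
qed

lemma group_endo_one: "group_endo n (1\<^sub>m n) = 1"
  by (simp add: group_endo_def)

lemma group_endo_inject:
  "A \<in> carrier_mat n n \<Longrightarrow> B \<in> carrier_mat n n \<Longrightarrow> group_endo n A = group_endo n B \<Longrightarrow> A = B"
  by (rule mat_endo_inject) (simp_all add: group_endo_def)

subsection \<open>Nilpotent complex matrices\<close>

text \<open>Each factor moves the support one diagonal further up.\<close>

lemma strict_upper_power:
  assumes T: "T \<in> carrier_mat n n" and s: "\<And>i j. i < n \<Longrightarrow> j \<le> i \<Longrightarrow> T $$ (i, j) = 0"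
  shows "i < n \<Longrightarrow> j < n \<Longrightarrow> j < i + k \<Longrightarrow> (T ^\<^sub>m k) $$ (i, j) = 0"
proof (induction k arbitrary: j)
  case (Suc k)
  have "(T ^\<^sub>m k) $$ (i, l) * T $$ (l, j) = 0" if "l < n" for l
    using Suc.IH[of l] Suc.prems s[of l j] that by (cases "l < i + k") auto
  thus ?case using Suc.prems mat_mult_index[OF pow_carrier_mat[OF T] T, of i j k] by simp
qed (use T in simp)

lemma upper_triangular_power:
  assumes T: "T \<in> carrier_mat n n" and ut: "upper_triangular T"
  shows "upper_triangular (T ^\<^sub>m k) \<and> (\<forall>i<n. (T ^\<^sub>m k) $$ (i, i) = T $$ (i, i) ^ k)"
proof (induction k)
  case (Suc k)
  have P: "T ^\<^sub>m k \<in> carrier_mat n n" using T by (rule pow_carrier_mat)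
  have z: "T $$ (i, j) = 0" "(T ^\<^sub>m k) $$ (i, j) = 0" if "j < i" "i < n" for i j
    using that ut Suc T P by auto
  have "(T ^\<^sub>m Suc k) $$ (i, j) = 0" if ij: "j < i" "i < n" for i j
  proof -
    have "(T ^\<^sub>m k) $$ (i, l) * T $$ (l, j) = 0" if "l < n" for l
      using z(2)[of l i] z(1)[of j l] ij that by (cases "l < i") auto
    thus ?thesis using ij mat_mult_index[OF P T, of i j] by simp
  qed
  moreover have "(T ^\<^sub>m Suc k) $$ (i, i) = T $$ (i, i) ^ Suc k" if i: "i < n" for i
  proof -
    have "(T ^\<^sub>m k) $$ (i, l) * T $$ (l, i) = (if l = i then (T ^\<^sub>m k) $$ (i, l) * T $$ (l, i) else 0)" if "l < n" for l
      using z(2)[of l i] z(1)[of i l] i that by (cases "l < i") auto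
    hence "(T ^\<^sub>m Suc k) $$ (i, i) = (\<Sum>l<n. if l = i then (T ^\<^sub>m k) $$ (i, l) * T $$ (l, i) else 0)"
      using i mat_mult_index[OF P T, of i i] by simp
    thus ?thesis using i Suc by (simp add: power_commutes)
  qed
  ultimately show ?case using T by (auto intro!: upper_triangularI)
qed (use T in simp)

text \<open>Over the complex numbers there is a triangular form; its diagonal entries are nilpotent
  numbers, hence zero.\<close>

lemma nilpotent_triangular:
  fixes A :: "complex mat"
  assumes A: "A \<in> carrier_mat n n" and nil: "A ^\<^sub>m K = 0\<^sub>m n n"
  shows "\<exists>P Q T. similar_mat_wit A T P Q \<and> T \<in> carrier_mat n n \<and> (\<forall>i<n. \<forall>j\<le>i. T $$ (i, j) = 0)"
proof -
  obtain es where "char_poly A = (\<Prod>a\<leftarrow>es. [:- a, 1:])" using char_poly_factorized[OF A] by blast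
  then obtain T where T: "T \<in> carrier_mat n n" "upper_triangular T" "similar_mat A T"
    using schur_decomposition_exists[OF A] by blast
  then obtain P Q where wit: "similar_mat_wit A T P Q" by (auto simp: similar_mat_def)
  hence "similar_mat_wit T A Q P" by (rule similar_mat_wit_sym)
  from similar_mat_wit_pow_id[OF this] have TK: "T ^\<^sub>m K = Q * A ^\<^sub>m K * P" .
  have PQ: "P \<in> carrier_mat n n" "Q \<in> carrier_mat n n" using similar_mat_witD2[OF A wit] by auto
  have "T ^\<^sub>m K = 0\<^sub>m n n" unfolding TK nil using PQ by simp
  hence diag: "T $$ (i, i) ^ K = 0" if "i < n" for i
    using upper_triangular_power[OF T(1,2), of K] that by auto
  have "T $$ (i, j) = 0" if "i < n" "j \<le> i" for i j
    using that diag[of i] T by (cases "j = i") (auto simp: le_less)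
  thus ?thesis using wit T(1) by blast
qed

text \<open>\<open>root_unipotent\<close> stops the exponential series at the dimension; this bound
  on the nilpotency index makes that truncation exact.\<close>

lemma nilpotent_power_dim:
  fixes A :: "complex mat"
  assumes A: "A \<in> carrier_mat n n" and nil: "A ^\<^sub>m K = 0\<^sub>m n n"
  shows "A ^\<^sub>m n = 0\<^sub>m n n"
proof -
  obtain P Q T where wit: "similar_mat_wit A T P Q" and T: "T \<in> carrier_mat n n"
    and s0: "\<forall>i<n. \<forall>j\<le>i. T $$ (i, j) = 0" using nilpotent_triangular[OF A nil] by blast
  have su: "(T ^\<^sub>m k) $$ (i, j) = 0" if "i < n" "j < n" "j < i + k" for i j k
    by (rule strict_upper_power[OF T _ that]) (use s0 in blast)
  have "T ^\<^sub>m n = 0\<^sub>m n n"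
    by (rule eq_matI) (use su pow_carrier_mat[OF T, of n] in auto)
  thus ?thesis using similar_mat_wit_pow_id[OF wit, of n] similar_mat_witD2[OF A wit] by auto
qed

text \<open>In triangular form all terms except the one with \<open>k = 0\<close> are strictly upper
  triangular, so the diagonal is 1. This places the complex root elements in \<open>SL n\<close>,
  which is needed to speak of the subgroup that they generate.\<close>

lemma det_exponential:
  fixes A :: "complex mat"
  assumes A: "A \<in> carrier_mat n n" and nil: "A ^\<^sub>m K = 0\<^sub>m n n" and c: "c 0 = 1"
  shows "det (mat n n (\<lambda>ij. \<Sum>k<n. c k * (A ^\<^sub>m k) $$ ij)) = 1"
proof -
  obtain P Q T where wit: "similar_mat_wit A T P Q" and T: "T \<in> carrier_mat n n"
    and s0: "\<forall>i<n. \<forall>j\<le>i. T $$ (i, j) = 0" using nilpotent_triangular[OF A nil] by blast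
  have su: "(T ^\<^sub>m k) $$ (i, j) = 0" if "i < n" "j < n" "j < i + k" for i j k
    by (rule strict_upper_power[OF T _ that]) (use s0 in blast)
  note w = similar_mat_witD2[OF A wit]
  have Tk: "T ^\<^sub>m k \<in> carrier_mat n n" for k using T by (rule pow_carrier_mat)
  define S where "S = mat n n (\<lambda>ij. \<Sum>k<n. c k * (T ^\<^sub>m k) $$ ij)"
  have S: "S \<in> carrier_mat n n" by (simp add: S_def)
  have trip: "(P * B * Q) $$ (i, j) = (\<Sum>b<n. \<Sum>a<n. P $$ (i, a) * B $$ (a, b) * Q $$ (b, j))"
    if "B \<in> carrier_mat n n" "i < n" "j < n" for B i j
  proof -
    have PB: "P * B \<in> carrier_mat n n" using that w by simp
    have "(P * B * Q) $$ (i, j) = (\<Sum>b<n. (P * B) $$ (i, b) * Q $$ (b, j))"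
      by (rule mat_mult_index[OF PB]) (use that w in auto)
    also have "\<dots> = (\<Sum>b<n. (\<Sum>a<n. P $$ (i, a) * B $$ (a, b)) * Q $$ (b, j))"
      using that w by (intro sum.cong refl arg_cong2[where f = "(*)"] mat_mult_index) auto
    finally show ?thesis by (simp add: sum_distrib_right)
  qed
  have "mat n n (\<lambda>ij. \<Sum>k<n. c k * (A ^\<^sub>m k) $$ ij) = P * S * Q"
  proof (rule eq_matI)
    fix i j assume "i < dim_row (P * S * Q)" "j < dim_col (P * S * Q)"
    hence ij: "i < n" "j < n" using w by auto
    have "(\<Sum>k<n. c k * (A ^\<^sub>m k) $$ (i, j)) = (\<Sum>k<n. \<Sum>b<n. \<Sum>a<n. c k * (P $$ (i, a) * (T ^\<^sub>m k) $$ (a, b) * Q $$ (b, j)))"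
      using ij by (simp add: similar_mat_wit_pow_id[OF wit] trip[OF Tk] sum_distrib_left del: index_mult_mat)
    also have "\<dots> = (\<Sum>b<n. \<Sum>k<n. \<Sum>a<n. c k * (P $$ (i, a) * (T ^\<^sub>m k) $$ (a, b) * Q $$ (b, j)))" by (rule sum.swap)
    also have "\<dots> = (\<Sum>b<n. \<Sum>a<n. \<Sum>k<n. c k * (P $$ (i, a) * (T ^\<^sub>m k) $$ (a, b) * Q $$ (b, j)))"
      by (rule sum.cong[OF refl]) (rule sum.swap)
    also have "\<dots> = (\<Sum>b<n. \<Sum>a<n. P $$ (i, a) * S $$ (a, b) * Q $$ (b, j))"
      by (intro sum.cong refl) (simp add: S_def sum_distrib_left sum_distrib_right ac_simps)
    also have "\<dots> = (P * S * Q) $$ (i, j)" by (rule trip[OF S ij, symmetric])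
    finally show "mat n n (\<lambda>ij. \<Sum>k<n. c k * (A ^\<^sub>m k) $$ ij) $$ (i, j) = (P * S * Q) $$ (i, j)"
      using ij by simp
  qed (use w in auto)
  hence "similar_mat (mat n n (\<lambda>ij. \<Sum>k<n. c k * (A ^\<^sub>m k) $$ ij)) S"
    using w S by (intro similar_matI[of _ _ P Q n]) auto
  hence "det (mat n n (\<lambda>ij. \<Sum>k<n. c k * (A ^\<^sub>m k) $$ ij)) = det S" by (rule det_similar)
  also have "\<dots> = prod_list (diag_mat S)"
  proof (rule det_upper_triangular[OF _ S], rule upper_triangularI)
    fix i j assume "j < i" "i < dim_row S"
    thus "S $$ (i, j) = 0" using su[of i j] by (simp add: S_def)
  qed
  also have "diag_mat S = map (\<lambda>i. 1) [0..<n]"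
  proof -
    have "S $$ (i, i) = 1" if i: "i < n" for i
    proof -
      have "S $$ (i, i) = (\<Sum>k<n. c k * (T ^\<^sub>m k) $$ (i, i))" using i by (simp add: S_def)
      also have "\<dots> = (\<Sum>k<n. if k = 0 then 1 else 0)"
        using i T c su[of i i] by (intro sum.cong) auto
      finally have "S $$ (i, i) = (\<Sum>k<n. if k = 0 then 1 else 0)" .
      thus ?thesis using i by simp
    qed
    thus ?thesis by (simp add: diag_mat_def S_def)
  qed
  also have "prod_list \<dots> = 1" by (induction n) auto
  finally show ?thesis .
qed

text \<open>\<open>A\<^sup>k / k!\<close> tends to zero, so it vanishes as soon as its integral entries are less than one.\<close>

lemma nilpotent_if_integral_divided_powers:
  assumes A: "A \<in> carrier_mat n n"
    and int: "\<And>k i j. i < n \<Longrightarrow> j < n \<Longrightarrow> divided_power A k $$ (i, j) \<in> \<int>"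
  shows "\<exists>K. A ^\<^sub>m K = 0\<^sub>m n n"
proof -
  define B where "B = (\<Sum>i<n. \<Sum>j<n. norm (A $$ (i, j)))"
  have entry: "norm (A $$ (i, j)) \<le> B" if "i < n" "j < n" for i j
  proof -
    have "norm (A $$ (i, j)) \<le> (\<Sum>j<n. norm (A $$ (i, j)))"
      using that by (intro member_le_sum) auto
    also have "\<dots> \<le> B" unfolding B_def using that by (intro member_le_sum) (auto intro: sum_nonneg)
    finally show ?thesis .
  qed
  have B0: "B \<ge> 0" unfolding B_def by (intro sum_nonneg) auto
  have bound: "norm ((A ^\<^sub>m k) $$ (i, j)) \<le> (real n * B) ^ k" if "i < n" "j < n" for i j k
    using that
  proof (induction k arbitrary: j)
    case (Suc k)
    have "norm ((A ^\<^sub>m Suc k) $$ (i, j)) \<le> (\<Sum>l<n. norm ((A ^\<^sub>m k) $$ (i, l) * A $$ (l, j)))"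
      using Suc.prems mat_mult_index[OF pow_carrier_mat[OF A] A, of i j k] by (simp add: sum_norm_le)
    also have "\<dots> \<le> (\<Sum>l<n. (real n * B) ^ k * B)"
      using Suc entry B0 by (intro sum_mono) (auto simp: norm_mult intro!: mult_mono)
    finally show ?case by (simp add: algebra_simps)
  qed (use A in auto)
  have "(\<lambda>k. (real n * B) ^ k / fact k) \<longlonglongrightarrow> 0"
    using summable_LIMSEQ_zero[OF summable_exp[of "real n * B"]] by (simp add: divide_inverse mult.commute)
  hence "\<forall>\<^sub>F k in sequentially. (real n * B) ^ k / fact k < 1" by (rule order_tendstoD(2)) simp
  then obtain K where K: "(real n * B) ^ K / fact K < 1" unfolding eventually_sequentially by blast
  have "(A ^\<^sub>m K) $$ (i, j) = 0" if ij: "i < n" "j < n" for i j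
  proof -
    have Kc: "A ^\<^sub>m K \<in> carrier_mat n n" using A by (rule pow_carrier_mat)
    have e: "divided_power A K $$ (i, j) = (A ^\<^sub>m K) $$ (i, j) / fact K"
      using ij by (simp add: divided_power_def carrier_matD[OF A])
    have "norm ((A ^\<^sub>m K) $$ (i, j) / fact K) \<le> (real n * B) ^ K / fact K"
      using bound[OF ij, of K] by (simp add: norm_divide divide_right_mono)
    hence "norm (divided_power A K $$ (i, j)) < 1" unfolding e using K by (rule le_less_trans)
    moreover obtain z where z: "divided_power A K $$ (i, j) = of_int z" using int[OF ij] by (auto elim: Ints_cases)
    ultimately have "z = 0" by simp
    thus ?thesis using e z by simp
  qed
  thus ?thesis using A by (intro exI[of _ K] eq_matI) auto
qed

subsection \<open>Integral polynomial functions of the matrix entries\<close>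

definition monomial_value :: "((nat \<times> nat) \<Rightarrow>\<^sub>0 nat) \<Rightarrow> 'a::comm_ring_1 mat \<Rightarrow> 'a" where
  "monomial_value m A = (\<Prod>ij\<in>Poly_Mapping.keys m. (A $$ ij) ^ Poly_Mapping.lookup m ij)"

lemma monomial_value_superset:
  "finite T \<Longrightarrow> Poly_Mapping.keys m \<subseteq> T \<Longrightarrow> monomial_value m A = (\<Prod>ij\<in>T. (A $$ ij) ^ Poly_Mapping.lookup m ij)"
  unfolding monomial_value_def by (rule prod.mono_neutral_left) (auto simp: in_keys_iff)

lemma monomial_value_add: "monomial_value (m + m') A = monomial_value m A * monomial_value m' A"
proof -
  let ?T = "Poly_Mapping.keys m \<union> Poly_Mapping.keys m'"
  have "monomial_value (m + m') A = (\<Prod>ij\<in>?T. (A $$ ij) ^ Poly_Mapping.lookup (m + m') ij)"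
    by (rule monomial_value_superset) (use keys_add[of m m'] in auto)
  also have "\<dots> = (\<Prod>ij\<in>?T. (A $$ ij) ^ Poly_Mapping.lookup m ij) * (\<Prod>ij\<in>?T. (A $$ ij) ^ Poly_Mapping.lookup m' ij)"
    by (simp add: lookup_add power_add prod.distrib)
  also have "\<dots> = monomial_value m A * monomial_value m' A"
    by (subst (1 2) monomial_value_superset[of ?T]) auto
  finally show ?thesis .
qed

lemma eval_superset:
  "finite T \<Longrightarrow> Poly_Mapping.keys f \<subseteq> T \<Longrightarrow>
    eval_entry_poly f A = (\<Sum>m\<in>T. of_int (Poly_Mapping.lookup f m) * monomial_value m A)"
  unfolding eval_entry_poly_def monomial_value_def[symmetric]
  by (rule sum.mono_neutral_left) (auto simp: in_keys_iff)

lemma eval_add: "eval_entry_poly (f + g) A = eval_entry_poly f A + eval_entry_poly g A"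
proof -
  let ?T = "Poly_Mapping.keys f \<union> Poly_Mapping.keys g"
  have "eval_entry_poly (f + g) A = (\<Sum>m\<in>?T. of_int (Poly_Mapping.lookup (f + g) m) * monomial_value m A)"
    by (rule eval_superset) (use keys_add[of f g] in auto)
  also have "\<dots> = (\<Sum>m\<in>?T. of_int (Poly_Mapping.lookup f m) * monomial_value m A)
      + (\<Sum>m\<in>?T. of_int (Poly_Mapping.lookup g m) * monomial_value m A)"
    by (simp add: lookup_add distrib_right sum.distrib)
  also have "\<dots> = eval_entry_poly f A + eval_entry_poly g A"
    by (subst (1 2) eval_superset[of ?T]) auto
  finally show ?thesis .
qed

lemma eval_single: "eval_entry_poly (Poly_Mapping.single m c) A = of_int c * monomial_value m A"
  by (subst eval_superset[of "{m}"]) (auto simp: keys_def lookup_single when_def)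

lemma eval_zero: "eval_entry_poly 0 A = 0"
  by (simp add: eval_entry_poly_def)

lemma poly_mapping_single_induct:
  assumes "P 0" "\<And>f m c. P f \<Longrightarrow> P (f + Poly_Mapping.single m c)"
  shows "P (f :: 'a \<Rightarrow>\<^sub>0 'b::comm_monoid_add)"
proof (induction f rule: update_induct)
  case (update f a b)
  have "Poly_Mapping.update a b f = f + Poly_Mapping.single a b"
    using update by (intro poly_mapping_eqI)
      (auto simp: lookup_update lookup_add lookup_single when_def in_keys_iff)
  thus ?case using assms(2) update by simp
qed (rule assms(1))

lemma eval_mult: "eval_entry_poly (f * g) A = eval_entry_poly f A * eval_entry_poly g A"
proof (induction f rule: poly_mapping_single_induct)
  case (2 f m c)
  have "eval_entry_poly (Poly_Mapping.single m c * g) A = of_int c * monomial_value m A * eval_entry_poly g A"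
    by (induction g rule: poly_mapping_single_induct)
      (simp_all add: eval_zero distrib_left eval_add mult_single eval_single monomial_value_add ac_simps)
  thus ?case by (simp add: distrib_right eval_add eval_single 2)
qed (simp add: eval_zero)

text \<open>One integral polynomial in the entries represents a function over the complex numbers
  and its counterpart over another ring. Building the two together lets an identity on the complex
  group be read off for the points over that ring.\<close>

definition poly_pair :: "nat \<Rightarrow> (complex mat \<Rightarrow> complex) \<Rightarrow> ('a::comm_ring_1 mat \<Rightarrow> 'a) \<Rightarrow> bool" where
  "poly_pair n F G \<longleftrightarrow> (\<exists>f\<in>entry_polys n. (\<forall>A\<in>carrier_mat n n. eval_entry_poly f A = F A) \<and>
    (\<forall>A\<in>carrier_mat n n. eval_entry_poly f A = G A))"

lemma poly_pair_const: "poly_pair n (\<lambda>_. of_int c) (\<lambda>_. of_int c)"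
  unfolding poly_pair_def
  by (rule bexI[of _ "Poly_Mapping.single 0 c"]) (auto simp: eval_single monomial_value_def entry_polys_def)

lemma poly_pair_entry:
  assumes "i < n" "j < n" shows "poly_pair n (\<lambda>A. A $$ (i, j)) (\<lambda>A. A $$ (i, j))"
  unfolding poly_pair_def
  by (rule bexI[of _ "Poly_Mapping.single (Poly_Mapping.single (i, j) 1) 1"])
    (use assms in \<open>auto simp: eval_single monomial_value_def entry_polys_def\<close>)

lemma poly_pair_add: "poly_pair n F G \<Longrightarrow> poly_pair n F' G' \<Longrightarrow> poly_pair n (\<lambda>A. F A + F' A) (\<lambda>A. G A + G' A)"
proof -
  assume "poly_pair n F G" "poly_pair n F' G'"
  then obtain f f' where f: "f \<in> entry_polys n" "f' \<in> entry_polys n"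
    "\<forall>A\<in>carrier_mat n n. eval_entry_poly f A = F A" "\<forall>A\<in>carrier_mat n n. eval_entry_poly f A = G A"
    "\<forall>A\<in>carrier_mat n n. eval_entry_poly f' A = F' A" "\<forall>A\<in>carrier_mat n n. eval_entry_poly f' A = G' A"
    by (auto simp: poly_pair_def)
  have "f + f' \<in> entry_polys n" using f(1,2) keys_add[of f f'] by (auto simp: entry_polys_def)
  thus ?thesis unfolding poly_pair_def by (rule bexI[rotated]) (use f in \<open>auto simp: eval_add\<close>)
qed

lemma poly_pair_mult: "poly_pair n F G \<Longrightarrow> poly_pair n F' G' \<Longrightarrow> poly_pair n (\<lambda>A. F A * F' A) (\<lambda>A. G A * G' A)"
proof -
  assume "poly_pair n F G" "poly_pair n F' G'"
  then obtain f f' where f: "f \<in> entry_polys n" "f' \<in> entry_polys n"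
    "\<forall>A\<in>carrier_mat n n. eval_entry_poly f A = F A" "\<forall>A\<in>carrier_mat n n. eval_entry_poly f A = G A"
    "\<forall>A\<in>carrier_mat n n. eval_entry_poly f' A = F' A" "\<forall>A\<in>carrier_mat n n. eval_entry_poly f' A = G' A"
    by (auto simp: poly_pair_def)
  have "f * f' \<in> entry_polys n" unfolding entry_polys_def
  proof (intro CollectI ballI)
    fix m assume "m \<in> Poly_Mapping.keys (f * f')"
    then obtain a b where "m = a + b" "a \<in> Poly_Mapping.keys f" "b \<in> Poly_Mapping.keys f'"
      using keys_mult[of f f'] by blast
    thus "Poly_Mapping.keys m \<subseteq> {..<n} \<times> {..<n}"
      using f(1,2) keys_add[of a b] unfolding entry_polys_def by blast
  qed
  thus ?thesis unfolding poly_pair_def by (rule bexI[rotated]) (use f in \<open>auto simp: eval_mult\<close>)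
qed

lemma poly_pair_sum:
  "(\<And>i. i \<in> I \<Longrightarrow> poly_pair n (F i) (G i)) \<Longrightarrow> poly_pair n (\<lambda>A. \<Sum>i\<in>I. F i A) (\<lambda>A. \<Sum>i\<in>I. G i A)"
proof (induction I rule: infinite_finite_induct)
  case (insert i I)
  hence "poly_pair n (\<lambda>A. F i A + (\<Sum>i\<in>I. F i A)) (\<lambda>A. G i A + (\<Sum>i\<in>I. G i A))"
    by (intro poly_pair_add) auto
  thus ?case using insert.hyps by simp
qed (use poly_pair_const[of n 0] in auto)

lemma poly_pair_prod:
  "(\<And>i. i \<in> I \<Longrightarrow> poly_pair n (F i) (G i)) \<Longrightarrow> poly_pair n (\<lambda>A. \<Prod>i\<in>I. F i A) (\<lambda>A. \<Prod>i\<in>I. G i A)"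
proof (induction I rule: infinite_finite_induct)
  case (insert i I)
  hence "poly_pair n (\<lambda>A. F i A * (\<Prod>i\<in>I. F i A)) (\<lambda>A. G i A * (\<Prod>i\<in>I. G i A))"
    by (intro poly_pair_mult) auto
  thus ?case using insert.hyps by simp
qed (use poly_pair_const[of n 1] in auto)

lemma poly_pair_power: "poly_pair n F G \<Longrightarrow> poly_pair n (\<lambda>A. F A ^ k) (\<lambda>A. G A ^ k)"
  using poly_pair_prod[of "{..<k}" n "\<lambda>_. F" "\<lambda>_. G"] by simp

lemma poly_pair_cong:
  assumes "poly_pair n F G" "\<And>A. A \<in> carrier_mat n n \<Longrightarrow> F A = F' A" "\<And>A. A \<in> carrier_mat n n \<Longrightarrow> G A = G' A"
  shows "poly_pair n F' G'"
  using assms unfolding poly_pair_def by auto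

definition mat_pair :: "nat \<Rightarrow> nat \<Rightarrow> (complex mat \<Rightarrow> complex mat) \<Rightarrow> ('a::comm_ring_1 mat \<Rightarrow> 'a mat) \<Rightarrow> bool" where
  "mat_pair n d F G \<longleftrightarrow> (\<forall>A\<in>carrier_mat n n. F A \<in> carrier_mat d d) \<and> (\<forall>A\<in>carrier_mat n n. G A \<in> carrier_mat d d) \<and>
    (\<forall>i<d. \<forall>j<d. poly_pair n (\<lambda>A. F A $$ (i, j)) (\<lambda>A. G A $$ (i, j)))"

lemma mat_pair_id: "mat_pair n n (\<lambda>A. A) (\<lambda>A. A)"
  by (auto simp: mat_pair_def poly_pair_entry)

lemma mat_pair_of_int: "M \<in> carrier_mat d d \<Longrightarrow> mat_pair n d (\<lambda>_. map_mat of_int M) (\<lambda>_. map_mat of_int M)"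
  by (auto simp: mat_pair_def poly_pair_const)

lemma mat_pair_mult:
  assumes "mat_pair n d F G" "mat_pair n d F' G'" shows "mat_pair n d (\<lambda>A. F A * F' A) (\<lambda>A. G A * G' A)"
  unfolding mat_pair_def
proof (intro conjI allI impI ballI)
  fix i j assume ij: "i < d" "j < d"
  have "poly_pair n (\<lambda>A. \<Sum>k<d. F A $$ (i, k) * F' A $$ (k, j)) (\<lambda>A. \<Sum>k<d. G A $$ (i, k) * G' A $$ (k, j))"
    using assms ij by (intro poly_pair_sum poly_pair_mult) (auto simp: mat_pair_def)
  thus "poly_pair n (\<lambda>A. (F A * F' A) $$ (i, j)) (\<lambda>A. (G A * G' A) $$ (i, j))"
    by (rule poly_pair_cong; subst mat_mult_index[of _ d]) (use assms ij in \<open>auto simp: mat_pair_def\<close>)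
qed (use assms in \<open>auto simp: mat_pair_def\<close>)

lemma mat_pair_det:
  assumes "mat_pair n d F G" shows "poly_pair n (\<lambda>A. det (F A)) (\<lambda>A. det (G A))"
proof -
  have "poly_pair n (\<lambda>A. \<Sum>p | p permutes {0..<d}. of_int (sign p) * (\<Prod>i = 0..<d. F A $$ (i, p i)))
    (\<lambda>A. \<Sum>p | p permutes {0..<d}. of_int (sign p) * (\<Prod>i = 0..<d. G A $$ (i, p i)))"
    using assms by (intro poly_pair_sum poly_pair_mult poly_pair_prod poly_pair_const)
      (auto simp: mat_pair_def permutes_in_image)
  thus ?thesis by (rule poly_pair_cong) (use assms in \<open>auto simp: mat_pair_def det_def'\<close>)
qed

text \<open>On \<open>SL n\<close> the adjugate is the inverse and, being polynomial in the entries
  over every ring, fits the transfer; this is why group inverses are rewritten as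
  \<open>adj_mat\<close>.\<close>

lemma mat_pair_adj: "mat_pair n n adj_mat adj_mat"
  unfolding mat_pair_def
proof (intro conjI allI impI ballI)
  fix i j assume ij: "i < n" "j < n"
  have "mat_pair n (n - 1) (\<lambda>A. mat_delete A j i) (\<lambda>A. mat_delete A j i)"
    unfolding mat_pair_def
  proof (intro conjI allI impI ballI)
    fix k l assume kl: "k < n - 1" "l < n - 1"
    have "poly_pair n (\<lambda>A. A $$ (if k < j then k else Suc k, if l < i then l else Suc l))
      (\<lambda>A. A $$ (if k < j then k else Suc k, if l < i then l else Suc l))"
      using kl by (intro poly_pair_entry) auto
    thus "poly_pair n (\<lambda>A. mat_delete A j i $$ (k, l)) (\<lambda>A. mat_delete A j i $$ (k, l))"
      by (rule poly_pair_cong) (use kl in \<open>auto simp: mat_delete_def\<close>)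
  qed (auto simp: mat_delete_def)
  hence "poly_pair n (\<lambda>A. of_int ((- 1) ^ (j + i)) * det (mat_delete A j i)) (\<lambda>A. of_int ((- 1) ^ (j + i)) * det (mat_delete A j i))"
    by (intro poly_pair_mult poly_pair_const mat_pair_det)
  thus "poly_pair n (\<lambda>A. adj_mat A $$ (i, j)) (\<lambda>A. adj_mat A $$ (i, j))"
    by (rule poly_pair_cong) (use ij in \<open>auto simp: adj_mat_def cofactor_def\<close>)
qed (auto simp: adj_mat(1))

lemma mat_pair_eval:
  assumes "f \<in> entry_polys n" "mat_pair n n F G"
  shows "poly_pair n (\<lambda>A. eval_entry_poly f (F A)) (\<lambda>A. eval_entry_poly f (G A))"
  unfolding eval_entry_poly_def
proof (intro poly_pair_sum poly_pair_mult poly_pair_prod poly_pair_power poly_pair_const)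
  fix m ij assume "m \<in> Poly_Mapping.keys f" "ij \<in> Poly_Mapping.keys m"
  hence "ij \<in> {..<n} \<times> {..<n}" using assms(1) unfolding entry_polys_def by blast
  then obtain i j where "ij = (i, j)" "i < n" "j < n" by auto
  thus "poly_pair n (\<lambda>A. F A $$ ij) (\<lambda>A. G A $$ ij)" using assms(2) by (simp add: mat_pair_def)
qed

subsection \<open>Special linear and Chevalley groups\<close>

lemma SL_simps [simp]:
  "carrier (SL n) = {A \<in> carrier_mat n n. det A = 1}" "monoid.mult (SL n) = (*)" "one (SL n) = 1\<^sub>m n"
  by (simp_all add: SL_def)

lemma adj_mat_inverse:
  assumes "A \<in> carrier_mat n n" "det A = (1 :: 'a::comm_ring_1)"
  shows "A * adj_mat A = 1\<^sub>m n" "adj_mat A * A = 1\<^sub>m n" "det (adj_mat A) = 1"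
proof -
  show 1: "A * adj_mat A = 1\<^sub>m n" "adj_mat A * A = 1\<^sub>m n" using adj_mat[OF assms(1)] assms(2) by auto
  show "det (adj_mat A) = 1"
    using det_mult[OF assms(1) adj_mat(1)[OF assms(1)]] assms(2) by (simp add: 1)
qed

lemma SL_group: "group (SL n :: 'a::comm_ring_1 mat monoid)"
proof (rule groupI)
  fix A :: "'a mat" assume "A \<in> carrier (SL n)"
  thus "\<exists>B\<in>carrier (SL n). B \<otimes>\<^bsub>SL n\<^esub> A = \<one>\<^bsub>SL n\<^esub>"
    using adj_mat_inverse[of A n] adj_mat(1)[of A n] by (intro bexI[of _ "adj_mat A"]) auto
qed (auto simp: det_mult)

lemma SL_inverse: "A \<in> carrier (SL n) \<Longrightarrow> inv\<^bsub>SL n\<^esub> A = adj_mat A"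
  using adj_mat_inverse[of A n] adj_mat(1)[of A n] by (intro group.inv_equality[OF SL_group]) auto

lemma inverse_unique_mat:
  fixes A :: "'a::comm_ring_1 mat"
  assumes "A \<in> carrier_mat n n" "B \<in> carrier_mat n n" "C \<in> carrier_mat n n" "A * B = 1\<^sub>m n" "C * A = 1\<^sub>m n"
  shows "B = C"
proof -
  have "B = (C * A) * B" using assms by simp
  also have "\<dots> = C * (A * B)" using assms by (intro assoc_mult_mat[of _ n n _ n _ n]) auto
  finally show ?thesis using assms by simp
qed

subsection \<open>The integral form of a Chevalley representation\<close>

definition mat_commutator :: "'a::comm_ring_1 mat \<Rightarrow> 'a mat \<Rightarrow> 'a mat" where
  "mat_commutator A B = A * B - B * A"

lemma mat_commutator_carrier [simp]:
  "A \<in> carrier_mat n n \<Longrightarrow> B \<in> carrier_mat n n \<Longrightarrow> mat_commutator A B \<in> carrier_mat n n"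
  unfolding mat_commutator_def by (intro minus_carrier_mat mult_carrier_mat)

lemma of_int_mat_mult:
  "A \<in> carrier_mat n n \<Longrightarrow> B \<in> carrier_mat n n \<Longrightarrow> map_mat of_int (A * B) = map_mat of_int A * map_mat of_int B"
  by (rule of_int_hom.mat_hom_mult)

lemma of_int_mat_pow: "A \<in> carrier_mat n n \<Longrightarrow> map_mat of_int (A ^\<^sub>m k) = map_mat of_int A ^\<^sub>m k"
  by (rule of_int_hom.mat_hom_pow)

lemma of_int_mat_diff:
  "A \<in> carrier_mat n n \<Longrightarrow> B \<in> carrier_mat n n \<Longrightarrow> map_mat of_int (A - B) = map_mat of_int A - (map_mat of_int B :: 'a::comm_ring_1 mat)"
  by (intro eq_matI) auto

lemma of_int_mat_commutator:
  "A \<in> carrier_mat n n \<Longrightarrow> B \<in> carrier_mat n n \<Longrightarrow>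
    map_mat of_int (mat_commutator A B) = mat_commutator (map_mat of_int A) (map_mat of_int B :: 'a::comm_ring_1 mat)"
  unfolding mat_commutator_def by (subst of_int_mat_diff[of _ n]) (auto simp: of_int_mat_mult)

lemma of_int_mat_smult: "map_mat of_int (c \<cdot>\<^sub>m A) = (of_int c :: 'a::comm_ring_1) \<cdot>\<^sub>m map_mat of_int A"
  by (intro eq_matI) auto

lemma of_int_mat_inject:
  "map_mat of_int A = (map_mat of_int B :: 'a::ring_char_0 mat) \<Longrightarrow> A = B"
proof (rule eq_matI)
  assume eq: "map_mat of_int A = (map_mat of_int B :: 'a mat)"
  show d: "dim_row A = dim_row B" "dim_col A = dim_col B"
    using arg_cong[OF eq, of dim_row] arg_cong[OF eq, of dim_col] by auto
  fix i j assume "i < dim_row B" "j < dim_col B"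
  thus "A $$ (i, j) = B $$ (i, j)" using arg_cong[OF eq, of "\<lambda>M. M $$ (i, j)"] d by simp
qed

definition int_endo :: "nat \<Rightarrow> int mat \<Rightarrow> 'a::comm_ring_1 endo" where
  "int_endo n A = mat_endo n (map_mat of_int A)"

lemma int_endo_commutator:
  "A \<in> carrier_mat n n \<Longrightarrow> B \<in> carrier_mat n n \<Longrightarrow>
    int_endo n (mat_commutator A B) = commutator (int_endo n A) (int_endo n B :: 'a::comm_ring_1 endo)"
  unfolding int_endo_def of_int_mat_commutator
  by (simp add: mat_commutator_def commutator_def mat_endo_diff mat_endo_mult)

lemma mat_endo_pow:
  "A \<in> carrier_mat n n \<Longrightarrow> mat_endo n (A ^\<^sub>m Suc k) = mat_endo n A ^ Suc k"
proof (induction k)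
  case 0
  thus ?case by simp
next
  case (Suc k)
  have "mat_endo n (A ^\<^sub>m Suc (Suc k)) = mat_endo n (A ^\<^sub>m Suc k) * mat_endo n A"
    unfolding pow_mat.simps(2)[of A "Suc k"] by (rule mat_endo_mult) (use Suc.prems in auto)
  thus ?case using Suc by (simp only: power_Suc2[of _ "Suc k"])
qed

context chevalley_representation
begin

sublocale root_sys \<Phi> \<Delta>
  using root_system base by unfold_locales

lemma rep_carrier [simp]: "\<pi> u \<in> carrier_mat n n"
  and rep_add: "\<pi> (u + v) = \<pi> u + \<pi> v"
  and rep_scale: "\<pi> (scale c u) = c \<cdot>\<^sub>m \<pi> u"
  and rep_bracket: "\<pi> (br u v) = mat_commutator (\<pi> u) (\<pi> v)"
  and rep_inject: "\<pi> u = \<pi> v \<Longrightarrow> u = v"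
  using faithful unfolding faithful_representation_def mat_commutator_def by (auto dest: injD)

lemma rep_zero: "\<pi> 0 = 0\<^sub>m n n"
proof -
  have "\<pi> 0 = 0 \<cdot>\<^sub>m \<pi> 0" using rep_scale[of 0 0] by simp
  moreover have "0 \<cdot>\<^sub>m \<pi> 0 = 0\<^sub>m n n" using carrier_matD[OF rep_carrier[of 0]] by (intro eq_matI) auto
  ultimately show ?thesis by simp
qed

lemma rep_sum_entry: "i < n \<Longrightarrow> j < n \<Longrightarrow> \<pi> (sum f A) $$ (i, j) = (\<Sum>a\<in>A. \<pi> (f a) $$ (i, j))"
proof (induction A rule: infinite_finite_induct)
  case (insert a A)
  have "\<pi> (sum f (insert a A)) = \<pi> (f a) + \<pi> (sum f A)" using insert by (simp add: rep_add)
  thus ?case using insert carrier_matD[OF rep_carrier] by simp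
qed (simp_all add: rep_zero)

lemma x_independent:
  assumes "(\<Sum>\<beta>\<in>\<Phi>. scale (c \<beta>) (x \<beta>)) + (\<Sum>a\<in>\<Delta>. scale (d a) (h a)) = 0"
  shows "\<beta> \<in> \<Phi> \<Longrightarrow> c \<beta> = 0" "a \<in> \<Delta> \<Longrightarrow> d a = 0"
proof -
  have inj: "inj_on h \<Delta>" "inj_on x \<Phi>" and disj: "h ` \<Delta> \<inter> x ` \<Phi> = {}" and ind: "independent (h ` \<Delta> \<union> x ` \<Phi>)"
    using basis[unfolded chevalley_basis_def, THEN conjunct1]
      basis[unfolded chevalley_basis_def, THEN conjunct2, THEN conjunct1]
      basis[unfolded chevalley_basis_def, THEN conjunct2, THEN conjunct2, THEN conjunct1]
      basis[unfolded chevalley_basis_def, THEN conjunct2, THEN conjunct2, THEN conjunct2, THEN conjunct1] .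
  define u where "u v = (if v \<in> x ` \<Phi> then c (the_inv_into \<Phi> x v) else d (the_inv_into \<Delta> h v))" for v
  have ux: "u (x \<beta>) = c \<beta>" if "\<beta> \<in> \<Phi>" for \<beta> using that inj(2) by (simp add: u_def the_inv_into_f_f)
  have uh: "u (h a) = d a" if "a \<in> \<Delta>" for a
  proof -
    have "h a \<notin> x ` \<Phi>" using disj that by blast
    thus ?thesis using that inj(1) by (simp add: u_def the_inv_into_f_f)
  qed
  have fin: "finite (h ` \<Delta> \<union> x ` \<Phi>)" using finite_roots finite_base by simp
  have "(\<Sum>v\<in>h ` \<Delta> \<union> x ` \<Phi>. scale (u v) v) = (\<Sum>v\<in>h ` \<Delta>. scale (u v) v) + (\<Sum>v\<in>x ` \<Phi>. scale (u v) v)"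
    using finite_roots finite_base disj by (intro sum.union_disjoint) auto
  also have "\<dots> = (\<Sum>a\<in>\<Delta>. scale (d a) (h a)) + (\<Sum>\<beta>\<in>\<Phi>. scale (c \<beta>) (x \<beta>))"
    using inj ux uh by (simp add: sum.reindex)
  also have "\<dots> = 0" using assms by (simp add: add.commute)
  finally have z: "u v = 0" if "v \<in> h ` \<Delta> \<union> x ` \<Phi>" for v
    using independentD[OF ind fin subset_refl _ that] by blast
  show "\<beta> \<in> \<Phi> \<Longrightarrow> c \<beta> = 0" using z[of "x \<beta>"] ux by auto
  show "a \<in> \<Delta> \<Longrightarrow> d a = 0" using z[of "h a"] uh by auto
qed

lemma x_nonzero: "\<alpha> \<in> \<Phi> \<Longrightarrow> x \<alpha> \<noteq> 0"
proof
  assume \<alpha>: "\<alpha> \<in> \<Phi>" and 0: "x \<alpha> = 0"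
  have "(\<Sum>\<beta>\<in>\<Phi>. scale (if \<beta> = \<alpha> then 1 else 0) (x \<beta>)) + (\<Sum>a\<in>\<Delta>. scale 0 (h a)) = 0"
    using 0 by (auto intro!: sum.neutral)
  from x_independent(1)[OF this \<alpha>] show False by simp
qed

lemma dim_pos: "\<Phi> \<noteq> {} \<Longrightarrow> n > 0"
proof (rule ccontr)
  assume ne: "\<Phi> \<noteq> {}" and "\<not> n > 0"
  then obtain \<alpha> where \<alpha>: "\<alpha> \<in> \<Phi>" by blast
  have "\<pi> (x \<alpha>) = \<pi> 0" using \<open>\<not> n > 0\<close> carrier_matD[OF rep_carrier] by (intro eq_matI) auto
  hence "x \<alpha> = 0" by (rule rep_inject)
  thus False using x_nonzero[OF \<alpha>] by simp
qed

lemma coroot_bracket: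
  assumes \<alpha>: "\<alpha> \<in> \<Phi>"
  shows "\<exists>k :: 'v \<Rightarrow> int. coroot \<alpha> = (\<Sum>a\<in>\<Delta>. of_int (k a) *\<^sub>R coroot a) \<and>
    br (x \<alpha>) (x (- \<alpha>)) = (\<Sum>a\<in>\<Delta>. scale (of_int (k a)) (h a))"
proof -
  have "\<forall>\<alpha>\<in>\<Phi>. \<exists>k :: 'v \<Rightarrow> int. coroot \<alpha> = (\<Sum>a\<in>\<Delta>. of_int (k a) *\<^sub>R coroot a) \<and>
    br (x \<alpha>) (x (- \<alpha>)) = (\<Sum>a\<in>\<Delta>. scale (of_int (k a)) (h a))"
    using basis unfolding chevalley_basis_def by (elim conjE)
  thus ?thesis using \<alpha> by (rule bspec)
qed

text \<open>The coroot of a base root has only the trivial expansion in base coroots, because the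
  base is independent. So the basis elements \<open>h a\<close> are themselves commutators, as
  \<open>chev_alg\<close> requires.\<close>

lemma base_coroot_bracket: assumes a: "a \<in> \<Delta>" shows "br (x a) (x (- a)) = h a"
proof -
  have "a \<in> \<Phi>" using a by (rule base_root)
  then obtain k :: "'v \<Rightarrow> int" where k: "coroot a = (\<Sum>b\<in>\<Delta>. of_int (k b) *\<^sub>R coroot b)"
    "br (x a) (x (- a)) = (\<Sum>b\<in>\<Delta>. scale (of_int (k b)) (h b))"
    using coroot_bracket by blast
  define q where "q b = (of_int (k b) - (if b = a then 1 else 0)) * (2 / inner b b)" for b
  have "(\<Sum>b\<in>\<Delta>. q b *\<^sub>R b) = (\<Sum>b\<in>\<Delta>. of_int (k b) *\<^sub>R coroot b - (if b = a then coroot b else 0))"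
    by (rule sum.cong) (auto simp: q_def coroot_def scaleR_diff_left left_diff_distrib diff_divide_distrib)
  also have "\<dots> = 0" using a finite_base by (simp add: sum_subtractf flip: k(1))
  finally have q0: "(\<Sum>b\<in>\<Delta>. q b *\<^sub>R b) = 0" .
  note ind = RB[unfolded root_base_def, THEN conjunct2, THEN conjunct1]
  have "q b = 0" if "b \<in> \<Delta>" for b
    using real_vector.independentD[OF ind finite_base subset_refl q0 that] .
  hence kb: "of_int (k b) = (if b = a then 1 else 0 :: real)" if "b \<in> \<Delta>" for b
    using that base_root root_nonzero by (fastforce simp: q_def)
  have kb': "k b = (if b = a then 1 else 0)" if "b \<in> \<Delta>" for b
    using kb[OF that] by (auto split: if_splits)
  have "br (x a) (x (- a)) = (\<Sum>b\<in>\<Delta>. if b = a then h b else 0)"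
    unfolding k(2) by (rule sum.cong) (auto simp: kb')
  thus ?thesis using a finite_base by simp
qed

lemma br_sum_left: "br (sum f A) v = (\<Sum>a\<in>A. br (f a) v)"
proof (induction A rule: infinite_finite_induct)
  case (insert a A) thus ?case by (simp add: br_add_left)
qed (use br_scale_left[of 0 0 v] in simp_all)

text \<open>The bracket expands in the \<open>h a\<close> with the same integers as the coroot in
  base coroots, and the Cartan number is linear in the coroot.\<close>

lemma coroot_weight:
  assumes \<alpha>: "\<alpha> \<in> \<Phi>" and \<beta>: "\<beta> \<in> \<Phi>"
  shows "br (br (x \<alpha>) (x (- \<alpha>))) (x \<beta>) = scale (of_int (cartan_number \<beta> \<alpha>)) (x \<beta>)"
proof -
  obtain k :: "'v \<Rightarrow> int" where k: "coroot \<alpha> = (\<Sum>a\<in>\<Delta>. of_int (k a) *\<^sub>R coroot a)"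
    "br (x \<alpha>) (x (- \<alpha>)) = (\<Sum>a\<in>\<Delta>. scale (of_int (k a)) (h a))" using coroot_bracket[OF \<alpha>] by blast
  have hw: "br (h a) (x \<beta>) = scale (of_real (cartan_int \<beta> a)) (x \<beta>)" if "a \<in> \<Delta>" for a
  proof -
    have "\<forall>a\<in>\<Delta>. h a \<in> H \<and> (\<forall>\<beta>\<in>\<Phi>. rt \<beta> (h a) = of_real (cartan_int \<beta> a))"
      using basis unfolding chevalley_basis_def by (elim conjE)
    moreover have "\<forall>\<alpha>\<in>\<Phi>. x \<alpha> \<in> root_space H (rt \<alpha>)"
      using basis unfolding chevalley_basis_def by (elim conjE)
    ultimately show ?thesis using \<beta> that unfolding root_space_def by simp
  qed
  have "cartan_int \<beta> \<gamma> = inner \<beta> (coroot \<gamma>)" for \<gamma> by (simp add: cartan_int_def coroot_def)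
  hence "cartan_int \<beta> \<alpha> = (\<Sum>a\<in>\<Delta>. of_int (k a) * cartan_int \<beta> a)" by (simp add: k(1) inner_sum_right)
  hence c: "(\<Sum>a\<in>\<Delta>. of_int (k a) * of_real (cartan_int \<beta> a)) = (of_int (cartan_number \<beta> \<alpha>) :: complex)"
  proof -
    have "(\<Sum>a\<in>\<Delta>. of_int (k a) * of_real (cartan_int \<beta> a)) = (of_real (\<Sum>a\<in>\<Delta>. of_int (k a) * cartan_int \<beta> a) :: complex)"
      by simp
    also have "\<dots> = of_real (of_int (cartan_number \<beta> \<alpha>))"
      by (simp only: cartan_number[OF \<alpha> \<beta>] \<open>cartan_int \<beta> \<alpha> = (\<Sum>a\<in>\<Delta>. of_int (k a) * cartan_int \<beta> a)\<close>)
    finally show ?thesis by simp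
  qed
  have "br (br (x \<alpha>) (x (- \<alpha>))) (x \<beta>) = (\<Sum>a\<in>\<Delta>. scale (of_int (k a) * of_real (cartan_int \<beta> a)) (x \<beta>))"
    unfolding k(2) br_sum_left by (rule sum.cong) (auto simp: br_scale_left hw)
  also have "\<dots> = scale (of_int (cartan_number \<beta> \<alpha>)) (x \<beta>)" by (simp add: c flip: scale_sum_left)
  finally show ?thesis .
qed

lemma root_bracket:
  assumes "\<alpha> \<in> \<Phi>" "\<beta> \<in> \<Phi>" "\<alpha> + \<beta> \<in> \<Phi>"
  obtains N :: int where "N \<noteq> 0" "br (x \<alpha>) (x \<beta>) = scale (of_int N) (x (\<alpha> + \<beta>))"
proof -
  define r where "r = Max {r :: nat. \<beta> - of_nat r *\<^sub>R \<alpha> \<in> \<Phi>}"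
  have "br (x \<alpha>) (x \<beta>) = scale (of_nat (r + 1)) (x (\<alpha> + \<beta>)) \<or> br (x \<alpha>) (x \<beta>) = scale (- of_nat (r + 1)) (x (\<alpha> + \<beta>))"
  proof -
    have "\<forall>\<alpha>\<in>\<Phi>. \<forall>\<beta>\<in>\<Phi>. \<alpha> + \<beta> \<in> \<Phi> \<longrightarrow>
      (let r = Max {r :: nat. \<beta> - of_nat r *\<^sub>R \<alpha> \<in> \<Phi>} in
        br (x \<alpha>) (x \<beta>) = scale (of_nat (r + 1)) (x (\<alpha> + \<beta>)) \<or>
        br (x \<alpha>) (x \<beta>) = scale (- of_nat (r + 1)) (x (\<alpha> + \<beta>)))"
      using basis unfolding chevalley_basis_def by (elim conjE)
    thus ?thesis using assms unfolding Let_def r_def by blast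
  qed
  thus thesis using that[of "int (r + 1)"] that[of "- int (r + 1)"] by auto
qed

section \<open>Integer matrices of the Chevalley basis and of divided powers\<close>

definition DI :: "'v \<Rightarrow> nat \<Rightarrow> int mat" where
  "DI \<alpha> k = mat n n (\<lambda>ij. \<lfloor>Re (divided_power (\<pi> (x \<alpha>)) k $$ ij)\<rfloor>)"

lemma DI_carrier [simp]: "DI \<alpha> k \<in> carrier_mat n n"
  by (simp add: DI_def)

lemma divided_power_carrier: "divided_power (\<pi> u) k \<in> carrier_mat n n"
  by (simp add: divided_power_def)

lemma DI_complex: "\<alpha> \<in> \<Phi> \<Longrightarrow> map_mat of_int (DI \<alpha> k) = divided_power (\<pi> (x \<alpha>)) k"
proof (rule eq_matI)
  assume \<alpha>: "\<alpha> \<in> \<Phi>"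
  note c = carrier_matD[OF divided_power_carrier[of "x \<alpha>" k]]
  fix i j assume "i < dim_row (divided_power (\<pi> (x \<alpha>)) k)" "j < dim_col (divided_power (\<pi> (x \<alpha>)) k)"
  hence ij: "i < n" "j < n" using c by auto
  obtain z where "divided_power (\<pi> (x \<alpha>)) k $$ (i, j) = of_int z"
    using admissible[OF \<alpha> ij] by (auto elim: Ints_cases)
  thus "map_mat of_int (DI \<alpha> k) $$ (i, j) = divided_power (\<pi> (x \<alpha>)) k $$ (i, j)"
    using ij by (simp add: DI_def)
qed (auto simp: DI_def carrier_matD[OF divided_power_carrier])

lemma DI_1: "\<alpha> \<in> \<Phi> \<Longrightarrow> map_mat of_int (DI \<alpha> 1) = \<pi> (x \<alpha>)"
  unfolding DI_complex divided_power_def using carrier_matD[OF rep_carrier[of "x \<alpha>"]] by (intro eq_matI) auto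

lemma DI_0: "\<alpha> \<in> \<Phi> \<Longrightarrow> DI \<alpha> 0 = 1\<^sub>m n"
proof (rule of_int_mat_inject)
  assume \<alpha>: "\<alpha> \<in> \<Phi>"
  have "divided_power (\<pi> (x \<alpha>)) 0 = 1\<^sub>m n"
    by (intro eq_matI) (auto simp: divided_power_def carrier_matD[OF rep_carrier])
  also have "\<dots> = map_mat of_int (1\<^sub>m n)" by (intro eq_matI) auto
  finally show "map_mat of_int (DI \<alpha> 0) = (map_mat of_int (1\<^sub>m n) :: complex mat)" by (simp only: DI_complex[OF \<alpha>])
qed

lemma DI_power: "\<alpha> \<in> \<Phi> \<Longrightarrow> fact k \<cdot>\<^sub>m DI \<alpha> k = DI \<alpha> 1 ^\<^sub>m k"
proof (rule of_int_mat_inject)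
  assume \<alpha>: "\<alpha> \<in> \<Phi>"
  have "map_mat of_int (fact k \<cdot>\<^sub>m DI \<alpha> k) = (of_int (fact k) :: complex) \<cdot>\<^sub>m divided_power (\<pi> (x \<alpha>)) k"
    using \<alpha> by (simp only: of_int_mat_smult DI_complex)
  also have "\<dots> = \<pi> (x \<alpha>) ^\<^sub>m k"
    unfolding divided_power_def by (intro eq_matI) auto
  also have "\<dots> = map_mat of_int (DI \<alpha> 1 ^\<^sub>m k)"
    unfolding DI_1[OF \<alpha>, symmetric] by (rule of_int_mat_pow[symmetric, OF DI_carrier])
  finally show "map_mat of_int (fact k \<cdot>\<^sub>m DI \<alpha> k) = (map_mat of_int (DI \<alpha> 1 ^\<^sub>m k) :: complex mat)" .
qed

lemma root_nilpotent: "\<alpha> \<in> \<Phi> \<Longrightarrow> \<pi> (x \<alpha>) ^\<^sub>m n = 0\<^sub>m n n"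
  using nilpotent_if_integral_divided_powers[OF rep_carrier admissible] nilpotent_power_dim[OF rep_carrier] by blast

lemma DI_nilpotent: "\<alpha> \<in> \<Phi> \<Longrightarrow> DI \<alpha> 1 ^\<^sub>m n = 0\<^sub>m n n"
proof (rule of_int_mat_inject)
  assume \<alpha>: "\<alpha> \<in> \<Phi>"
  have "map_mat of_int (DI \<alpha> 1 ^\<^sub>m n) = \<pi> (x \<alpha>) ^\<^sub>m n"
    unfolding DI_1[OF \<alpha>, symmetric] by (rule of_int_mat_pow[OF DI_carrier])
  thus "map_mat of_int (DI \<alpha> 1 ^\<^sub>m n) = (map_mat of_int (0\<^sub>m n n) :: complex mat)"
    unfolding root_nilpotent[OF \<alpha>] by (intro eq_matI) auto
qed

definition Hmat :: "'v \<Rightarrow> int mat" where "Hmat \<alpha> = mat_commutator (DI \<alpha> 1) (DI (- \<alpha>) 1)"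

lemma Hmat_carrier [simp]: "Hmat \<alpha> \<in> carrier_mat n n"
  by (simp add: Hmat_def)

lemma int_commutator_complex:
  "\<alpha> \<in> \<Phi> \<Longrightarrow> \<beta> \<in> \<Phi> \<Longrightarrow> map_mat of_int (mat_commutator (DI \<alpha> 1) (DI \<beta> 1)) = \<pi> (br (x \<alpha>) (x \<beta>))"
  by (simp only: of_int_mat_commutator[OF DI_carrier DI_carrier] DI_1 rep_bracket)

lemma Hmat_complex: "\<alpha> \<in> \<Phi> \<Longrightarrow> map_mat of_int (Hmat \<alpha>) = \<pi> (br (x \<alpha>) (x (- \<alpha>)))"
  unfolding Hmat_def by (rule int_commutator_complex) (auto simp: root_minus)

lemma int_bracket_zero:
  assumes "\<alpha> \<in> \<Phi>" "\<beta> \<in> \<Phi>" "\<alpha> + \<beta> \<notin> \<Phi>" "\<alpha> + \<beta> \<noteq> 0"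
  shows "mat_commutator (DI \<alpha> 1) (DI \<beta> 1) = 0\<^sub>m n n"
proof (rule of_int_mat_inject)
  have "\<forall>\<alpha>\<in>\<Phi>. \<forall>\<beta>\<in>\<Phi>. \<alpha> + \<beta> \<notin> \<Phi> \<and> \<alpha> + \<beta> \<noteq> 0 \<longrightarrow> br (x \<alpha>) (x \<beta>) = 0"
    using basis unfolding chevalley_basis_def by (elim conjE)
  hence "br (x \<alpha>) (x \<beta>) = 0" using assms by blast
  thus "map_mat of_int (mat_commutator (DI \<alpha> 1) (DI \<beta> 1)) = (map_mat of_int (0\<^sub>m n n) :: complex mat)"
    unfolding int_commutator_complex[OF assms(1,2)] by (simp add: rep_zero) (intro eq_matI, auto)
qed

lemma int_bracket_root:
  assumes "\<alpha> \<in> \<Phi>" "\<beta> \<in> \<Phi>" "\<alpha> + \<beta> \<in> \<Phi>"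
  shows "\<exists>N. N \<noteq> 0 \<and> mat_commutator (DI \<alpha> 1) (DI \<beta> 1) = N \<cdot>\<^sub>m DI (\<alpha> + \<beta>) 1"
proof -
  obtain N :: int where N: "N \<noteq> 0" "br (x \<alpha>) (x \<beta>) = scale (of_int N) (x (\<alpha> + \<beta>))"
    by (rule root_bracket[OF assms])
  have "mat_commutator (DI \<alpha> 1) (DI \<beta> 1) = N \<cdot>\<^sub>m DI (\<alpha> + \<beta>) 1"
  proof (rule of_int_mat_inject)
    show "map_mat of_int (mat_commutator (DI \<alpha> 1) (DI \<beta> 1)) = (map_mat of_int (N \<cdot>\<^sub>m DI (\<alpha> + \<beta>) 1) :: complex mat)"
      unfolding int_commutator_complex[OF assms(1,2)] N(2) rep_scale of_int_mat_smult DI_1[OF assms(3)] ..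
  qed
  thus ?thesis using N(1) by blast
qed

lemma int_weight:
  assumes "\<alpha> \<in> \<Phi>" "\<beta> \<in> \<Phi>"
  shows "mat_commutator (Hmat \<alpha>) (DI \<beta> 1) = cartan_number \<beta> \<alpha> \<cdot>\<^sub>m DI \<beta> 1"
proof (rule of_int_mat_inject)
  show "map_mat of_int (mat_commutator (Hmat \<alpha>) (DI \<beta> 1)) = (map_mat of_int (cartan_number \<beta> \<alpha> \<cdot>\<^sub>m DI \<beta> 1) :: complex mat)"
    by (subst of_int_mat_commutator[of _ n])
      (simp_all add: Hmat_complex DI_1[unfolded One_nat_def] assms of_int_mat_smult rep_bracket[symmetric] coroot_weight rep_scale)
qed

lemma int_coroot_span:
  assumes \<alpha>: "\<alpha> \<in> \<Phi>"
  shows "\<exists>k. \<forall>i<n. \<forall>j<n. Hmat \<alpha> $$ (i, j) = (\<Sum>a\<in>\<Delta>. k a * Hmat a $$ (i, j))"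
proof -
  obtain k :: "'v \<Rightarrow> int" where k: "br (x \<alpha>) (x (- \<alpha>)) = (\<Sum>a\<in>\<Delta>. scale (of_int (k a)) (h a))"
    using coroot_bracket[OF \<alpha>] by blast
  have e: "(of_int (Hmat \<beta> $$ (i, j)) :: complex) = \<pi> (br (x \<beta>) (x (- \<beta>))) $$ (i, j)" if "\<beta> \<in> \<Phi>" "i < n" "j < n" for \<beta> i j
    using that carrier_matD[OF Hmat_carrier[of \<beta>]] by (simp flip: Hmat_complex)
  have "Hmat \<alpha> $$ (i, j) = (\<Sum>a\<in>\<Delta>. k a * Hmat a $$ (i, j))" if ij: "i < n" "j < n" for i j
  proof -
    have "(of_int (Hmat \<alpha> $$ (i, j)) :: complex) = (\<Sum>a\<in>\<Delta>. \<pi> (scale (of_int (k a)) (h a)) $$ (i, j))"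
      using ij by (simp add: e \<alpha> k rep_sum_entry)
    also have "\<dots> = (\<Sum>a\<in>\<Delta>. of_int (k a) * of_int (Hmat a $$ (i, j)))"
      using ij carrier_matD[OF rep_carrier]
      by (intro sum.cong) (auto simp: rep_scale e base_root base_coroot_bracket)
    also have "\<dots> = of_int (\<Sum>a\<in>\<Delta>. k a * Hmat a $$ (i, j))" by simp
    finally show ?thesis by (simp only: of_int_eq_iff)
  qed
  thus ?thesis by blast
qed

fun basis_mat :: "'v + 'v \<Rightarrow> int mat" where
  "basis_mat (Inl \<beta>) = DI \<beta> 1"
| "basis_mat (Inr a) = Hmat a"

lemma basis_mat_carrier [simp]: "basis_mat b \<in> carrier_mat n n"
  by (cases b) (auto simp: simp del: One_nat_def)

text \<open>Faithfulness makes the integer matrices of the Chevalley basis independent. Coordinates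
  of a matrix in their span are then given, up to \<open>D\<close>, by integral functionals of its
  entries, which make sense over every ring.\<close>

lemma basis_dual:
  "\<exists>D l. D \<noteq> 0 \<and> (\<forall>b\<in>\<Phi> <+> \<Delta>. \<forall>b'\<in>\<Phi> <+> \<Delta>.
    (\<Sum>ij\<in>{..<n} \<times> {..<n}. l b ij * basis_mat b' $$ ij) = (if b = b' then D else 0))"
proof (rule integer_dual)
  show "finite (\<Phi> <+> \<Delta>)" "finite ({..<n} \<times> {..<n})" using finite_roots finite_base by auto
  fix q :: "'v + 'v \<Rightarrow> int"
  assume q: "\<forall>ij\<in>{..<n} \<times> {..<n}. (\<Sum>b\<in>\<Phi> <+> \<Delta>. q b * basis_mat b $$ ij) = 0"
  let ?u = "(\<Sum>\<beta>\<in>\<Phi>. scale (of_int (q (Inl \<beta>))) (x \<beta>)) + (\<Sum>a\<in>\<Delta>. scale (of_int (q (Inr a))) (h a))"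
  have "\<pi> ?u = \<pi> 0"
  proof (rule eq_matI)
    fix i j assume "i < dim_row (\<pi> 0)" "j < dim_col (\<pi> 0)"
    hence ij: "i < n" "j < n" using carrier_matD[OF rep_carrier] by auto
    note d = carrier_matD[OF rep_carrier] carrier_matD[OF DI_carrier] carrier_matD[OF Hmat_carrier]
    have 1: "\<pi> (x \<beta>) $$ (i, j) = of_int (DI \<beta> 1 $$ (i, j))" if "\<beta> \<in> \<Phi>" for \<beta>
      using ij d by (simp flip: DI_1[OF that])
    have 2: "\<pi> (h a) $$ (i, j) = of_int (Hmat a $$ (i, j))" if "a \<in> \<Delta>" for a
    proof -
      have "\<pi> (h a) = map_mat of_int (Hmat a)"
        using Hmat_complex[OF base_root[OF that]] base_coroot_bracket[OF that] by simp
      thus ?thesis using ij d by simp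
    qed
    have "\<pi> ?u $$ (i, j) = (\<Sum>\<beta>\<in>\<Phi>. of_int (q (Inl \<beta>)) * of_int (DI \<beta> 1 $$ (i, j)))
        + (\<Sum>a\<in>\<Delta>. of_int (q (Inr a)) * of_int (Hmat a $$ (i, j)))"
      using ij d by (simp add: rep_add rep_sum_entry rep_scale 1 2 del: One_nat_def)
    also have "\<dots> = of_int (\<Sum>b\<in>\<Phi> <+> \<Delta>. q b * basis_mat b $$ (i, j))"
      using finite_roots finite_base by (simp add: sum.Plus del: One_nat_def)
    also have "\<dots> = 0" using q ij by simp
    finally show "\<pi> ?u $$ (i, j) = \<pi> 0 $$ (i, j)" using ij by (simp add: rep_zero)
  qed (simp_all add: carrier_matD[OF rep_carrier])
  hence "?u = 0" by (rule rep_inject)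
  from x_independent[OF this] show "\<forall>b\<in>\<Phi> <+> \<Delta>. q b = 0" by auto
qed

definition Xe :: "'v \<Rightarrow> 'a::comm_ring_1 endo" where "Xe \<alpha> = int_endo n (DI \<alpha> 1)"

lemma commutator_Xe: "commutator (Xe \<alpha>) (Xe \<beta>) = int_endo n (mat_commutator (DI \<alpha> 1) (DI \<beta> 1))"
  unfolding Xe_def by (rule int_endo_commutator[symmetric]) simp_all

lemma commutator_Xe_minus: "commutator (Xe \<alpha>) (Xe (- \<alpha>)) = int_endo n (Hmat \<alpha>)"
  by (simp only: commutator_Xe Hmat_def)

lemma int_endo_smult: "A \<in> carrier_mat n n \<Longrightarrow> int_endo n (c \<cdot>\<^sub>m A) = scalar_endo (of_int c) * int_endo n A"
  unfolding int_endo_def of_int_mat_smult by (rule mat_endo_smult) simp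

lemma endo_entry_int: "i < n \<Longrightarrow> j < n \<Longrightarrow> A \<in> carrier_mat n n \<Longrightarrow> endo_entry (int_endo n A) (i, j) = of_int (A $$ (i, j))"
  by (simp add: int_endo_def endo_entry_mat)

text \<open>Independence over the integers need not be repeated over the field: the dual functionals
  isolate each coefficient times the nonzero integer \<open>D\<close>.\<close>

lemma basis_endo_independent:
  fixes c d :: "'v \<Rightarrow> 'f::field_char_0"
  assumes "(\<Sum>\<beta>\<in>\<Phi>. scalar_endo (c \<beta>) * Xe \<beta>) + (\<Sum>a\<in>\<Delta>. scalar_endo (d a) * int_endo n (Hmat a)) = 0"
  shows "(\<forall>\<beta>\<in>\<Phi>. c \<beta> = 0) \<and> (\<forall>a\<in>\<Delta>. d a = 0)"
proof -
  obtain D l where D: "D \<noteq> 0" and l: "\<And>b b'. b \<in> \<Phi> <+> \<Delta> \<Longrightarrow> b' \<in> \<Phi> <+> \<Delta> \<Longrightarrow>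
      (\<Sum>ij\<in>{..<n} \<times> {..<n}. l b ij * basis_mat b' $$ ij) = (if b = b' then D else 0)"
    using basis_dual by blast
  define e where "e b = (case b of Inl \<beta> \<Rightarrow> c \<beta> | Inr a \<Rightarrow> d a)" for b
  have z: "(\<Sum>b\<in>\<Phi> <+> \<Delta>. e b * of_int (basis_mat b $$ ij)) = 0" if mem: "ij \<in> {..<n} \<times> {..<n}" for ij
  proof -
    obtain i j where ij: "ij = (i, j)" "i < n" "j < n" using mem by (cases ij) auto
    have "(\<Sum>b\<in>\<Phi> <+> \<Delta>. e b * of_int (basis_mat b $$ ij)) = endo_entry ((\<Sum>\<beta>\<in>\<Phi>. scalar_endo (c \<beta>) * Xe \<beta>)
        + (\<Sum>a\<in>\<Delta>. scalar_endo (d a) * int_endo n (Hmat a))) (i, j)"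
      using finite_roots finite_base ij
      by (simp add: sum.Plus endo_entry_add endo_entry_sum endo_entry_scalar Xe_def endo_entry_int e_def del: One_nat_def)
    thus ?thesis by (simp only: assms endo_entry_0)
  qed
  have "e b = 0" if b: "b \<in> \<Phi> <+> \<Delta>" for b
  proof -
    have "0 = (\<Sum>ij\<in>{..<n} \<times> {..<n}. of_int (l b ij) * (\<Sum>b'\<in>\<Phi> <+> \<Delta>. e b' * of_int (basis_mat b' $$ ij)))"
      by (rule sum.neutral[symmetric]) (simp add: z)
    also have "\<dots> = (\<Sum>b'\<in>\<Phi> <+> \<Delta>. e b' * of_int (\<Sum>ij\<in>{..<n} \<times> {..<n}. l b ij * basis_mat b' $$ ij))"
      by (simp only: sum_distrib_left of_int_sum of_int_mult mult.left_commute) (rule sum.swap)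
    also have "\<dots> = (\<Sum>b'\<in>\<Phi> <+> \<Delta>. if b' = b then e b' * of_int D else 0)"
      using b by (intro sum.cong) (auto simp: l)
    also have "\<dots> = e b * of_int D" using b finite_roots finite_base by simp
    finally show ?thesis using D by simp
  qed
  from this[of "Inl _"] this[of "Inr _"] show ?thesis by (auto simp: e_def)
qed

lemma chev_alg:
  assumes "\<Phi> \<noteq> {}"
  shows "chev_alg (scalar_endo :: 'f::field_char_0 \<Rightarrow> 'f endo) \<Phi> \<Delta> Xe n"
proof unfold_locales
  show n: "n > 0" using dim_pos assms by blast
  fix \<alpha> \<beta> assume \<alpha>: "\<alpha> \<in> \<Phi>"
  obtain k where k: "n = Suc k" using n by (cases n) auto
  have "(Xe \<alpha> :: 'f endo) ^ n = mat_endo n (map_mat of_int (DI \<alpha> 1) ^\<^sub>m n)"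
    unfolding Xe_def int_endo_def
    using mat_endo_pow[of "map_mat of_int (DI \<alpha> 1)" n k, folded k, symmetric] by simp
  also have "map_mat of_int (DI \<alpha> 1) ^\<^sub>m n = (map_mat of_int (0\<^sub>m n n) :: 'f mat)"
    unfolding DI_nilpotent[OF \<alpha>, symmetric] by (rule of_int_mat_pow[symmetric, OF DI_carrier])
  also have "\<dots> = 0\<^sub>m n n" by (intro eq_matI) auto
  finally show "(Xe \<alpha> :: 'f endo) ^ n = 0" by (simp add: mat_endo_zero)
  show "\<exists>k. commutator (Xe \<alpha>) (Xe (- \<alpha>)) = (\<Sum>a\<in>\<Delta>. scalar_endo (k a) * commutator (Xe a) (Xe (- a) :: 'f endo))"
  proof -
    obtain k where k: "\<forall>i<n. \<forall>j<n. Hmat \<alpha> $$ (i, j) = (\<Sum>a\<in>\<Delta>. k a * Hmat a $$ (i, j))"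
      using int_coroot_span[OF \<alpha>] by blast
    have "map_mat of_int (Hmat \<alpha>) = (mat n n (\<lambda>ij. \<Sum>a\<in>\<Delta>. of_int (k a) * map_mat of_int (Hmat a) $$ ij) :: 'f mat)"
      using k carrier_matD[OF Hmat_carrier] by (intro eq_matI) auto
    hence "(int_endo n (Hmat \<alpha>) :: 'f endo) = (\<Sum>a\<in>\<Delta>. scalar_endo (of_int (k a)) * int_endo n (Hmat a))"
      unfolding int_endo_def by (simp add: mat_endo_sum_mat)
    thus ?thesis unfolding commutator_Xe_minus by (intro exI[of _ "\<lambda>a. of_int (k a)"]) simp
  qed
  assume \<beta>: "\<beta> \<in> \<Phi>"
  show "commutator (commutator (Xe \<alpha>) (Xe (- \<alpha>))) (Xe \<beta>) = scalar_endo (of_int (cartan_number \<beta> \<alpha>)) * (Xe \<beta> :: 'f endo)"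
    unfolding commutator_Xe_minus unfolding Xe_def
    by (simp only: int_endo_commutator[OF Hmat_carrier DI_carrier, symmetric] int_weight[OF \<alpha> \<beta>] int_endo_smult[OF DI_carrier])
  show "commutator (Xe \<alpha>) (Xe \<beta>) = (0 :: 'f endo)" if "\<alpha> + \<beta> \<notin> \<Phi>" "\<alpha> + \<beta> \<noteq> 0"
  proof -
    have "map_mat of_int (0\<^sub>m n n) = (0\<^sub>m n n :: 'f mat)" by (intro eq_matI) auto
    thus ?thesis unfolding commutator_Xe int_bracket_zero[OF \<alpha> \<beta> that] int_endo_def by (simp add: mat_endo_zero)
  qed
  show "\<exists>N. N \<noteq> 0 \<and> commutator (Xe \<alpha>) (Xe \<beta>) = scalar_endo (of_int N) * (Xe (\<alpha> + \<beta>) :: 'f endo)" if sum: "\<alpha> + \<beta> \<in> \<Phi>"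
  proof -
    obtain N where N: "N \<noteq> 0" "mat_commutator (DI \<alpha> 1) (DI \<beta> 1) = N \<cdot>\<^sub>m DI (\<alpha> + \<beta>) 1"
      using int_bracket_root[OF \<alpha> \<beta> sum] by blast
    have "commutator (Xe \<alpha>) (Xe \<beta>) = scalar_endo (of_int N) * (Xe (\<alpha> + \<beta>) :: 'f endo)"
      unfolding commutator_Xe N(2) unfolding Xe_def by (rule int_endo_smult[OF DI_carrier])
    thus ?thesis using N(1) by blast
  qed
next
  fix c d :: "'v \<Rightarrow> 'f"
  assume "(\<Sum>\<beta>\<in>\<Phi>. scalar_endo (c \<beta>) * Xe \<beta>) + (\<Sum>a\<in>\<Delta>. scalar_endo (d a) * commutator (Xe a) (Xe (- a))) = 0"
  thus "(\<forall>\<beta>\<in>\<Phi>. c \<beta> = 0) \<and> (\<forall>a\<in>\<Delta>. d a = 0)" unfolding commutator_Xe_minus by (rule basis_endo_independent)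
qed

end

subsection \<open>Root unipotents and the Chevalley group\<close>

context chevalley_representation
begin

abbreviation ru :: "'v \<Rightarrow> 'a::comm_ring_1 \<Rightarrow> 'a mat" where
  "ru \<equiv> root_unipotent n (\<lambda>\<alpha>. \<pi> (x \<alpha>))"

lemma ru_eq: "ru \<alpha> t = mat n n (\<lambda>ij. \<Sum>k<n. t ^ k * map_mat of_int (DI \<alpha> k) $$ ij)"
  unfolding root_unipotent_def by (intro eq_matI) (auto simp: DI_def)

lemma ru_carrier [simp]: "ru \<alpha> t \<in> carrier_mat n n"
  by (simp add: root_unipotent_def)

lemma of_int_DI:
  assumes "\<alpha> \<in> \<Phi>"
  shows "(fact k :: 'f::field_char_0) \<cdot>\<^sub>m map_mat of_int (DI \<alpha> k) = map_mat of_int (DI \<alpha> 1) ^\<^sub>m k"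
  using arg_cong[OF DI_power[OF assms, of k], of "map_mat of_int :: int mat \<Rightarrow> 'f mat"]
  by (simp only: of_int_mat_smult of_int_mat_pow[OF DI_carrier] of_int_fact)

text \<open>In characteristic zero the integral matrix \<open>DI \<alpha> k\<close> is the
  \<open>k\<close>-th power divided by \<open>k!\<close>, so the integrally defined root element
  becomes a genuine exponential and the algebra of \<open>nexp\<close> applies.\<close>

lemma ru_group_endo:
  assumes \<alpha>: "\<alpha> \<in> \<Phi>"
  shows "group_endo n (ru \<alpha> t) = scalar_endo.nexp n (Xe \<alpha>) (t :: 'f::field_char_0)"
proof -
  obtain n' where n': "n = Suc n'" using dim_pos \<alpha> by (metis emptyE gr0_implies_Suc)
  let ?D = "\<lambda>k. mat_endo n (map_mat of_int (DI \<alpha> k)) :: 'f endo"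
  have D: "scalar_endo (t ^ Suc k) * ?D (Suc k) = scalar_endo (t ^ Suc k / fact (Suc k)) * Xe \<alpha> ^ Suc k" for k
  proof -
    have "scalar_endo (fact (Suc k)) * ?D (Suc k) = mat_endo n (map_mat of_int (DI \<alpha> 1) ^\<^sub>m Suc k)"
      unfolding of_int_DI[OF \<alpha>, symmetric] by (rule mat_endo_smult[symmetric]) simp
    also have "\<dots> = Xe \<alpha> ^ Suc k"
      unfolding Xe_def int_endo_def by (rule mat_endo_pow) simp
    finally have "scalar_endo (t ^ Suc k / fact (Suc k)) * Xe \<alpha> ^ Suc k
        = scalar_endo (t ^ Suc k / fact (Suc k)) * (scalar_endo (fact (Suc k)) * ?D (Suc k))" by simp
    thus ?thesis by (simp only: scalar_endo.sc_sc) (simp add: fact_nonzero del: fact_Suc power_Suc)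
  qed
  have "mat_endo n (ru \<alpha> t) = (\<Sum>k<n. scalar_endo (t ^ k) * ?D k)"
    unfolding ru_eq by (rule mat_endo_sum_mat) simp
  \<comment> \<open>The constant term is split off: \<open>mat_endo\<close> maps the identity matrix
    only to a projection, which \<open>group_endo\<close> completes to 1.\<close>
  also have "\<dots> = ?D 0 + (\<Sum>k<n'. scalar_endo (t ^ Suc k) * ?D (Suc k))"
    unfolding n' by (subst sum.lessThan_Suc_shift) (simp add: scalar_endo.sc_1)
  also have "?D 0 = mat_endo n (1\<^sub>m n)"
    by (simp add: DI_0[OF \<alpha>] of_int_hom.mat_hom_one)
  finally have "group_endo n (ru \<alpha> t) = 1 + (\<Sum>k<n'. scalar_endo (t ^ Suc k / fact (Suc k)) * Xe \<alpha> ^ Suc k)"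
    unfolding D by (simp add: group_endo_def)
  also have "\<dots> = scalar_endo.nexp n (Xe \<alpha>) t"
    unfolding scalar_endo.nexp_def n' by (subst sum.lessThan_Suc_shift) (simp add: scalar_endo.sc_1)
  finally show ?thesis .
qed

lemma chev_alg_nonempty: "\<alpha> \<in> \<Phi> \<Longrightarrow> chev_alg (scalar_endo :: 'f::field_char_0 \<Rightarrow> 'f endo) \<Phi> \<Delta> Xe n"
  by (rule chev_alg) auto

lemma ru_field_props:
  fixes s t :: "'f::field_char_0"
  assumes \<alpha>: "\<alpha> \<in> \<Phi>"
  shows "ru \<alpha> (s + t) = ru \<alpha> s * ru \<alpha> t" "ru \<alpha> (0 :: 'f) = 1\<^sub>m n"
    "ru \<alpha> t * ru \<alpha> (- t) = 1\<^sub>m n" "ru \<alpha> (- t) * ru \<alpha> t = 1\<^sub>m n"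
proof -
  interpret chev_alg "scalar_endo :: 'f \<Rightarrow> 'f endo" \<Phi> \<Delta> Xe n by (rule chev_alg_nonempty[OF \<alpha>])
  have add: "ru \<alpha> (s + t) = ru \<alpha> s * ru \<alpha> t" for s t :: 'f
    by (rule group_endo_inject[of _ n])
      (simp_all add: group_endo_mult(1)[of _ n] ru_group_endo[OF \<alpha>] xr_add[OF \<alpha>, unfolded xr_def] mult_carrier_mat[of _ n n])
  have zero: "ru \<alpha> (0 :: 'f) = 1\<^sub>m n"
    by (rule group_endo_inject[of _ n])
      (simp_all add: group_endo_one ru_group_endo[OF \<alpha>] xr_0[OF \<alpha>, unfolded xr_def])
  show "ru \<alpha> (s + t) = ru \<alpha> s * ru \<alpha> t" "ru \<alpha> (0 :: 'f) = 1\<^sub>m n" using add zero by auto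
  show "ru \<alpha> t * ru \<alpha> (- t) = 1\<^sub>m n" "ru \<alpha> (- t) * ru \<alpha> t = 1\<^sub>m n"
    using add[of t "- t"] add[of "- t" t] zero by simp_all
qed

lemma ru_complex_SL:
  assumes \<alpha>: "\<alpha> \<in> \<Phi>" shows "ru \<alpha> (t :: complex) \<in> carrier (SL n)"
proof -
  have "ru \<alpha> t = mat n n (\<lambda>ij. \<Sum>k<n. (t ^ k / fact k) * (\<pi> (x \<alpha>) ^\<^sub>m k) $$ ij)"
    unfolding ru_eq DI_complex[OF \<alpha>]
    by (intro eq_matI) (auto simp: divided_power_def carrier_matD[OF rep_carrier])
  hence "det (ru \<alpha> t) = 1"
    using det_exponential[OF rep_carrier root_nilpotent[OF \<alpha>], of "\<lambda>k. t ^ k / fact k"] by simp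
  thus ?thesis by simp
qed

section \<open>Conjugation by the group preserves the Lie algebra\<close>

abbreviation EC :: "complex mat set" where "EC \<equiv> elementary_group n (\<lambda>\<alpha>. \<pi> (x \<alpha>)) \<Phi>"

lemma EC_subgroup: "subgroup EC (SL n)"
  unfolding elementary_group_def
  by (rule group.generate_is_subgroup[OF SL_group]) (use ru_complex_SL in auto)

lemma EC_carrier: "B \<in> EC \<Longrightarrow> B \<in> carrier_mat n n \<and> det B = 1"
  using subgroup.subset[OF EC_subgroup] by auto

lemma adj_unique:
  fixes A B :: "'a::comm_ring_1 mat"
  assumes "A \<in> carrier_mat n n" "B \<in> carrier_mat n n" "det A = 1" "A * B = 1\<^sub>m n"
  shows "adj_mat A = B"
  using inverse_unique_mat[OF assms(1,2) adj_mat(1)[OF assms(1)] assms(4)] adj_mat_inverse[OF assms(1,3)] by simp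

lemma EC_adj: "B \<in> EC \<Longrightarrow> adj_mat B \<in> EC"
  using subgroup.m_inv_closed[OF EC_subgroup, of B] EC_carrier[of B] SL_inverse[of B n] by auto

lemma conj_mult:
  fixes A B M :: "'a::comm_ring_1 mat"
  assumes "A \<in> carrier_mat n n" "B \<in> carrier_mat n n" "M \<in> carrier_mat n n" "det A = 1" "det B = 1"
  shows "(A * B) * M * adj_mat (A * B) = A * (B * M * adj_mat B) * adj_mat A"
proof -
  note c = assms(1-3) adj_mat(1)[OF assms(1)] adj_mat(1)[OF assms(2)]
  have assoc: "P * Q * R = P * (Q * R)" if "P \<in> carrier_mat n n" "Q \<in> carrier_mat n n" "R \<in> carrier_mat n n" for P Q R :: "'a mat"
    using that by (rule assoc_mult_mat)
  have "(A * B) * (adj_mat B * adj_mat A) = A * (B * adj_mat B) * adj_mat A"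
    using c by (simp add: assoc mult_carrier_mat[of _ n n])
  also have "\<dots> = 1\<^sub>m n"
    using adj_mat_inverse(1)[OF assms(1,4)] adj_mat_inverse(1)[OF assms(2,5)] assms(1) by simp
  finally have "adj_mat (A * B) = adj_mat B * adj_mat A"
    using c assms by (intro adj_unique) (auto simp: det_mult)
  thus ?thesis using c by (simp add: assoc mult_carrier_mat[of _ n n])
qed

text \<open>Conjugation is a finite sum of iterated commutators with scalar coefficients, and each
  of these is the image of an iterated Lie bracket.\<close>

lemma ru_conj_rep:
  assumes \<alpha>: "\<alpha> \<in> \<Phi>"
  shows "\<exists>v. ru \<alpha> (t :: complex) * \<pi> u * adj_mat (ru \<alpha> t) = \<pi> v"
proof -
  interpret chev_alg "scalar_endo :: complex \<Rightarrow> complex endo" \<Phi> \<Delta> Xe n by (rule chev_alg_nonempty[OF \<alpha>])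
  have adj: "adj_mat (ru \<alpha> t) = ru \<alpha> (- t)"
    using ru_complex_SL[OF \<alpha>] ru_field_props(3)[OF \<alpha>] by (intro adj_unique) auto
  have Xc: "Xe \<alpha> = mat_endo n (\<pi> (x \<alpha>))" by (simp only: Xe_def int_endo_def DI_1[OF \<alpha>])
  have ad: "(commutator (Xe \<alpha>) ^^ k) (mat_endo n (\<pi> u)) = mat_endo n (\<pi> ((br (x \<alpha>) ^^ k) u))" for k
    by (induction k) (simp_all add: Xc rep_bracket mat_commutator_def commutator_def mat_endo_diff mat_endo_mult mult_carrier_mat[of _ n n])
  define v where "v = (\<Sum>k<2 * n. scale (t ^ k / fact k) ((br (x \<alpha>) ^^ k) u))"
  have v: "mat_endo n (\<pi> v) = (\<Sum>k<2 * n. scalar_endo (t ^ k / fact k) * mat_endo n (\<pi> ((br (x \<alpha>) ^^ k) u)))"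
  proof -
    have "\<pi> v = mat n n (\<lambda>ij. \<Sum>k<2 * n. (t ^ k / fact k) * \<pi> ((br (x \<alpha>) ^^ k) u) $$ ij)"
      unfolding v_def
      by (intro eq_matI) (auto simp: rep_sum_entry rep_scale carrier_matD[OF rep_carrier])
    thus ?thesis by (simp only:) (rule mat_endo_sum_mat, simp)
  qed
  have c: "ru \<alpha> t * \<pi> u \<in> carrier_mat n n" by (rule mult_carrier_mat[OF ru_carrier rep_carrier])
  have "mat_endo n (ru \<alpha> t * \<pi> u * ru \<alpha> (- t)) = scalar_endo.nexp n (Xe \<alpha>) t * mat_endo n (\<pi> u) * scalar_endo.nexp n (Xe \<alpha>) (- t)"
    by (simp add: ru_group_endo[OF \<alpha>, symmetric] group_endo_mult(2)[of _ n] group_endo_mult(3)[OF _ c])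
  also have "\<dots> = (\<Sum>k<2 * n. scalar_endo (t ^ k / fact k) * (commutator (Xe \<alpha>) ^^ k) (mat_endo n (\<pi> u)))"
    by (rule scalar_endo.nexp_conj_sum[OF n_pos nilpotent[OF \<alpha>] order_refl])
  also have "\<dots> = mat_endo n (\<pi> v)" by (simp only: ad v)
  finally have "ru \<alpha> t * \<pi> u * ru \<alpha> (- t) = \<pi> v"
    using c by (intro mat_endo_inject) auto
  thus ?thesis unfolding adj by blast
qed

lemma EC_conj_rep:
  assumes "B \<in> EC" shows "\<exists>v. B * \<pi> u * adj_mat B = \<pi> v"
  using assms unfolding elementary_group_def
proof (induction arbitrary: u rule: generate.induct)
  case one
  have "adj_mat (1\<^sub>m n) = (1\<^sub>m n :: complex mat)" by (intro adj_unique) auto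
  thus ?case by (intro exI[of _ u]) (simp add: left_mult_one_mat[OF rep_carrier] right_mult_one_mat[OF rep_carrier])
next
  case (incl B)
  thus ?case using ru_conj_rep by auto
next
  case (inv B)
  then obtain \<alpha> t where B: "B = ru \<alpha> t" "\<alpha> \<in> \<Phi>" by auto
  have "inv\<^bsub>SL n\<^esub> B = ru \<alpha> (- t)"
  proof -
    have "adj_mat (ru \<alpha> t) = ru \<alpha> (- t)"
      by (intro adj_unique ru_field_props(3)[OF B(2)]) (use ru_complex_SL[OF B(2), of t] in auto)
    thus ?thesis using SL_inverse[OF ru_complex_SL[OF B(2), of t]] by (simp add: B(1))
  qed
  thus ?case using ru_conj_rep[OF B(2)] by simp
next
  case (eng A B)
  have AB: "A \<in> EC" "B \<in> EC" using eng by (auto simp: elementary_group_def)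
  obtain v where v: "B * \<pi> u * adj_mat B = \<pi> v" using eng by blast
  obtain w where w: "A * \<pi> v * adj_mat A = \<pi> w" using eng by blast
  have "(A * B) * \<pi> u * adj_mat (A * B) = \<pi> w"
    using conj_mult[of A B "\<pi> u"] EC_carrier AB v w by auto
  thus ?case by auto
qed

lemma x_span: "\<exists>c d. v = (\<Sum>\<beta>\<in>\<Phi>. scale (c \<beta>) (x \<beta>)) + (\<Sum>a\<in>\<Delta>. scale (d a) (h a))"
proof -
  have "span (h ` \<Delta> \<union> x ` \<Phi>) = UNIV"
    by (rule basis[unfolded chevalley_basis_def, THEN conjunct2, THEN conjunct2, THEN conjunct2, THEN conjunct2, THEN conjunct1])
  hence "v \<in> span (x ` \<Phi> \<union> h ` \<Delta>)" by (simp add: Un_commute)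
  then obtain v1 v2 where v: "v = v1 + v2" "v1 \<in> span (x ` \<Phi>)" "v2 \<in> span (h ` \<Delta>)"
    unfolding span_Un by auto
  have comb: "\<exists>c. w = (\<Sum>i\<in>I. scale (c i) (f i))" if "w \<in> span (f ` I)" "finite I" for w :: 'l and f :: "'v \<Rightarrow> 'l" and I
    using that(1)
  proof (induction rule: span_induct_alt)
    case base
    show ?case by (rule exI[of _ "\<lambda>_. 0"]) simp
  next
    case (step r y z)
    then obtain i c where i: "i \<in> I" "y = f i" "z = (\<Sum>i\<in>I. scale (c i) (f i))" by blast
    have "scale r y + z = (\<Sum>j\<in>I. scale ((if j = i then r else 0) + c j) (f j))"
    proof -
      have "(\<Sum>j\<in>I. scale (if j = i then r else 0) (f j)) = (\<Sum>j\<in>I. if j = i then scale r (f j) else 0)"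
        by (rule sum.cong) auto
      thus ?thesis using i that(2) by (simp add: scale_left_distrib sum.distrib)
    qed
    thus ?case by (rule exI[of _ "\<lambda>j. (if j = i then r else 0) + c j"])
  qed
  show ?thesis using v comb[OF v(2) finite_roots] comb[OF v(3) finite_base] by blast
qed

abbreviation CG :: "'a::comm_ring_1 mat monoid" where
  "CG \<equiv> chevalley_group n (\<lambda>\<alpha>. \<pi> (x \<alpha>)) \<Phi>"

lemma CG_simps [simp]: "monoid.mult CG = (*)" "one CG = 1\<^sub>m n"
  by (simp_all add: chevalley_group_def SL_def)

lemma CG_carrier_SL: "A \<in> carrier CG \<Longrightarrow> A \<in> carrier_mat n n \<and> det A = 1"
  by (simp add: chevalley_group_def)

text \<open>Points of the Chevalley group satisfy every integral equation valid on the complex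
  elementary group; \<open>poly_pair\<close> spares the explicit polynomial.\<close>

lemma CG_transfer:
  assumes "poly_pair n F G" "\<And>B. B \<in> EC \<Longrightarrow> F B = 0" "A \<in> carrier CG"
  shows "G A = 0"
proof -
  obtain f where f: "f \<in> entry_polys n" "\<forall>A\<in>carrier_mat n n. eval_entry_poly f A = F A"
    "\<forall>A\<in>carrier_mat n n. eval_entry_poly f A = G A" using assms(1) by (auto simp: poly_pair_def)
  have "\<forall>B\<in>EC. eval_entry_poly f B = 0" using f(2) assms(2) EC_carrier by auto
  hence "eval_entry_poly f A = 0" using assms(3) f(1) by (auto simp: chevalley_group_def)
  thus ?thesis using f(3) CG_carrier_SL[OF assms(3)] by auto
qed

lemma CG_adj:
  assumes A: "A \<in> carrier CG" shows "adj_mat A \<in> carrier CG"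
proof -
  note A' = CG_carrier_SL[OF A]
  have "eval_entry_poly f (adj_mat A) = 0"
    if f: "f \<in> entry_polys n" "\<forall>B\<in>EC. eval_entry_poly f B = 0" for f
    by (rule CG_transfer[OF mat_pair_eval[OF f(1) mat_pair_adj] _ A]) (use f(2) EC_adj in auto)
  thus ?thesis using A' adj_mat_inverse(3) adj_mat(1) by (auto simp: chevalley_group_def)
qed

end

context chevalley_representation
begin

text \<open>A point of the group need not be a product of root elements, so no induction on words is
  available. But membership in the span of the Chevalley basis is an integral polynomial condition
  on the conjugated matrix; it holds for complex elementary elements by \<open>EC_conj_rep\<close>
  and transfers.\<close>

lemma CG_conj_lie_span:
  fixes A :: "'f::field_char_0 mat"
  assumes \<alpha>: "\<alpha> \<in> \<Phi>" and A: "A \<in> carrier CG"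
  shows "\<exists>c d. group_endo n A * Xe \<alpha> * group_endo n (adj_mat A)
    = (\<Sum>\<beta>\<in>\<Phi>. scalar_endo (c \<beta>) * Xe \<beta>) + (\<Sum>a\<in>\<Delta>. scalar_endo (d a) * commutator (Xe a) (Xe (- a)))"
proof -
  let ?J = "\<Phi> <+> \<Delta>" and ?I = "{..<n} \<times> {..<n}"
  obtain D l where D: "D \<noteq> 0" and l: "\<And>b b'. b \<in> ?J \<Longrightarrow> b' \<in> ?J \<Longrightarrow>
      (\<Sum>ij\<in>?I. l b ij * basis_mat b' $$ ij) = (if b = b' then D else 0)"
    using basis_dual by blast
  have fin: "finite ?J" using finite_roots finite_base by simp
  define MC where "MC B = B * map_mat of_int (DI \<alpha> 1) * adj_mat B" for B :: "complex mat"
  define MF where "MF B = B * map_mat of_int (DI \<alpha> 1) * adj_mat B" for B :: "'f mat"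
  have pair: "mat_pair n n MC MF"
    unfolding MC_def MF_def by (intro mat_pair_mult mat_pair_id mat_pair_of_int mat_pair_adj DI_carrier)
  have MFc: "MF A \<in> carrier_mat n n" using pair CG_carrier_SL[OF A] by (simp add: mat_pair_def)
  \<comment> \<open>A matrix lies in the span exactly if \<open>D\<close> times it is rebuilt from
    its dual coordinates. The factor \<open>of_int (- 1)\<close> stands for a subtraction, so that
    the expression consists of sums and products only.\<close>
  have rel: "of_int D * MF A $$ (r, s) + of_int (- 1) * (\<Sum>b\<in>?J. (\<Sum>ij\<in>?I. of_int (l b ij) * MF A $$ ij) * of_int (basis_mat b $$ (r, s))) = 0"
    if rs: "r < n" "s < n" for r s
  proof (rule CG_transfer[OF _ _ A])
    show "poly_pair n (\<lambda>B. of_int D * MC B $$ (r, s) + of_int (- 1) * (\<Sum>b\<in>?J. (\<Sum>ij\<in>?I. of_int (l b ij) * MC B $$ ij) * of_int (basis_mat b $$ (r, s))))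
       (\<lambda>B. of_int D * MF B $$ (r, s) + of_int (- 1) * (\<Sum>b\<in>?J. (\<Sum>ij\<in>?I. of_int (l b ij) * MF B $$ ij) * of_int (basis_mat b $$ (r, s))))"
    proof (intro poly_pair_add poly_pair_mult poly_pair_sum poly_pair_const)
      show "poly_pair n (\<lambda>B. MC B $$ (r, s)) (\<lambda>B. MF B $$ (r, s))" using pair rs by (simp add: mat_pair_def)
      fix ij assume "ij \<in> ?I"
      thus "poly_pair n (\<lambda>B. MC B $$ ij) (\<lambda>B. MF B $$ ij)" using pair by (auto simp: mat_pair_def)
    qed
    fix B assume "B \<in> EC"
    then obtain v where v: "MC B = \<pi> v" unfolding MC_def DI_1[OF \<alpha>] using EC_conj_rep by blast
    obtain c d where cd: "v = (\<Sum>\<beta>\<in>\<Phi>. scale (c \<beta>) (x \<beta>)) + (\<Sum>a\<in>\<Delta>. scale (d a) (h a))" using x_span by blast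
    define e where "e b = (case b of Inl \<beta> \<Rightarrow> c \<beta> | Inr a \<Rightarrow> d a)" for b
    have entry: "MC B $$ ij = (\<Sum>b\<in>?J. e b * of_int (basis_mat b $$ ij))" if mem: "ij \<in> ?I" for ij
    proof -
      obtain i j where ij: "ij = (i, j)" "i < n" "j < n" using mem by (cases ij) auto
      note dm = carrier_matD[OF rep_carrier] carrier_matD[OF DI_carrier] carrier_matD[OF Hmat_carrier]
      have 1: "\<pi> (x \<beta>) $$ (i, j) = of_int (DI \<beta> 1 $$ (i, j))" if "\<beta> \<in> \<Phi>" for \<beta>
        using ij dm by (simp flip: DI_1[OF that])
      have 2: "\<pi> (h a) $$ (i, j) = of_int (Hmat a $$ (i, j))" if "a \<in> \<Delta>" for a
      proof -
        have "\<pi> (h a) = map_mat of_int (Hmat a)"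
          using Hmat_complex[OF base_root[OF that]] base_coroot_bracket[OF that] by simp
        thus ?thesis using ij dm by simp
      qed
      have "MC B $$ ij = (\<Sum>\<beta>\<in>\<Phi>. c \<beta> * of_int (DI \<beta> 1 $$ (i, j))) + (\<Sum>a\<in>\<Delta>. d a * of_int (Hmat a $$ (i, j)))"
        unfolding v cd using ij dm by (simp add: rep_add rep_sum_entry rep_scale 1 2 del: One_nat_def)
      thus ?thesis using ij finite_roots finite_base by (simp add: sum.Plus e_def del: One_nat_def)
    qed
    have coef: "(\<Sum>ij\<in>?I. of_int (l b ij) * MC B $$ ij) = e b * of_int D" if b: "b \<in> ?J" for b
    proof -
      have "(\<Sum>ij\<in>?I. of_int (l b ij) * MC B $$ ij) = (\<Sum>ij\<in>?I. of_int (l b ij) * (\<Sum>b'\<in>?J. e b' * of_int (basis_mat b' $$ ij)))"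
        by (rule sum.cong) (simp_all add: entry)
      also have "\<dots> = (\<Sum>b'\<in>?J. e b' * of_int (\<Sum>ij\<in>?I. l b ij * basis_mat b' $$ ij))"
        by (simp only: sum_distrib_left of_int_sum of_int_mult mult.left_commute) (rule sum.swap)
      also have "\<dots> = (\<Sum>b'\<in>?J. if b' = b then e b' * of_int D else 0)"
        using b by (intro sum.cong) (auto simp: l)
      finally show ?thesis using b fin by simp
    qed
    have "(\<Sum>b\<in>?J. (\<Sum>ij\<in>?I. of_int (l b ij) * MC B $$ ij) * of_int (basis_mat b $$ (r, s)))
        = (\<Sum>b\<in>?J. e b * of_int D * of_int (basis_mat b $$ (r, s)))"
      by (rule sum.cong) (simp_all add: coef)
    also have "\<dots> = of_int D * MC B $$ (r, s)" using rs by (simp add: entry sum_distrib_left ac_simps)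
    finally show "of_int D * MC B $$ (r, s) + of_int (- 1) * (\<Sum>b\<in>?J. (\<Sum>ij\<in>?I. of_int (l b ij) * MC B $$ ij) * of_int (basis_mat b $$ (r, s))) = 0"
      by simp
  qed
  define e where "e b = (\<Sum>ij\<in>?I. of_int (l b ij) * MF A $$ ij) / of_int D" for b
  have "MF A = mat n n (\<lambda>rs. \<Sum>b\<in>?J. e b * map_mat of_int (basis_mat b) $$ rs)"
  proof (rule eq_matI)
    fix r s assume "r < dim_row (mat n n (\<lambda>rs. \<Sum>b\<in>?J. e b * map_mat of_int (basis_mat b) $$ rs))"
      "s < dim_col (mat n n (\<lambda>rs. \<Sum>b\<in>?J. e b * map_mat of_int (basis_mat b) $$ rs))"
    hence rs: "r < n" "s < n" by auto
    have "of_int D * MF A $$ (r, s) = (\<Sum>b\<in>?J. of_int D * e b * of_int (basis_mat b $$ (r, s)))"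
      using rel[OF rs] D by (simp add: e_def)
    also have "\<dots> = of_int D * (\<Sum>b\<in>?J. e b * of_int (basis_mat b $$ (r, s)))" by (simp add: sum_distrib_left mult.assoc)
    finally have "MF A $$ (r, s) = (\<Sum>b\<in>?J. e b * of_int (basis_mat b $$ (r, s)))" using D by simp
    thus "MF A $$ (r, s) = mat n n (\<lambda>rs. \<Sum>b\<in>?J. e b * map_mat of_int (basis_mat b) $$ rs) $$ (r, s)"
      using rs carrier_matD[OF basis_mat_carrier] by simp
  qed (use MFc in auto)
  hence "mat_endo n (MF A) = (\<Sum>b\<in>?J. scalar_endo (e b) * int_endo n (basis_mat b))"
    unfolding int_endo_def by (simp only:) (rule mat_endo_sum_mat, simp)
  also have "\<dots> = (\<Sum>\<beta>\<in>\<Phi>. scalar_endo (e (Inl \<beta>)) * Xe \<beta>) + (\<Sum>a\<in>\<Delta>. scalar_endo (e (Inr a)) * commutator (Xe a) (Xe (- a)))"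
    using finite_roots finite_base by (simp add: sum.Plus commutator_Xe_minus Xe_def[symmetric] del: One_nat_def)
  also have "mat_endo n (MF A) = group_endo n A * Xe \<alpha> * group_endo n (adj_mat A)"
  proof -
    have c: "A \<in> carrier_mat n n" "adj_mat A \<in> carrier_mat n n" using CG_carrier_SL[OF A] adj_mat(1) by auto
    have c2: "A * map_mat of_int (DI \<alpha> 1) \<in> carrier_mat n n" by (rule mult_carrier_mat[OF c(1)]) simp
    have c3: "map_mat of_int (DI \<alpha> 1) \<in> carrier_mat n n" by simp
    show ?thesis unfolding Xe_def int_endo_def MF_def
      by (simp only: group_endo_mult(2)[OF c(1) c3] group_endo_mult(3)[OF c(2) c2])
  qed
  finally show ?thesis by (intro exI)
qed

lemma ru_elementary: "\<alpha> \<in> \<Phi> \<Longrightarrow> ru \<alpha> t \<in> elementary_group n (\<lambda>\<alpha>. \<pi> (x \<alpha>)) \<Phi>"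
  unfolding elementary_group_def by (rule generate.incl) auto

section \<open>Large subgroups as groups of matrices\<close>

context
  fixes K :: "'a::comm_ring_1 mat set"
  assumes K: "large_subgroup n (\<lambda>\<alpha>. \<pi> (x \<alpha>)) \<Phi> K"
begin

lemma large_CG: "A \<in> K \<Longrightarrow> A \<in> carrier CG"
  using K subgroup.subset unfolding large_subgroup_def by blast

lemma large_carrier: "A \<in> K \<Longrightarrow> A \<in> carrier_mat n n" "A \<in> K \<Longrightarrow> det A = 1"
  using CG_carrier_SL large_CG by blast+

lemma large_one: "1\<^sub>m n \<in> K"
  using K subgroup.one_closed[of K CG] by (simp add: large_subgroup_def)

lemma large_mult: "A \<in> K \<Longrightarrow> B \<in> K \<Longrightarrow> A * B \<in> K"
  using K subgroup.m_closed[of K CG A B] by (simp add: large_subgroup_def)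

lemma large_elementary: "elementary_group n (\<lambda>\<alpha>. \<pi> (x \<alpha>)) \<Phi> \<subseteq> K"
  using K by (simp add: large_subgroup_def)

lemma large_ru: "\<alpha> \<in> \<Phi> \<Longrightarrow> ru \<alpha> t \<in> K"
  using ru_elementary large_elementary by blast

lemma large_adj: assumes A: "A \<in> K" shows "adj_mat A \<in> K"
proof -
  note c = large_carrier[OF A]
  have "inv\<^bsub>CG\<^esub> A = adj_mat A" unfolding m_inv_def
  proof (rule the_equality)
    show "adj_mat A \<in> carrier CG \<and> A \<otimes>\<^bsub>CG\<^esub> adj_mat A = \<one>\<^bsub>CG\<^esub> \<and> adj_mat A \<otimes>\<^bsub>CG\<^esub> A = \<one>\<^bsub>CG\<^esub>"
      using CG_adj[OF large_CG[OF A]] adj_mat_inverse[OF c] by simp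
    fix B assume "B \<in> carrier CG \<and> A \<otimes>\<^bsub>CG\<^esub> B = \<one>\<^bsub>CG\<^esub> \<and> B \<otimes>\<^bsub>CG\<^esub> A = \<one>\<^bsub>CG\<^esub>"
    thus "B = adj_mat A" using adj_unique[OF c(1) _ c(2), of B] CG_carrier_SL by auto
  qed
  thus ?thesis using subgroup.m_inv_closed[of K CG A] K A by (simp add: large_subgroup_def)
qed

lemma large_group: "group (CG\<lparr>carrier := K\<rparr>)"
proof (rule groupI)
  fix A assume "A \<in> carrier (CG\<lparr>carrier := K\<rparr>)"
  hence A: "A \<in> K" by simp
  show "\<exists>B\<in>carrier (CG\<lparr>carrier := K\<rparr>). B \<otimes>\<^bsub>CG\<lparr>carrier := K\<rparr>\<^esub> A = \<one>\<^bsub>CG\<lparr>carrier := K\<rparr>\<^esub>"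
    using large_adj[OF A] adj_mat_inverse(2)[OF large_carrier[OF A]] by (intro bexI[of _ "adj_mat A"]) simp_all
  show "\<one>\<^bsub>CG\<lparr>carrier := K\<rparr>\<^esub> \<otimes>\<^bsub>CG\<lparr>carrier := K\<rparr>\<^esub> A = A" using large_carrier[OF A] by simp
  fix B C assume "B \<in> carrier (CG\<lparr>carrier := K\<rparr>)" "C \<in> carrier (CG\<lparr>carrier := K\<rparr>)"
  hence BC: "B \<in> K" "C \<in> K" by simp_all
  show "A \<otimes>\<^bsub>CG\<lparr>carrier := K\<rparr>\<^esub> B \<otimes>\<^bsub>CG\<lparr>carrier := K\<rparr>\<^esub> C = A \<otimes>\<^bsub>CG\<lparr>carrier := K\<rparr>\<^esub> (B \<otimes>\<^bsub>CG\<lparr>carrier := K\<rparr>\<^esub> C)"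
    using assoc_mult_mat[OF large_carrier(1)[OF A] large_carrier(1)[OF BC(1)] large_carrier(1)[OF BC(2)]] by simp
qed (simp_all add: large_mult large_one)

end

lemma large_group_embedding:
  assumes K: "large_subgroup n (\<lambda>\<alpha>. \<pi> (x \<alpha>)) \<Phi> (K :: 'a::comm_ring_1 mat set)" and cs: "set cs \<subseteq> K"
    and inj: "inj_on \<iota> K" and mult: "\<And>A B. A \<in> K \<Longrightarrow> B \<in> K \<Longrightarrow> \<iota> (A * B) = \<iota> A * \<iota> B" and one: "\<iota> (1\<^sub>m n) = 1\<^sub>m n"
    and car: "\<And>A. A \<in> K \<Longrightarrow> \<iota> A \<in> carrier_mat n n"
  shows "group_embedding (CG\<lparr>carrier := K\<rparr>) (\<lambda>A. group_endo n (\<iota> A :: 'b::comm_ring_1 mat)) cs"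
proof -
  interpret group "CG\<lparr>carrier := K\<rparr>" by (rule large_group[OF K])
  show ?thesis
  proof unfold_locales
    fix A B assume AB: "A \<in> carrier (CG\<lparr>carrier := K\<rparr>)" "B \<in> carrier (CG\<lparr>carrier := K\<rparr>)"
    show "group_endo n (\<iota> (A \<otimes>\<^bsub>CG\<lparr>carrier := K\<rparr>\<^esub> B)) = group_endo n (\<iota> A) * group_endo n (\<iota> B)"
      using AB car by (simp add: mult group_endo_mult(1)[of _ n])
    assume "group_endo n (\<iota> A) = group_endo n (\<iota> B)"
    hence "\<iota> A = \<iota> B" using AB car by (intro group_endo_inject[of _ n]) auto
    thus "A = B" using AB inj by (auto dest: inj_onD)
  qed (use cs one in \<open>simp_all add: group_endo_one\<close>)
qed

end

subsection \<open>Bounded sets of root elements cut out by equations\<close>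

context chev_alg
begin

lemma central_pair_mult:
  assumes "central_pair z z'" "central_pair w w'" shows "central_pair (z * w) (w' * z')"
proof -
  have "z * w * (w' * z') = z * (w * w') * z'" "w' * z' * (z * w) = w' * (z' * z) * w" by (simp_all add: mult.assoc)
  moreover have "z * w * X \<alpha> = X \<alpha> * (z * w)" if "\<alpha> \<in> \<Phi>" for \<alpha>
  proof -
    have "z * w * X \<alpha> = z * (X \<alpha> * w)" using assms(2) that by (simp add: central_pair_def mult.assoc)
    also have "\<dots> = (X \<alpha> * z) * w" using assms(1) that by (simp add: central_pair_def flip: mult.assoc)
    finally show ?thesis by (simp add: mult.assoc)
  qed
  ultimately show ?thesis using assms by (simp add: central_pair_def)
qed

lemma central_pair_xr: "central_pair z z' \<Longrightarrow> \<alpha> \<in> \<Phi> \<Longrightarrow> z * xr \<alpha> t = xr \<alpha> t * z"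
  by (rule central_commutes_xr) (auto simp: central_pair_def)

lemma central_pair_xr_left: "central_pair z z' \<Longrightarrow> \<alpha> \<in> \<Phi> \<Longrightarrow> xr \<alpha> t * (z * y) = z * (xr \<alpha> t * y)"
  by (simp add: central_pair_xr flip: mult.assoc)

text \<open>\<open>root_coset \<gamma> A A' t\<close>: up to a central factor, \<open>A\<close> (with inverse \<open>A'\<close>) is \<open>x\<^sub>\<gamma>(t)\<close>.\<close>

definition root_coset :: "'v \<Rightarrow> 'e \<Rightarrow> 'e \<Rightarrow> 'f \<Rightarrow> bool" where
  "root_coset \<gamma> A A' t \<longleftrightarrow> (\<exists>z z'. central_pair z z' \<and> A = z * xr \<gamma> t \<and> A' = xr \<gamma> (- t) * z')"

lemma root_coset_xr: "root_coset \<gamma> (xr \<gamma> t) (xr \<gamma> (- t)) t"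
  unfolding root_coset_def by (intro exI[of _ 1]) (simp add: central_pair_def)

text \<open>Commuting with \<open>xr \<sigma> 1\<close> is the same as commuting with
  \<open>X \<sigma>\<close>. By \<open>long_group_centralizer\<close> a product
  \<open>xr \<gamma> t * A\<close> is central, so \<open>A\<close> has the parameter
  \<open>- t\<close>.\<close>

lemma root_coset_if_commutes:
  assumes \<gamma>: "long \<gamma>" and inv: "A * A' = 1" "A' * A = 1"
    and comm: "\<And>\<sigma>. \<sigma> \<in> \<Phi> \<Longrightarrow> cartan_number \<sigma> \<gamma> \<ge> 0 \<Longrightarrow> A * xr \<sigma> 1 = xr \<sigma> 1 * A"
    and span: "A * X (- \<gamma>) * A' \<in> lie_span"
  shows "\<exists>t. root_coset \<gamma> A A' t"
proof -
  have \<gamma>\<Phi>: "\<gamma> \<in> \<Phi>" using \<gamma> by (rule long_root)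
  have "A * X \<sigma> = X \<sigma> * A" if "\<sigma> \<in> \<Phi>" "cartan_number \<sigma> \<gamma> \<ge> 0" for \<sigma>
    using comm[OF that] commutes_xr_iff[OF that(1), of 1 A] by simp
  from long_group_centralizer[OF \<gamma> inv this span] obtain t
    where t: "\<forall>\<alpha>\<in>\<Phi>. (xr \<gamma> t * A) * X \<alpha> = X \<alpha> * (xr \<gamma> t * A)" by blast
  define z where "z = xr \<gamma> t * A"
  define z' where "z' = A' * xr \<gamma> (- t)"
  have "z * z' = xr \<gamma> t * (A * A') * xr \<gamma> (- t)" "z' * z = A' * (xr \<gamma> (- t) * xr \<gamma> t) * A"
    by (simp_all add: z_def z'_def mult.assoc)
  hence cp: "central_pair z z'" using inv xr_inverse[OF \<gamma>\<Phi>] t by (simp add: central_pair_def z_def)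
  have "xr \<gamma> (- t) * z = A" "z' * xr \<gamma> t = A'"
    using xr_inverse[OF \<gamma>\<Phi>, of t] by (simp_all add: z_def z'_def mult.assoc) (simp add: mult.assoc[symmetric])
  hence "A = z * xr \<gamma> (- t)" "A' = xr \<gamma> (- (- t)) * z'"
    using central_pair_xr[OF cp \<gamma>\<Phi>] central_pair_xr[OF central_pair_swap[OF cp] \<gamma>\<Phi>] by simp_all
  thus ?thesis using cp unfolding root_coset_def by blast
qed

lemma root_coset_commutes:
  assumes "root_coset \<gamma> A A' t" "long \<gamma>" "\<sigma> \<in> \<Phi>" "cartan_number \<sigma> \<gamma> \<ge> 0"
  shows "A * xr \<sigma> s = xr \<sigma> s * A"
proof -
  have \<gamma>\<Phi>: "\<gamma> \<in> \<Phi>" using assms by (simp add: long_root)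
  have "commutator (X \<gamma>) (X \<sigma>) = 0"
    using long_add_not_root[OF assms(2-4)] by (intro bracket_zero \<gamma>\<Phi> assms(3)) (auto simp: add.commute)
  hence "X \<sigma> * X \<gamma> = X \<gamma> * X \<sigma>" by (simp add: commutator_eq_0_iff)
  hence "X \<sigma> * xr \<gamma> t = xr \<gamma> t * X \<sigma>" using commutes_xr_iff[OF \<gamma>\<Phi>, of t "X \<sigma>"] by (cases "t = 0") (auto simp: xr_0 \<gamma>\<Phi>)
  hence "xr \<gamma> t * xr \<sigma> s = xr \<sigma> s * xr \<gamma> t"
    using commutes_xr_iff[OF assms(3), of s "xr \<gamma> t"] by (cases "s = 0") (auto simp: xr_0 assms(3))
  moreover obtain z z' where "central_pair z z'" "A = z * xr \<gamma> t" using assms(1) by (auto simp: root_coset_def)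
  ultimately show ?thesis using central_pair_xr[OF _ assms(3), of z z' s] by (simp add: mult.assoc) (simp flip: mult.assoc)
qed

lemma root_coset_mult:
  assumes "root_coset \<gamma> A A' s" "root_coset \<gamma> B B' t" "\<gamma> \<in> \<Phi>"
  shows "root_coset \<gamma> (A * B) (B' * A') (s + t)"
proof -
  obtain z z' w w' where zw: "central_pair z z'" "A = z * xr \<gamma> s" "A' = xr \<gamma> (- s) * z'"
    "central_pair w w'" "B = w * xr \<gamma> t" "B' = xr \<gamma> (- t) * w'"
    using assms(1,2) by (auto simp: root_coset_def)
  note cw = central_pair_xr[OF zw(4) assms(3)] central_pair_xr[OF central_pair_swap[OF zw(4)] assms(3)]
  have "A * B = z * (xr \<gamma> s * w) * xr \<gamma> t" by (simp add: zw mult.assoc)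
  also have "\<dots> = (z * w) * xr \<gamma> (s + t)" by (simp add: xr_add assms(3) mult.assoc flip: cw)
  finally have 1: "A * B = (z * w) * xr \<gamma> (s + t)" .
  have "B' * A' = xr \<gamma> (- t) * (w' * xr \<gamma> (- s)) * z'" by (simp add: zw mult.assoc)
  also have "\<dots> = (xr \<gamma> (- t) * xr \<gamma> (- s)) * (w' * z')" by (simp add: cw mult.assoc)
  also have "xr \<gamma> (- t) * xr \<gamma> (- s) = xr \<gamma> (- (s + t))" using xr_add[OF assms(3), of "- t" "- s"] by (simp add: add.commute)
  finally have 2: "B' * A' = xr \<gamma> (- (s + t)) * (w' * z')" .
  show ?thesis unfolding root_coset_def using central_pair_mult[OF zw(1,4)] 1 2 by blast
qed

lemma root_coset_power:
  assumes "root_coset \<gamma> A A' t" "\<gamma> \<in> \<Phi>"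
  shows "root_coset \<gamma> (A ^ k) (A' ^ k) (of_nat k * t)"
proof (induction k)
  case 0
  show ?case using root_coset_xr[of \<gamma> 0] xr_0[OF assms(2)] by simp
next
  case (Suc k)
  from root_coset_mult[OF assms(1) Suc assms(2)] show ?case by (simp add: power_commutes algebra_simps)
qed

text \<open>\<open>x\<^sub>\<gamma>(t)\<close> moves \<open>X (\<alpha> - \<gamma>)\<close> by \<open>t X \<alpha>\<close>, up to sign.\<close>

lemma central_xr_trivial:
  assumes \<gamma>: "long \<gamma>" and \<alpha>: "\<alpha> \<in> \<Phi>" "cartan_number \<alpha> \<gamma> = 1"
    and c: "xr \<gamma> t * X (\<alpha> - \<gamma>) = X (\<alpha> - \<gamma>) * xr \<gamma> t"
  shows "t = 0"
proof -
  have \<gamma>\<Phi>: "\<gamma> \<in> \<Phi>" using \<gamma> by (rule long_root)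
  obtain e :: int where e: "e * e = 1" "commutator (X \<gamma>) (X (\<alpha> - \<gamma>)) = sc (of_int e) * X \<alpha>" "commutator (X \<gamma>) (X \<alpha>) = 0"
    using long_pair[OF \<gamma> \<alpha>] by blast
  have "xr \<gamma> t * X (\<alpha> - \<gamma>) * xr \<gamma> (- t) = X (\<alpha> - \<gamma>) + sc t * (sc (of_int e) * X \<alpha>)"
    by (rule xr_conj2[OF \<gamma>\<Phi> e(2)]) (simp add: commutator_sc e(3))
  moreover have "xr \<gamma> t * X (\<alpha> - \<gamma>) * xr \<gamma> (- t) = X (\<alpha> - \<gamma>)"
    unfolding c by (simp add: mult.assoc xr_inverse[OF \<gamma>\<Phi>])
  ultimately have "sc (t * of_int e) * X \<alpha> = 0" by (simp add: sc_sc)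
  hence "t * of_int e = 0" using X_nonzero[OF \<alpha>(1)] by (simp add: sc_eq_0_iff)
  moreover have "e \<noteq> 0" using e(1) by auto
  ultimately show ?thesis by simp
qed

text \<open>The central factor of \<open>A ^ N\<close> is itself the root element with parameter
  \<open>1 - N t\<close>. A central root element is trivial, so the parameter is
  \<open>1 / N\<close> in spite of the central ambiguity of \<open>A\<close>.\<close>

lemma root_coset_root_of_unit:
  assumes \<gamma>: "long \<gamma>" and \<alpha>: "\<alpha> \<in> \<Phi>" "cartan_number \<alpha> \<gamma> = 1"
    and A: "root_coset \<gamma> A A' t" and pow: "A ^ N = xr \<gamma> 1"
  shows "of_nat N * t = 1"
proof -
  have \<gamma>\<Phi>: "\<gamma> \<in> \<Phi>" using \<gamma> by (rule long_root)
  obtain z z' where z: "central_pair z z'" "A ^ N = z * xr \<gamma> (of_nat N * t)"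
    using root_coset_power[OF A \<gamma>\<Phi>, of N] by (auto simp: root_coset_def)
  have "z = z * xr \<gamma> (of_nat N * t) * xr \<gamma> (- (of_nat N * t))" by (simp add: mult.assoc xr_inverse[OF \<gamma>\<Phi>])
  also have "\<dots> = xr \<gamma> (1 - of_nat N * t)" using z(2) pow xr_add[OF \<gamma>\<Phi>, of 1 "- (of_nat N * t)"] by simp
  finally have "xr \<gamma> (1 - of_nat N * t) * X (\<alpha> - \<gamma>) = X (\<alpha> - \<gamma>) * xr \<gamma> (1 - of_nat N * t)"
    using z(1) long_sub_root[OF \<gamma> \<alpha>] by (simp add: central_pair_def)
  from central_xr_trivial[OF \<gamma> \<alpha> this] show ?thesis by simp
qed

text \<open>Both equations say that the inverse of \<open>h P\<close> times \<open>P h\<close>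
  commutes with the conjugated element, and commuting with \<open>xr \<alpha> 1\<close> or with
  \<open>X \<alpha>\<close> is the same.\<close>

lemma conj_equation_iff:
  assumes \<alpha>: "\<alpha> \<in> \<Phi>" and P: "P * P' = 1" "P' * P = 1" and h: "h * h' = 1" "h' * h = 1"
  shows "P * h * xr \<alpha> 1 * h' * P' = h * P * xr \<alpha> 1 * P' * h' \<longleftrightarrow> P * h * X \<alpha> * h' * P' = h * P * X \<alpha> * P' * h'"
proof -
  define W where "W = (P' * h') * (P * h)"
  have red: "P * h * M * h' * P' = h * P * M * P' * h' \<longleftrightarrow> W * M = M * W" for M
  proof
    assume eq: "P * h * M * h' * P' = h * P * M * P' * h'"
    have "W * M = P' * h' * (P * h * M * (h' * (P' * P) * h))" by (simp add: W_def mult.assoc P h)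
    also have "\<dots> = P' * h' * (P * h * M * h' * P') * (P * h)" by (simp add: mult.assoc)
    also have "\<dots> = P' * (h' * h) * P * M * (P' * h' * (P * h))" unfolding eq by (simp add: mult.assoc)
    finally show "W * M = M * W" by (simp add: P h W_def mult.assoc)
  next
    assume eq: "W * M = M * W"
    have "P * h * M * h' * P' = h * (P * P') * h' * (P * h) * M * h' * P'" by (simp add: P h)
    also have "\<dots> = h * P * (W * M) * h' * P'" by (simp add: W_def mult.assoc)
    also have "\<dots> = h * P * M * P' * h' * (P * (h * h') * P')" unfolding eq by (simp add: W_def mult.assoc)
    finally show "P * h * M * h' * P' = h * P * M * P' * h'" by (simp add: P h)
  qed
  show ?thesis unfolding red using commutes_xr_iff[OF \<alpha>, of 1 W] by simp
qed

lemma pair_context: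
  assumes "long \<gamma>" "\<alpha> \<in> \<Phi>" "cartan_number \<alpha> \<gamma> = 1"
  obtains e :: int where "e * e = 1" "commutator (X (- \<gamma>)) (X \<alpha>) = sc (of_int e) * X (\<alpha> - \<gamma>)"
    "commutator (X (- \<gamma>)) (X (\<alpha> - \<gamma>)) = 0" "commutator (X \<gamma>) (X (\<alpha> - \<gamma>)) = sc (of_int e) * X \<alpha>"
    "commutator (X \<gamma>) (X \<alpha>) = 0"
  using long_pair[OF assms] by blast

text \<open>\<open>h\<close> lies in an anisotropic torus of the \<open>SL\<^sub>2\<close> belonging to \<open>\<gamma>\<close>.  The equation says that \<open>P\<close> commutes
  with \<open>h\<close> on the two-dimensional module containing \<open>X \<alpha>\<close>, which puts \<open>P\<close> into that torus.\<close>

definition torus_equation :: "'v \<Rightarrow> 'v \<Rightarrow> int \<Rightarrow> 'f \<Rightarrow> 'e \<Rightarrow> 'e \<Rightarrow> bool" where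
  "torus_equation \<gamma> \<alpha> e p P P' \<longleftrightarrow>
    (let h = xr (- \<gamma>) (of_int e * p) * xr \<gamma> (of_int e); h' = xr \<gamma> (- of_int e) * xr (- \<gamma>) (- (of_int e * p))
     in P * h * xr \<alpha> 1 * h' * P' = h * P * xr \<alpha> 1 * P' * h')"

text \<open>A central factor of \<open>P\<close> commutes with \<open>h\<close>, so on both sides it
  becomes the outermost conjugation and cancels.\<close>

lemma torus_equation_iff:
  assumes \<gamma>: "long \<gamma>" and \<alpha>: "\<alpha> \<in> \<Phi>" and P: "fst ` set ws \<subseteq> \<Phi>" and z: "central_pair z z'"
  shows "torus_equation \<gamma> \<alpha> e p (z * xword ws) (xword (xword_inv ws) * z') \<longleftrightarrow>
    conj_word (ws @ [(- \<gamma>, of_int e * p), (\<gamma>, of_int e * 1)]) (X \<alpha>)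
      = conj_word ([(- \<gamma>, of_int e * p), (\<gamma>, of_int e * 1)] @ ws) (X \<alpha>)"
proof -
  have \<gamma>\<Phi>: "\<gamma> \<in> \<Phi>" "- \<gamma> \<in> \<Phi>" using \<gamma> long_root root_minus by blast+
  let ?hs = "[(- \<gamma>, of_int e * p), (\<gamma>, of_int e * 1)]"
  define h h' Q Q' where "h = xword ?hs" and "h' = xword (xword_inv ?hs)" and "Q = xword ws" and "Q' = xword (xword_inv ws)"
  have h_eq: "h = xr (- \<gamma>) (of_int e * p) * xr \<gamma> (of_int e)" "h' = xr \<gamma> (- of_int e) * xr (- \<gamma>) (- (of_int e * p))"
    by (simp_all add: h_def h'_def xword_def xword_inv_def)
  have hh: "h * h' = 1" "h' * h = 1" unfolding h_def h'_def by (rule xword_inverse; use \<gamma>\<Phi> in simp)+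
  have QQ: "Q * Q' = 1" "Q' * Q = 1" unfolding Q_def Q'_def by (rule xword_inverse[OF P])+
  have zz: "z * z' = 1" "z' * z = 1" using z by (auto simp: central_pair_def)
  have zh: "z * h = h * z" "z' * h' = h' * z'"
  proof -
    note c = central_pair_xr[OF z \<gamma>\<Phi>(1)] central_pair_xr[OF z \<gamma>\<Phi>(2)]
      central_pair_xr[OF central_pair_swap[OF z] \<gamma>\<Phi>(1)] central_pair_xr[OF central_pair_swap[OF z] \<gamma>\<Phi>(2)]
    have "z * h = (z * xr (- \<gamma>) (of_int e * p)) * xr \<gamma> (of_int e)" by (simp add: h_eq mult.assoc)
    also have "\<dots> = xr (- \<gamma>) (of_int e * p) * (z * xr \<gamma> (of_int e))" by (simp add: c mult.assoc)
    finally show "z * h = h * z" by (simp add: c h_eq mult.assoc)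
    have "z' * h' = (z' * xr \<gamma> (- of_int e)) * xr (- \<gamma>) (- (of_int e * p))" by (simp add: h_eq mult.assoc)
    also have "\<dots> = xr \<gamma> (- of_int e) * (z' * xr (- \<gamma>) (- (of_int e * p)))" by (simp add: c mult.assoc)
    finally show "z' * h' = h' * z'" by (simp add: c h_eq mult.assoc)
  qed
  have PP: "(z * Q) * (Q' * z') = 1" "(Q' * z') * (z * Q) = 1"
  proof -
    have "(z * Q) * (Q' * z') = z * (Q * Q') * z'" "(Q' * z') * (z * Q) = Q' * (z' * z) * Q" by (simp_all add: mult.assoc)
    thus "(z * Q) * (Q' * z') = 1" "(Q' * z') * (z * Q) = 1" using QQ zz by simp_all
  qed
  have L: "z * Q * h * X \<alpha> * h' * (Q' * z') = z * conj_word (ws @ ?hs) (X \<alpha>) * z'"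
    by (simp add: conj_word_def xword_append xword_inv_append Q_def Q'_def h_def h'_def mult.assoc)
  have R: "h * (z * Q) * X \<alpha> * (Q' * z') * h' = z * conj_word (?hs @ ws) (X \<alpha>) * z'"
  proof -
    have "h * (z * Q) * X \<alpha> * (Q' * z') * h' = (h * z) * Q * X \<alpha> * Q' * (z' * h')" by (simp add: mult.assoc)
    also have "\<dots> = z * (h * Q * X \<alpha> * Q' * h') * z'" unfolding zh(1)[symmetric] zh(2) by (simp add: mult.assoc)
    finally show ?thesis
      unfolding conj_word_def xword_append xword_inv_append Q_def Q'_def h_def h'_def by (simp only: mult.assoc)
  qed
  have cancel: "z * M * z' = z * N * z' \<longleftrightarrow> M = N" for M N
  proof
    assume "z * M * z' = z * N * z'"
    hence "z' * (z * M * z') * z = z' * (z * N * z') * z" by simp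
    moreover have "z' * (z * M * z') * z = (z' * z) * M * (z' * z)" for M by (simp add: mult.assoc)
    ultimately show "M = N" by (simp add: zz)
  qed simp
  have "torus_equation \<gamma> \<alpha> e p (z * Q) (Q' * z') \<longleftrightarrow>
      z * Q * h * xr \<alpha> 1 * h' * (Q' * z') = h * (z * Q) * xr \<alpha> 1 * (Q' * z') * h'"
    unfolding torus_equation_def Let_def h_eq[symmetric] ..
  also have "\<dots> \<longleftrightarrow> z * Q * h * X \<alpha> * h' * (Q' * z') = h * (z * Q) * X \<alpha> * (Q' * z') * h'"
    by (rule conj_equation_iff[OF \<alpha> PP hh])
  finally show ?thesis unfolding L R cancel unfolding Q_def Q'_def .
qed

lemma torus_sound:
  assumes \<gamma>: "long \<gamma>" and \<alpha>: "\<alpha> \<in> \<Phi>" "cartan_number \<alpha> \<gamma> = 1"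
    and e: "e * e = 1" "commutator (X (- \<gamma>)) (X \<alpha>) = sc (of_int e) * X (\<alpha> - \<gamma>)"
      "commutator (X (- \<gamma>)) (X (\<alpha> - \<gamma>)) = 0" "commutator (X \<gamma>) (X (\<alpha> - \<gamma>)) = sc (of_int e) * X \<alpha>"
      "commutator (X \<gamma>) (X \<alpha>) = 0"
    and p: "p \<noteq> 0"
    and A: "root_coset \<gamma> A A' a" and B: "root_coset (- \<gamma>) B B' b" and C: "root_coset \<gamma> C C' c"
    and eq: "torus_equation \<gamma> \<alpha> e p (A * B * C) (C' * B' * A')"
  shows "\<exists>u v. of_int e * b = p * v \<and> u\<^sup>2 + p * u * v - p * v\<^sup>2 = 1"
proof -
  have \<gamma>\<Phi>: "\<gamma> \<in> \<Phi>" "- \<gamma> \<in> \<Phi>" using \<gamma> long_root root_minus by blast+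
  obtain z1 z1' z2 z2' z3 z3' where z: "central_pair z1 z1'" "A = z1 * xr \<gamma> a" "A' = xr \<gamma> (- a) * z1'"
    "central_pair z2 z2'" "B = z2 * xr (- \<gamma>) b" "B' = xr (- \<gamma>) (- b) * z2'"
    "central_pair z3 z3'" "C = z3 * xr \<gamma> c" "C' = xr \<gamma> (- c) * z3'"
    using A B C unfolding root_coset_def by blast
  let ?ws = "[(\<gamma>, a), (- \<gamma>, b), (\<gamma>, c)]"

  have 1: "A * B * C = (z1 * z2 * z3) * xword ?ws"
    using \<gamma>\<Phi> by (simp add: z(2,5,8) xword_def mult.assoc central_pair_xr_left[OF z(4)] central_pair_xr_left[OF z(7)])
  note sw = z(1)[THEN central_pair_swap] z(4)[THEN central_pair_swap] z(7)[THEN central_pair_swap]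
  have 2: "C' * B' * A' = xword (xword_inv ?ws) * (z3' * (z2' * z1'))"
    using \<gamma>\<Phi> by (simp add: z(3,6,9) xword_def xword_inv_def mult.assoc sw[THEN central_pair_xr_left, symmetric])
  have cp: "central_pair (z1 * z2 * z3) (z3' * (z2' * z1'))"
    by (intro central_pair_mult z)
  have "fst ` set ?ws \<subseteq> \<Phi>" using \<gamma>\<Phi> by simp
  from eq[unfolded 1 2 torus_equation_iff[OF \<gamma> \<alpha>(1) this cp]]
  have "conj_word (?ws @ [(- \<gamma>, of_int e * p), (\<gamma>, of_int e * 1)]) (X \<alpha>)
      = conj_word ([(- \<gamma>, of_int e * p), (\<gamma>, of_int e * 1)] @ ?ws) (X \<alpha>)" .
  \<comment> \<open>Since \<open>e\<close> squares to 1, every parameter is \<open>e\<close> times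
    another one, which is the normalization of \<open>norm_torus_sound\<close>.\<close>
  moreover have "?ws = [(\<gamma>, of_int e * (of_int e * a)), (- \<gamma>, of_int e * (of_int e * b)), (\<gamma>, of_int e * (of_int e * c))]"
    using e_mult[OF \<gamma> \<alpha> e] by (simp flip: mult.assoc)
  ultimately show ?thesis using norm_torus_sound[OF \<gamma> \<alpha> e p] by metis
qed

lemma torus_complete:
  assumes \<gamma>: "long \<gamma>" and \<alpha>: "\<alpha> \<in> \<Phi>" "cartan_number \<alpha> \<gamma> = 1"
    and e: "e * e = 1" "commutator (X (- \<gamma>)) (X \<alpha>) = sc (of_int e) * X (\<alpha> - \<gamma>)"
      "commutator (X (- \<gamma>)) (X (\<alpha> - \<gamma>)) = 0" "commutator (X \<gamma>) (X (\<alpha> - \<gamma>)) = sc (of_int e) * X \<alpha>"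
      "commutator (X \<gamma>) (X \<alpha>) = 0"
    and p: "p \<noteq> 0" and u: "u \<noteq> 0" "u\<^sup>2 + p * u * v - p * v\<^sup>2 = 1" and b: "of_int e * b = p * v"
  shows "\<exists>a c. torus_equation \<gamma> \<alpha> e p (xr \<gamma> a * xr (- \<gamma>) b * xr \<gamma> c) (xr \<gamma> (- c) * xr (- \<gamma>) (- b) * xr \<gamma> (- a))"
proof -
  have \<gamma>\<Phi>: "\<gamma> \<in> \<Phi>" "- \<gamma> \<in> \<Phi>" using \<gamma> long_root root_minus by blast+
  have "b = of_int e * (p * v)" using b e_mult[OF \<gamma> \<alpha> e] by (metis mult.assoc mult_1_left)
  then obtain a c where ac: "conj_word ([(\<gamma>, of_int e * a), (- \<gamma>, b), (\<gamma>, of_int e * c)] @ [(- \<gamma>, of_int e * p), (\<gamma>, of_int e * 1)]) (X \<alpha>)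
      = conj_word ([(- \<gamma>, of_int e * p), (\<gamma>, of_int e * 1)] @ [(\<gamma>, of_int e * a), (- \<gamma>, b), (\<gamma>, of_int e * c)]) (X \<alpha>)"
    using norm_torus_complete[OF \<gamma> \<alpha> e p u] by blast
  let ?ws = "[(\<gamma>, of_int e * a), (- \<gamma>, b), (\<gamma>, of_int e * c)]"
  have ws: "fst ` set ?ws \<subseteq> \<Phi>" using \<gamma>\<Phi> by simp
  have one: "central_pair 1 1" by (simp add: central_pair_def)
  have "torus_equation \<gamma> \<alpha> e p (1 * xword ?ws) (xword (xword_inv ?ws) * 1)"
    unfolding torus_equation_iff[OF \<gamma> \<alpha>(1) ws one] by (rule ac)
  thus ?thesis by (intro exI[of _ "of_int e * a"] exI[of _ "of_int e * c"]) (simp add: xword_def xword_inv_def mult.assoc)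
qed

end

subsection \<open>Systems of equations for the parameters of an elementary element\<close>

context group_embedding
begin

lemma emb_inv: "A \<in> carrier G \<Longrightarrow> emb A * emb (inv\<^bsub>G\<^esub> A) = 1" "A \<in> carrier G \<Longrightarrow> emb (inv\<^bsub>G\<^esub> A) * emb A = 1"
  by (simp_all add: emb_one flip: emb_mult)

lemma emb_inv_unique: "A \<in> carrier G \<Longrightarrow> y * emb A = 1 \<Longrightarrow> emb (inv\<^bsub>G\<^esub> A) = y"
proof -
  assume A: "A \<in> carrier G" "y * emb A = 1"
  have "emb (inv\<^bsub>G\<^esub> A) = y * emb A * emb (inv\<^bsub>G\<^esub> A)" by (simp add: A)
  also have "\<dots> = y" by (simp only: mult.assoc emb_inv[OF A(1)] mult_1_right)
  finally show ?thesis .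
qed

lemma power_word_iff:
  assumes "\<And>i. \<sigma> i \<in> carrier G"
  shows "word_value G cs \<sigma> (power_word j m M) = \<one> \<longleftrightarrow>
    emb (\<sigma> (prod_encode (j, 0))) = emb (\<sigma> (prod_encode (j, 1))) ^ m * emb (\<sigma> (prod_encode (j, 2))) ^ M"
proof -
  let ?y = "\<sigma> (prod_encode (j, 0))" and ?Q = "emb (\<sigma> (prod_encode (j, 1))) ^ m * emb (\<sigma> (prod_encode (j, 2))) ^ M"
  have "word_value G cs \<sigma> (power_word j m M) = \<one> \<longleftrightarrow> emb (inv\<^bsub>G\<^esub> ?y) * ?Q = 1"
    by (subst word_value_eq_one_iff[OF assms])
      (simp_all add: power_word_def emb_word_Cons emb_word_append emb_word_replicate del: One_nat_def)
  also have "\<dots> \<longleftrightarrow> emb ?y = ?Q"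
  proof
    assume "emb (inv\<^bsub>G\<^esub> ?y) * ?Q = 1"
    hence "emb ?y * (emb (inv\<^bsub>G\<^esub> ?y) * ?Q) = emb ?y" by simp
    thus "emb ?y = ?Q" by (simp only: mult.assoc[symmetric] emb_inv[OF assms] mult_1_left)
  next
    assume "emb ?y = ?Q"
    thus "emb (inv\<^bsub>G\<^esub> ?y) * ?Q = 1" using emb_inv(2)[OF assms, of "prod_encode (j, 0)"] by (simp only:)
  qed
  finally show ?thesis .
qed

end

text \<open>What is used of a large subgroup: it contains all root elements, and conjugation keeps
  root vectors inside \<open>lie_span\<close>. \<open>idx\<close> locates the constants
  \<open>xr \<alpha> 1\<close> in the coefficient list.\<close>

locale chev_group = chev_alg sc \<Phi> \<Delta> X n + group_embedding G emb cs
  for sc :: "'f::field_char_0 \<Rightarrow> 'e::ring_1" and \<Phi> \<Delta> :: "'v::euclidean_space set" and X n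
    and G :: "('a, 'b) monoid_scheme" (structure) and emb :: "'a \<Rightarrow> 'e" and cs +
  fixes idx :: "'v \<Rightarrow> nat"
  assumes ind: "indecomposable \<Phi>" and rank: "dim \<Phi> > 1"
    and idx_less: "\<alpha> \<in> \<Phi> \<Longrightarrow> idx \<alpha> < length cs" and emb_idx: "\<alpha> \<in> \<Phi> \<Longrightarrow> emb (cs ! idx \<alpha>) = xr \<alpha> 1"
    and root_element: "\<alpha> \<in> \<Phi> \<Longrightarrow> \<exists>A\<in>carrier G. emb A = xr \<alpha> t"
    and conj_span: "A \<in> carrier G \<Longrightarrow> \<alpha> \<in> \<Phi> \<Longrightarrow> emb A * X \<alpha> * emb (inv\<^bsub>G\<^esub> A) \<in> lie_span"
begin

section \<open>Equations for a single parameter\<close>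

definition grade_root :: "'v \<Rightarrow> 'v" where
  "grade_root \<gamma> = (SOME \<alpha>. \<alpha> \<in> \<Phi> \<and> cartan_number \<alpha> \<gamma> = 1)"

lemma grade_root: "long \<gamma> \<Longrightarrow> grade_root \<gamma> \<in> \<Phi>" "long \<gamma> \<Longrightarrow> cartan_number (grade_root \<gamma>) \<gamma> = 1"
  using someI_ex[of "\<lambda>\<alpha>. \<alpha> \<in> \<Phi> \<and> cartan_number \<alpha> \<gamma> = 1"] ex_grade_1[OF ind rank, of \<gamma>]
  unfolding grade_root_def by blast+

definition pair_sign :: "'v \<Rightarrow> int" where
  "pair_sign \<gamma> = (SOME e. e * e = 1 \<and> commutator (X (- \<gamma>)) (X (grade_root \<gamma>)) = sc (of_int e) * X (grade_root \<gamma> - \<gamma>) \<and>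
    commutator (X (- \<gamma>)) (X (grade_root \<gamma> - \<gamma>)) = 0 \<and>
    commutator (X \<gamma>) (X (grade_root \<gamma> - \<gamma>)) = sc (of_int e) * X (grade_root \<gamma>) \<and>
    commutator (X \<gamma>) (X (grade_root \<gamma>)) = 0)"

lemma pair_sign:
  assumes "long \<gamma>"
  shows "pair_sign \<gamma> * pair_sign \<gamma> = 1"
    "commutator (X (- \<gamma>)) (X (grade_root \<gamma>)) = sc (of_int (pair_sign \<gamma>)) * X (grade_root \<gamma> - \<gamma>)"
    "commutator (X (- \<gamma>)) (X (grade_root \<gamma> - \<gamma>)) = 0"
    "commutator (X \<gamma>) (X (grade_root \<gamma> - \<gamma>)) = sc (of_int (pair_sign \<gamma>)) * X (grade_root \<gamma>)"
    "commutator (X \<gamma>) (X (grade_root \<gamma>)) = 0"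
proof -
  have "\<exists>e::int. e * e = 1 \<and> commutator (X (- \<gamma>)) (X (grade_root \<gamma>)) = sc (of_int e) * X (grade_root \<gamma> - \<gamma>) \<and>
    commutator (X (- \<gamma>)) (X (grade_root \<gamma> - \<gamma>)) = 0 \<and>
    commutator (X \<gamma>) (X (grade_root \<gamma> - \<gamma>)) = sc (of_int e) * X (grade_root \<gamma>) \<and>
    commutator (X \<gamma>) (X (grade_root \<gamma>)) = 0"
    by (rule pair_context[OF assms grade_root[OF assms]]) blast
  from someI_ex[OF this, folded pair_sign_def]
  show "pair_sign \<gamma> * pair_sign \<gamma> = 1"
    "commutator (X (- \<gamma>)) (X (grade_root \<gamma>)) = sc (of_int (pair_sign \<gamma>)) * X (grade_root \<gamma> - \<gamma>)"
    "commutator (X (- \<gamma>)) (X (grade_root \<gamma> - \<gamma>)) = 0"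
    "commutator (X \<gamma>) (X (grade_root \<gamma> - \<gamma>)) = sc (of_int (pair_sign \<gamma>)) * X (grade_root \<gamma>)"
    "commutator (X \<gamma>) (X (grade_root \<gamma>)) = 0" by simp_all
qed

definition commuting :: "'v \<Rightarrow> nat \<Rightarrow> gword list" where
  "commuting \<gamma> i = map (\<lambda>\<rho>. equation [(Var i, False), (Coeff (idx \<rho>), False)] [(Coeff (idx \<rho>), False), (Var i, False)])
    (SOME \<rho>s. set \<rho>s = {\<rho>\<in>\<Phi>. cartan_number \<rho> \<gamma> \<ge> 0})"

definition root_word :: "'v \<Rightarrow> int \<Rightarrow> gword" where
  "root_word \<alpha> i = replicate (nat \<bar>i\<bar>) (Coeff (idx \<alpha>), i < 0)"

definition torus_word :: "'v \<Rightarrow> nat \<Rightarrow> gword \<Rightarrow> gword" where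
  "torus_word \<gamma> p P = (let h = root_word (- \<gamma>) (pair_sign \<gamma> * int p) @ root_word \<gamma> (pair_sign \<gamma>);
      \<alpha> = (Coeff (idx (grade_root \<gamma>)), False)
    in equation (P @ h @ [\<alpha>] @ inverse_word h @ inverse_word P) (h @ P @ [\<alpha>] @ inverse_word P @ inverse_word h))"

text \<open>For parameter \<open>j\<close>, unknown 1 is forced to be
  \<open>x\<^sub>\<gamma>(1 / N)\<close> and unknown 2 to be \<open>x\<^sub>\<gamma>(b)\<close>, up
  to central factors; unknowns 3 and 4 are the outer factors of \<open>P\<close>, which belong to
  \<open>- \<gamma>\<close>. The torus is therefore taken for \<open>- \<gamma>\<close>, so that the
  middle factor belongs to \<gamma>. Unknown 0 is reserved for the element that
  \<open>power_word\<close> builds from unknowns 1 and 2.\<close>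

definition local_system :: "'v \<Rightarrow> nat \<Rightarrow> nat \<Rightarrow> nat \<Rightarrow> gword list" where
  "local_system \<gamma> N p j = commuting \<gamma> (prod_encode (j, 1)) @ commuting \<gamma> (prod_encode (j, 2)) @
    commuting (- \<gamma>) (prod_encode (j, 3)) @ commuting (- \<gamma>) (prod_encode (j, 4)) @
    [equation (replicate N (Var (prod_encode (j, 1)), False)) [(Coeff (idx \<gamma>), False)],
     torus_word (- \<gamma>) p (map (\<lambda>k. (Var (prod_encode (j, k)), False)) [3, 2, 4])]"

lemma set_commuting:
  "set (commuting \<gamma> i) = (\<lambda>\<rho>. equation [(Var i, False), (Coeff (idx \<rho>), False)] [(Coeff (idx \<rho>), False), (Var i, False)])
    ` {\<rho>\<in>\<Phi>. cartan_number \<rho> \<gamma> \<ge> 0}"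
proof -
  have "\<exists>\<rho>s. set \<rho>s = {\<rho>\<in>\<Phi>. cartan_number \<rho> \<gamma> \<ge> 0}" using finite_roots by (intro finite_list) simp
  from someI_ex[OF this] show ?thesis by (simp add: commuting_def)
qed

lemma coeffs_below_root_word: "\<alpha> \<in> \<Phi> \<Longrightarrow> coeffs_below (length cs) (root_word \<alpha> i)"
  unfolding root_word_def by (intro coeffs_below_replicate_Coeff idx_less)

lemma coeffs_below_torus_word:
  assumes "long \<gamma>" "coeffs_below (length cs) P" shows "coeffs_below (length cs) (torus_word \<gamma> p P)"
  using assms long_root[OF assms(1)] root_minus grade_root[OF assms(1)]
  by (simp add: torus_word_def Let_def coeffs_below_root_word idx_less)

lemma coeffs_below_local_system:
  assumes "long \<gamma>" "w \<in> set (local_system \<gamma> N p j)" shows "coeffs_below (length cs) w"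
  using assms long_root[OF assms(1)] long_minus[OF assms(1)]
  by (auto simp: local_system_def set_commuting idx_less coeffs_below_torus_word)

lemma root_coset_inverse: assumes "root_coset \<gamma> A A' t" "\<gamma> \<in> \<Phi>" shows "A' * A = 1"
proof -
  obtain z z' where z: "central_pair z z'" "A = z * xr \<gamma> t" "A' = xr \<gamma> (- t) * z'" using assms(1) by (auto simp: root_coset_def)
  have "A' * A = xr \<gamma> (- t) * (z' * z) * xr \<gamma> t" unfolding z(2,3) by (simp only: mult.assoc)
  moreover have "z' * z = 1" using z(1) by (simp add: central_pair_def)
  ultimately show ?thesis by (simp add: xr_inverse[OF assms(2)])
qed

lemma emb_root_letter: "\<alpha> \<in> \<Phi> \<Longrightarrow> emb (letter_value G cs \<sigma> (Coeff (idx \<alpha>), b)) = xr \<alpha> (if b then - 1 else 1)"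
proof -
  assume \<alpha>: "\<alpha> \<in> \<Phi>"
  have "cs ! idx \<alpha> \<in> carrier G" using idx_less[OF \<alpha>] coeffs by (auto dest: nth_mem)
  hence "emb (inv\<^bsub>G\<^esub> (cs ! idx \<alpha>)) = xr \<alpha> (- 1)"
    by (rule emb_inv_unique) (simp add: emb_idx[OF \<alpha>] xr_inverse[OF \<alpha>])
  thus ?thesis by (simp add: emb_idx[OF \<alpha>])
qed

lemma emb_root_word: "\<alpha> \<in> \<Phi> \<Longrightarrow> emb_word \<sigma> (root_word \<alpha> i) = xr \<alpha> (of_int i)"
proof -
  assume \<alpha>: "\<alpha> \<in> \<Phi>"
  have "emb_word \<sigma> (root_word \<alpha> i) = xr \<alpha> (if i < 0 then - 1 else 1) ^ nat \<bar>i\<bar>"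
    by (simp add: root_word_def emb_word_replicate emb_root_letter[OF \<alpha>] del: letter_value.simps)
  also have "\<dots> = xr \<alpha> (of_int (int (nat \<bar>i\<bar>) * (if i < 0 then - 1 else 1)))" by (simp add: xr_power[OF \<alpha>])
  also have "int (nat \<bar>i\<bar>) * (if i < 0 then - 1 else 1) = i" by simp
  finally show ?thesis .
qed

context
  fixes \<sigma> :: "nat \<Rightarrow> 'a" assumes \<sigma>: "\<And>i. \<sigma> i \<in> carrier G"
begin

lemma emb_inverse_word_unique:
  assumes "coeffs_below (length cs) w" "emb_word \<sigma> w * y = 1"
  shows "emb_word \<sigma> (inverse_word w) = y"
proof -
  have "emb_word \<sigma> (inverse_word w) = emb_word \<sigma> (inverse_word w) * emb_word \<sigma> w * y"
    using assms(2) by (simp only: mult.assoc mult_1_right)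
  thus ?thesis using emb_inverse_word[OF \<sigma> assms(1)] by simp
qed

lemma commuting_iff:
  "(\<forall>w\<in>set (commuting \<gamma> i). word_value G cs \<sigma> w = \<one>) \<longleftrightarrow>
    (\<forall>\<rho>\<in>\<Phi>. cartan_number \<rho> \<gamma> \<ge> 0 \<longrightarrow> emb (\<sigma> i) * xr \<rho> 1 = xr \<rho> 1 * emb (\<sigma> i))"
proof -
  have "word_value G cs \<sigma> (equation [(Var i, False), (Coeff (idx \<rho>), False)] [(Coeff (idx \<rho>), False), (Var i, False)]) = \<one>
      \<longleftrightarrow> emb (\<sigma> i) * xr \<rho> 1 = xr \<rho> 1 * emb (\<sigma> i)" if "\<rho> \<in> \<Phi>" for \<rho>
    by (subst equation_iff[OF \<sigma>]) (use that in \<open>simp_all add: idx_less emb_word_Cons emb_word_Nil emb_idx\<close>)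
  thus ?thesis unfolding set_commuting by auto
qed

lemma commuting_root_coset:
  assumes "long \<gamma>" "\<forall>w\<in>set (commuting \<gamma> i). word_value G cs \<sigma> w = \<one>"
  shows "\<exists>t. root_coset \<gamma> (emb (\<sigma> i)) (emb (inv\<^bsub>G\<^esub> (\<sigma> i))) t"
  by (rule root_coset_if_commutes[OF assms(1) emb_inv[OF \<sigma>]])
    (use assms(2)[unfolded commuting_iff] conj_span[OF \<sigma> root_minus[OF long_root[OF assms(1)]]] in auto)

lemma torus_word_iff:
  assumes \<gamma>: "long \<gamma>"
  shows "word_value G cs \<sigma> (torus_word \<gamma> p (map (\<lambda>i. (Var i, False)) [i, j, k])) = \<one> \<longleftrightarrow>
    torus_equation \<gamma> (grade_root \<gamma>) (pair_sign \<gamma>) (of_nat p) (emb (\<sigma> i) * emb (\<sigma> j) * emb (\<sigma> k))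
      (emb (inv\<^bsub>G\<^esub> (\<sigma> k)) * emb (inv\<^bsub>G\<^esub> (\<sigma> j)) * emb (inv\<^bsub>G\<^esub> (\<sigma> i)))"
proof -
  let ?P = "map (\<lambda>i. (Var i, False)) [i, j, k]"
  let ?h = "root_word (- \<gamma>) (pair_sign \<gamma> * int p) @ root_word \<gamma> (pair_sign \<gamma>)"
  let ?e = "of_int (pair_sign \<gamma>) :: 'f"
  have \<gamma>\<Phi>: "\<gamma> \<in> \<Phi>" "- \<gamma> \<in> \<Phi>" using \<gamma> long_root root_minus by blast+
  have h: "emb_word \<sigma> ?h = xr (- \<gamma>) (?e * of_nat p) * xr \<gamma> ?e"
    using \<gamma>\<Phi> by (simp add: emb_word_append emb_root_word)
  have cb: "coeffs_below (length cs) ?h" "coeffs_below (length cs) ?P"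
    using \<gamma>\<Phi> by (simp_all add: coeffs_below_root_word)
  have h': "emb_word \<sigma> (inverse_word ?h) = xr \<gamma> (- ?e) * xr (- \<gamma>) (- (?e * of_nat p))"
  proof (rule emb_inverse_word_unique[OF cb(1)])
    have "emb_word \<sigma> ?h * (xr \<gamma> (- ?e) * xr (- \<gamma>) (- (?e * of_nat p)))
        = xr (- \<gamma>) (?e * of_nat p) * (xr \<gamma> ?e * xr \<gamma> (- ?e)) * xr (- \<gamma>) (- (?e * of_nat p))"
      unfolding h by (simp only: mult.assoc)
    thus "emb_word \<sigma> ?h * (xr \<gamma> (- ?e) * xr (- \<gamma>) (- (?e * of_nat p))) = 1"
      using xr_inverse[OF \<gamma>\<Phi>(1)] xr_inverse[OF \<gamma>\<Phi>(2)] by simp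
  qed
  have P: "emb_word \<sigma> ?P = emb (\<sigma> i) * emb (\<sigma> j) * emb (\<sigma> k)"
    "emb_word \<sigma> (inverse_word ?P) = emb (inv\<^bsub>G\<^esub> (\<sigma> k)) * emb (inv\<^bsub>G\<^esub> (\<sigma> j)) * emb (inv\<^bsub>G\<^esub> (\<sigma> i))"
    by (simp_all add: emb_word_Cons emb_word_Nil inverse_word_def mult.assoc)
  have a: "emb_word \<sigma> [(Coeff (idx (grade_root \<gamma>)), False)] = xr (grade_root \<gamma>) 1"
    by (simp add: emb_word_Cons emb_word_Nil emb_idx grade_root[OF \<gamma>])
  have c: "coeffs_below (length cs) [(Coeff (idx (grade_root \<gamma>)), False)]"
    by (simp add: idx_less grade_root[OF \<gamma>])
  show ?thesis unfolding torus_word_def Let_def torus_equation_def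
    by (subst equation_iff[OF \<sigma>])
      (use cb c in \<open>simp_all only: coeffs_below_append coeffs_below_inverse_word emb_word_append[of _ _ "_ @ _"] h h' P a emb_word_append[of _ ?P] emb_word_append[of _ "[_]"] emb_word_append[of _ "inverse_word _"] mult.assoc simp_thms\<close>)
qed

lemma local_sound:
  assumes \<gamma>: "long \<gamma>" and p: "p > 0" and sol: "\<forall>w\<in>set (local_system \<gamma> N p j). word_value G cs \<sigma> w = \<one>"
  shows "\<exists>t (e::int) u v. of_nat N * t = 1 \<and> e * e = 1 \<and> u\<^sup>2 + of_nat p * u * v - of_nat p * v\<^sup>2 = 1 \<and>
    root_coset \<gamma> (emb (\<sigma> (prod_encode (j, 1)))) (emb (inv\<^bsub>G\<^esub> (\<sigma> (prod_encode (j, 1))))) t \<and>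
    root_coset \<gamma> (emb (\<sigma> (prod_encode (j, 2)))) (emb (inv\<^bsub>G\<^esub> (\<sigma> (prod_encode (j, 2))))) (of_int e * of_nat p * v)"
proof -
  let ?v = "\<lambda>k. \<sigma> (prod_encode (j, k))"
  note \<gamma>' = long_minus[OF \<gamma>]
  have sol': "\<forall>w\<in>set (commuting \<gamma> (prod_encode (j, 1))). word_value G cs \<sigma> w = \<one>"
    "\<forall>w\<in>set (commuting \<gamma> (prod_encode (j, 2))). word_value G cs \<sigma> w = \<one>"
    "\<forall>w\<in>set (commuting (- \<gamma>) (prod_encode (j, 3))). word_value G cs \<sigma> w = \<one>"
    "\<forall>w\<in>set (commuting (- \<gamma>) (prod_encode (j, 4))). word_value G cs \<sigma> w = \<one>"
    "word_value G cs \<sigma> (equation (replicate N (Var (prod_encode (j, 1)), False)) [(Coeff (idx \<gamma>), False)]) = \<one>"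
    "word_value G cs \<sigma> (torus_word (- \<gamma>) p (map (\<lambda>i. (Var i, False)) [prod_encode (j, 3), prod_encode (j, 2), prod_encode (j, 4)])) = \<one>"
    using sol by (simp_all add: local_system_def del: One_nat_def)
  obtain t where t: "root_coset \<gamma> (emb (?v 1)) (emb (inv\<^bsub>G\<^esub> (?v 1))) t"
    using commuting_root_coset[OF \<gamma> sol'(1)] by blast
  obtain b where b: "root_coset \<gamma> (emb (?v 2)) (emb (inv\<^bsub>G\<^esub> (?v 2))) b"
    using commuting_root_coset[OF \<gamma> sol'(2)] by blast
  obtain a where a: "root_coset (- \<gamma>) (emb (?v 3)) (emb (inv\<^bsub>G\<^esub> (?v 3))) a"
    using commuting_root_coset[OF \<gamma>' sol'(3)] by blast
  obtain c where c: "root_coset (- \<gamma>) (emb (?v 4)) (emb (inv\<^bsub>G\<^esub> (?v 4))) c"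
    using commuting_root_coset[OF \<gamma>' sol'(4)] by blast
  have "emb (?v 1) ^ N = xr \<gamma> 1"
  proof -
    have "emb_word \<sigma> (replicate N (Var (prod_encode (j, 1)), False)) = emb_word \<sigma> [(Coeff (idx \<gamma>), False)]"
      using sol'(5) by (subst (asm) equation_iff[OF \<sigma>]) (simp_all add: idx_less long_root[OF \<gamma>] del: One_nat_def)
    thus ?thesis by (simp add: emb_word_replicate emb_word_Cons emb_word_Nil emb_idx long_root[OF \<gamma>] del: One_nat_def)
  qed
  hence "of_nat N * t = 1" by (rule root_coset_root_of_unit[OF \<gamma> grade_root[OF \<gamma>] t])
  moreover obtain u v where uv: "of_int (pair_sign (- \<gamma>)) * b = of_nat p * v" "u\<^sup>2 + of_nat p * u * v - of_nat p * v\<^sup>2 = 1"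
  proof -
    have p0: "(of_nat p :: 'f) \<noteq> 0" using p by simp
    have b': "root_coset (- (- \<gamma>)) (emb (?v 2)) (emb (inv\<^bsub>G\<^esub> (?v 2))) b" using b by simp
    show ?thesis
      using torus_sound[OF \<gamma>' grade_root[OF \<gamma>'] pair_sign[OF \<gamma>'] p0 a b' c sol'(6)[unfolded torus_word_iff[OF \<gamma>']]] that
      by blast
  qed
  have "b = of_int (pair_sign (- \<gamma>)) * of_nat p * v"
    using uv(1) e_mult[OF \<gamma>' grade_root[OF \<gamma>'] pair_sign[OF \<gamma>']] by (metis mult.assoc mult_1_left)
  ultimately show ?thesis using uv(2) pair_sign(1)[OF \<gamma>'] t b by blast
qed

end

text \<open>Unknown 0 is free in the local equations. It belongs to the family \<open>A\<close>
  nevertheless, since the power equation will relate it to unknowns 1 and 2.\<close>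

lemma local_complete:
  assumes \<gamma>: "long \<gamma>" and N: "N > 0" and p: "p > 0" and u: "u \<noteq> 0" "u\<^sup>2 + of_nat p * u * v - of_nat p * v\<^sup>2 = 1"
  shows "\<exists>A :: nat \<Rightarrow> 'a. (\<forall>k. A k \<in> carrier G) \<and> emb (A 0) = xr \<gamma> s \<and> emb (A 1) = xr \<gamma> (1 / of_nat N) \<and>
    emb (A 2) = xr \<gamma> (of_int (pair_sign (- \<gamma>)) * of_nat p * v) \<and>
    (\<forall>\<sigma> w. (\<forall>i. \<sigma> i \<in> carrier G) \<longrightarrow> (\<forall>k<5. \<sigma> (prod_encode (j, k)) = A k) \<longrightarrow>
      w \<in> set (local_system \<gamma> N p j) \<longrightarrow> word_value G cs \<sigma> w = \<one>)"
proof -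
  note \<gamma>' = long_minus[OF \<gamma>]
  have \<gamma>\<Phi>: "\<gamma> \<in> \<Phi>" "- \<gamma> \<in> \<Phi>" using long_root[OF \<gamma>] long_root[OF \<gamma>'] by auto
  let ?b = "of_int (pair_sign (- \<gamma>)) * of_nat p * v"
  have p0: "(of_nat p :: 'f) \<noteq> 0" using p by simp
  have "of_int (pair_sign (- \<gamma>)) * ?b = of_nat p * v"
    using e_mult[OF \<gamma>' grade_root[OF \<gamma>'] pair_sign[OF \<gamma>']] by (simp flip: mult.assoc)
  from torus_complete[OF \<gamma>' grade_root[OF \<gamma>'] pair_sign[OF \<gamma>'] p0 u this]
  obtain a c where ac: "torus_equation (- \<gamma>) (grade_root (- \<gamma>)) (pair_sign (- \<gamma>)) (of_nat p)
      (xr (- \<gamma>) a * xr (- (- \<gamma>)) ?b * xr (- \<gamma>) c) (xr (- \<gamma>) (- c) * xr (- (- \<gamma>)) (- ?b) * xr (- \<gamma>) (- a))"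
    by (elim exE)
  define \<rho> t where "\<rho> k = (if k < 3 then \<gamma> else - \<gamma>)" and
    "t k = (if k = 0 then s else if k = 1 then 1 / of_nat N else if k = 2 then ?b else if k = 3 then a else c)" for k :: nat
  have "\<exists>A. A \<in> carrier G \<and> emb A = xr (\<rho> k) (t k)" for k
    using root_element[of "\<rho> k" "t k"] \<gamma>\<Phi> by (auto simp: \<rho>_def)
  then obtain A where A: "\<And>k. A k \<in> carrier G" "\<And>k. emb (A k) = xr (\<rho> k) (t k)" by metis
  have A': "emb (inv\<^bsub>G\<^esub> (A k)) = xr (\<rho> k) (- t k)" for k
    by (rule emb_inv_unique[OF A(1)]) (use \<gamma>\<Phi> in \<open>simp add: A(2) \<rho>_def xr_inverse\<close>)
  show ?thesis
  proof (intro exI[of _ A] conjI allI impI)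
    fix \<sigma> w assume a: "\<forall>i. \<sigma> i \<in> carrier G" "\<forall>k<5. \<sigma> (prod_encode (j, k)) = A k"
      and w: "w \<in> set (local_system \<gamma> N p j)"
    have \<sigma>: "\<And>i. \<sigma> i \<in> carrier G" and \<sigma>A: "\<And>k. k < 5 \<Longrightarrow> \<sigma> (prod_encode (j, k)) = A k" using a by auto
    have com: "word_value G cs \<sigma> w = \<one>"
      if mem: "w \<in> set (commuting (\<rho> k) (prod_encode (j, k)))" and k: "k < 5" for k
    proof -
      have l: "long (\<rho> k)" using \<gamma> \<gamma>' by (simp add: \<rho>_def)
      have "\<forall>w\<in>set (commuting (\<rho> k) (prod_encode (j, k))). word_value G cs \<sigma> w = \<one>"
        unfolding commuting_iff[OF \<sigma>] \<sigma>A[OF k] A(2) using root_coset_commutes[OF root_coset_xr l] by blast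
      thus ?thesis using mem by blast
    qed
    have pow: "word_value G cs \<sigma> (equation (replicate N (Var (prod_encode (j, 1)), False)) [(Coeff (idx \<gamma>), False)]) = \<one>"
    proof (subst equation_iff[OF \<sigma>])
      show "emb_word \<sigma> (replicate N (Var (prod_encode (j, 1)), False)) = emb_word \<sigma> [(Coeff (idx \<gamma>), False)]"
        using N \<gamma>\<Phi>(1) by (simp add: emb_word_replicate emb_word_Cons emb_word_Nil emb_idx \<sigma>A A(2) xr_power \<rho>_def t_def del: One_nat_def)
    qed (simp_all add: idx_less \<gamma>\<Phi> del: One_nat_def)
    have tor: "word_value G cs \<sigma> (torus_word (- \<gamma>) p (map (\<lambda>i. (Var i, False)) [prod_encode (j, 3), prod_encode (j, 2), prod_encode (j, 4)])) = \<one>"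
      unfolding torus_word_iff[OF \<sigma> \<gamma>'] using ac by (simp add: \<sigma>A A(2) A' \<rho>_def t_def)
    show "word_value G cs \<sigma> w = \<one>"
      using w com[of 1] com[of 2] com[of 3] com[of 4] pow tor
      by (auto simp: local_system_def \<rho>_def simp del: One_nat_def)
  qed (use A in \<open>auto simp: \<rho>_def t_def\<close>)
qed

section \<open>The system attached to a word\<close>

definition translate :: "('v \<times> 'f \<Rightarrow> nat) \<Rightarrow> ('v, 'f) pword \<Rightarrow> gword" where
  "translate ix w = map (\<lambda>(s, b). (case s of Const \<alpha> \<Rightarrow> Coeff (idx \<alpha>) | Param q \<Rightarrow> Var (prod_encode (ix q, 0)), b)) w"

lemma coeffs_below_translate: "long_word w \<Longrightarrow> coeffs_below (length cs) (translate ix w)"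
proof (induction w)
  case (Cons l w)
  obtain s b where l: "l = (s, b)" by fastforce
  have "long_word w" "\<And>\<alpha>. s = Const \<alpha> \<Longrightarrow> \<alpha> \<in> \<Phi>" using Cons.prems by (auto simp: long_word_def l)
  thus ?case using Cons.IH by (cases s) (auto simp: translate_def l idx_less)
qed (simp add: translate_def)

lemma emb_translate:
  assumes "long_word w"
  shows "emb_word \<sigma> (translate ix w) = pword_value (\<lambda>q. emb (\<sigma> (prod_encode (ix q, 0))))
    (\<lambda>q. emb (inv\<^bsub>G\<^esub> (\<sigma> (prod_encode (ix q, 0))))) w"
  using assms
proof (induction w)
  case (Cons l w)
  obtain s b where l: "l = (s, b)" by fastforce
  have w: "long_word w" and s: "\<And>\<alpha>. s = Const \<alpha> \<Longrightarrow> \<alpha> \<in> \<Phi>"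
    using Cons.prems by (auto simp: long_word_def l)
  show ?case
  proof (cases s)
    case (Const \<alpha>)
    show ?thesis using Cons.IH[OF w] emb_root_letter[OF s[OF Const], of \<sigma> b]
      by (simp add: translate_def pword_value_def emb_word_Cons l Const del: letter_value.simps)
  next
    case (Param q)
    show ?thesis using Cons.IH[OF w] by (simp add: translate_def pword_value_def emb_word_Cons l Param)
  qed
qed (simp add: translate_def pword_value_def emb_word_Nil)

lemma pword_value_cong:
  assumes "\<And>q b. (Param q, b) \<in> set w \<Longrightarrow> Y q = Z q \<and> Y' q = Z' q"
  shows "pword_value Y Y' w = pword_value Z Z' w"
proof -
  have "symb_value Y Y' l = symb_value Z Z' l" if "l \<in> set w" for l
  proof -
    obtain s b where l: "l = (s, b)" by fastforce
    show ?thesis using assms that unfolding l by (cases s) auto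
  qed
  thus ?thesis unfolding pword_value_def by (metis map_cong)
qed

text \<open>The list \<open>pars\<close> contains the parameters occurring in \<open>w\<close>, and \<open>ix\<close> gives their positions in it.\<close>

definition param_system :: "('v \<times> 'f) list \<Rightarrow> ('v \<times> 'f \<Rightarrow> nat) \<Rightarrow> ('v, 'f) pword \<Rightarrow> nat \<Rightarrow> nat \<Rightarrow> nat \<Rightarrow> gword list" where
  "param_system pars ix w N p g = concat (map (\<lambda>q. local_system (fst q) N p (ix q)) pars)
    @ [equation (translate ix w) [(Coeff g, False)]]"

context
  fixes w :: "('v, 'f) pword" and pars :: "('v \<times> 'f) list" and ix :: "'v \<times> 'f \<Rightarrow> nat" and N p g :: nat
  assumes w: "long_word w" "ignores_central w"
    and pars: "\<And>q b. (Param q, b) \<in> set w \<Longrightarrow> q \<in> set pars" "\<And>q. q \<in> set pars \<Longrightarrow> long (fst q)"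
    and ix: "\<And>j. j < length pars \<Longrightarrow> ix (pars ! j) = j"
    and N: "N > 0" and p: "p > 0" and g: "g < length cs"
begin

lemma ix_bound: "q \<in> set pars \<Longrightarrow> ix q < length pars \<and> pars ! ix q = q"
  using ix by (auto simp: in_set_conv_nth)

lemma param_system_over: "system_over cs (param_system pars ix w N p g)"
proof -
  have "coeffs_below (length cs) u" if "q \<in> set pars" "u \<in> set (local_system (fst q) N p (ix q))" for q u
    using coeffs_below_local_system[OF pars(2)[OF that(1)] that(2)] .
  thus ?thesis unfolding system_over_iff using coeffs_below_translate[OF w(1), of ix] g by (auto simp: param_system_def)
qed

text \<open>An arbitrary solution is analysed: its parameters may differ from those of the original
  word, but they still produce the given element, because the word ignores central factors. Each
  parameter is known up to \<open>M\<close> times a multiple of \<open>p * v\<close>.\<close>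

lemma param_system_sound:
  assumes "solvable_in G cs (power_system (length pars) (param_system pars ix w N p g) m M)"
  shows "\<exists>\<tau>. emb (cs ! g) = root_value \<tau> w \<and> (\<forall>q\<in>set pars. \<exists>(e::int) u v. e * e = 1 \<and>
    u\<^sup>2 + of_nat p * u * v - of_nat p * v\<^sup>2 = 1 \<and>
    \<tau> q = of_nat (m (ix q)) / of_nat N + of_nat M * (of_int e * of_nat p * v))"
proof -
  obtain \<sigma> where \<sigma>: "\<And>i. \<sigma> i \<in> carrier G"
    and sol: "\<And>w'. w' \<in> set (power_system (length pars) (param_system pars ix w N p g) m M) \<Longrightarrow> word_value G cs \<sigma> w' = \<one>"
    using assms by (auto simp: solvable_in_def)
  let ?y = "\<lambda>q. \<sigma> (prod_encode (ix q, 0))"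
  let ?par = "\<lambda>q t. \<exists>(e::int) u v. e * e = 1 \<and> u\<^sup>2 + of_nat p * u * v - of_nat p * v\<^sup>2 = 1 \<and>
      t = of_nat (m (ix q)) / of_nat N + of_nat M * (of_int e * of_nat p * v)"
  have "\<forall>q\<in>set pars. \<exists>t. ?par q t \<and> root_coset (fst q) (emb (?y q)) (emb (inv\<^bsub>G\<^esub> (?y q))) t"
  proof
    fix q assume q: "q \<in> set pars"
    note l = pars(2)[OF q]
    have \<gamma>: "fst q \<in> \<Phi>" using l by (rule long_root)
    have "\<forall>w\<in>set (local_system (fst q) N p (ix q)). word_value G cs \<sigma> w = \<one>"
      using sol q by (auto simp: power_system_def param_system_def)
    from local_sound[OF \<sigma> l p this] obtain t and e :: int and u v where t: "of_nat N * t = 1" "e * e = 1"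
      "u\<^sup>2 + of_nat p * u * v - of_nat p * v\<^sup>2 = 1"
      and A: "root_coset (fst q) (emb (\<sigma> (prod_encode (ix q, 1)))) (emb (inv\<^bsub>G\<^esub> (\<sigma> (prod_encode (ix q, 1))))) t"
      and B: "root_coset (fst q) (emb (\<sigma> (prod_encode (ix q, 2)))) (emb (inv\<^bsub>G\<^esub> (\<sigma> (prod_encode (ix q, 2))))) (of_int e * of_nat p * v)"
      by (elim exE conjE)
    have "word_value G cs \<sigma> (power_word (ix q) (m (ix q)) M) = \<one>"
      using sol ix_bound[OF q] by (auto simp: power_system_def)
    hence y: "emb (?y q) = emb (\<sigma> (prod_encode (ix q, 1))) ^ m (ix q) * emb (\<sigma> (prod_encode (ix q, 2))) ^ M"
      by (rule power_word_iff[OF \<sigma>, THEN iffD1])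
    let ?t = "of_nat (m (ix q)) * t + of_nat M * (of_int e * of_nat p * v)"
    from root_coset_mult[OF root_coset_power[OF A \<gamma>] root_coset_power[OF B \<gamma>] \<gamma>]
    obtain Y' where Y': "root_coset (fst q) (emb (?y q)) Y' ?t" unfolding y by blast
    have "emb (inv\<^bsub>G\<^esub> (?y q)) = Y'" by (rule emb_inv_unique[OF \<sigma> root_coset_inverse[OF Y' \<gamma>]])
    moreover have t': "t = 1 / of_nat N" using t(1) N by (simp add: field_simps)
    moreover have "?par q ?t" using t(2,3) unfolding t' by (intro exI conjI) auto
    ultimately show "\<exists>t. ?par q t \<and> root_coset (fst q) (emb (?y q)) (emb (inv\<^bsub>G\<^esub> (?y q))) t"
      using Y' by (intro exI[of _ ?t] conjI) simp_all
  qed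
  from bchoice[OF this] obtain \<tau> where \<tau>: "\<forall>q\<in>set pars. ?par q (\<tau> q) \<and> root_coset (fst q) (emb (?y q)) (emb (inv\<^bsub>G\<^esub> (?y q))) (\<tau> q)"
    by (elim exE)
  have "\<forall>q. \<exists>zz. central_pair (fst zz) (snd zz) \<and> (q \<in> set pars \<longrightarrow> emb (?y q) = fst zz * xr (fst q) (\<tau> q) \<and>
      emb (inv\<^bsub>G\<^esub> (?y q)) = xr (fst q) (- \<tau> q) * snd zz)"
  proof
    fix q
    show "\<exists>zz. central_pair (fst zz) (snd zz) \<and> (q \<in> set pars \<longrightarrow> emb (?y q) = fst zz * xr (fst q) (\<tau> q) \<and>
      emb (inv\<^bsub>G\<^esub> (?y q)) = xr (fst q) (- \<tau> q) * snd zz)"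
    proof (cases "q \<in> set pars")
      case True
      hence "root_coset (fst q) (emb (?y q)) (emb (inv\<^bsub>G\<^esub> (?y q))) (\<tau> q)" using \<tau> by blast
      then obtain z z' where "central_pair z z'" "emb (?y q) = z * xr (fst q) (\<tau> q)"
        "emb (inv\<^bsub>G\<^esub> (?y q)) = xr (fst q) (- \<tau> q) * z'" unfolding root_coset_def by (elim exE conjE)
      thus ?thesis by (intro exI[of _ "(z, z')"]) simp
    next
      \<comment> \<open>Outside \<open>pars\<close> a trivial pair is supplied because
        \<open>ignores_central\<close> asks for a central pair at every \<open>q\<close>.\<close>
      case False
      thus ?thesis by (intro exI[of _ "(1, 1)"]) (simp add: central_pair_def)
    qed
  qed
  from choice[OF this] obtain zz where zz: "\<forall>q. central_pair (fst (zz q)) (snd (zz q)) \<and>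
      (q \<in> set pars \<longrightarrow> emb (?y q) = fst (zz q) * xr (fst q) (\<tau> q) \<and> emb (inv\<^bsub>G\<^esub> (?y q)) = xr (fst q) (- \<tau> q) * snd (zz q))"
    by (elim exE)
  define z z' where "z q = fst (zz q)" and "z' q = snd (zz q)" for q
  have z: "\<forall>q. central_pair (z q) (z' q)" "\<And>q. q \<in> set pars \<Longrightarrow> emb (?y q) = z q * xr (fst q) (\<tau> q)"
    "\<And>q. q \<in> set pars \<Longrightarrow> emb (inv\<^bsub>G\<^esub> (?y q)) = xr (fst q) (- \<tau> q) * z' q"
    unfolding z_def z'_def using zz by blast+
  have "word_value G cs \<sigma> (equation (translate ix w) [(Coeff g, False)]) = \<one>"
    using sol by (simp add: power_system_def param_system_def)
  hence "emb_word \<sigma> (translate ix w) = emb_word \<sigma> [(Coeff g, False)]"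
    by (subst (asm) equation_iff[OF \<sigma>]) (simp_all add: coeffs_below_translate w g)
  hence "emb (cs ! g) = pword_value (\<lambda>q. emb (?y q)) (\<lambda>q. emb (inv\<^bsub>G\<^esub> (?y q))) w"
    by (simp add: emb_translate[OF w(1)] emb_word_Cons emb_word_Nil)
  also have "\<dots> = pword_value (\<lambda>q. z q * xr (fst q) (\<tau> q)) (\<lambda>q. xr (fst q) (- \<tau> q) * z' q) w"
    by (rule pword_value_cong) (auto dest!: pars(1) simp: z)
  also have "\<dots> = root_value \<tau> w" using w(2)[unfolded ignores_central_def, rule_format, of z z' \<tau>] z(1) by blast
  finally show ?thesis using \<tau> by (intro exI[of _ \<tau>] conjI) auto
qed

lemma param_system_complete:
  assumes gw: "emb (cs ! g) = root_value snd w"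
    and ex: "\<And>q (e::int). q \<in> set pars \<Longrightarrow> e * e = 1 \<Longrightarrow> \<exists>u v. u \<noteq> 0 \<and> u\<^sup>2 + of_nat p * u * v - of_nat p * v\<^sup>2 = 1 \<and>
      snd q = of_nat (m (ix q)) / of_nat N + of_nat M * (of_int e * of_nat p * v)"
  shows "solvable_in G cs (power_system (length pars) (param_system pars ix w N p g) m M)"
proof -
  have "\<forall>q\<in>set pars. \<exists>A :: nat \<Rightarrow> 'a. (\<forall>k. A k \<in> carrier G) \<and> emb (A 0) = xr (fst q) (snd q) \<and>
      emb (A 0) = emb (A 1) ^ m (ix q) * emb (A 2) ^ M \<and>
      (\<forall>\<sigma> w. (\<forall>i. \<sigma> i \<in> carrier G) \<longrightarrow> (\<forall>k<5. \<sigma> (prod_encode (ix q, k)) = A k) \<longrightarrow>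
        w \<in> set (local_system (fst q) N p (ix q)) \<longrightarrow> word_value G cs \<sigma> w = \<one>)"
  proof
    fix q assume q: "q \<in> set pars"
    note l = pars(2)[OF q]
    have \<gamma>: "fst q \<in> \<Phi>" using l by (rule long_root)
    let ?e = "pair_sign (- fst q)"
    obtain u v where uv: "u \<noteq> 0" "u\<^sup>2 + of_nat p * u * v - of_nat p * v\<^sup>2 = 1"
      "snd q = of_nat (m (ix q)) / of_nat N + of_nat M * (of_int ?e * of_nat p * v)"
      using ex[OF q pair_sign(1)[OF long_minus[OF l]]] by blast
    from local_complete[OF l N p uv(1,2), where s = "snd q" and j = "ix q"]
    obtain A :: "nat \<Rightarrow> 'a" where A: "\<forall>k. A k \<in> carrier G" "emb (A 0) = xr (fst q) (snd q)" "emb (A 1) = xr (fst q) (1 / of_nat N)"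
      "emb (A 2) = xr (fst q) (of_int ?e * of_nat p * v)"
      and A5: "\<forall>\<sigma> w. (\<forall>i. \<sigma> i \<in> carrier G) \<longrightarrow> (\<forall>k<5. \<sigma> (prod_encode (ix q, k)) = A k) \<longrightarrow>
        w \<in> set (local_system (fst q) N p (ix q)) \<longrightarrow> word_value G cs \<sigma> w = \<one>"
      by (elim exE conjE)
    have "emb (A 0) = emb (A 1) ^ m (ix q) * emb (A 2) ^ M"
      unfolding A(2-4) xr_power[OF \<gamma>] xr_add[OF \<gamma>, symmetric] by (simp add: uv(3)[symmetric])
    thus "\<exists>A :: nat \<Rightarrow> 'a. (\<forall>k. A k \<in> carrier G) \<and> emb (A 0) = xr (fst q) (snd q) \<and>
      emb (A 0) = emb (A 1) ^ m (ix q) * emb (A 2) ^ M \<and>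
      (\<forall>\<sigma> w. (\<forall>i. \<sigma> i \<in> carrier G) \<longrightarrow> (\<forall>k<5. \<sigma> (prod_encode (ix q, k)) = A k) \<longrightarrow>
        w \<in> set (local_system (fst q) N p (ix q)) \<longrightarrow> word_value G cs \<sigma> w = \<one>)"
      using A(1,2) A5 by (intro exI[of _ A] conjI)
  qed
  from bchoice[OF this] obtain A where A0: "\<forall>q\<in>set pars. (\<forall>k. A q k \<in> carrier G) \<and> emb (A q 0) = xr (fst q) (snd q) \<and>
      emb (A q 0) = emb (A q 1) ^ m (ix q) * emb (A q 2) ^ M \<and>
      (\<forall>\<sigma> w. (\<forall>i. \<sigma> i \<in> carrier G) \<longrightarrow> (\<forall>k<5. \<sigma> (prod_encode (ix q, k)) = A q k) \<longrightarrow>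
        w \<in> set (local_system (fst q) N p (ix q)) \<longrightarrow> word_value G cs \<sigma> w = \<one>)" by (elim exE)
  have A: "\<And>q k. q \<in> set pars \<Longrightarrow> A q k \<in> carrier G" "\<And>q. q \<in> set pars \<Longrightarrow> emb (A q 0) = xr (fst q) (snd q)"
      "\<And>q. q \<in> set pars \<Longrightarrow> emb (A q 0) = emb (A q 1) ^ m (ix q) * emb (A q 2) ^ M"
      "\<And>q \<sigma> w. q \<in> set pars \<Longrightarrow> (\<forall>i. \<sigma> i \<in> carrier G) \<Longrightarrow> (\<forall>k<5. \<sigma> (prod_encode (ix q, k)) = A q k) \<Longrightarrow>
        w \<in> set (local_system (fst q) N p (ix q)) \<Longrightarrow> word_value G cs \<sigma> w = \<one>"
    using A0 by blast+
  define \<sigma> where "\<sigma> i = (if fst (prod_decode i) < length pars then A (pars ! fst (prod_decode i)) (snd (prod_decode i)) else \<one>)" for i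
  have \<sigma>: "\<sigma> i \<in> carrier G" for i by (simp add: \<sigma>_def A(1))
  have \<sigma>A: "\<sigma> (prod_encode (ix q, k)) = A q k" if "q \<in> set pars" for q k
    using ix_bound[OF that] by (simp add: \<sigma>_def)
  have loc: "word_value G cs \<sigma> w' = \<one>" if "q \<in> set pars" "w' \<in> set (local_system (fst q) N p (ix q))" for q w'
    using A(4)[OF that(1) _ _ that(2)] \<sigma> \<sigma>A[OF that(1)] by blast
  have pw: "word_value G cs \<sigma> (power_word j (m j) M) = \<one>" if "j < length pars" for j
  proof -
    have q: "pars ! j \<in> set pars" "ix (pars ! j) = j" using that ix by auto
    show ?thesis unfolding power_word_iff[OF \<sigma>] using \<sigma>A[OF q(1), unfolded q(2)] A(3)[OF q(1), unfolded q(2)] by (simp only:)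
  qed
  have "emb_word \<sigma> (translate ix w) = pword_value (\<lambda>q. xr (fst q) (snd q)) (\<lambda>q. xr (fst q) (- snd q)) w"
    unfolding emb_translate[OF w(1)]
  proof (rule pword_value_cong)
    fix q b assume "(Param q, b) \<in> set w"
    hence q: "q \<in> set pars" by (rule pars(1))
    have "emb (inv\<^bsub>G\<^esub> (A q 0)) = xr (fst q) (- snd q)"
      by (rule emb_inv_unique[OF A(1)[OF q]]) (simp add: A(2)[OF q] xr_inverse long_root[OF pars(2)[OF q]])
    thus "emb (\<sigma> (prod_encode (ix q, 0))) = xr (fst q) (snd q) \<and> emb (inv\<^bsub>G\<^esub> (\<sigma> (prod_encode (ix q, 0)))) = xr (fst q) (- snd q)"
      by (simp add: \<sigma>A[OF q] A(2)[OF q])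
  qed
  also have "\<dots> = emb_word \<sigma> [(Coeff g, False)]" by (simp add: gw root_value_def emb_word_Cons emb_word_Nil)
  finally have "word_value G cs \<sigma> (equation (translate ix w) [(Coeff g, False)]) = \<one>"
    by (subst equation_iff[OF \<sigma>]) (simp_all add: coeffs_below_translate w g)
  hence "\<forall>w'\<in>set (power_system (length pars) (param_system pars ix w N p g) m M). word_value G cs \<sigma> w' = \<one>"
    using loc pw by (auto simp: power_system_def param_system_def)
  thus ?thesis using \<sigma> unfolding solvable_in_def by blast
qed

end

end

subsection \<open>Approximation of matrix products\<close>

definition mat_prod :: "nat \<Rightarrow> 'a::comm_ring_1 mat list \<Rightarrow> 'a mat" where
  "mat_prod n As = foldr (*) As (1\<^sub>m n)"

lemma mat_prod_simps [simp]: "mat_prod n [] = 1\<^sub>m n" "mat_prod n (A # As) = A * mat_prod n As"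
  by (simp_all add: mat_prod_def)

lemma mat_prod_carrier [simp]: "set As \<subseteq> carrier_mat n n \<Longrightarrow> mat_prod n As \<in> carrier_mat n n"
  by (induction As) (auto intro!: mult_carrier_mat)

lemma mat_prod_append:
  "set As \<subseteq> carrier_mat n n \<Longrightarrow> set Bs \<subseteq> carrier_mat n n \<Longrightarrow> mat_prod n (As @ Bs) = mat_prod n As * mat_prod n Bs"
proof (induction As)
  case (Cons A As)
  thus ?case using assoc_mult_mat[of A n n "mat_prod n As" n "mat_prod n Bs" n] by simp
qed (simp add: left_mult_one_mat[of _ n n])

lemma group_endo_mat_prod:
  "set As \<subseteq> carrier_mat n n \<Longrightarrow> group_endo n (mat_prod n As) = prod_list (map (group_endo n) As)"
  by (induction As) (simp_all add: group_endo_one group_endo_mult(1)[of _ n])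

definition mat_cong :: "nat \<Rightarrow> 'a::comm_ring_1 \<Rightarrow> 'a mat \<Rightarrow> 'a mat \<Rightarrow> bool" where
  "mat_cong n q A B \<longleftrightarrow> (\<forall>i<n. \<forall>j<n. q dvd A $$ (i, j) - B $$ (i, j))"

lemma mat_cong_mult:
  assumes "mat_cong n q A A'" "mat_cong n q B B'"
    and "A \<in> carrier_mat n n" "A' \<in> carrier_mat n n" "B \<in> carrier_mat n n" "B' \<in> carrier_mat n n"
  shows "mat_cong n q (A * B) (A' * B')"
  unfolding mat_cong_def
proof (intro allI impI)
  fix i j assume ij: "i < n" "j < n"
  have "q dvd A $$ (i, k) * B $$ (k, j) - A' $$ (i, k) * B' $$ (k, j)" if "k < n" for k
  proof -
    have "q dvd (A $$ (i, k) - A' $$ (i, k)) * B $$ (k, j) + A' $$ (i, k) * (B $$ (k, j) - B' $$ (k, j))"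
      using assms(1,2) ij that by (auto simp: mat_cong_def)
    thus ?thesis by (simp add: algebra_simps)
  qed
  hence "q dvd (\<Sum>k<n. A $$ (i, k) * B $$ (k, j) - A' $$ (i, k) * B' $$ (k, j))" by (intro dvd_sum) auto
  thus "q dvd (A * B) $$ (i, j) - (A' * B') $$ (i, j)"
    using ij assms(3-) by (simp add: mat_mult_index[of _ n] sum_subtractf del: index_mult_mat(1))
qed

lemma mat_prod_cong:
  assumes "\<And>l. l \<in> set ws \<Longrightarrow> A l \<in> carrier_mat n n \<and> B l \<in> carrier_mat n n \<and> mat_cong n q (A l) (B l)"
  shows "mat_cong n q (mat_prod n (map A ws)) (mat_prod n (map B ws))"
  using assms
proof (induction ws)
  case (Cons l ws)
  have "set (map A ws) \<subseteq> carrier_mat n n" "set (map B ws) \<subseteq> carrier_mat n n" using Cons.prems by auto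
  thus ?case using Cons by (simp add: mat_cong_mult)
qed (simp add: mat_cong_def)

lemma mat_prod_hom:
  fixes f :: "'a::comm_ring_1 \<Rightarrow> 'b::comm_ring_1"
  assumes "\<And>A B. A \<in> carrier_mat n n \<Longrightarrow> B \<in> carrier_mat n n \<Longrightarrow> map_mat f (A * B) = map_mat f A * map_mat f B"
    and "map_mat f (1\<^sub>m n) = 1\<^sub>m n" and "set As \<subseteq> carrier_mat n n"
  shows "map_mat f (mat_prod n As) = mat_prod n (map (map_mat f) As)"
  using assms(3) by (induction As) (simp_all add: assms(1,2))

lemma of_int_mat_prod: "set As \<subseteq> carrier_mat n n \<Longrightarrow> map_mat of_int (mat_prod n As) = mat_prod n (map (map_mat of_int) As)"
  by (rule mat_prod_hom) (simp_all add: of_int_mat_mult of_int_hom.mat_hom_one)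

lemma to_fract_mat_mult:
    "A \<in> carrier_mat n n \<Longrightarrow> B \<in> carrier_mat n n \<Longrightarrow> map_mat to_fract (A * B) = map_mat to_fract A * map_mat to_fract B"
  and to_fract_mat_one: "map_mat to_fract (1\<^sub>m n) = 1\<^sub>m n"
proof -
  interpret idom_hom to_fract by unfold_locales simp_all
  show "A \<in> carrier_mat n n \<Longrightarrow> B \<in> carrier_mat n n \<Longrightarrow> map_mat to_fract (A * B) = map_mat to_fract A * map_mat to_fract B"
    by (rule mat_hom_mult)
  show "map_mat to_fract (1\<^sub>m n) = 1\<^sub>m n" by (rule mat_hom_one)
qed

lemma to_fract_mat_prod:
  "set As \<subseteq> carrier_mat n n \<Longrightarrow> map_mat to_fract (mat_prod n As) = mat_prod n (map (map_mat to_fract) As)"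
  by (rule mat_prod_hom) (simp_all add: to_fract_mat_mult to_fract_mat_one)

lemma computable_int_mat_prod:
  assumes "\<And>l. l \<in> set ws \<Longrightarrow> (\<forall>a. A l a \<in> carrier_mat n n) \<and> (\<forall>i<n. \<forall>j<n. computable_int (\<lambda>a. A l a $$ (i, j)))"
    and "i < n" "j < n"
  shows "computable_int (\<lambda>a. mat_prod n (map (\<lambda>l. A l a) ws) $$ (i, j))"
  using assms
proof (induction ws arbitrary: i)
  case Nil
  thus ?case by (simp add: computable_int_const)
next
  case (Cons l ws)
  have "set (map (\<lambda>l. A l a) ws) \<subseteq> carrier_mat n n" for a using Cons.prems by auto
  hence "mat_prod n (map (\<lambda>l. A l a) (l # ws)) $$ (i, j)
      = (\<Sum>k<n. A l a $$ (i, k) * mat_prod n (map (\<lambda>l. A l a) ws) $$ (k, j))" for a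
    using Cons.prems by (simp add: mat_mult_index[of _ n])
  thus ?case using Cons by (auto intro!: computable_int_sum computable_int_mult)
qed

lemma computable_mat_if_approx:
  fixes B :: "'p::prime_card padic mat"
  assumes B: "B \<in> carrier_mat n n" and c: "computable_fun 1 (\<lambda>xs. c (xs ! 0))"
    and Q: "\<And>i j. i < n \<Longrightarrow> j < n \<Longrightarrow> computable_int (\<lambda>a. Q a $$ (i, j))" "\<And>a. Q a \<in> carrier_mat n n"
    and approx: "\<And>k. \<exists>Y. Y \<in> carrier_mat n n \<and> of_nat CARD('p) ^ N \<cdot>\<^sub>m B = map_mat to_fract Y \<and>
      mat_cong n (padic_p ^ k) Y (map_mat of_int (Q (c k)))"
  shows "computable_mat B"
  unfolding computable_mat_def
proof (intro allI impI)
  fix i j assume "i < dim_row B" "j < dim_col B"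
  hence ij: "i < n" "j < n" using B by auto
  show "computable_padic (B $$ (i, j))"
  proof (rule computable_padic_if_approx[OF c Q(1)[OF ij], where N = N])
    fix k
    obtain Y where Y: "Y \<in> carrier_mat n n" "of_nat CARD('p) ^ N \<cdot>\<^sub>m B = map_mat to_fract Y"
      "mat_cong n (padic_p ^ k) Y (map_mat of_int (Q (c k)))" using approx by blast
    have "(of_nat CARD('p) ^ N \<cdot>\<^sub>m B) $$ (i, j) = map_mat to_fract Y $$ (i, j)" by (simp only: Y(2))
    moreover have "padic_p ^ k dvd Y $$ (i, j) - of_int (Q (c k) $$ (i, j))"
      using Y(3) ij carrier_matD[OF Q(2)] by (simp add: mat_cong_def)
    ultimately show "\<exists>y. B $$ (i, j) * of_nat CARD('p) ^ N = to_fract y \<and> padic_p ^ k dvd y - of_int (Q (c k) $$ (i, j))"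
      using ij B Y(1) by (intro exI[of _ "Y $$ (i, j)"]) (simp add: mult.commute)
  qed
qed

context chevalley_representation
begin

text \<open>\<open>x\<^sub>\<alpha>(y / d)\<close> multiplied by \<open>d ^ n\<close>.\<close>

definition homogenized_ru :: "'a::comm_ring_1 \<Rightarrow> 'v \<Rightarrow> 'a \<Rightarrow> 'a mat" where
  "homogenized_ru d \<alpha> y = mat n n (\<lambda>ij. \<Sum>k<n. y ^ k * d ^ (n - k) * of_int (DI \<alpha> k $$ ij))"

lemma homogenized_ru_carrier [simp]: "homogenized_ru d \<alpha> y \<in> carrier_mat n n"
  by (simp add: homogenized_ru_def)

lemma homogenized_ru: "d ^ n \<cdot>\<^sub>m ru \<alpha> t = homogenized_ru d \<alpha> (t * d)"
proof (rule eq_matI)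
  fix i j assume "i < dim_row (homogenized_ru d \<alpha> (t * d))" "j < dim_col (homogenized_ru d \<alpha> (t * d))"
  hence ij: "i < n" "j < n" by (simp_all add: homogenized_ru_def)
  have pw: "d ^ n * (t ^ k * z) = (t * d) ^ k * d ^ (n - k) * z" if "k < n" for k z
  proof -
    have "d ^ n = d ^ k * d ^ (n - k)" using that by (simp flip: power_add)
    thus ?thesis by (simp add: power_mult_distrib ac_simps)
  qed
  have "(d ^ n \<cdot>\<^sub>m ru \<alpha> t) $$ (i, j) = (\<Sum>k<n. d ^ n * (t ^ k * of_int (DI \<alpha> k $$ (i, j))))"
    using ij carrier_matD[OF DI_carrier] by (simp add: ru_eq sum_distrib_left)
  also have "\<dots> = (\<Sum>k<n. (t * d) ^ k * d ^ (n - k) * of_int (DI \<alpha> k $$ (i, j)))"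
    by (rule sum.cong) (simp_all add: pw)
  finally show "(d ^ n \<cdot>\<^sub>m ru \<alpha> t) $$ (i, j) = homogenized_ru d \<alpha> (t * d) $$ (i, j)"
    using ij by (simp add: homogenized_ru_def)
qed (simp_all add: homogenized_ru_def ru_eq)

lemma homogenized_ru_prod:
  "(d ^ n) ^ length ws \<cdot>\<^sub>m mat_prod n (map (\<lambda>l. ru (\<rho> l) (t l)) ws) = mat_prod n (map (\<lambda>l. homogenized_ru d (\<rho> l) (t l * d)) ws)"
proof (induction ws)
  case Nil
  show ?case by (intro eq_matI) auto
next
  case (Cons l ws)
  let ?P = "mat_prod n (map (\<lambda>l. ru (\<rho> l) (t l)) ws)"
  have c: "?P \<in> carrier_mat n n" by (rule mat_prod_carrier) auto
  have "(d ^ n) ^ length (l # ws) \<cdot>\<^sub>m (ru (\<rho> l) (t l) * ?P) = (d ^ n \<cdot>\<^sub>m ru (\<rho> l) (t l)) * ((d ^ n) ^ length ws \<cdot>\<^sub>m ?P)"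
    using c by (intro eq_matI)
      (auto simp: mat_mult_index[of _ n] sum_distrib_left ac_simps carrier_matD[OF ru_carrier])
  thus ?case by (simp add: Cons homogenized_ru)
qed

lemma homogenized_ru_to_fract: "map_mat to_fract (homogenized_ru d \<alpha> y) = homogenized_ru (to_fract d) \<alpha> (to_fract y)"
  unfolding homogenized_ru_def by (intro eq_matI) (simp_all add: to_fract_sum)

lemma homogenized_ru_of_int: "map_mat of_int (homogenized_ru d \<alpha> y) = homogenized_ru (of_int d) \<alpha> (of_int y)"
  unfolding homogenized_ru_def by (intro eq_matI) simp_all

lemma homogenized_ru_cong:
  assumes "q dvd y - y'" shows "mat_cong n q (homogenized_ru d \<alpha> y) (homogenized_ru d \<alpha> y')"
  unfolding mat_cong_def
proof (intro allI impI)
  fix i j assume ij: "i < n" "j < n"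
  have "q dvd y ^ k * d ^ (n - k) * z - y' ^ k * d ^ (n - k) * z" for k z
  proof -
    have "y ^ k * d ^ (n - k) * z - y' ^ k * d ^ (n - k) * z = (y ^ k - y' ^ k) * (d ^ (n - k) * z)"
      by (simp add: algebra_simps)
    moreover have "q dvd y ^ k - y' ^ k" using assms by (rule dvd_trans) (simp add: power_diff_sumr2)
    ultimately show ?thesis by simp
  qed
  hence "q dvd (\<Sum>k<n. y ^ k * d ^ (n - k) * of_int (DI \<alpha> k $$ (i, j)) - y' ^ k * d ^ (n - k) * of_int (DI \<alpha> k $$ (i, j)))"
    by (intro dvd_sum)
  thus "q dvd homogenized_ru d \<alpha> y $$ (i, j) - homogenized_ru d \<alpha> y' $$ (i, j)"
    using ij by (simp add: homogenized_ru_def sum_subtractf)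
qed

lemma computable_int_homogenized_ru:
  "computable_int f \<Longrightarrow> i < n \<Longrightarrow> j < n \<Longrightarrow> computable_int (\<lambda>a. homogenized_ru d \<alpha> (f a) $$ (i, j))"
  by (auto simp: homogenized_ru_def intro!: computable_int_sum computable_int_mult computable_int_power computable_int_const)

text \<open>The parameters may depend on the precision \<open>k\<close>; only the product
  \<open>B\<close> is fixed. A power of \<open>p\<close> times \<open>B\<close> is an integral
  polynomial expression in the cleared parameters, so congruent numerators give congruent matrices
  and the integers \<open>f l (c k)\<close> suffice.\<close>

lemma computable_mat_if_word:
  fixes B :: "'p::prime_card padic mat"
  assumes c: "computable_fun 1 (\<lambda>xs. c (xs ! 0))" and f: "\<And>l. l \<in> set ws \<Longrightarrow> computable_int (f l)"
    and t: "\<And>k. \<exists>t. B = mat_prod n (map (\<lambda>l. ru (\<rho> l) (t l)) ws) \<and>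
      (\<forall>l\<in>set ws. \<exists>y. t l * of_nat CARD('p) ^ s = to_fract y \<and> padic_p ^ k dvd y - of_int (f l (c k)))"
  shows "computable_mat B"
proof (rule computable_mat_if_approx[OF _ c])
  let ?d = "int CARD('p) ^ s"
  let ?Q = "\<lambda>a. mat_prod n (map (\<lambda>l. homogenized_ru ?d (\<rho> l) (f l a)) ws)"
  obtain t0 where "B = mat_prod n (map (\<lambda>l. ru (\<rho> l) (t0 l)) ws)" using t by blast
  thus "B \<in> carrier_mat n n" by (simp only:) (rule mat_prod_carrier, auto)
  show "?Q a \<in> carrier_mat n n" for a by (rule mat_prod_carrier) auto
  show "computable_int (\<lambda>a. ?Q a $$ (i, j))" if "i < n" "j < n" for i j
    by (rule computable_int_mat_prod) (use f that in \<open>auto intro: computable_int_homogenized_ru\<close>)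
  fix k
  obtain t' where B: "B = mat_prod n (map (\<lambda>l. ru (\<rho> l) (t' l)) ws)"
    and t': "\<forall>l\<in>set ws. \<exists>y. t' l * of_nat CARD('p) ^ s = to_fract y \<and> padic_p ^ k dvd y - of_int (f l (c k))"
    using t by blast
  obtain y where y: "\<forall>l\<in>set ws. t' l * of_nat CARD('p) ^ s = to_fract (y l) \<and> padic_p ^ k dvd y l - of_int (f l (c k))"
    using bchoice[OF t'] by blast
  let ?Y = "mat_prod n (map (\<lambda>l. homogenized_ru (padic_p ^ s) (\<rho> l) (y l)) ws)"
  have "((of_nat CARD('p) ^ s) ^ n) ^ length ws \<cdot>\<^sub>m B = mat_prod n (map (\<lambda>l. homogenized_ru (of_nat CARD('p) ^ s) (\<rho> l) (t' l * of_nat CARD('p) ^ s)) ws)"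
    unfolding B by (rule homogenized_ru_prod)
  also have "map (\<lambda>l. homogenized_ru (of_nat CARD('p) ^ s) (\<rho> l) (t' l * of_nat CARD('p) ^ s)) ws
      = map (map_mat to_fract) (map (\<lambda>l. homogenized_ru (padic_p ^ s) (\<rho> l) (y l)) ws)"
    using y by (simp add: homogenized_ru_to_fract)
  also have "mat_prod n \<dots> = map_mat to_fract ?Y" by (rule to_fract_mat_prod[symmetric]) auto
  finally have 1: "of_nat CARD('p) ^ (s * n * length ws) \<cdot>\<^sub>m B = map_mat to_fract ?Y" by (simp add: power_mult)
  have "map_mat of_int (?Q (c k)) = mat_prod n (map (\<lambda>l. homogenized_ru ((padic_p :: 'p padic_int) ^ s) (\<rho> l) (of_int (f l (c k)))) ws)"
    by (subst of_int_mat_prod) (auto simp: comp_def homogenized_ru_of_int)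
  hence "mat_cong n (padic_p ^ k) ?Y (map_mat of_int (?Q (c k)))"
    by (simp only:) (rule mat_prod_cong, use y in \<open>auto intro: homogenized_ru_cong\<close>)
  moreover have "?Y \<in> carrier_mat n n" by (rule mat_prod_carrier) auto
  ultimately show "\<exists>Y. Y \<in> carrier_mat n n \<and> of_nat CARD('p) ^ (s * n * length ws) \<cdot>\<^sub>m B = map_mat to_fract Y \<and>
      mat_cong n (padic_p ^ k) Y (map_mat of_int (?Q (c k)))"
    using 1 by blast
qed

end

subsection \<open>The field case\<close>

lemma common_denominator:
  assumes "finite T"
  shows "\<exists>s. \<forall>t\<in>T. \<exists>y. (t :: 'p::prime_card padic) * of_nat CARD('p) ^ s = to_fract y"
  using assms
proof (induction T rule: finite_induct)
  case (insert t T)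
  let ?P = "of_nat CARD('p) :: 'p padic"
  obtain s where s: "\<forall>t\<in>T. \<exists>y. t * ?P ^ s = to_fract y" using insert.IH by blast
  obtain s' x where x: "t * ?P ^ s' = to_fract x" by (rule padic_denominator)
  have "t * ?P ^ (s + s') = to_fract (x * padic_p ^ s)" using x by (simp add: power_add ac_simps)
  moreover have "\<exists>y. u * ?P ^ (s + s') = to_fract y" if "u \<in> T" for u
  proof -
    obtain y where "u * ?P ^ s = to_fract y" using s \<open>u \<in> T\<close> by blast
    hence "u * ?P ^ (s + s') = to_fract (y * padic_p ^ s')" by (simp add: power_add flip: mult.assoc)
    thus ?thesis by blast
  qed
  ultimately show ?case by (intro exI[of _ "s + s'"]) blast
qed simp

text \<open>Completeness of the field equations: \<open>y\<close> is approximated so well that the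
  remainder, divided by \<open>p ^ (k + 1)\<close>, is still divisible by 4. It then has the shape
  \<open>p * (4 * w)\<close> up to sign, for which \<open>norm_one_solvable\<close> provides the
  other coordinate.\<close>

lemma padic_approx_norm:
  fixes y :: "'p::prime_card padic_int"
  shows "\<exists>m::nat. \<forall>e::int. e * e = 1 \<longrightarrow> (\<exists>x w. 1 + 2 * padic_p * x \<noteq> 0 \<and>
    (1 + 2 * padic_p * x)\<^sup>2 + padic_p * (1 + 2 * padic_p * x) * (4 * w) - padic_p * (4 * w)\<^sup>2 = 1 \<and>
    y = of_nat m + padic_p ^ k * (of_int e * padic_p * (4 * w)))"
proof -
  let ?p = "padic_p :: 'p padic_int"
  have four: "(4 :: 'p padic_int) \<noteq> 0" by simp
  obtain c u where cu: "(4 :: 'p padic_int) = ?p ^ c * u" "u dvd 1" using padic_int_decompose[OF four] by metis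
  obtain u' where u': "1 = u * u'" using cu(2) by (elim dvdE)
  \<comment> \<open>The summand \<open>c\<close> pays for the power of \<open>p\<close> in 4, which
    matters for \<open>p = 2\<close>; the summand 1 pays for the factor \<open>p\<close> in
    \<open>b = p v\<close>.\<close>
  obtain m where "?p ^ (k + 1 + c) dvd y - of_nat m" using padic_int_approx by blast
  then obtain r where r: "y - of_nat m = ?p ^ (k + 1 + c) * r" by (elim dvdE)
  show ?thesis
  proof (intro exI[of _ m] allI impI)
    fix e :: int assume e: "e * e = 1"
    define w where "w = of_int e * u' * r"
    obtain x where x: "(1 + 2 * ?p * x)\<^sup>2 + ?p * (1 + 2 * ?p * x) * (4 * w) - ?p * (4 * w)\<^sup>2 = 1"
      using norm_one_solvable by blast
    \<comment> \<open>This number is 1 modulo \<open>p\<close>. It becomes \<open>u\<close>, by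
      which the factorization of \<open>P\<close> divides.\<close>
    have "1 + 2 * ?p * x \<noteq> 0"
    proof
      assume "1 + 2 * ?p * x = 0"
      hence "(1 :: 'p padic_int) = ?p * (- 2 * x)" by (simp add: eq_neg_iff_add_eq_0 ac_simps)
      hence "?p dvd 1" by (rule dvdI)
      hence "?p ^ 1 dvd of_int 1" by simp
      hence "int CARD('p) ^ 1 dvd 1" by (rule p_power_dvd_of_int)
      thus False using card_gt_1[where 'p = 'p] by simp
    qed
    moreover have "of_int e * ?p * (4 * w) = ?p * (?p ^ c * r)"
    proof -
      have "of_int e * ?p * (4 * w) = ?p * (?p ^ c * (of_int (e * e) * (u * u') * r))"
        unfolding cu(1) w_def by (simp add: ac_simps)
      thus ?thesis by (simp only: e flip: u') simp
    qed
    hence "y = of_nat m + ?p ^ k * (of_int e * ?p * (4 * w))" using r by (simp add: power_add algebra_simps)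
    ultimately show "\<exists>x w. 1 + 2 * ?p * x \<noteq> 0 \<and> (1 + 2 * ?p * x)\<^sup>2 + ?p * (1 + 2 * ?p * x) * (4 * w) - ?p * (4 * w)\<^sup>2 = 1 \<and>
      y = of_nat m + ?p ^ k * (of_int e * ?p * (4 * w))" using x by blast
  qed
qed

context chevalley_representation
begin

context
  fixes K :: "'f::field_char_0 mat set"
  assumes K: "large_subgroup n (\<lambda>\<alpha>. \<pi> (x \<alpha>)) \<Phi> K" and ind: "indecomposable \<Phi>" and rank: "Real_Vector_Spaces.dim \<Phi> > 1"
begin

lemma large_inv: "A \<in> K \<Longrightarrow> inv\<^bsub>CG\<lparr>carrier := K\<rparr>\<^esub> A = adj_mat A"
  using large_adj[OF K] adj_mat_inverse[OF large_carrier[OF K]]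
  by (intro group.inv_equality[OF large_group[OF K]]) simp_all

lemma large_chev_group:
  assumes cs: "set cs = {ru \<alpha> 1 | \<alpha>. \<alpha> \<in> \<Phi>} \<union> {g}" and g: "g \<in> K"
  shows "\<exists>idx. chev_group (scalar_endo :: 'f \<Rightarrow> 'f endo) \<Phi> \<Delta> Xe n (CG\<lparr>carrier := K\<rparr>) (group_endo n) cs idx"
proof -
  have "\<forall>\<alpha>. \<exists>i. \<alpha> \<in> \<Phi> \<longrightarrow> i < length cs \<and> cs ! i = ru \<alpha> 1"
  proof
    fix \<alpha>
    have "\<alpha> \<in> \<Phi> \<longrightarrow> ru \<alpha> 1 \<in> set cs" unfolding cs by blast
    thus "\<exists>i. \<alpha> \<in> \<Phi> \<longrightarrow> i < length cs \<and> cs ! i = ru \<alpha> 1" by (auto simp: in_set_conv_nth)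
  qed
  from choice[OF this] obtain idx where idx: "\<forall>\<alpha>. \<alpha> \<in> \<Phi> \<longrightarrow> idx \<alpha> < length cs \<and> cs ! idx \<alpha> = ru \<alpha> 1" by (elim exE)
  have "\<Phi> \<noteq> {}" using ind by (simp add: indecomposable_def)
  then interpret chev_alg "scalar_endo :: 'f \<Rightarrow> 'f endo" \<Phi> \<Delta> Xe n by (rule chev_alg)
  have "set cs \<subseteq> K" using cs g large_ru[OF K] by auto
  hence "group_embedding (CG\<lparr>carrier := K\<rparr>) (\<lambda>A. group_endo n (id A)) cs"
    by (rule large_group_embedding[OF K]) (use large_carrier[OF K] in auto)
  then interpret group_embedding "CG\<lparr>carrier := K\<rparr>" "group_endo n" cs by (simp only: id_apply)
  have xr: "group_endo n (ru \<alpha> t) = xr \<alpha> t" if "\<alpha> \<in> \<Phi>" for \<alpha> t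
    unfolding xr_def by (rule ru_group_endo[OF that])
  have "chev_group (scalar_endo :: 'f \<Rightarrow> 'f endo) \<Phi> \<Delta> Xe n (CG\<lparr>carrier := K\<rparr>) (group_endo n) cs idx"
  proof unfold_locales
    fix \<alpha> assume \<alpha>: "\<alpha> \<in> \<Phi>"
    show "idx \<alpha> < length cs" using idx \<alpha> by blast
    show "group_endo n (cs ! idx \<alpha>) = xr \<alpha> 1" using idx \<alpha> xr[OF \<alpha>] by simp
    show "\<exists>A\<in>carrier (CG\<lparr>carrier := K\<rparr>). group_endo n A = xr \<alpha> t" for t
      using large_ru[OF K \<alpha>, of t] xr[OF \<alpha>, of t] by auto
    fix A assume "A \<in> carrier (CG\<lparr>carrier := K\<rparr>)"
    hence A: "A \<in> K" by simp
    obtain c d where "group_endo n A * Xe \<alpha> * group_endo n (adj_mat A)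
        = (\<Sum>\<beta>\<in>\<Phi>. scalar_endo (c \<beta>) * Xe \<beta>) + (\<Sum>a\<in>\<Delta>. scalar_endo (d a) * commutator (Xe a) (Xe (- a)))"
      using CG_conj_lie_span[OF \<alpha> large_CG[OF K A]] by (elim exE)
    hence "group_endo n A * Xe \<alpha> * group_endo n (adj_mat A) = lin_comb c d" by (simp only: lin_comb_def Hr_def)
    thus "group_endo n A * Xe \<alpha> * group_endo n (inv\<^bsub>CG\<lparr>carrier := K\<rparr>\<^esub> A) \<in> lie_span"
      unfolding large_inv[OF A] by (simp only: lie_spanI)
  qed (use ind rank in auto)
  thus ?thesis by blast
qed

lemma elementary_expressible:
  assumes "g \<in> elementary_group n (\<lambda>\<alpha>. \<pi> (x \<alpha>)) \<Phi>"
  shows "chev_alg.expressible (scalar_endo :: 'f \<Rightarrow> 'f endo) \<Phi> Xe n (group_endo n g)"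
proof -
  have "\<Phi> \<noteq> {}" using ind by (simp add: indecomposable_def)
  then interpret chev_alg "scalar_endo :: 'f \<Rightarrow> 'f endo" \<Phi> \<Delta> Xe n by (rule chev_alg)
  have ru: "expressible (group_endo n (ru \<alpha> t))" if "\<alpha> \<in> \<Phi>" for \<alpha> and t :: 'f
    using expressible_xr[OF ind that, of t] unfolding xr_def ru_group_endo[OF that] .
  show ?thesis using assms unfolding elementary_group_def
  proof (induction rule: generate.induct)
    case one
    show ?case using expressible_1 by (simp add: group_endo_one)
  next
    case (incl B)
    thus ?case using ru by auto
  next
    case (inv B)
    then obtain \<alpha> t where B: "B = ru \<alpha> t" "\<alpha> \<in> \<Phi>" by auto
    note c = large_carrier[OF K large_ru[OF K B(2)], of t]
    have "inv\<^bsub>SL n\<^esub> B = ru \<alpha> (- t)"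
      using SL_inverse[of B n] adj_unique[OF c(1) ru_carrier c(2) ru_field_props(3)[OF B(2)]] c by (simp add: B(1))
    thus ?case using ru[OF B(2)] by simp
  next
    case (eng A B)
    have "A \<in> carrier_mat n n" "B \<in> carrier_mat n n"
      using eng(1,2) large_elementary[OF K] large_carrier[OF K] unfolding elementary_group_def by blast+
    thus ?case using expressible_mult[OF eng(3,4)] by (simp add: group_endo_mult(1)[of _ n])
  qed
qed

end

theorem computable_if_decidable_field:
  fixes g :: "'p::prime_card padic mat"
  assumes ind: "indecomposable \<Phi>" and rank: "Real_Vector_Spaces.dim \<Phi> > 1"
    and g: "g \<in> elementary_group n (\<lambda>\<alpha>. \<pi> (x \<alpha>)) \<Phi>" and K: "large_subgroup n (\<lambda>\<alpha>. \<pi> (x \<alpha>)) \<Phi> K"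
    and dec: "diophantine_decidable (CG\<lparr>carrier := K\<rparr>) ({ru \<alpha> 1 | \<alpha>. \<alpha> \<in> \<Phi>} \<union> {g})"
  shows "computable_mat g"
proof -
  let ?P = "of_nat CARD('p) :: 'p padic" and ?p = "CARD('p)"
  let ?G = "CG\<lparr>carrier := K\<rparr>"
  have gK: "g \<in> K" using g large_elementary[OF K] by blast
  obtain cs f where cs: "set cs = {ru \<alpha> 1 | \<alpha>. \<alpha> \<in> \<Phi>} \<union> {g}" and f: "computable f"
    "\<And>S. system_over cs S \<Longrightarrow> f (system_code S) = 1 \<longleftrightarrow> solvable_in ?G cs S"
    using dec unfolding diophantine_decidable_def by blast
  obtain idx where "chev_group (scalar_endo :: 'p padic \<Rightarrow> 'p padic endo) \<Phi> \<Delta> Xe n ?G (group_endo n) cs idx"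
    using large_chev_group[OF K ind rank cs gK] by (elim exE)
  then interpret chev_group "scalar_endo :: 'p padic \<Rightarrow> 'p padic endo" \<Phi> \<Delta> Xe n ?G "group_endo n" cs idx .
  have "g \<in> set cs" unfolding cs by simp
  then obtain gi where gi: "gi < length cs" "cs ! gi = g" by (auto simp: in_set_conv_nth)
  obtain w where w: "long_word w" "ignores_central w" and gw: "root_value snd w = group_endo n g"
    using elementary_expressible[OF K ind rank g] unfolding expressible_def by (elim exE conjE)
  define pars where "pars = remdups (concat (map (\<lambda>l. case fst l of Param q \<Rightarrow> [q] | Const \<alpha> \<Rightarrow> []) w))"
  define ix where "ix q = (SOME j. j < length pars \<and> pars ! j = q)" for q
  have pars_iff: "q \<in> set pars \<longleftrightarrow> (\<exists>b. (Param q, b) \<in> set w)" for q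
  proof -
    have "q \<in> set (case s of Param q \<Rightarrow> [q] | Const \<alpha> \<Rightarrow> []) \<longleftrightarrow> s = Param q" for s :: "('v, 'p padic) symb"
      by (cases s) auto
    hence "q \<in> set pars \<longleftrightarrow> (\<exists>l\<in>set w. fst l = Param q)" by (simp add: pars_def)
    thus ?thesis by (auto simp: Bex_def)
  qed
  have pars1: "q \<in> set pars" if "(Param q, b) \<in> set w" for q b using that unfolding pars_iff by blast
  have pars2: "long (fst q)" if mem: "q \<in> set pars" for q
  proof -
    obtain b where "(Param (fst q, snd q), b) \<in> set w" using mem unfolding pars_iff by auto
    thus ?thesis using w(1) unfolding long_word_def by blast
  qed
  have ix: "ix (pars ! j) = j" if "j < length pars" for j
  proof -
    have 1: "ix (pars ! j) < length pars \<and> pars ! ix (pars ! j) = pars ! j"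
      unfolding ix_def by (rule someI[of _ j]) (use that in simp)
    have "distinct pars" by (simp add: pars_def)
    from nth_eq_iff_index_eq[OF this conjunct1[OF 1] that] 1 show ?thesis by blast
  qed
  obtain s where "\<forall>t\<in>snd ` set pars. \<exists>y. t * ?P ^ s = to_fract y"
    using common_denominator[of "snd ` set pars"] by blast
  hence "\<forall>q\<in>set pars. \<exists>y. snd q * ?P ^ s = to_fract y" by blast
  from bchoice[OF this] obtain y where y: "\<forall>q\<in>set pars. snd q * ?P ^ s = to_fract (y q)" by (elim exE)
  \<comment> \<open>\<open>N\<close> is the common denominator \<open>p ^ s\<close> of the
    parameters: natural powers of \<open>x\<^sub>\<gamma>(1 / p ^ s)\<close> approximate every
    parameter with that denominator.\<close>
  have N: "?p ^ s > 0" and p: "?p > 0" by simp_all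
  have P0: "?P \<noteq> 0" by simp
  let ?S = "param_system pars ix w (?p ^ s) ?p gi"
  note sys = w pars1 pars2 ix N p gi(1)
  have over: "system_over cs ?S" using param_system_over[OF sys] .
  have solvable: "\<exists>m. solvable_in ?G cs (power_system (length pars) ?S m (1 * ?p ^ k))" for k
  proof -
    \<comment> \<open>Precision \<open>s + k\<close> is needed because the numerators are the
      parameters multiplied by \<open>p ^ s\<close>, which raises the error \<open>p ^ k\<close> to
      that order.\<close>
    have "\<exists>m. \<forall>q. \<forall>e::int. e * e = 1 \<longrightarrow> (\<exists>x w. 1 + 2 * padic_p * x \<noteq> 0 \<and>
      (1 + 2 * padic_p * x)\<^sup>2 + padic_p * (1 + 2 * padic_p * x) * (4 * w) - padic_p * (4 * w)\<^sup>2 = 1 \<and>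
      y q = of_nat (m q) + padic_p ^ (s + k) * (of_int e * padic_p * (4 * w)))"
      by (rule choice) (use padic_approx_norm[of _ "s + k"] in blast)
    then obtain m where m: "\<And>q e. e * e = 1 \<Longrightarrow> \<exists>x w. 1 + 2 * padic_p * x \<noteq> 0 \<and>
      (1 + 2 * padic_p * x)\<^sup>2 + padic_p * (1 + 2 * padic_p * x) * (4 * w) - padic_p * (4 * w)\<^sup>2 = 1 \<and>
      y q = of_nat (m q) + padic_p ^ (s + k) * (of_int (e :: int) * padic_p * (4 * w))" by (elim exE) blast
    have "solvable_in ?G cs (power_system (length pars) ?S (\<lambda>j. m (pars ! j)) (1 * ?p ^ k))"
    proof (rule param_system_complete[OF sys])
      show "group_endo n (cs ! gi) = root_value snd w" using gw gi(2) by simp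
      fix q and e :: int assume q: "q \<in> set pars" and e: "e * e = 1"
      obtain x' w' where xw: "1 + 2 * padic_p * x' \<noteq> 0"
        "(1 + 2 * padic_p * x')\<^sup>2 + padic_p * (1 + 2 * padic_p * x') * (4 * w') - padic_p * (4 * w')\<^sup>2 = 1"
        "y q = of_nat (m q) + padic_p ^ (s + k) * (of_int e * padic_p * (4 * w'))" using m[OF e] by blast
      define U V where "U = 1 + 2 * padic_p * x'" and "V = 4 * w'"
      define u v where "u = to_fract U" and "v = to_fract V"
      note xw = xw[folded U_def V_def]
      have "u \<noteq> 0" using xw(1) by (simp add: u_def)
      moreover have "u\<^sup>2 + of_nat ?p * u * v - of_nat ?p * v\<^sup>2 = 1"
        using arg_cong[OF xw(2), of to_fract] by (simp add: u_def v_def)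
      moreover have "pars ! ix q = q" using ix_bound[OF sys q] by simp
      moreover have "snd q = of_nat (m q) / of_nat (?p ^ s) + of_nat (1 * ?p ^ k) * (of_int e * of_nat ?p * v)"
      proof -
        have "snd q * ?P ^ s = of_nat (m q) + ?P ^ (s + k) * (of_int e * ?P * v)"
          using y q xw(3) by (simp add: v_def)
        thus ?thesis using P0 by (simp add: power_add field_simps)
      qed
      ultimately show "\<exists>u v. u \<noteq> 0 \<and> u\<^sup>2 + of_nat ?p * u * v - of_nat ?p * v\<^sup>2 = 1 \<and>
        snd q = of_nat (m (pars ! ix q)) / of_nat (?p ^ s) + of_nat (1 * ?p ^ k) * (of_int e * of_nat ?p * v)"
        by (intro exI[of _ u] exI[of _ v]) simp
    qed
    thus ?thesis by (intro exI[of _ "\<lambda>j. m (pars ! j)"])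
  qed
  have "\<exists>c. computable_fun 1 (\<lambda>xs. c (xs ! 0)) \<and>
    (\<forall>k. solvable_in ?G cs (power_system (length pars) ?S (\<lambda>j. tuple_entry j (c k)) (1 * ?p ^ k)))"
    by (rule computable_search[OF f(1) _ over solvable]) (rule f(2))
  then obtain c where c: "computable_fun 1 (\<lambda>xs. c (xs ! 0))"
    and sol: "\<forall>k. solvable_in ?G cs (power_system (length pars) ?S (\<lambda>j. tuple_entry j (c k)) (1 * ?p ^ k))"
    by (elim exE conjE)
  \<comment> \<open>Letter \<open>l\<close> evaluates to the root element of \<open>\<rho> l\<close>
    with parameter \<open>T \<tau> l\<close>. The integer \<open>F l\<close> approximates this
    parameter times \<open>p ^ s\<close> and is exact for constant letters.\<close>
  define \<rho> where "\<rho> l = (case fst l of Const \<alpha> \<Rightarrow> \<alpha> | Param q \<Rightarrow> fst q)" for l :: "('v, 'p padic) symb \<times> bool"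
  define F where "F l a = (if snd l then - 1 else 1) * (case fst l of Const \<alpha> \<Rightarrow> int ?p ^ s | Param q \<Rightarrow> int (tuple_entry (ix q) a))"
    for l :: "('v, 'p padic) symb \<times> bool" and a
  define T where "T \<tau> l = (if snd l then - 1 else 1) * (case fst l of Const \<alpha> \<Rightarrow> 1 | Param q \<Rightarrow> \<tau> q)"
    for \<tau> :: "'v \<times> 'p padic \<Rightarrow> 'p padic" and l
  have letter: "symb_value (\<lambda>q. xr (fst q) (\<tau> q)) (\<lambda>q. xr (fst q) (- \<tau> q)) l = group_endo n (ru (\<rho> l) (T \<tau> l))"
    if l: "l \<in> set w" for \<tau> l
  proof -
    obtain a b where ab: "l = (a, b)" by fastforce
    have "\<rho> l \<in> \<Phi>"
    proof (cases a)
      case (Const \<alpha>)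
      thus ?thesis using w(1) l unfolding ab long_word_def \<rho>_def by auto
    next
      case (Param q)
      thus ?thesis using long_root[OF pars2[OF pars1]] l unfolding ab \<rho>_def by auto
    qed
    thus ?thesis unfolding xr_def ru_group_endo[OF \<open>\<rho> l \<in> \<Phi>\<close>] by (cases a) (simp_all add: ab \<rho>_def T_def xr_def)
  qed
  show ?thesis
  proof (rule computable_mat_if_word[OF c])
    show "computable_int (F l)" for l
      unfolding F_def by (rule computable_int_mult[OF computable_int_const], cases "fst l")
        (simp_all add: computable_int_const computable_int_tuple_entry)
    fix k
    have "\<exists>\<tau>. group_endo n (cs ! gi) = root_value \<tau> w \<and> (\<forall>q\<in>set pars. \<exists>(e::int) u v. e * e = 1 \<and>
      u\<^sup>2 + of_nat ?p * u * v - of_nat ?p * v\<^sup>2 = 1 \<and>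
      \<tau> q = of_nat (tuple_entry (ix q) (c k)) / of_nat (?p ^ s) + of_nat (1 * ?p ^ k) * (of_int e * of_nat ?p * v))"
      by (rule param_system_sound[OF sys sol[rule_format, of k]])
    then obtain \<tau> where g\<tau>: "group_endo n (cs ! gi) = root_value \<tau> w" and \<tau>: "\<forall>q\<in>set pars. \<exists>(e::int) u v. e * e = 1 \<and>
      u\<^sup>2 + of_nat ?p * u * v - of_nat ?p * v\<^sup>2 = 1 \<and>
      \<tau> q = of_nat (tuple_entry (ix q) (c k)) / of_nat (?p ^ s) + of_nat (1 * ?p ^ k) * (of_int e * of_nat ?p * v)"
      by (elim exE conjE)
    have cr: "set (map (\<lambda>l. ru (\<rho> l) (T \<tau> l)) w) \<subseteq> carrier_mat n n" by auto
    have "group_endo n g = prod_list (map (group_endo n) (map (\<lambda>l. ru (\<rho> l) (T \<tau> l)) w))"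
      using g\<tau> gi(2) letter[of _ \<tau>] by (simp add: root_value_def pword_value_def comp_def cong: map_cong)
    also have "\<dots> = group_endo n (mat_prod n (map (\<lambda>l. ru (\<rho> l) (T \<tau> l)) w))"
      by (rule group_endo_mat_prod[OF cr, symmetric])
    finally have "g = mat_prod n (map (\<lambda>l. ru (\<rho> l) (T \<tau> l)) w)"
      using large_carrier[OF K gK] mat_prod_carrier[OF cr] by (intro group_endo_inject[of _ n])
    moreover have "\<exists>y. T \<tau> l * ?P ^ s = to_fract y \<and> padic_p ^ k dvd y - of_int (F l (c k))" if l: "l \<in> set w" for l
    proof -
      obtain a b where ab: "l = (a, b)" by fastforce
      show ?thesis
      proof (cases a)
        case (Const \<alpha>)
        show ?thesis
          by (rule exI[of _ "of_int (F l (c k))"]) (simp add: T_def F_def ab Const)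
      next
        case (Param q)
        have "q \<in> set pars" using pars1 l unfolding ab Param by blast
        then obtain e :: int and u v where uv: "u\<^sup>2 + of_nat ?p * u * v - of_nat ?p * v\<^sup>2 = 1"
          "\<tau> q = of_nat (tuple_entry (ix q) (c k)) / of_nat (?p ^ s) + of_nat (1 * ?p ^ k) * (of_int e * of_nat ?p * v)"
          using \<tau> by blast
        \<comment> \<open>Here anisotropy enters: only an integral \<open>v\<close> makes the error
          term divisible by \<open>p ^ k\<close>.\<close>
        obtain z where z: "v = to_fract z" using norm_one_integral[OF uv(1)] by blast
        let ?r = "padic_p ^ k * (padic_p ^ s * (of_int e * padic_p * z))"
        have \<tau>s: "\<tau> q * ?P ^ s = to_fract (of_nat (tuple_entry (ix q) (c k)) + ?r)"
          using P0 unfolding uv(2) z by (simp add: field_simps)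
        show ?thesis
        proof (cases b)
          case True
          have "T \<tau> l * ?P ^ s = to_fract (- (of_nat (tuple_entry (ix q) (c k)) + ?r))"
            using \<tau>s by (simp add: T_def ab Param True)
          moreover have "- (of_nat (tuple_entry (ix q) (c k)) + ?r) - of_int (F l (c k)) = padic_p ^ k * - (padic_p ^ s * (of_int e * padic_p * z))"
            by (simp add: F_def ab Param True)
          ultimately show ?thesis by (metis dvd_triv_left)
        next
          case False
          have "T \<tau> l * ?P ^ s = to_fract (of_nat (tuple_entry (ix q) (c k)) + ?r)"
            using \<tau>s by (simp add: T_def ab Param False)
          moreover have "of_nat (tuple_entry (ix q) (c k)) + ?r - of_int (F l (c k)) = ?r"
            by (simp add: F_def ab Param False)
          ultimately show ?thesis by (metis dvd_triv_left)
        qed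
      qed
    qed
    ultimately show "\<exists>t. g = mat_prod n (map (\<lambda>l. ru (\<rho> l) (t l)) w) \<and>
      (\<forall>l\<in>set w. \<exists>y. t l * ?P ^ s = to_fract y \<and> padic_p ^ k dvd y - of_int (F l (c k)))"
      by (intro exI[of _ "T \<tau>"]) blast
  qed
qed

end

subsection \<open>The ring case\<close>

lemma mult_of_nat_left_commute: "x * (of_nat m * y) = of_nat m * (x * (y :: 'e::ring_1))"
  by (metis mult.assoc mult_of_nat_commute)

text \<open>Besides integers only powers of the single element \<open>D\<close> occur, so the
  expansion to second order works in a noncommutative ring.\<close>

lemma power_congruent_one:
  fixes D :: "'e::ring_1"
  shows "\<exists>E. (1 + of_nat q * D) ^ m = 1 + of_nat q * (of_nat m * D) + of_nat (q * q) * E"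
proof (induction m)
  case 0
  show ?case by (rule exI[of _ 0]) simp
next
  case (Suc m)
  let ?q = "of_nat q :: 'e"
  obtain E where E: "(1 + ?q * D) ^ m = 1 + ?q * (of_nat m * D) + of_nat (q * q) * E" using Suc by blast

  have "(1 + ?q * D) ^ Suc m = (1 + ?q * D) * (1 + ?q * (of_nat m * D) + of_nat (q * q) * E)" by (simp only: power_Suc E)
  also have "\<dots> = 1 + ?q * (of_nat (Suc m) * D) + of_nat (q * q) * (of_nat m * (D * D) + E + ?q * (D * E))"
    by (simp add: distrib_left distrib_right mult.assoc mult_of_nat_left_commute[of D] add_ac)
  finally show ?case by blast
qed

text \<open>Taking the \<open>p\<close>-th power of \<open>1 + q D\<close> with
  \<open>q = p ^ Suc k\<close> multiplies the linear term by \<open>p\<close>, and the rest is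
  divisible by \<open>q * q\<close>, hence by \<open>p * q\<close>. So every such power gains one
  digit.\<close>

lemma power_p_power_congruent_one:
  fixes C :: "'e::ring_1"
  assumes "\<exists>D. C = 1 + of_nat p * D"
  shows "\<exists>D. C ^ (p ^ k) = 1 + of_nat (p ^ Suc k) * D"
proof (induction k)
  case (Suc k)
  obtain D where D: "C ^ (p ^ k) = 1 + of_nat (p ^ Suc k) * D" using Suc by blast
  obtain E where E: "(1 + of_nat (p ^ Suc k) * D) ^ p = 1 + of_nat (p ^ Suc k) * (of_nat p * D) + of_nat (p ^ Suc k * p ^ Suc k) * E"
    using power_congruent_one by blast
  have "C ^ (p ^ Suc k) = (C ^ (p ^ k)) ^ p" by (simp add: mult.commute flip: power_mult)
  also have "\<dots> = 1 + of_nat (p ^ Suc (Suc k)) * (D + of_nat (p ^ k) * E)"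
  proof -
    have "p ^ Suc k * p ^ Suc k = p ^ Suc (Suc k) * p ^ k" "p ^ Suc k * p = p ^ Suc (Suc k)" by (simp_all add: ac_simps)
    hence "of_nat (p ^ Suc k * p ^ Suc k) = (of_nat (p ^ Suc (Suc k)) * of_nat (p ^ k) :: 'e)"
      "of_nat (p ^ Suc k) * of_nat p = (of_nat (p ^ Suc (Suc k)) :: 'e)" by (simp_all only: of_nat_mult[symmetric])
    thus ?thesis unfolding D E by (simp only: distrib_left mult.assoc[symmetric] add.assoc)
  qed
  finally show ?case by blast
qed (use assms in simp)

lemma endo_entry_of_nat: "endo_entry (of_nat m * f) ij = of_nat m * endo_entry f ij"
  by (induction m) (simp_all add: endo_entry_0 endo_entry_add algebra_simps)

lemma mat_endo_of_nat: "D \<in> carrier_mat n n \<Longrightarrow> mat_endo n (of_nat m \<cdot>\<^sub>m D) = of_nat m * mat_endo n D"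
proof (induction m)
  case 0
  have "of_nat 0 \<cdot>\<^sub>m D = 0\<^sub>m n n" using 0 by (intro eq_matI) auto
  thus ?case by (simp add: mat_endo_zero)
next
  case (Suc m)
  have "of_nat (Suc m) \<cdot>\<^sub>m D = D + of_nat m \<cdot>\<^sub>m D" using Suc.prems by (intro eq_matI) (auto simp: algebra_simps)
  thus ?case using Suc by (simp add: mat_endo_add[of _ n] distrib_right)
qed

lemma group_endo_congruent_one:
  assumes B: "B \<in> carrier_mat n n" and "mat_cong n (of_nat q) B (1\<^sub>m n)"
  shows "\<exists>D. group_endo n B = 1 + of_nat q * D"
proof -
  have "\<forall>ij. \<exists>d. ij \<in> {..<n} \<times> {..<n} \<longrightarrow> B $$ ij - 1\<^sub>m n $$ ij = of_nat q * d"
  proof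
    fix ij :: "nat \<times> nat"
    obtain i j where ij: "ij = (i, j)" by fastforce
    have "of_nat q dvd B $$ (i, j) - 1\<^sub>m n $$ (i, j)" if "i < n" "j < n"
      using assms(2) that unfolding mat_cong_def by blast
    thus "\<exists>d. ij \<in> {..<n} \<times> {..<n} \<longrightarrow> B $$ ij - 1\<^sub>m n $$ ij = of_nat q * d" unfolding ij dvd_def by auto
  qed
  from choice[OF this] obtain d where d: "\<forall>ij. ij \<in> {..<n} \<times> {..<n} \<longrightarrow> B $$ ij - 1\<^sub>m n $$ ij = of_nat q * d ij" by (elim exE)
  have "B = 1\<^sub>m n + of_nat q \<cdot>\<^sub>m mat n n d"
    using d B by (intro eq_matI) (auto simp: algebra_simps)
  hence "mat_endo n B = mat_endo n (1\<^sub>m n) + of_nat q * mat_endo n (mat n n d)"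
    by (simp only:) (simp add: mat_endo_add[of _ n] mat_endo_of_nat)
  hence "group_endo n B = 1 + of_nat q * mat_endo n (mat n n d)" by (simp add: group_endo_def)
  thus ?thesis by (rule exI)
qed

lemma endo_entry_group: "i < n \<Longrightarrow> j < n \<Longrightarrow> endo_entry (group_endo n A) (i, j) = A $$ (i, j)"
proof -
  assume ij: "i < n" "j < n"
  have "endo_entry (1 - mat_endo n (1\<^sub>m n)) (i, j) + endo_entry (mat_endo n (1\<^sub>m n)) (i, j) = endo_entry (1 :: 'a endo) (i, j)"
    by (simp flip: endo_entry_add)
  moreover have "endo_entry (1 :: 'a endo) (i, j) = (if i = j then 1 else 0)"
    by (simp add: endo_entry_def one_endo.rep_eq)
  ultimately show ?thesis using ij by (simp add: group_endo_def endo_entry_add endo_entry_mat)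
qed

lemma mat_cong_if_group_endo:
  assumes "group_endo n A = group_endo n B * (1 + of_nat q * D)" shows "mat_cong n (of_nat q) A B"
  unfolding mat_cong_def
proof (intro allI impI)
  fix i j assume ij: "i < n" "j < n"
  have "group_endo n A = group_endo n B + of_nat q * (group_endo n B * D)"
    unfolding assms by (simp add: distrib_left mult_of_nat_left_commute)
  hence "A $$ (i, j) = B $$ (i, j) + of_nat q * endo_entry (group_endo n B * D) (i, j)"
    using ij by (simp add: endo_entry_add endo_entry_of_nat flip: endo_entry_group)
  thus "of_nat q dvd A $$ (i, j) - B $$ (i, j)" by simp
qed

lemma mat_cong_refl: "mat_cong n q A A" by (simp add: mat_cong_def)

lemma group_endo_pow: "A \<in> carrier_mat n n \<Longrightarrow> group_endo n (A ^\<^sub>m k) = group_endo n A ^ k"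
  by (induction k) (simp_all add: group_endo_one group_endo_mult(1)[of _ n] power_commutes)

text \<open>Pigeonhole principle for the powers of \<open>B\<close> modulo \<open>p\<close>.\<close>

lemma congruence_exponent:
  "\<exists>M>0. \<forall>B :: 'p::prime_card padic_int mat. B \<in> carrier_mat n n \<longrightarrow> det B = 1 \<longrightarrow>
    (\<exists>D. group_endo n B ^ M = 1 + of_nat CARD('p) * D)"
proof -
  \<comment> \<open>Matrices modulo \<open>p\<close>, recorded as the functions of their digit-zero
    residues. Their number bounds the exponent independently of \<open>B\<close>.\<close>
  define R where "R = ({..<n} \<times> {..<n}) \<rightarrow>\<^sub>E {0..<int CARD('p)}"
  have fin: "finite R" unfolding R_def by (intro finite_PiE) auto
  define T where "T = card R"
  have "\<exists>D. group_endo n B ^ fact T = 1 + of_nat CARD('p) * D"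
    if B: "B \<in> carrier_mat n n" "det B = 1" for B :: "'p padic_int mat"
  proof -
    define r where "r k = restrict (\<lambda>ij. residue ((B ^\<^sub>m k) $$ ij) 0) ({..<n} \<times> {..<n})" for k
    have rb: "0 \<le> residue z 0 \<and> residue z 0 < int CARD('p)" for z :: "'p padic_int"
      using residue_bounds[of z 0] by simp
    have "r ` {..T} \<subseteq> R"
    proof
      fix f assume "f \<in> r ` {..T}"
      then obtain k where f: "f = r k" by blast
      show "f \<in> R" unfolding R_def f r_def restrict_PiE_iff by (simp add: rb)
    qed
    hence "card (r ` {..T}) \<le> T" unfolding T_def by (intro card_mono fin)
    hence "\<not> inj_on r {..T}" using card_image[of r "{..T}"] by auto
    then obtain a b where ab: "a < b" "b \<le> T" "r a = r b"
      unfolding inj_on_def by (metis atMost_iff linorder_neqE_nat)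
    have cong: "mat_cong n (of_nat CARD('p)) (B ^\<^sub>m b) (B ^\<^sub>m a)"
      unfolding mat_cong_def
    proof (intro allI impI)
      fix i j assume "i < n" "j < n"
      hence "residue ((B ^\<^sub>m b) $$ (i, j)) 0 = residue ((B ^\<^sub>m a) $$ (i, j)) 0"
        using fun_cong[OF ab(3), of "(i, j)"] by (simp add: r_def)
      thus "of_nat CARD('p) dvd (B ^\<^sub>m b) $$ (i, j) - (B ^\<^sub>m a) $$ (i, j)" by (simp add: residue_eq_iff_dvd)
    qed
    note adj = adj_mat_inverse[OF B]
    have A: "adj_mat B ^\<^sub>m a \<in> carrier_mat n n" using adj_mat(1)[OF B(1)] by simp
    have Bab: "B ^\<^sub>m a \<in> carrier_mat n n" "B ^\<^sub>m b \<in> carrier_mat n n" using B(1) by simp_all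
    have "group_endo n B * group_endo n (adj_mat B) = 1"
      using adj(1) B(1) adj_mat(1)[OF B(1)] by (simp add: group_endo_one flip: group_endo_mult(1)[of _ n])
    hence "group_endo n (B ^\<^sub>m a * adj_mat B ^\<^sub>m a) = group_endo n (1\<^sub>m n)"
      using left_right_inverse_power by (simp add: group_endo_mult(1)[OF Bab(1) A] group_endo_pow[OF B(1)]
          group_endo_pow[OF adj_mat(1)[OF B(1)]] group_endo_one)
    hence inv: "B ^\<^sub>m a * adj_mat B ^\<^sub>m a = 1\<^sub>m n"
      by (rule group_endo_inject[rotated 2]) (auto intro: mult_carrier_mat[OF Bab(1) A])
    have "mat_cong n (of_nat CARD('p)) (B ^\<^sub>m b * adj_mat B ^\<^sub>m a) (B ^\<^sub>m a * adj_mat B ^\<^sub>m a)"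
      by (rule mat_cong_mult[OF cong mat_cong_refl Bab(2,1) A A])
    hence "\<exists>D. group_endo n (B ^\<^sub>m b * adj_mat B ^\<^sub>m a) = 1 + of_nat CARD('p) * D"
      unfolding inv by (intro group_endo_congruent_one mult_carrier_mat[OF Bab(2) A])
    moreover have "group_endo n (B ^\<^sub>m b * adj_mat B ^\<^sub>m a) = group_endo n B ^ (b - a)"
    proof -
      have "group_endo n (B ^\<^sub>m b * adj_mat B ^\<^sub>m a) = group_endo n B ^ (b - a + a) * group_endo n (adj_mat B ^\<^sub>m a)"
        using ab(1) by (simp add: group_endo_mult(1)[OF Bab(2) A] group_endo_pow[OF B(1)])
      also have "\<dots> = group_endo n B ^ (b - a) * group_endo n (B ^\<^sub>m a * adj_mat B ^\<^sub>m a)"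
        by (simp only: power_add mult.assoc group_endo_mult(1)[OF Bab(1) A] group_endo_pow[OF B(1)])
      finally show ?thesis by (simp add: inv group_endo_one)
    qed
    ultimately obtain D where D: "group_endo n B ^ (b - a) = 1 + of_nat CARD('p) * D" by auto
    \<comment> \<open>The period \<open>b - a\<close> depends on \<open>B\<close> but is at most
      \<open>T\<close>, so the factorial of \<open>T\<close> serves for all matrices at
      once.\<close>
    have "b - a dvd fact T" using ab by (intro dvd_fact) auto
    then obtain m where m: "fact T = (b - a) * m" by (elim dvdE)
    obtain E where E: "(1 + of_nat CARD('p) * D) ^ m = 1 + of_nat CARD('p) * (of_nat m * D) + of_nat (CARD('p) * CARD('p)) * E"
      using power_congruent_one by blast
    have "group_endo n B ^ fact T = 1 + of_nat CARD('p) * (of_nat m * D + of_nat CARD('p) * E)"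
      unfolding m power_mult D E by (simp add: distrib_left mult.assoc)
    thus ?thesis by blast
  qed
  thus ?thesis by (intro exI[of _ "fact T"]) auto
qed

context chevalley_representation
begin

lemma ru_to_fract: "map_mat to_fract (ru \<alpha> t) = ru \<alpha> (to_fract t)"
  unfolding ru_eq by (intro eq_matI) (simp_all add: to_fract_sum carrier_matD[OF DI_carrier])

text \<open>The exponential laws were obtained by dividing by factorials, so over a domain they are
  checked in the fraction field, where the root elements keep their integral definition.\<close>

lemma ru_add_mult:
  fixes s t :: "'a::{idom,ring_char_0}"
  assumes \<alpha>: "\<alpha> \<in> \<Phi>"
  shows "ru \<alpha> (s + t) = ru \<alpha> s * ru \<alpha> t" "ru \<alpha> (0 :: 'a) = 1\<^sub>m n" "ru \<alpha> t * ru \<alpha> (- t) = 1\<^sub>m n"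
proof -
  have inj: "A = B" if eq: "map_mat to_fract A = map_mat to_fract B" for A B :: "'a mat"
  proof (rule eq_matI)
    show d: "dim_row A = dim_row B" "dim_col A = dim_col B"
      using arg_cong[OF eq, of dim_row] arg_cong[OF eq, of dim_col] by simp_all
    fix i j assume "i < dim_row B" "j < dim_col B"
    thus "A $$ (i, j) = B $$ (i, j)" using arg_cong[OF eq, of "\<lambda>M. M $$ (i, j)"] d by simp
  qed
  show add: "ru \<alpha> (s + t) = ru \<alpha> s * ru \<alpha> t" for s t :: 'a
    by (rule inj) (simp add: to_fract_mat_mult[of _ n] ru_to_fract ru_field_props(1)[OF \<alpha>])
  show zero: "ru \<alpha> (0 :: 'a) = 1\<^sub>m n"
    by (rule inj) (simp add: ru_to_fract ru_field_props(2)[OF \<alpha>] to_fract_mat_one)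
  show "ru \<alpha> t * ru \<alpha> (- t) = 1\<^sub>m n" using add[of t "- t"] zero by simp
qed

lemma ru_endo_power:
  assumes \<alpha>: "\<alpha> \<in> \<Phi>"
  shows "group_endo n (ru \<alpha> (t :: 'a::{idom,ring_char_0})) ^ m = group_endo n (ru \<alpha> (of_nat m * t))"
proof (induction m)
  case 0
  show ?case by (simp add: ru_add_mult(2)[OF \<alpha>] group_endo_one)
next
  case (Suc m)
  have "ru \<alpha> (of_nat (Suc m) * t) = ru \<alpha> t * ru \<alpha> (of_nat m * t)"
    by (simp add: distrib_right flip: ru_add_mult(1)[OF \<alpha>])
  thus ?case by (simp add: Suc group_endo_mult(1)[of _ n] del: of_nat_Suc)
qed

lemma elementary_word:
  fixes g :: "'a::{idom,ring_char_0} mat"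
  assumes K: "large_subgroup n (\<lambda>\<alpha>. \<pi> (x \<alpha>)) \<Phi> (K :: 'a mat set)" and g: "g \<in> elementary_group n (\<lambda>\<alpha>. \<pi> (x \<alpha>)) \<Phi>"
  shows "\<exists>ws. fst ` set ws \<subseteq> \<Phi> \<and> g = mat_prod n (map (\<lambda>q. ru (fst q) (snd q)) ws)"
  using g unfolding elementary_group_def
proof (induction rule: generate.induct)
  case one
  show ?case by (rule exI[of _ "[]"]) simp
next
  case (incl B)
  then obtain \<alpha> t where "B = ru \<alpha> t" "\<alpha> \<in> \<Phi>" by auto
  thus ?case by (intro exI[of _ "[(\<alpha>, t)]"]) (simp add: right_mult_one_mat[OF ru_carrier])
next
  case (inv B)
  then obtain \<alpha> t where B: "B = ru \<alpha> t" "\<alpha> \<in> \<Phi>" by auto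
  note c = large_carrier[OF K large_ru[OF K B(2)], of t]
  have "inv\<^bsub>SL n\<^esub> B = ru \<alpha> (- t)"
    using SL_inverse[of B n] adj_unique[OF c(1) ru_carrier c(2) ru_add_mult(3)[OF B(2)]] c by (simp add: B(1))
  thus ?case using B(2) by (intro exI[of _ "[(\<alpha>, - t)]"]) (simp add: right_mult_one_mat[OF ru_carrier])
next
  case (eng A B)
  obtain u where u: "fst ` set u \<subseteq> \<Phi>" "A = mat_prod n (map (\<lambda>q. ru (fst q) (snd q)) u)" using eng(3) by blast
  obtain w where w: "fst ` set w \<subseteq> \<Phi>" "B = mat_prod n (map (\<lambda>q. ru (fst q) (snd q)) w)" using eng(4) by blast
  have "A * B = mat_prod n (map (\<lambda>q. ru (fst q) (snd q)) (u @ w))"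
    unfolding u(2) w(2) map_append by (rule mat_prod_append[symmetric]) auto
  thus ?case using u(1) w(1) by (intro exI[of _ "u @ w"]) auto
qed

theorem computable_if_decidable_ring:
  fixes g :: "'p::prime_card padic_int mat"
  assumes g: "g \<in> elementary_group n (\<lambda>\<alpha>. \<pi> (x \<alpha>)) \<Phi>" and K: "large_subgroup n (\<lambda>\<alpha>. \<pi> (x \<alpha>)) \<Phi> K"
    and dec: "diophantine_decidable (CG\<lparr>carrier := K\<rparr>) ({ru \<alpha> 1 | \<alpha>. \<alpha> \<in> \<Phi>} \<union> {g})"
  shows "computable_mat (map_mat to_fract g)"
proof -
  let ?p = "CARD('p)" and ?G = "CG\<lparr>carrier := K\<rparr>"
  have gK: "g \<in> K" using g large_elementary[OF K] by blast
  obtain cs f where cs: "set cs = {ru \<alpha> 1 | \<alpha>. \<alpha> \<in> \<Phi>} \<union> {g}" and f: "computable f"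
    "\<And>S. system_over cs S \<Longrightarrow> f (system_code S) = 1 \<longleftrightarrow> solvable_in ?G cs S"
    using dec unfolding diophantine_decidable_def by blast
  have "set cs \<subseteq> K" using cs gK large_ru[OF K] by auto
  hence "group_embedding ?G (\<lambda>A. group_endo n (id A)) cs"
    by (rule large_group_embedding[OF K]) (use large_carrier[OF K] in auto)
  then interpret group_embedding ?G "group_endo n :: 'p padic_int mat \<Rightarrow> 'p padic_int endo" cs by (simp only: id_apply)
  have "\<forall>\<alpha>. \<exists>i. \<alpha> \<in> \<Phi> \<longrightarrow> i < length cs \<and> cs ! i = ru \<alpha> 1"
  proof
    fix \<alpha>
    have "\<alpha> \<in> \<Phi> \<longrightarrow> ru \<alpha> 1 \<in> set cs" unfolding cs by blast
    thus "\<exists>i. \<alpha> \<in> \<Phi> \<longrightarrow> i < length cs \<and> cs ! i = ru \<alpha> 1" by (auto simp: in_set_conv_nth)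
  qed
  from choice[OF this] obtain idx where idx: "\<And>\<alpha>. \<alpha> \<in> \<Phi> \<Longrightarrow> idx \<alpha> < length cs \<and> cs ! idx \<alpha> = ru \<alpha> 1" by (elim exE) blast
  have "g \<in> set cs" unfolding cs by simp
  then obtain gi where gi: "gi < length cs" "cs ! gi = g" by (auto simp: in_set_conv_nth)
  obtain ws where ws: "fst ` set ws \<subseteq> \<Phi>" and gws: "g = mat_prod n (map (\<lambda>q. ru (fst q) (snd q)) ws)"
    using elementary_word[OF K g] by blast
  define \<rho> \<tau> where "\<rho> j = fst (ws ! j)" and "\<tau> j = snd (ws ! j)" for j
  define r where "r = length ws"
  have \<rho>: "\<rho> j \<in> \<Phi>" if "j < r" for j using ws that by (auto simp: \<rho>_def r_def)
  have g_eq: "g = mat_prod n (map (\<lambda>j. ru (\<rho> j) (\<tau> j)) [0..<r])"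
  proof -
    have "ws = map (\<lambda>j. ws ! j) [0..<r]" by (simp add: r_def map_nth)
    hence "map (\<lambda>q. ru (fst q) (snd q)) ws = map (\<lambda>q. ru (fst q) (snd q)) (map (\<lambda>j. ws ! j) [0..<r])" by simp
    thus ?thesis unfolding gws by (simp only: map_map comp_def \<rho>_def \<tau>_def)
  qed
  obtain M where M: "M > 0" "\<And>B :: 'p padic_int mat. B \<in> carrier_mat n n \<Longrightarrow> det B = 1 \<Longrightarrow>
      \<exists>D. group_endo n B ^ M = 1 + of_nat ?p * D"
    using congruence_exponent[of n] by blast
  let ?v = "\<lambda>j i. (Var (prod_encode (j, i)), False)"
  let ?gen = "\<lambda>j. equation [?v j 1] [(Coeff (idx (\<rho> j)), False)]"
  let ?prod = "equation (map (\<lambda>j. ?v j 0) [0..<r]) [(Coeff gi, False)]"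
  \<comment> \<open>Unknown 1 is pinned to \<open>x\<^sub>\<rho>(1)\<close>, while unknown 2 remains
    an arbitrary group element: its high power is close to 1 whatever it is.\<close>
  define S where "S = map ?gen [0..<r] @ [?prod]"
  have cb: "coeffs_below (length cs) (map (\<lambda>j. ?v j 0) js)" for js by (induction js) auto
  have over: "system_over cs S"
    unfolding system_over_iff S_def using idx \<rho> gi(1) cb by auto
  have gen_iff: "word_value ?G cs \<sigma> (?gen j) = \<one>\<^bsub>?G\<^esub> \<longleftrightarrow> \<sigma> (prod_encode (j, 1)) = ru (\<rho> j) 1"
    if \<sigma>: "\<And>i. \<sigma> i \<in> carrier ?G" and j: "j < r" for \<sigma> j
  proof -
    have "word_value ?G cs \<sigma> (?gen j) = \<one>\<^bsub>?G\<^esub> \<longleftrightarrow> emb_word \<sigma> [?v j 1] = emb_word \<sigma> [(Coeff (idx (\<rho> j)), False)]"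
      by (rule equation_iff[OF \<sigma>]) (use idx[OF \<rho>[OF j]] in auto)
    also have "\<dots> \<longleftrightarrow> group_endo n (\<sigma> (prod_encode (j, 1))) = group_endo n (ru (\<rho> j) 1)"
      using idx[OF \<rho>[OF j]] by (simp add: emb_word_Cons emb_word_Nil del: One_nat_def)
    also have "\<dots> \<longleftrightarrow> \<sigma> (prod_encode (j, 1)) = ru (\<rho> j) 1"
      using emb_inj[of "\<sigma> (prod_encode (j, 1))" "ru (\<rho> j) 1"] \<sigma> large_ru[OF K \<rho>[OF j], of 1] by auto
    finally show ?thesis .
  qed
  have prod_iff: "word_value ?G cs \<sigma> ?prod = \<one>\<^bsub>?G\<^esub> \<longleftrightarrow> g = mat_prod n (map (\<lambda>j. \<sigma> (prod_encode (j, 0))) [0..<r])"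
    if \<sigma>: "\<And>i. \<sigma> i \<in> carrier ?G" for \<sigma>
  proof -
    have c: "set (map (\<lambda>j. \<sigma> (prod_encode (j, 0))) js) \<subseteq> carrier_mat n n" for js
      using \<sigma> large_carrier[OF K] by auto
    have e: "emb_word \<sigma> (map (\<lambda>j. ?v j 0) js) = group_endo n (mat_prod n (map (\<lambda>j. \<sigma> (prod_encode (j, 0))) js))" for js
      unfolding group_endo_mat_prod[OF c] by (simp add: emb_word_def comp_def)
    have "word_value ?G cs \<sigma> ?prod = \<one>\<^bsub>?G\<^esub> \<longleftrightarrow> emb_word \<sigma> (map (\<lambda>j. ?v j 0) [0..<r]) = emb_word \<sigma> [(Coeff gi, False)]"
      by (rule equation_iff[OF \<sigma> cb]) (use gi in simp)
    also have "\<dots> \<longleftrightarrow> group_endo n (mat_prod n (map (\<lambda>j. \<sigma> (prod_encode (j, 0))) [0..<r])) = group_endo n g"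
      unfolding e using gi(2) by (simp add: emb_word_Cons emb_word_Nil)
    also have "\<dots> \<longleftrightarrow> g = mat_prod n (map (\<lambda>j. \<sigma> (prod_encode (j, 0))) [0..<r])"
      using group_endo_inject[OF mat_prod_carrier[OF c] large_carrier(1)[OF K gK]] by auto
    finally show ?thesis .
  qed
  have solvable: "\<exists>m. solvable_in ?G cs (power_system r S m (M * ?p ^ k))" for k
  proof -
    \<comment> \<open>To realize \<open>\<tau> j\<close> exactly, the error after subtracting
      \<open>m\<close> must be a multiple of \<open>M * p ^ k\<close>. So \<open>m\<close> is also
      taken accurate to the \<open>p\<close>-part \<open>p ^ d\<close> of \<open>M\<close>, and the
      unit part of \<open>M\<close> is inverted.\<close>
    have "(of_nat M :: 'p padic_int) \<noteq> 0" using M(1) by simp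
    then obtain d u where Mu: "(of_nat M :: 'p padic_int) = padic_p ^ d * u" "u dvd 1" by (rule padic_int_decompose)
    obtain u' where u': "1 = u * u'" using Mu(2) by (elim dvdE)
    have "\<forall>j. \<exists>m w. \<tau> j = of_nat m + of_nat (M * ?p ^ k) * w"
    proof
      fix j
      obtain m where "padic_p ^ (d + k) dvd \<tau> j - of_nat m" using padic_int_approx by blast
      then obtain w where w: "\<tau> j - of_nat m = padic_p ^ (d + k) * w" by (elim dvdE)
      have "of_nat (M * ?p ^ k) * (u' * w) = padic_p ^ (d + k) * (u * u') * w"
        by (simp add: Mu(1) power_add ac_simps)
      also have "\<dots> = \<tau> j - of_nat m" by (simp add: w flip: u')
      finally have "\<tau> j = of_nat m + of_nat (M * ?p ^ k) * (u' * w)" by (simp add: eq_diff_eq add.commute)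
      thus "\<exists>m w. \<tau> j = of_nat m + of_nat (M * ?p ^ k) * w" by blast
    qed
    then obtain m w where mw: "\<And>j. \<tau> j = of_nat (m j) + of_nat (M * ?p ^ k) * w j" by metis
    define A where "A j i = (if i = 0 then ru (\<rho> j) (\<tau> j) else if i = 1 then ru (\<rho> j) 1 else ru (\<rho> j) (w j))" for j and i :: nat
    define \<sigma> where "\<sigma> i = (if fst (prod_decode i) < r then A (fst (prod_decode i)) (snd (prod_decode i)) else 1\<^sub>m n)" for i
    have \<sigma>: "\<sigma> i \<in> carrier ?G" for i using large_ru[OF K \<rho>] large_one[OF K] by (simp add: \<sigma>_def A_def)
    have \<sigma>A: "\<sigma> (prod_encode (j, i)) = A j i" if "j < r" for j i using that by (simp add: \<sigma>_def)
    have "word_value ?G cs \<sigma> (power_word j (m j) (M * ?p ^ k)) = \<one>\<^bsub>?G\<^esub>" if j: "j < r" for j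
    proof -
      have "group_endo n (ru (\<rho> j) (\<tau> j)) = group_endo n (ru (\<rho> j) 1) ^ m j * group_endo n (ru (\<rho> j) (w j)) ^ (M * ?p ^ k)"
        unfolding ru_endo_power[OF \<rho>[OF j]] mw[of j] ru_add_mult(1)[OF \<rho>[OF j]]
        by (simp add: group_endo_mult(1)[of _ n])
      thus ?thesis unfolding power_word_iff[OF \<sigma>] using \<sigma>A[OF j] by (simp add: A_def)
    qed
    moreover have "word_value ?G cs \<sigma> ?prod = \<one>\<^bsub>?G\<^esub>"
      unfolding prod_iff[OF \<sigma>] g_eq by (intro arg_cong[of _ _ "mat_prod n"] map_cong) (simp_all add: \<sigma>A A_def)
    moreover have "word_value ?G cs \<sigma> (?gen j) = \<one>\<^bsub>?G\<^esub>" if "j < r" for j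
      unfolding gen_iff[OF \<sigma> that] using \<sigma>A[OF that] by (simp add: A_def)
    ultimately have "\<forall>w\<in>set (power_system r S m (M * ?p ^ k)). word_value ?G cs \<sigma> w = \<one>\<^bsub>?G\<^esub>"
      by (auto simp: power_system_def S_def simp del: One_nat_def)
    hence "solvable_in ?G cs (power_system r S m (M * ?p ^ k))" using \<sigma> unfolding solvable_in_def by blast
    thus ?thesis by (intro exI[of _ m])
  qed
  have "\<exists>c. computable_fun 1 (\<lambda>xs. c (xs ! 0)) \<and>
    (\<forall>k. solvable_in ?G cs (power_system r S (\<lambda>j. tuple_entry j (c k)) (M * ?p ^ k)))"
    by (rule computable_search[OF f(1) _ over solvable]) (rule f(2))
  then obtain c where c: "computable_fun 1 (\<lambda>xs. c (xs ! 0))"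
    and sol: "\<And>k. solvable_in ?G cs (power_system r S (\<lambda>j. tuple_entry j (c k)) (M * ?p ^ k))" by blast
  let ?Q = "\<lambda>a. mat_prod n (map (\<lambda>j. homogenized_ru 1 (\<rho> j) (int (tuple_entry j a))) [0..<r])"
  show ?thesis
  proof (rule computable_mat_if_approx[OF _ c])
    show "map_mat to_fract g \<in> carrier_mat n n" using large_carrier(1)[OF K gK] by simp
    show "?Q a \<in> carrier_mat n n" for a by (rule mat_prod_carrier) auto
    show "computable_int (\<lambda>a. ?Q a $$ (i, j))" if "i < n" "j < n" for i j
      by (rule computable_int_mat_prod)
        (use that in \<open>auto intro: computable_int_homogenized_ru computable_int_tuple_entry\<close>)
    fix k
    obtain \<sigma> where \<sigma>: "\<And>i. \<sigma> i \<in> carrier ?G"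
      and sat: "\<And>w. w \<in> set (power_system r S (\<lambda>j. tuple_entry j (c k)) (M * ?p ^ k)) \<Longrightarrow> word_value ?G cs \<sigma> w = \<one>\<^bsub>?G\<^esub>"
      using sol[of k] unfolding solvable_in_def by blast
    have "word_value ?G cs \<sigma> ?prod = \<one>\<^bsub>?G\<^esub>" by (rule sat) (simp add: power_system_def S_def)
    hence g\<sigma>: "g = mat_prod n (map (\<lambda>j. \<sigma> (prod_encode (j, 0))) [0..<r])" unfolding prod_iff[OF \<sigma>] .
    have letter: "mat_cong n (padic_p ^ k) (\<sigma> (prod_encode (j, 0))) (ru (\<rho> j) (of_nat (tuple_entry j (c k))))" if j: "j < r" for j
    proof -
      have "word_value ?G cs \<sigma> (?gen j) = \<one>\<^bsub>?G\<^esub>" by (rule sat) (use j in \<open>simp add: power_system_def S_def\<close>)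
      hence q: "\<sigma> (prod_encode (j, 1)) = ru (\<rho> j) 1" unfolding gen_iff[OF \<sigma> j] .
      have "word_value ?G cs \<sigma> (power_word j (tuple_entry j (c k)) (M * ?p ^ k)) = \<one>\<^bsub>?G\<^esub>"
        by (rule sat) (use j in \<open>simp add: power_system_def\<close>)
      hence y: "group_endo n (\<sigma> (prod_encode (j, 0))) = group_endo n (ru (\<rho> j) (of_nat (tuple_entry j (c k)))) *
          group_endo n (\<sigma> (prod_encode (j, 2))) ^ (M * ?p ^ k)"
        unfolding power_word_iff[OF \<sigma>] q ru_endo_power[OF \<rho>[OF j]] by simp
      \<comment> \<open>Only membership in the large subgroup, hence determinant 1, is known of this
        element; the exponent \<open>M\<close> works for all such matrices.\<close>
      have "\<sigma> (prod_encode (j, 2)) \<in> K" using \<sigma> by simp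
      hence "\<exists>D. group_endo n (\<sigma> (prod_encode (j, 2))) ^ M = 1 + of_nat ?p * D"
        by (intro M(2) large_carrier[OF K])
      from power_p_power_congruent_one[OF this, of k]
      obtain D where "group_endo n (\<sigma> (prod_encode (j, 2))) ^ (M * ?p ^ k) = 1 + of_nat (?p ^ Suc k) * D"
        unfolding power_mult by blast
      hence "group_endo n (\<sigma> (prod_encode (j, 2))) ^ (M * ?p ^ k) = 1 + of_nat (?p ^ k) * (of_nat ?p * D)"
        by (simp add: mult.assoc mult_of_nat_commute)
      hence "mat_cong n (of_nat (?p ^ k)) (\<sigma> (prod_encode (j, 0))) (ru (\<rho> j) (of_nat (tuple_entry j (c k))))"
        using y by (intro mat_cong_if_group_endo[of n _ _ _ "of_nat ?p * D"]) simp
      thus ?thesis by simp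
    qed
    \<comment> \<open>With denominator 1 homogenization does nothing, so the integral matrices
      \<open>?Q\<close> reduce to root elements with natural parameters.\<close>
    have h1: "homogenized_ru 1 \<alpha> t = ru \<alpha> t" for \<alpha> and t :: "'p padic_int"
    proof -
      have "homogenized_ru 1 \<alpha> t = 1 \<cdot>\<^sub>m ru \<alpha> t" using homogenized_ru[of 1 \<alpha> t] by simp
      also have "\<dots> = ru \<alpha> t" by (intro eq_matI) auto
      finally show ?thesis .
    qed
    have "map_mat of_int (?Q (c k)) = mat_prod n (map (\<lambda>j. ru (\<rho> j) (of_nat (tuple_entry j (c k)) :: 'p padic_int)) [0..<r])"
      by (subst of_int_mat_prod) (auto simp: comp_def homogenized_ru_of_int h1)
    hence "mat_cong n (padic_p ^ k) g (map_mat of_int (?Q (c k)))"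
      unfolding g\<sigma> by (simp only:) (rule mat_prod_cong, use letter \<sigma> large_carrier[OF K] in auto)
    thus "\<exists>Y. Y \<in> carrier_mat n n \<and> of_nat ?p ^ 0 \<cdot>\<^sub>m map_mat to_fract g = map_mat to_fract Y \<and>
      mat_cong n (padic_p ^ k) Y (map_mat of_int (?Q (c k)))"
      using large_carrier(1)[OF K gK] by (intro exI[of _ g] conjI) (auto intro!: eq_matI)
  qed
qed

end

theorem mainTheorem12:
  fixes \<Phi> \<Delta> :: "'v::euclidean_space set"
    and scale :: "complex \<Rightarrow> 'l::ab_group_add \<Rightarrow> 'l" and br :: "'l \<Rightarrow> 'l \<Rightarrow> 'l"
    and H :: "'l set" and rt :: "'v \<Rightarrow> 'l \<Rightarrow> complex" and h x :: "'v \<Rightarrow> 'l"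
    and n :: nat and \<pi> :: "'l \<Rightarrow> complex mat" and X :: "'v \<Rightarrow> complex mat"
  assumes "chevalley_representation scale br \<Phi> H rt \<Delta> h x n \<pi>"
    and "indecomposable \<Phi>" and "dim \<Phi> > 1"
    and "X = (\<lambda>\<alpha>. \<pi> (x \<alpha>))"
  shows "(\<forall>(g :: 'p::prime_card padic mat) K.
      g \<in> elementary_group n X \<Phi> \<and> \<not> computable_mat g \<and> large_subgroup n X \<Phi> K \<longrightarrow>
      \<not> diophantine_decidable ((chevalley_group n X \<Phi>)\<lparr>carrier := K\<rparr>)
          ({root_unipotent n X \<alpha> 1 | \<alpha>. \<alpha> \<in> \<Phi>} \<union> {g}))
    \<and> (CARD('p) \<noteq> 2 \<longrightarrow>
      (\<forall>(g :: 'p padic_int mat) K.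
        g \<in> elementary_group n X \<Phi> \<and> \<not> computable_mat (map_mat to_fract g) \<and>
        large_subgroup n X \<Phi> K \<longrightarrow>
        \<not> diophantine_decidable ((chevalley_group n X \<Phi>)\<lparr>carrier := K\<rparr>)
            ({root_unipotent n X \<alpha> 1 | \<alpha>. \<alpha> \<in> \<Phi>} \<union> {g})))"
proof -
  interpret chevalley_representation scale br \<Phi> H rt \<Delta> h x n \<pi> by (rule assms(1))
  show ?thesis
    unfolding assms(4)
    using computable_if_decidable_field[OF assms(2,3)] computable_if_decidable_ring by blast
qed

end
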